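(* Let $d\ge 2$, $T>0$, and let $L$ be any constant coefficient (linear) differential operator in the space variable, of order $m\ge 1$. There exists a divergence-free vector field $u:[0,T]\times\mathbb{T}^d\to\mathbb{R}^d$ with $u\in L^1(0,T;W^{1,p}(\mathbb{T}^d))$ for all $p<\infty$, such that uniqueness of weak solutions to $$\partial_t\rho-L\rho+u\cdot\nabla\rho=0,\qquad\rho|_{t=0}=\rho_0$$ fails in the class $$\rho\in\bigcap_{p<\infty,\;k\in\mathbb{N}}L^p(0,T;C^k(\mathbb{T}^d)),$$ i.e. there are an initial datum $\rho_0$ and two distinct weak solutions, both belonging to this class, with the same vector field $u$ and the same initial datum $\rho_0$.
   Context: $\mathbb{T}^d=\mathbb{R}^d/\mathbb{Z}^d$; $\nabla$ and $\operatorname{div}$ act in the space variable only, and $\operatorname{div}u=0$ is understood in the sense of distributions. Let $L^*$ denote the formal adjoint of $L$. For divergence-free $u$, a scalar function $\rho:[0,T]\times\mathbb{T}^d\to\mathbb{R}$ is a weak solution with initial datum $\rho_0$ if $\rho,\ \rho u\in L^1([0,T]\times\mathbb{T}^d)$ and $$-\int_{\mathbb{T}^d}\rho_0\,\varphi(0,\cdot)\,dx=\int_0^T\int_{\mathbb{T}^d}\rho\,(\partial_t\varphi+L^*\varphi+u\cdot\nabla\varphi)\,dx\,dt\qquad\text{for all }\varphi\in C_c^\infty([0,T)\times\mathbb{T}^d).$$ Functions equal a.e. are identified. *)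

theory Defs
  imports "HOL-Analysis.Analysis"
begin

text \<open>
  Functions on the torus \<open>\<real>\<^sup>d / \<int>\<^sup>d\<close> are represented by \<open>\<int>\<^sup>d\<close>-periodic functions on
  \<open>real ^ 'd\<close>, where \<open>d = CARD('d)\<close>; integrals over the torus are integrals over the
  fundamental cell \<open>cbox 0 1\<close>.
\<close>

definition periodic :: "(real ^ 'd \<Rightarrow> 'b) \<Rightarrow> bool" where
  "periodic f \<longleftrightarrow> (\<forall>x i. f (x + axis i 1) = f x)"

abbreviation cell :: "(real ^ 'd) set" where
  "cell \<equiv> cbox 0 1"


subsection \<open>Classical derivatives\<close>

primrec C_k :: "nat \<Rightarrow> ('a::euclidean_space \<Rightarrow> 'b::real_normed_vector) \<Rightarrow> bool" where
  "C_k 0 f \<longleftrightarrow> continuous_on UNIV f"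
| "C_k (Suc k) f \<longleftrightarrow>
     (\<forall>x. f differentiable (at x)) \<and>
     (\<forall>b\<in>Basis. C_k k (\<lambda>x. frechet_derivative f (at x) b))"

definition smooth :: "('a::euclidean_space \<Rightarrow> 'b::real_normed_vector) \<Rightarrow> bool" where
  "smooth f \<longleftrightarrow> (\<forall>k. C_k k f)"

definition partial ::
    "'d \<Rightarrow> (real ^ 'd \<Rightarrow> 'b::real_normed_vector) \<Rightarrow> real ^ 'd \<Rightarrow> 'b" where
  "partial i f = (\<lambda>x. frechet_derivative f (at x) (axis i 1))"

definition grad :: "(real ^ 'd \<Rightarrow> real) \<Rightarrow> real ^ 'd \<Rightarrow> real ^ 'd" where
  "grad f x = (\<chi> i. partial i f x)"

definition mi_size :: "('d::finite \<Rightarrow> nat) \<Rightarrow> nat" where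
  "mi_size \<alpha> = (\<Sum>i\<in>UNIV. \<alpha> i)"

lemma finite_mi_size_le: "finite {\<alpha> :: 'd::finite \<Rightarrow> nat. mi_size \<alpha> \<le> m}"
proof (rule finite_subset)
  show "{\<alpha> :: 'd \<Rightarrow> nat. mi_size \<alpha> \<le> m} \<subseteq> (UNIV :: 'd set) \<rightarrow>\<^sub>E {..m}"
  proof
    fix \<alpha> :: "'d \<Rightarrow> nat"
    assume "\<alpha> \<in> {\<alpha>. mi_size \<alpha> \<le> m}"
    then have "(\<Sum>i\<in>UNIV. \<alpha> i) \<le> m" by (simp add: mi_size_def)
    moreover have "\<alpha> i \<le> (\<Sum>i\<in>UNIV. \<alpha> i)" for i
      by (rule member_le_sum) simp_all
    ultimately have "\<alpha> i \<le> m" for i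
      by (meson order_trans)
    then show "\<alpha> \<in> (UNIV :: 'd set) \<rightarrow>\<^sub>E {..m}" by (simp add: PiE_def Pi_def)
  qed
  show "finite ((UNIV :: 'd set) \<rightarrow>\<^sub>E {..m})"
    by (rule finite_PiE) simp_all
qed

text \<open>
  A fixed enumeration of the coordinates.  It only serves to give the composition defining
  the derivative of a multi-index a definite order; the order is immaterial on the
  functions to which it is applied.
\<close>

definition coords :: "'d::finite list" where
  "coords = (SOME is. distinct is \<and> set is = UNIV)"

lemma coords: "distinct (coords :: 'd::finite list) \<and> set (coords :: 'd list) = UNIV"
proof -
  have "\<exists>is. distinct is \<and> set is = (UNIV :: 'd set)"
    using finite_distinct_list[OF finite[of "UNIV :: 'd set"]] by blast
  then show ?thesis unfolding coords_def by (rule someI_ex)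
qed

definition mi_deriv ::
    "('d::finite \<Rightarrow> nat) \<Rightarrow> (real ^ 'd \<Rightarrow> 'b::real_normed_vector) \<Rightarrow> real ^ 'd \<Rightarrow> 'b" where
  "mi_deriv \<alpha> f = foldr (\<lambda>i. partial i ^^ \<alpha> i) coords f"


subsection \<open>Constant coefficient differential operators\<close>

text \<open>
  The family \<open>c\<close> encodes \<open>L = (\<Sum>\<bar>\<alpha>\<bar>\<le>m. c \<alpha> \<partial>\<^sup>\<alpha>)\<close>; only the values of \<open>c\<close> at
  multi-indices of size at most \<open>m\<close> matter.
\<close>

definition diff_op ::
    "nat \<Rightarrow> (('d::finite \<Rightarrow> nat) \<Rightarrow> real) \<Rightarrow> (real ^ 'd \<Rightarrow> real) \<Rightarrow> real ^ 'd \<Rightarrow> real" where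
  "diff_op m c f x = (\<Sum>\<alpha> | mi_size \<alpha> \<le> m. c \<alpha> * mi_deriv \<alpha> f x)"

definition adjoint_coeffs :: "(('d::finite \<Rightarrow> nat) \<Rightarrow> real) \<Rightarrow> ('d \<Rightarrow> nat) \<Rightarrow> real" where
  "adjoint_coeffs c \<alpha> = (- 1) ^ mi_size \<alpha> * c \<alpha>"

definition exact_order :: "nat \<Rightarrow> (('d::finite \<Rightarrow> nat) \<Rightarrow> real) \<Rightarrow> bool" where
  "exact_order m c \<longleftrightarrow> (\<exists>\<alpha>. mi_size \<alpha> = m \<and> c \<alpha> \<noteq> 0)"


subsection \<open>Function spaces on the torus\<close>

definition Lp_torus :: "real \<Rightarrow> (real ^ 'd \<Rightarrow> 'b::euclidean_space) set" where
  "Lp_torus p = {f. periodic f \<and> f \<in> borel_measurable lebesgue \<and>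
     set_integrable lebesgue cell (\<lambda>x. norm (f x) powr p)}"

definition Lp_norm :: "real \<Rightarrow> (real ^ 'd \<Rightarrow> 'b::euclidean_space) \<Rightarrow> real" where
  "Lp_norm p f = (LINT x:cell|lebesgue. norm (f x) powr p) powr (1 / p)"

definition is_weak_partial ::
    "'d \<Rightarrow> (real ^ 'd \<Rightarrow> 'b::euclidean_space) \<Rightarrow> (real ^ 'd \<Rightarrow> 'b) \<Rightarrow> bool" where
  "is_weak_partial i f g \<longleftrightarrow> g \<in> Lp_torus 1 \<and>
     (\<forall>\<phi> :: real ^ 'd \<Rightarrow> real. smooth \<phi> \<and> periodic \<phi> \<longrightarrow>
        (LINT x:cell|lebesgue. partial i \<phi> x *\<^sub>R f x) =
          - (LINT x:cell|lebesgue. \<phi> x *\<^sub>R g x))"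

text \<open>Weak derivatives are unique up to null sets, so the choice below is harmless.\<close>

definition weak_partial ::
    "'d \<Rightarrow> (real ^ 'd \<Rightarrow> 'b::euclidean_space) \<Rightarrow> real ^ 'd \<Rightarrow> 'b" where
  "weak_partial i f = (SOME g. is_weak_partial i f g)"

definition W1p :: "real \<Rightarrow> (real ^ 'd \<Rightarrow> 'b::euclidean_space) set" where
  "W1p p = {f \<in> Lp_torus p. \<forall>i. \<exists>g \<in> Lp_torus p. is_weak_partial i f g}"

definition W1p_norm :: "real \<Rightarrow> (real ^ 'd \<Rightarrow> 'b::euclidean_space) \<Rightarrow> real" where
  "W1p_norm p f =
     (Lp_norm p f powr p + (\<Sum>i\<in>UNIV. Lp_norm p (weak_partial i f) powr p)) powr (1 / p)"

definition Ck_torus :: "nat \<Rightarrow> (real ^ 'd \<Rightarrow> real) set" where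
  "Ck_torus k = {f. periodic f \<and> C_k k f}"

definition Ck_norm :: "nat \<Rightarrow> (real ^ 'd \<Rightarrow> real) \<Rightarrow> real" where
  "Ck_norm k f = (\<Sum>\<alpha> | mi_size \<alpha> \<le> k. SUP x. \<bar>mi_deriv \<alpha> f x\<bar>)"


subsection \<open>Bochner spaces\<close>

text \<open>
  \<open>X\<close> is the underlying set and \<open>N\<close> the norm of a Banach space of functions on the torus.
\<close>

definition simple_valued ::
    "real \<Rightarrow> (real ^ 'd \<Rightarrow> 'b) set \<Rightarrow> (real \<Rightarrow> real ^ 'd \<Rightarrow> 'b) \<Rightarrow> bool" where
  "simple_valued T X s \<longleftrightarrow> s ` {0..T} \<subseteq> X \<and> finite (s ` {0..T}) \<and>
     (\<forall>v. {t \<in> {0..T}. s t = v} \<in> sets lebesgue)"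

definition strongly_measurable ::
    "real \<Rightarrow> (real ^ 'd \<Rightarrow> 'b::real_normed_vector) set \<Rightarrow> ((real ^ 'd \<Rightarrow> 'b) \<Rightarrow> real) \<Rightarrow>
     (real \<Rightarrow> real ^ 'd \<Rightarrow> 'b) \<Rightarrow> bool" where
  "strongly_measurable T X N f \<longleftrightarrow>
     (\<exists>s. (\<forall>n. simple_valued T X (s n)) \<and>
        (AE t in lebesgue_on {0..T}.
           f t \<in> X \<and> (\<lambda>n. N (\<lambda>x. s n t x - f t x)) \<longlonglongrightarrow> 0))"

definition Bochner_Lp ::
    "real \<Rightarrow> real \<Rightarrow> (real ^ 'd \<Rightarrow> 'b::real_normed_vector) set \<Rightarrow> ((real ^ 'd \<Rightarrow> 'b) \<Rightarrow> real) \<Rightarrow>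
     (real \<Rightarrow> real ^ 'd \<Rightarrow> 'b) set" where
  "Bochner_Lp p T X N = {f. strongly_measurable T X N f \<and>
     set_integrable lebesgue {0..T} (\<lambda>t. N (f t) powr p)}"


subsection \<open>Space-time functions and weak solutions\<close>

definition L1_spacetime :: "real \<Rightarrow> (real \<Rightarrow> real ^ 'd \<Rightarrow> 'b::euclidean_space) set" where
  "L1_spacetime T = {f. (\<forall>t\<in>{0..T}. periodic (f t)) \<and>
     (\<lambda>(t, x). f t x) absolutely_integrable_on ({0..T} \<times> cell)}"

definition spacetime_smooth :: "(real \<Rightarrow> real ^ 'd \<Rightarrow> real) \<Rightarrow> bool" where
  "spacetime_smooth \<phi> \<longleftrightarrow> smooth (\<lambda>(t, x). \<phi> t x) \<and> (\<forall>t. periodic (\<phi> t))"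

text \<open>
  Smoothness on \<open>[0,T) \<times> \<real>\<^sup>d\<close> up to the boundary \<open>t = 0\<close> means being the restriction of a
  smooth function; an element of \<open>C\<^sub>c\<^sup>\<infinity>([0,T) \<times> \<real>\<^sup>d / \<int>\<^sup>d)\<close> is represented by such an extension.
\<close>

definition test_initial :: "real \<Rightarrow> (real \<Rightarrow> real ^ 'd \<Rightarrow> real) set" where
  "test_initial T = {\<phi>. spacetime_smooth \<phi> \<and> (\<exists>\<tau><T. \<forall>t x. \<tau> \<le> t \<longrightarrow> \<phi> t x = 0)}"

definition test_interior :: "real \<Rightarrow> (real \<Rightarrow> real ^ 'd \<Rightarrow> real) set" where
  "test_interior T = {\<phi>. spacetime_smooth \<phi> \<and>
     (\<exists>a b. 0 < a \<and> b < T \<and> (\<forall>t x. t \<notin> {a..b} \<longrightarrow> \<phi> t x = 0))}"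

definition div_free :: "real \<Rightarrow> (real \<Rightarrow> real ^ 'd \<Rightarrow> real ^ 'd) \<Rightarrow> bool" where
  "div_free T u \<longleftrightarrow> u \<in> L1_spacetime T \<and>
     (\<forall>\<phi> \<in> test_interior T.
        (LINT t:{0..T}|lebesgue. LINT x:cell|lebesgue. u t x \<bullet> grad (\<phi> t) x) = 0)"

definition weak_solution ::
    "real \<Rightarrow> nat \<Rightarrow> (('d::finite \<Rightarrow> nat) \<Rightarrow> real) \<Rightarrow> (real \<Rightarrow> real ^ 'd \<Rightarrow> real ^ 'd) \<Rightarrow>
     (real ^ 'd \<Rightarrow> real) \<Rightarrow> (real \<Rightarrow> real ^ 'd \<Rightarrow> real) \<Rightarrow> bool" where
  "weak_solution T m c u \<rho>0 \<rho> \<longleftrightarrow>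
     \<rho> \<in> L1_spacetime T \<and> (\<lambda>t x. \<rho> t x *\<^sub>R u t x) \<in> L1_spacetime T \<and>
     (\<forall>\<phi> \<in> test_initial T.
        - (LINT x:cell|lebesgue. \<rho>0 x * \<phi> 0 x) =
          (LINT t:{0..T}|lebesgue. LINT x:cell|lebesgue.
             \<rho> t x * (deriv (\<lambda>s. \<phi> s x) t + diff_op m (adjoint_coeffs c) (\<phi> t) x
                        + u t x \<bullet> grad (\<phi> t) x)))"

end

theory Submission
  imports Defs
begin

text \<open>
  The proof is by convex integration with concentration in time.  One constructs \<open>\<rho>\<^sub>n\<close>, vanishing at
  \<open>t = 0\<close>, divergence-free \<open>U\<^sub>n\<close> and defects \<open>R\<^sub>n\<close> with
  \<open>\<partial>\<^sub>t \<rho>\<^sub>n - L \<rho>\<^sub>n + div (\<rho>\<^sub>n U\<^sub>n) = div R\<^sub>n\<close> and \<open>R\<^sub>n \<longlonglongrightarrow> 0\<close> in \<open>L\<^sup>1\<close>, starting from \<open>U\<^sub>0 = 0\<close> and a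
  large \<open>\<rho>\<^sub>0\<close>.  A component \<open>R\<^sub>i\<close> of the defect is removed by adding to \<open>\<rho>\<close> the function
  \<open>- \<partial>\<^sub>j (\<alpha>(t) \<Phi>(x\<^sub>j) R\<^sub>i)\<close> and to \<open>U\<close> the shear flow \<open>\<beta>(t) \<Psi>(x\<^sub>j)\<close> in direction \<open>i\<close>, where \<open>\<alpha> \<beta>\<close>
  and \<open>\<Phi>' \<Psi>\<close> are \<open>1\<close> up to fast oscillations.  The product of the perturbations then compensates
  \<open>R\<^sub>i\<close>, while \<open>\<alpha>\<close> is so small in \<open>L\<^sup>q(0,T)\<close>, and \<open>\<beta>\<close> so small in \<open>L\<^sup>1(0,T)\<close>, that the perturbations
  are small in \<open>L\<^sup>q(0,T; C\<^sup>k)\<close> and \<open>L\<^sup>1(0,T; W\<^sup>1\<^sup>,\<^sup>p)\<close> however large their space norms are.  Hence \<open>\<rho>\<^sub>n\<close>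
  and \<open>U\<^sub>n\<close> converge; the limit density solves the equation with initial datum \<open>0\<close> and stays close
  to the large \<open>\<rho>\<^sub>0\<close>, so it differs from the solution \<open>0\<close>.
\<close>

text \<open>The obstacle is the time derivative of \<alpha>: total variation in time gains nothing
  from concentration. The error with \<alpha>' \<Phi> R_i must therefore be small through \<Phi>,
  while \<beta> \<Psi> must be small in L^1(0,T; W^{1,p}). Concentration in x_j pays for both:
  \<Phi>' \<Psi> keeps mean 1, yet the L^1 norm of \<Phi> times the L^p norm of \<Psi>' becomes
  arbitrarily small. A number A that splits this smallness between \<Phi> and \<Psi> is also the
  height of \<alpha>, so that it cancels in both estimates. Space derivatives of the perturbation,
  in particular its image under L, contain \<alpha> itself, whose integral is chosen last and beats
  every derivative of the profiles; this is why L may have any order. The main part of the density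
  perturbation and its corrector are exact derivatives, so their images under \<partial>_t and L are
  divergences and no divergence equation has to be solved. A shear is divergence-free because i and
  j differ, which needs d >= 2. Step n controls n space derivatives in L^{n+1}(0,T), so the limit is
  in the spaces for all k and p at once.\<close>

definition smooth1 :: "(real \<Rightarrow> real) \<Rightarrow> bool" where
  "smooth1 f \<longleftrightarrow> (\<forall>n x. (deriv ^^ n) f field_differentiable at x)"

lemma smooth1_has_deriv:
  assumes "smooth1 f" shows "(f has_real_derivative deriv f x) (at x)"
  using assms[unfolded smooth1_def, rule_format, of 0 x]
  by (simp add: DERIV_deriv_iff_field_differentiable)

lemma smooth1_deriv: "smooth1 f \<Longrightarrow> smooth1 (deriv f)"
  unfolding smooth1_def by (metis funpow_swap1 funpow.simps(2) o_apply)

text \<open>Smoothness as a greatest fixed point: it suffices to exhibit a set containing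
  \<open>f\<close> in which every member has its derivative. No formula for higher derivatives is
  ever needed; \<open>smooth1_flat\<close>, \<open>smooth1_sin\<close> and
  \<open>smooth1_per\<close> only name such a set.\<close>

lemma smooth1_coinduct:
  assumes "f \<in> S"
    and step: "\<And>g. g \<in> S \<Longrightarrow> \<exists>g'\<in>S. \<forall>x. (g has_real_derivative g' x) (at x)"
  shows "smooth1 f"
proof -
  have "(deriv ^^ n) f \<in> S" for n
  proof (induction n)
    case (Suc n)
    from step[OF this] obtain g' where g: "g' \<in> S"
      "\<forall>x. ((deriv ^^ n) f has_real_derivative g' x) (at x)" by blast
    then have "deriv ((deriv ^^ n) f) = g'" by (auto intro!: DERIV_imp_deriv)
    with g show ?case by simp
  qed (simp add: assms)
  then show ?thesis unfolding smooth1_def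
    using step by (meson field_differentiable_def)
qed

text \<open>The set for the coinduction must be closed under differentiation. Products and affine
  substitutions of smooth functions are so only together with sums and constants, which the product
  and chain rules produce.\<close>

inductive smooth1_ring :: "(real \<Rightarrow> real) \<Rightarrow> bool" where
  base: "smooth1 f \<Longrightarrow> smooth1_ring f"
| const: "smooth1_ring (\<lambda>x. c)"
| ident: "smooth1_ring (\<lambda>x. x)"
| add: "smooth1_ring f \<Longrightarrow> smooth1_ring g \<Longrightarrow> smooth1_ring (\<lambda>x. f x + g x)"
| mult: "smooth1_ring f \<Longrightarrow> smooth1_ring g \<Longrightarrow> smooth1_ring (\<lambda>x. f x * g x)"
| affine: "smooth1_ring f \<Longrightarrow> smooth1_ring (\<lambda>x. f (a * x + b))"

lemma smooth1_ring_deriv: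
  assumes "smooth1_ring f"
  shows "\<exists>f'. smooth1_ring f' \<and> (\<forall>x. (f has_real_derivative f' x) (at x))"
  using assms
proof induction
  case (base f)
  then show ?case using smooth1_has_deriv smooth1_deriv smooth1_ring.base by blast
next
  case (const c)
  show ?case by (rule exI[of _ "\<lambda>x. 0"]) (auto intro: smooth1_ring.const)
next
  case ident
  show ?case by (rule exI[of _ "\<lambda>x. 1"]) (auto intro: smooth1_ring.const)
next
  case (add f g)
  then obtain f' g' where "smooth1_ring f'" "smooth1_ring g'"
    "\<forall>x. (f has_real_derivative f' x) (at x)" "\<forall>x. (g has_real_derivative g' x) (at x)"
    by blast
  then show ?case
    by (intro exI[of _ "\<lambda>x. f' x + g' x"]) (auto intro!: smooth1_ring.add DERIV_add)
next
  case (mult f g)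
  then obtain f' g' where *: "smooth1_ring f'" "smooth1_ring g'"
    "\<forall>x. (f has_real_derivative f' x) (at x)" "\<forall>x. (g has_real_derivative g' x) (at x)"
    by blast
  then show ?case
    by (intro exI[of _ "\<lambda>x. f' x * g x + g' x * f x"])
       (auto intro!: smooth1_ring.add smooth1_ring.mult mult DERIV_mult)
next
  case (affine f a b)
  then obtain f' where *: "smooth1_ring f'" "\<And>x. (f has_real_derivative f' x) (at x)" by blast
  have "((\<lambda>x. f (a * x + b)) has_real_derivative a * f' (a * x + b)) (at x)" for x
    by (rule DERIV_cong[OF DERIV_chain2[OF *(2)]]) (auto intro!: derivative_eq_intros)
  then show ?case
    by (intro exI[of _ "\<lambda>x. a * f' (a * x + b)"])
       (auto intro!: smooth1_ring.mult smooth1_ring.const smooth1_ring.affine *)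
qed

lemma smooth1_ring_smooth1: "smooth1_ring f \<Longrightarrow> smooth1 f"
  using smooth1_coinduct[of f "{f. smooth1_ring f}"] smooth1_ring_deriv by auto

lemma smooth1_const [simp]: "smooth1 (\<lambda>x. c)"
  and smooth1_ident [simp]: "smooth1 (\<lambda>x. x)"
  and smooth1_add: "smooth1 f \<Longrightarrow> smooth1 g \<Longrightarrow> smooth1 (\<lambda>x. f x + g x)"
  and smooth1_mult: "smooth1 f \<Longrightarrow> smooth1 g \<Longrightarrow> smooth1 (\<lambda>x. f x * g x)"
  and smooth1_affine: "smooth1 f \<Longrightarrow> smooth1 (\<lambda>x. f (a * x + b))"
  by (auto intro!: smooth1_ring_smooth1 intro: smooth1_ring.intros)

lemma smooth1_scale: "smooth1 f \<Longrightarrow> smooth1 (\<lambda>x. f (a * x))"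
  using smooth1_affine[of f a 0] by simp

lemma smooth1_cmult: "smooth1 f \<Longrightarrow> smooth1 (\<lambda>x. c * f x)"
  by (intro smooth1_mult smooth1_const)

lemma smooth1_of_deriv:
  assumes "\<And>x. (f has_real_derivative g x) (at x)" "smooth1 g" shows "smooth1 f"
proof (rule smooth1_coinduct[of f "insert f {h. smooth1 h}"])
  fix h assume "h \<in> insert f {h. smooth1 h}"
  then show "\<exists>g'\<in>insert f {h. smooth1 h}. \<forall>x. (h has_real_derivative g' x) (at x)"
    using assms smooth1_has_deriv smooth1_deriv by blast
qed simp

lemma smooth1_continuous: "smooth1 f \<Longrightarrow> continuous_on A f"
  by (meson smooth1_has_deriv DERIV_isCont continuous_at_imp_continuous_on)

lemma smooth1_sin: "smooth1 (\<lambda>x. sin (a * x))"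
proof -
  \<comment> \<open>The span of cosine and sine of frequency \<open>a\<close> is closed under
    differentiation, the sines alone are not.\<close>
  let ?S = "{\<lambda>x. c * cos (a * x) + d * sin (a * x) | c d. True}"
  have "smooth1 f" if "f \<in> ?S" for f
  proof (rule smooth1_coinduct[OF that])
    fix g assume "g \<in> ?S"
    then obtain c d where g: "g = (\<lambda>x. c * cos (a * x) + d * sin (a * x))" by auto
    have "(g has_real_derivative (a * d) * cos (a * x) + (- a * c) * sin (a * x)) (at x)" for x
      unfolding g by (auto intro!: derivative_eq_intros simp: algebra_simps)
    then show "\<exists>g'\<in>?S. \<forall>x. (g has_real_derivative g' x) (at x)"
      by (intro bexI[of _ "\<lambda>x. (a * d) * cos (a * x) + (- a * c) * sin (a * x)"]) blast+
  qed
  moreover have "(\<lambda>x. sin (a * x)) \<in> ?S"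
    by (rule CollectI, rule exI[of _ 0], rule exI[of _ 1]) simp
  ultimately show ?thesis by blast
qed

subsection \<open>A smooth bump function\<close>

lemma poly_times_exp_minus_tendsto_0:
  fixes p :: "real poly"
  shows "((\<lambda>x. poly p x * exp (- x)) \<longlongrightarrow> 0) at_top"
proof -
  have "poly p x * exp (-x) = (\<Sum>i\<le>degree p. coeff p i * (x ^ i / exp x))" for x
    unfolding poly_altdef sum_distrib_right by (simp add: exp_minus field_simps)
  moreover have "((\<lambda>x. \<Sum>i\<le>degree p. coeff p i * (x ^ i / exp x)) \<longlongrightarrow> (\<Sum>i\<le>degree p. coeff p i * 0)) at_top"
    by (intro tendsto_intros tendsto_power_div_exp_0)
  ultimately show ?thesis by simp
qed

text \<open>The standard smooth function that is not analytic at 0; a product with its reflection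
  yields bumps of compact support.\<close>

definition flat :: "real \<Rightarrow> real" where
  "flat x = (if x > 0 then exp (- (1 / x)) else 0)"

text \<open>The functions p(1/x) exp(-1/x), p a polynomial, extended by 0, form a set closed under
  differentiation; at 0 the exponential beats every power of 1/x.\<close>

lemma smooth1_flat: "smooth1 flat"
proof (rule smooth1_coinduct)
  let ?f = "\<lambda>p::real poly. \<lambda>x::real. if x > 0 then poly p (1 / x) * exp (- (1 / x)) else 0"
  show "flat \<in> range ?f"
    by (rule image_eqI[of _ _ "1"]) (auto simp: flat_def)
  fix g assume "g \<in> range ?f"
  then obtain p where g: "g = ?f p" by auto
  \<comment> \<open>By the chain rule the derivative of p(1/x) exp(-1/x) is x^(-2) (p - p')(1/x)
    exp(-1/x).\<close>
  define q where "q = [:0,0,1:] * (p - pderiv p)"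
  have "(g has_real_derivative ?f q x) (at x)" for x
  proof -
    consider "x > 0" | "x < 0" | "x = 0" by linarith
    then show ?thesis
    proof cases
      case 1
      have "((\<lambda>x. poly p (1 / x) * exp (- (1 / x))) has_real_derivative ?f q x) (at x)"
        using 1 by (auto intro!: derivative_eq_intros poly_DERIV[THEN DERIV_chain2]
            simp: q_def field_simps power2_eq_square)
      then show ?thesis unfolding g
        by (rule has_field_derivative_transform_within_open[of _ _ _ "{0<..}"]) (use 1 in auto)
    next
      case 2
      have "((\<lambda>x. 0) has_real_derivative ?f q x) (at x)" using 2 by auto
      then show ?thesis unfolding g
        by (rule has_field_derivative_transform_within_open[of _ _ _ "{..<0}"]) (use 2 in auto)
    next
      case 3
      \<comment> \<open>Division by y only multiplies the polynomial in 1/y by one more power, so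
        the difference quotient at 0 again decays.\<close>
      have r: "((\<lambda>y. g y / y) \<longlongrightarrow> 0) (at_right 0)"
      proof -
        have "((\<lambda>y. poly (p * [:0,1:]) (inverse y) * exp (- (inverse y))) \<longlongrightarrow> 0) (at_right 0)"
          by (rule filterlim_compose[OF poly_times_exp_minus_tendsto_0 filterlim_inverse_at_top_right])
        then show ?thesis
          by (rule Lim_transform_eventually)
             (auto simp: g eventually_at_right_field field_simps intro!: exI[of _ 1])
      qed
      have l: "((\<lambda>y. g y / y) \<longlongrightarrow> 0) (at_left 0)"
        by (rule Lim_transform_eventually[OF tendsto_const])
           (auto simp: g eventually_at_left_field intro!: exI[of _ "-1"])
      have "((\<lambda>y. g y / y) \<longlongrightarrow> 0) (at 0)" using filterlim_split_at[OF l r] .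
      then show ?thesis using 3 by (simp add: has_field_derivative_iff g)
    qed
  qed
  then show "\<exists>g'\<in>range ?f. \<forall>x. (g has_real_derivative g' x) (at x)"
    by (intro bexI[of _ "?f q"]) blast+
qed

lemma flat_nonneg: "0 \<le> flat x" and flat_le_1: "flat x \<le> 1"
  and flat_pos_iff: "0 < flat x \<longleftrightarrow> 0 < x" and flat_0: "x \<le> 0 \<Longrightarrow> flat x = 0"
  by (auto simp: flat_def)

subsection \<open>Periodisation\<close>

text \<open>Only the values on [0,1) enter. This is the sum of all integer translates when
  \<open>f\<close> vanishes outside the unit interval; \<open>supp01\<close> asks for this, with
  both end points included so that the pieces fit together at the integers.\<close>

definition per :: "(real \<Rightarrow> real) \<Rightarrow> real \<Rightarrow> real" where
  "per f t = f (frac t)"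

definition per1 :: "(real \<Rightarrow> 'a) \<Rightarrow> bool" where
  "per1 f \<longleftrightarrow> (\<forall>t. f (t + 1) = f t)"

definition supp01 :: "(real \<Rightarrow> real) \<Rightarrow> bool" where
  "supp01 f \<longleftrightarrow> (\<forall>t. t \<le> 0 \<or> 1 \<le> t \<longrightarrow> f t = 0)"

lemma per1_per [simp]: "per1 (per f)"
  by (simp add: per1_def per_def frac_1_eq)

lemma per1_int: assumes "per1 f" shows "f (t + of_int n) = f t"
proof -
  have nat: "f (t + of_nat n) = f t" for t n
  proof (induction n)
    case (Suc n)
    have "f (t + of_nat (Suc n)) = f ((t + of_nat n) + 1)" by (simp add: algebra_simps)
    with Suc assms show ?case by (simp add: per1_def)
  qed simp
  show ?thesis
  proof (cases "n \<ge> 0")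
    case True
    then show ?thesis using nat[of t "nat n"] by simp
  next
    case False
    then show ?thesis using nat[of "t + of_int n" "nat (- n)"] by simp
  qed
qed

lemma per1_frac: "per1 f \<Longrightarrow> f (frac t) = f t"
  using per1_int[of f t "- floor t"] by (simp add: frac_def)

lemma per1_scale: "per1 f \<Longrightarrow> per1 (\<lambda>t. f (of_nat n * t))"
  using per1_int[of f "of_nat n * t" "int n" for t] by (simp add: per1_def ring_distribs)

text \<open>Off the closed unit interval the function is locally 0; the zero set of the continuous
  derivative is closed and so contains 0 and 1 as well.\<close>

lemma supp01_deriv:
  assumes "smooth1 f" "supp01 f" shows "supp01 (deriv f)"
proof -
  have "deriv f t = 0" if "t < 0 \<or> 1 < t" for t
  proof -
    have "((\<lambda>x. 0) has_real_derivative 0) (at t)" by simp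
    then have "(f has_real_derivative 0) (at t)"
      by (rule has_field_derivative_transform_within_open[of _ _ _ "{..<0} \<union> {1<..}"])
         (use that assms(2) in \<open>auto simp: supp01_def\<close>)
    then show ?thesis by (rule DERIV_imp_deriv)
  qed
  then have sub: "{..<0} \<union> {1<..} \<subseteq> {t. deriv f t = 0}" by auto
  have "closed {t. deriv f t = 0}"
    using smooth1_continuous[OF smooth1_deriv[OF assms(1)], of UNIV]
      continuous_closed_preimage_constant[of UNIV "deriv f" 0] by simp
  then have "closure ({..<0} \<union> {1<..}) \<subseteq> {t. deriv f t = 0}"
    by (rule closure_minimal[OF sub])
  then show ?thesis by (auto simp: supp01_def)
qed

text \<open>Near \<open>t\<close> the periodisation is the sum of two neighbouring translates of
  \<open>f\<close>, at most one of which is nonzero at each point. This avoids a separate treatment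
  of integers \<open>t\<close>.\<close>

lemma per_has_deriv:
  assumes "smooth1 f" "supp01 f"
  shows "(per f has_real_derivative per (deriv f) t) (at t)"
proof -
  define n where "n = real_of_int \<lfloor>t\<rfloor>"
  have t: "n \<le> t" "t < n + 1" unfolding n_def by linarith+
  have fr: "frac t = t - n" by (simp add: frac_def n_def)
  have z: "f s = 0" "deriv f s = 0" if "s \<le> 0 \<or> 1 \<le> s" for s
    using assms(2) supp01_deriv[OF assms] that by (auto simp: supp01_def)
  have "((\<lambda>s. f (s - n) + f (s - n + 1)) has_real_derivative deriv f (t - n) + deriv f (t - n + 1)) (at t)"
    by (rule DERIV_cong, (rule derivative_intros smooth1_has_deriv[OF assms(1), THEN DERIV_chain2])+)
       (auto intro!: derivative_eq_intros)
  moreover have "deriv f (t - n + 1) = 0" using z t by simp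
  ultimately have "((\<lambda>s. f (s - n) + f (s - n + 1)) has_real_derivative per (deriv f) t) (at t)"
    by (simp add: per_def fr)
  moreover have "f (s - n) + f (s - n + 1) = per f s" if "s \<in> {n-1<..<n+1}" for s
  proof (cases "s < n")
    case True
    then have "\<lfloor>s\<rfloor> = \<lfloor>t\<rfloor> - 1" using that unfolding n_def by (intro floor_unique) auto
    then have "frac s = s - n + 1" by (simp add: frac_def n_def)
    then show ?thesis using z True by (simp add: per_def)
  next
    case False
    then have "\<lfloor>s\<rfloor> = \<lfloor>t\<rfloor>" using that unfolding n_def by (intro floor_unique) auto
    then have "frac s = s - n" by (simp add: frac_def n_def)
    then show ?thesis using z False by (simp add: per_def)
  qed
  ultimately show ?thesis
    using has_field_derivative_transform_within_open[of "\<lambda>s. f (s - n) + f (s - n + 1)" _ t "{n-1<..<n+1}"] t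
    by auto
qed

lemma deriv_per: "smooth1 f \<Longrightarrow> supp01 f \<Longrightarrow> deriv (per f) = per (deriv f)"
  by (intro ext DERIV_imp_deriv per_has_deriv)

lemma smooth1_per:
  assumes "smooth1 f" "supp01 f" shows "smooth1 (per f)"
proof (rule smooth1_coinduct[of _ "{per f |f. smooth1 f \<and> supp01 f}"])
  show "per f \<in> {per f |f. smooth1 f \<and> supp01 f}" using assms by blast
  fix g assume "g \<in> {per f |f. smooth1 f \<and> supp01 f}"
  then obtain f where "g = per f" "smooth1 f" "supp01 f" by blast
  then show "\<exists>g'\<in>{per f |f. smooth1 f \<and> supp01 f}. \<forall>x. (g has_real_derivative g' x) (at x)"
    using smooth1_deriv supp01_deriv per_has_deriv by blast
qed

lemma per1_deriv: assumes "smooth1 f" "per1 f" shows "per1 (deriv f)"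
proof -
  have "deriv f (t + 1) = deriv f t" for t
  proof -
    have "((\<lambda>s. f (s + 1)) has_real_derivative deriv f (t + 1)) (at t)"
      using smooth1_has_deriv[OF assms(1), of "t+1"] by (simp add: DERIV_shift)
    then have "(f has_real_derivative deriv f (t + 1)) (at t)"
      using assms(2) by (simp add: per1_def)
    then show ?thesis by (metis DERIV_imp_deriv)
  qed
  then show ?thesis by (simp add: per1_def)
qed

section \<open>Means of stretched periodic functions and periodic primitives\<close>

lemma integral_stretch_Icc:
  fixes f :: "real \<Rightarrow> real"
  assumes "0 < a" "0 \<le> b" "continuous_on UNIV f"
  shows "integral {0..b} (\<lambda>t. f (a * t)) = integral {0..a * b} f / a"
proof -
  have "(f has_integral integral {0..a*b} f) (cbox 0 (a*b))"
    by (auto intro!: integrable_integral integrable_continuous_real continuous_on_subset[OF assms(3)])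
  from has_integral_affinity[OF this, of a 0] assms(1)
  have "((\<lambda>t. f (a * t)) has_integral integral {0..a*b} f / a) ((\<lambda>x. x / a) ` {0..a*b})"
    by simp
  moreover have "(\<lambda>x. x / a) ` {0..a*b} = {0..b}"
  proof -
    have "x \<in> (\<lambda>x. x / a) ` {0..a*b}" if "0 \<le> x" "x \<le> b" for x
      by (rule image_eqI[of _ _ "a * x"]) (use that assms in auto)
    then show ?thesis using assms by (auto simp: field_simps)
  qed
  ultimately show ?thesis by (simp add: integral_unique)
qed

lemma integral_per1_nat:
  fixes P :: "real \<Rightarrow> real"
  assumes "continuous_on UNIV P" "per1 P"
  shows "integral {0..real n} P = real n * integral {0..1} P"
proof (induction n)
  case (Suc n)
  have int: "P integrable_on {a..b}" for a b
    by (intro integrable_continuous_real continuous_on_subset[OF assms(1)]) auto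
  have "integral {0..real (Suc n)} P = integral {0..real n} P + integral {real n..real n + 1} P"
    using Henstock_Kurzweil_Integration.integral_combine[where a=0 and c="real n" and b="real n + 1" and f=P] int by (simp add: add.commute)
  also have "integral {real n..real n + 1} P = integral {0..1} (\<lambda>x. P (x + real n))"
    using integral_shift_real_ivl[of "real n" "real n" "real n + 1" P] int by simp
  also have "(\<lambda>x. P (x + real n)) = P"
    using per1_int[OF assms(2), of _ "int n"] by auto
  finally show ?case using Suc by (simp add: algebra_simps)
qed simp

lemma integral_per1_stretch:
  fixes P :: "real \<Rightarrow> real"
  assumes "continuous_on UNIV P" "per1 P" "0 < T" "0 < n"
  shows "integral {0..T} (\<lambda>t. P (real n / T * t)) = T * integral {0..1} P"
  using integral_stretch_Icc[of "real n / T" T P] integral_per1_nat[OF assms(1,2), of n] assms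
  by simp

text \<open>Vanishing mean makes the primitive periodic, hence it is controlled by the integral over
  one period. Such primitives, rescaled, are the small functions \<open>h\<close> and
  \<open>K\<close> through which fast oscillations become small errors.\<close>

lemma per1_antideriv:
  fixes P :: "real \<Rightarrow> real"
  assumes P: "continuous_on UNIV P" "per1 P" and 0: "integral {0..1} P = 0"
  obtains K where "\<And>x. (K has_real_derivative P x) (at x)" "per1 K" "K 0 = 0"
    "\<And>x. \<bar>K x\<bar> \<le> integral {0..1} (\<lambda>t. \<bar>P t\<bar>)"
proof -
  have int: "P integrable_on {a..b}" "(\<lambda>t. \<bar>P t\<bar>) integrable_on {a..b}" for a b
    by (auto intro!: integrable_continuous_real continuous_intros continuous_on_subset[OF P(1)])
  \<comment> \<open>At most one of the two integrals is over a nondegenerate interval; the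
    difference is the oriented integral from 0 to s.\<close>
  define K where "K s = integral {0..s} P - integral {s..0} P" for s
  have K: "(K has_real_derivative P x) (at x)" for x
  proof -
    define N where "N = - \<bar>x\<bar> - 1"
    have N: "N < x" "N < 0" by (auto simp: N_def)
    have "((\<lambda>s. integral {N..s} P) has_real_derivative P x) (at x within {N..x+1})"
      by (rule integral_has_real_derivative) (auto simp: N less_imp_le intro: continuous_on_subset[OF P(1)])
    then have "((\<lambda>s. integral {N..s} P) has_real_derivative P x) (at x)"
      using N at_within_interior[of x "{N..x+1}"] by simp
    then have "((\<lambda>s. integral {N..s} P - integral {N..0} P) has_real_derivative P x) (at x)"
      by (auto intro!: derivative_eq_intros)
    moreover have "integral {N..s} P - integral {N..0} P = K s" if "s \<in> {N<..}" for s
    proof (cases "0 \<le> s")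
      case True
      then show ?thesis using Henstock_Kurzweil_Integration.integral_combine[where a=N and c=0 and b=s and f=P] N int
        by (cases "s = 0") (auto simp: K_def)
    next
      case False
      then show ?thesis using Henstock_Kurzweil_Integration.integral_combine[where a=N and c=s and b=0 and f=P] that int by (auto simp: K_def)
    qed
    ultimately show ?thesis
      using has_field_derivative_transform_within_open[of "\<lambda>s. integral {N..s} P - integral {N..0} P" _ x "{N<..}" K] N
      by auto
  qed
  have "K (s + 1) - K s = K (0 + 1) - K 0" for s
  proof (rule DERIV_isconst_all[of "\<lambda>s. K (s + 1) - K s"], rule allI)
    fix s
    show "((\<lambda>s. K (s + 1) - K s) has_real_derivative 0) (at s)"
      by (rule DERIV_cong[OF DERIV_diff[OF _ K]])
        (use K[of "s+1"] in \<open>auto simp: DERIV_shift\<close>, use P(2) in \<open>simp add: per1_def\<close>)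
  qed
  then have per: "per1 K" by (simp add: per1_def K_def 0)
  have "\<bar>K x\<bar> \<le> integral {0..1} (\<lambda>t. \<bar>P t\<bar>)" for x
  proof -
    have f: "0 \<le> frac x" "frac x \<le> 1" using frac_lt_1[of x] by auto
    have "integral {y..0} P = 0" if "0 \<le> y" for y using that by (cases "y = 0") auto
    from this[OF f(1)] have "integral {frac x..0} P = 0" .
    then have "\<bar>K x\<bar> = \<bar>integral {0..frac x} P\<bar>"
      using per1_frac[OF per, of x] by (simp add: K_def)
    also have "\<dots> \<le> integral {0..frac x} (\<lambda>t. \<bar>P t\<bar>)"
      using integral_norm_bound_integral[of P "{0..frac x}" "\<lambda>t. \<bar>P t\<bar>"] int by auto
    also have "\<dots> \<le> integral {0..1} (\<lambda>t. \<bar>P t\<bar>)"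
      by (rule integral_subset_le) (use f int in auto)
    finally show ?thesis .
  qed
  with that[OF K per] show ?thesis by (simp add: K_def)
qed

lemma integral_per:
  assumes "supp01 f" shows "integral {0..1} (per f) = integral {0..1} f"
proof (rule integral_cong)
  fix x :: real assume "x \<in> {0..1}"
  then consider "x = 1" | "frac x = x" using frac_eq[of x] by force
  then show "per f x = f x" using assms by cases (auto simp: per_def supp01_def)
qed

text \<open>Only one squeezed copy of \<open>f\<close> lies in the interval, so the integral is
  divided by \<open>k\<close>; for a periodic function (\<open>integral_per1_stretch\<close>)
  squeezing preserves the mean. The profiles combine both: concentration first, then periodisation
  and oscillation.\<close>

lemma integral_bump_scale:
  assumes "continuous_on UNIV f" "supp01 f" "0 < (k::nat)"
  shows "integral {0..1} (\<lambda>s. f (real k * s)) = integral {0..1} f / real k"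
proof -
  have "integral {0..real k} f = integral {0..1} f"
    using assms by (intro integral_spike_set)
      (auto intro!: negligible_subset[OF negligible_empty] simp: supp01_def not_le dest: less_imp_le)
  then show ?thesis using integral_stretch_Icc[of "real k" 1 f] assms by simp
qed

lemma supp01_scale: "supp01 f \<Longrightarrow> 0 < (k::nat) \<Longrightarrow> supp01 (\<lambda>s. f (real k * s))"
proof (unfold supp01_def, intro allI impI)
  fix t :: real
  assume f: "\<forall>t. t \<le> 0 \<or> 1 \<le> t \<longrightarrow> f t = 0" and k: "0 < k" and t: "t \<le> 0 \<or> 1 \<le> t"
  from t show "f (real k * t) = 0"
  proof
    assume "t \<le> 0" then show ?thesis using f by (simp add: mult_nonneg_nonpos)
  next
    assume "1 \<le> t"
    then have "1 * 1 \<le> real k * t" using k by (intro mult_mono) auto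
    then show ?thesis using f by simp
  qed
qed

lemma supp01_bounded:
  fixes f :: "real \<Rightarrow> real"
  assumes "continuous_on UNIV f" "supp01 f"
  obtains B where "1 \<le> B" "\<And>s. \<bar>f s\<bar> \<le> B"
proof -
  have "bounded (f ` {0..1})"
    by (intro compact_imp_bounded compact_continuous_image continuous_on_subset[OF assms(1)]) auto
  then obtain B where B: "\<And>s. s \<in> {0..1} \<Longrightarrow> \<bar>f s\<bar> \<le> B"
    unfolding bounded_iff by (metis imageI real_norm_def)
  have "\<bar>f s\<bar> \<le> max 1 B" for s
    using B[of s] assms(2) by (cases "s \<in> {0..1}") (auto simp: supp01_def not_le)
  then show ?thesis using that[of "max 1 B"] by auto
qed

section \<open>A fixed bump and its integrals\<close>

definition bump :: "real \<Rightarrow> real" where "bump s = flat s * flat (1 - s)"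

lemma smooth1_bump: "smooth1 bump"
  using smooth1_mult[OF smooth1_flat smooth1_affine[OF smooth1_flat, of "-1" 1]]
  by (simp add: bump_def[abs_def])

lemma supp01_bump: "supp01 bump" and bump_nonneg: "0 \<le> bump s" and bump_le_1: "bump s \<le> 1"
  by (auto simp: supp01_def bump_def flat_0 flat_nonneg flat_le_1 mult_le_one)

lemma bump_half_pos: "0 < bump (1/2)"
  by (simp add: bump_def flat_pos_iff)

lemma integral_pos_of_continuous:
  fixes f :: "real \<Rightarrow> real"
  assumes f: "continuous_on UNIV f" "\<And>s. 0 \<le> f s" and s: "s \<in> {0..1}" "f s \<noteq> 0"
  shows "0 < integral {0..1} f"
proof -
  have c: "continuous_on {0..1} f" by (rule continuous_on_subset[OF f(1)]) simp
  have "integral {0..1} f \<noteq> 0"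
    using integral_eq_0_iff[OF c] f(2) s by auto
  moreover have "0 \<le> integral {0..1} f" by (rule integral_nonneg) (auto intro: integrable_continuous_real c f)
  ultimately show ?thesis by simp
qed

lemma bump_integrals:
  shows "0 < integral {0..1} bump" "0 < integral {0..1} (\<lambda>s. (bump s)\<^sup>2)"
    "0 < integral {0..1} (\<lambda>s. (deriv bump s)\<^sup>2)"
proof -
  note c = smooth1_continuous[OF smooth1_bump, of UNIV]
    smooth1_continuous[OF smooth1_deriv[OF smooth1_bump], of UNIV]
  show "0 < integral {0..1} bump" "0 < integral {0..1} (\<lambda>s. (bump s)\<^sup>2)"
    by (rule integral_pos_of_continuous[of _ "1/2"];
        use bump_half_pos in \<open>auto intro!: c continuous_intros bump_nonneg\<close>)+
  have "\<exists>s\<in>{0..1}. deriv bump s \<noteq> 0"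
  proof (rule ccontr)
    assume "\<not> ?thesis"
    moreover have "deriv bump s = 0" if "s \<notin> {0..1}" for s
      using supp01_deriv[OF smooth1_bump supp01_bump] that by (auto simp: supp01_def not_le)
    ultimately have "deriv bump s = 0" for s by blast
    then have "bump (1/2) = bump 0"
      using smooth1_has_deriv[OF smooth1_bump] by (intro DERIV_isconst_all) metis
    then show False using bump_half_pos by (simp add: bump_def flat_0)
  qed
  then obtain s where "s \<in> {0..1}" "deriv bump s \<noteq> 0" by blast
  then show "0 < integral {0..1} (\<lambda>s. (deriv bump s)\<^sup>2)"
    by (intro integral_pos_of_continuous[of _ s]) (auto intro!: c continuous_intros)
qed

lemma per_mult: "per f s * per g s = per (\<lambda>s. f s * g s) s"
  by (simp add: per_def)

lemma deriv_scale: "smooth1 f \<Longrightarrow> deriv (\<lambda>s. f (a * s)) s = a * deriv f (a * s)"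
  by (rule DERIV_imp_deriv, rule DERIV_cong[OF DERIV_chain2[OF smooth1_has_deriv]])
     (auto intro!: derivative_eq_intros)

lemma deriv_cmult1: "smooth1 f \<Longrightarrow> deriv (\<lambda>s. c * f s) s = c * deriv f s"
  by (rule DERIV_imp_deriv) (rule DERIV_cmult[OF smooth1_has_deriv])

subsection \<open>Intermittent profiles\<close>

text \<open>The product \<open>\<alpha> \<beta>\<close> is \<open>1\<close> up to a fast oscillation \<open>h'\<close>, although \<open>\<alpha>\<close> is small in \<open>L\<^sup>q\<close> and
  \<open>\<beta>\<close> is small in \<open>L\<^sup>1\<close>: both are concentrated on short time intervals, the height of
  \<open>\<alpha>\<close> being bounded as \<open>\<eta>\<close> tends to \<open>0\<close>.\<close>

lemma time_profile:
  fixes T :: real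
  assumes T: "0 < T"
  obtains C where "0 < C" and
    "\<And>\<delta>. 0 < \<delta> \<Longrightarrow> \<exists>B>0. \<forall>A>0. \<forall>\<eta>>0. \<forall>q::nat. 1 \<le> q \<longrightarrow>
      (\<exists>\<alpha> \<beta> h. smooth1 \<alpha> \<and> smooth1 \<beta> \<and> smooth1 h \<and>
        (\<forall>t. 0 \<le> \<alpha> t \<and> 0 \<le> \<beta> t \<and> \<alpha> t * \<beta> t = 1 + deriv h t \<and> \<bar>h t\<bar> \<le> \<delta>) \<and> \<alpha> 0 = 0 \<and> h 0 = 0 \<and>
        integral {0..T} (\<lambda>t. \<alpha> t * \<beta> t) \<le> C \<and> integral {0..T} \<beta> \<le> C / A \<and>
        integral {0..T} (\<lambda>t. \<bar>deriv \<alpha> t\<bar>) \<le> A * B \<and>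
        integral {0..T} \<alpha> \<le> \<eta> \<and> integral {0..T} (\<lambda>t. \<alpha> t ^ q) \<le> \<eta>)"
proof -
  note c = smooth1_continuous[OF smooth1_bump, of UNIV]
    smooth1_continuous[OF smooth1_deriv[OF smooth1_bump], of UNIV]
  have cc: "continuous_on A (\<lambda>x. bump (f x))" if "continuous_on A f" for A and f :: "real \<Rightarrow> real"
    by (rule continuous_on_compose2[OF c(1) that]) simp
  define I0 where "I0 = integral {0..1} bump"
  define I1 where "I1 = integral {0..1} (\<lambda>s. \<bar>deriv bump s\<bar>)"
  \<comment> \<open>Normalises the mean of the product profile \<open>Q\<close> below to 1.\<close>
  define d where "d = 1 / integral {0..1} (\<lambda>s. (bump s)\<^sup>2)"
  have pos: "0 < I0" "0 < d" using bump_integrals by (auto simp: I0_def d_def)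
  have I1: "0 \<le> I1" unfolding I1_def
    by (rule integral_nonneg) (auto intro!: integrable_continuous_real continuous_intros continuous_on_subset[OF c(2)])
  define C where "C = T + d * T * I0"
  show thesis
  proof (rule that[of C])
    show "0 < C" using T pos by (simp add: C_def add_pos_pos)
    fix \<delta> :: real assume "0 < \<delta>"
    \<comment> \<open>\<nu> is the number of periods in [0,T]. The primitive of \<open>Q - 1\<close>
      is bounded by 2, so \<open>h\<close> will be bounded by 2 T / \<nu>.\<close>
    obtain \<nu> :: nat where "2 * T / \<delta> \<le> real \<nu>" using real_arch_simple by blast
    moreover have "0 < 2 * T / \<delta>" using T \<open>0 < \<delta>\<close> by simp
    ultimately have \<nu>0: "0 < \<nu>" "T * 2 \<le> \<delta> * real \<nu>"
      using \<open>0 < \<delta>\<close> by (auto simp: field_simps intro: Nat.gr0I)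
    then have \<nu>: "0 < \<nu>" "T * 2 / real \<nu> \<le> \<delta>" by (auto simp: divide_le_eq)
    \<comment> \<open>The total variation of a train of bumps depends on their number \<nu> but not
      on their width. So \<open>B\<close> is fixed before \<open>A\<close>, \<eta> and the
      concentration \<open>k\<close>; the summand 1 secures positivity.\<close>
    define B where "B = real \<nu> * I1 + 1"
    show "\<exists>B>0. \<forall>A>0. \<forall>\<eta>>0. \<forall>q::nat. 1 \<le> q \<longrightarrow>
      (\<exists>\<alpha> \<beta> h. smooth1 \<alpha> \<and> smooth1 \<beta> \<and> smooth1 h \<and>
        (\<forall>t. 0 \<le> \<alpha> t \<and> 0 \<le> \<beta> t \<and> \<alpha> t * \<beta> t = 1 + deriv h t \<and> \<bar>h t\<bar> \<le> \<delta>) \<and> \<alpha> 0 = 0 \<and> h 0 = 0 \<and>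
        integral {0..T} (\<lambda>t. \<alpha> t * \<beta> t) \<le> C \<and> integral {0..T} \<beta> \<le> C / A \<and>
        integral {0..T} (\<lambda>t. \<bar>deriv \<alpha> t\<bar>) \<le> A * B \<and>
        integral {0..T} \<alpha> \<le> \<eta> \<and> integral {0..T} (\<lambda>t. \<alpha> t ^ q) \<le> \<eta>)"
    proof (intro exI[of _ B] conjI allI impI)
      show "0 < B" using I1 by (simp add: B_def add_nonneg_pos)
      fix A \<eta> :: real and q :: nat assume A: "0 < A" and \<eta>: "0 < \<eta>" and q: "1 \<le> q"
      \<comment> \<open>The two integrals to be made small are at most T I0 / k times A and A^q
        respectively; the sum covers them together.\<close>
      define X where "X = (A + A ^ q) * T * I0 / \<eta>"
      have X: "0 < X" using A \<eta> T pos by (auto simp: X_def intro!: divide_pos_pos mult_pos_pos add_pos_pos)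
      obtain k :: nat where "X \<le> real k" using real_arch_simple by blast
      with X have k: "0 < k" "X \<le> real k" by (auto intro: Nat.gr0I)
      define f where "f s = bump (real k * s)" for s
      have f: "smooth1 f" "supp01 f" "continuous_on UNIV f"
        using smooth1_scale[OF smooth1_bump] supp01_scale[OF supp01_bump k(1)]
        by (auto simp: f_def[abs_def] intro: smooth1_continuous)
      have f01: "0 \<le> f s" "f s \<le> 1" for s by (auto simp: f_def bump_nonneg bump_le_1)
      define p where "p = per f"
      have p: "smooth1 p" "per1 p" "continuous_on UNIV p"
        using smooth1_per[OF f(1,2)] by (auto simp: p_def intro: smooth1_continuous)
      have p01: "0 \<le> p s" "p s \<le> 1" for s using f01 by (auto simp: p_def per_def)
      have p0: "p 0 = 0" using f(2) by (simp add: p_def per_def supp01_def)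
      define w where "w = real \<nu> / T"
      have w: "0 < w" using \<nu> T by (simp add: w_def)
      define \<alpha> where "\<alpha> t = A * p (w * t)" for t
      \<comment> \<open>The factor \<open>k\<close> compensates that \<open>p * p\<close> lives on a
        fraction 1/k of each period. Since the mean of \<open>p\<close> is I0 / k, the integral of
        \<beta> stays below C / A for every \<open>k\<close>.\<close>
      define \<beta> where "\<beta> t = d * real k / A * p (w * t)" for t
      define Q where "Q s = d * real k * (p s * p s)" for s
      have ab: "\<alpha> t * \<beta> t = Q (w * t)" for t using A by (simp add: \<alpha>_def \<beta>_def Q_def)
      have Q: "smooth1 Q" "per1 Q" "continuous_on UNIV Q" "0 \<le> Q s" for s
        using p p01 pos by (auto simp: Q_def[abs_def] per1_def intro!: smooth1_cmult smooth1_mult smooth1_continuous)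
      have intp: "integral {0..1} p = I0 / real k"
        using integral_per[OF f(2)] integral_bump_scale[OF c(1) supp01_bump k(1)]
        by (simp add: p_def I0_def f_def[abs_def])
      have "integral {0..1} (\<lambda>s. p s * p s) = integral {0..1} (\<lambda>s. f s * f s)"
        unfolding p_def per_mult by (rule integral_per) (use f(2) in \<open>auto simp: supp01_def\<close>)
      also have "\<dots> = integral {0..1} (\<lambda>s. (bump s)\<^sup>2) / real k"
        unfolding f_def power2_eq_square[symmetric]
        by (rule integral_bump_scale[of "\<lambda>s. (bump s)\<^sup>2"])
           (use k supp01_bump in \<open>auto simp: supp01_def intro!: continuous_intros c\<close>)
      finally have intQ: "integral {0..1} Q = 1"
        using k pos by (simp add: Q_def[abs_def] d_def)
      have intg: "g integrable_on {a..b}" if "continuous_on UNIV g" for g :: "real \<Rightarrow> real" and a b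
        by (intro integrable_continuous_real continuous_on_subset[OF that]) auto
      have "integral {0..1} (\<lambda>s. Q s - 1) = 0"
        by (subst integral_diff) (auto intro!: intg Q simp: intQ)
      moreover have "per1 (\<lambda>s. Q s - 1)" using Q by (simp add: per1_def)
      moreover have "continuous_on UNIV (\<lambda>s. Q s - 1)" by (intro continuous_intros Q(3))
      ultimately obtain H where H: "\<And>x. (H has_real_derivative Q x - 1) (at x)" "H 0 = 0"
        "\<And>x. \<bar>H x\<bar> \<le> integral {0..1} (\<lambda>t. \<bar>Q t - 1\<bar>)"
        by (rule_tac per1_antideriv) blast+
      have "integral {0..1} (\<lambda>t. \<bar>Q t - 1\<bar>) \<le> integral {0..1} (\<lambda>t. Q t + 1)"
        by (rule integral_le) (auto intro!: intg Q continuous_intros, use Q(4) in \<open>smt (verit)\<close>)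
      also have "\<dots> = 2" by (subst integral_add) (auto intro!: intg Q simp: intQ)
      finally have H2: "\<bar>H x\<bar> \<le> 2" for x using H(3)[of x] by linarith
      have sH: "smooth1 H"
        by (rule smooth1_of_deriv[OF H(1)]) (use smooth1_add[OF Q(1) smooth1_const[of "-1"]] in simp)
      define h where "h t = 1 / w * H (w * t)" for t
      have dh: "deriv h t = Q (w * t) - 1" for t
      proof -
        have "(h has_real_derivative 1 / w * ((Q (w * t) - 1) * w)) (at t)"
          unfolding h_def by (intro DERIV_cmult DERIV_chain2[OF H(1)] DERIV_cmult_Id)
        from DERIV_imp_deriv[OF this] show ?thesis using w by simp
      qed
      have stretch: "integral {0..T} (\<lambda>t. P (w * t)) = T * integral {0..1} P"
        if "continuous_on UNIV P" "per1 P" for P :: "real \<Rightarrow> real"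
        unfolding w_def by (rule integral_per1_stretch[OF that T \<nu>(1)])
      have dp: "deriv p s = per (\<lambda>s. real k * deriv bump (real k * s)) s" for s
      proof -
        have "deriv f = (\<lambda>s. real k * deriv bump (real k * s))"
          unfolding f_def[abs_def] by (rule ext) (rule deriv_scale[OF smooth1_bump])
        then show ?thesis unfolding p_def deriv_per[OF f(1,2)] by simp
      qed
      \<comment> \<open>Scale invariance: the derivative grows like \<open>k\<close> on a set of
        length 1/k.\<close>
      have "integral {0..1} (\<lambda>s. \<bar>deriv p s\<bar>) = integral {0..1} (per (\<lambda>s. real k * \<bar>deriv bump (real k * s)\<bar>))"
        by (rule integral_cong) (simp add: dp per_def abs_mult)
      also have "\<dots> = integral {0..1} (\<lambda>s. real k * \<bar>deriv bump (real k * s)\<bar>)"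
        by (rule integral_per) (use supp01_scale[OF supp01_deriv[OF smooth1_bump supp01_bump] k(1)] in \<open>simp add: supp01_def\<close>)
      also have "\<dots> = I1"
        using integral_bump_scale[of "\<lambda>s. \<bar>deriv bump s\<bar>" k] k c supp01_deriv[OF smooth1_bump supp01_bump]
        by (simp add: I1_def supp01_def continuous_intros)
      finally have intdp: "integral {0..1} (\<lambda>s. \<bar>deriv p s\<bar>) = I1" .
      have da: "\<bar>deriv \<alpha> t\<bar> = A * w * \<bar>deriv p (w * t)\<bar>" for t
        unfolding \<alpha>_def using A w
        by (simp add: deriv_cmult1[OF smooth1_scale[OF p(1)]] deriv_scale[OF p(1)] abs_mult)
      have cdp: "continuous_on UNIV (\<lambda>s. \<bar>deriv p s\<bar>)"
        by (intro continuous_intros smooth1_continuous smooth1_deriv p)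
      have ia: "integral {0..T} \<alpha> = A * (T * (I0 / real k))"
        using stretch[OF p(3,2)] intp by (simp add: \<alpha>_def[abs_def])
      have "(A + A ^ q) * T * I0 \<le> real k * \<eta>"
        using k(2) by (simp only: X_def pos_divide_le_eq[OF \<eta>])
      then have "(A + A ^ q) * T * I0 / real k \<le> \<eta>"
        using k(1) by (simp only: pos_divide_le_eq of_nat_0_less_iff mult.commute)
      then have small: "A * (T * (I0 / real k)) + A ^ q * (T * (I0 / real k)) \<le> \<eta>"
        by (simp add: algebra_simps add_divide_distrib)
      have nn: "0 \<le> T * (I0 / real k)" using T pos by simp
      \<comment> \<open>As \<open>p\<close> has values in [0,1], high powers cost nothing; this is
        where the height of \<alpha>, independent of \<open>k\<close>, pays off.\<close>
      have "integral {0..1} (\<lambda>s. p s ^ q) \<le> integral {0..1} p"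
      proof (rule integral_le)
        fix x show "p x ^ q \<le> p x" using power_decreasing[of 1 q "p x"] p01[of x] q by simp
      qed (auto intro!: intg p continuous_intros)
      then have iaq: "integral {0..T} (\<lambda>t. \<alpha> t ^ q) \<le> A ^ q * (T * (I0 / real k))"
      proof -
        assume le: "integral {0..1} (\<lambda>s. p s ^ q) \<le> integral {0..1} p"
        have "integral {0..T} (\<lambda>t. \<alpha> t ^ q) = A ^ q * integral {0..T} (\<lambda>t. p (w * t) ^ q)"
          by (simp add: \<alpha>_def power_mult_distrib)
        also have "\<dots> = A ^ q * (T * integral {0..1} (\<lambda>s. p s ^ q))"
          using stretch[of "\<lambda>s. p s ^ q"] p by (simp add: per1_def continuous_intros)
        also have "\<dots> \<le> A ^ q * (T * (I0 / real k))"
          using le A T unfolding intp by (intro mult_left_mono) auto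
        finally show ?thesis .
      qed
      show "\<exists>\<alpha> \<beta> h. smooth1 \<alpha> \<and> smooth1 \<beta> \<and> smooth1 h \<and>
        (\<forall>t. 0 \<le> \<alpha> t \<and> 0 \<le> \<beta> t \<and> \<alpha> t * \<beta> t = 1 + deriv h t \<and> \<bar>h t\<bar> \<le> \<delta>) \<and> \<alpha> 0 = 0 \<and> h 0 = 0 \<and>
        integral {0..T} (\<lambda>t. \<alpha> t * \<beta> t) \<le> C \<and> integral {0..T} \<beta> \<le> C / A \<and>
        integral {0..T} (\<lambda>t. \<bar>deriv \<alpha> t\<bar>) \<le> A * B \<and>
        integral {0..T} \<alpha> \<le> \<eta> \<and> integral {0..T} (\<lambda>t. \<alpha> t ^ q) \<le> \<eta>"
      proof (rule exI[of _ \<alpha>], rule exI[of _ \<beta>], rule exI[of _ h], intro conjI allI)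
        show "smooth1 \<alpha>" "smooth1 \<beta>" "smooth1 h"
          unfolding \<alpha>_def[abs_def] \<beta>_def[abs_def] h_def[abs_def]
          by (intro smooth1_cmult smooth1_scale p sH)+
        show "0 \<le> \<alpha> t" "0 \<le> \<beta> t" for t using A pos p01 by (auto simp: \<alpha>_def \<beta>_def)
        show "\<alpha> t * \<beta> t = 1 + deriv h t" for t by (simp add: ab dh)
        show "\<bar>h t\<bar> \<le> \<delta>" for t
        proof -
          have "\<bar>h t\<bar> = 1 / w * \<bar>H (w * t)\<bar>" using w by (simp add: h_def abs_mult)
          also have "\<dots> \<le> 1 / w * 2" using w H2 by (intro mult_left_mono) auto
          also have "\<dots> \<le> \<delta>" using \<nu> by (simp add: w_def)
          finally show ?thesis .
        qed
        show "\<alpha> 0 = 0" "h 0 = 0" by (auto simp: \<alpha>_def h_def p0 H)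
        show "integral {0..T} (\<lambda>t. \<alpha> t * \<beta> t) \<le> C"
          using stretch[OF Q(3,2)] pos T by (simp add: ab intQ C_def)
        show "integral {0..T} \<beta> \<le> C / A"
        proof -
          have "integral {0..T} \<beta> = d * real k / A * (T * (I0 / real k))"
            using stretch[OF p(3,2)] intp by (simp add: \<beta>_def[abs_def])
          also have "\<dots> = d * T * I0 / A" using k by simp
          also have "\<dots> \<le> C / A" using A T by (intro divide_right_mono) (auto simp: C_def)
          finally show ?thesis .
        qed
        show "integral {0..T} (\<lambda>t. \<bar>deriv \<alpha> t\<bar>) \<le> A * B"
        proof -
          have "per1 (\<lambda>s. \<bar>deriv p s\<bar>)" using per1_deriv[OF p(1,2)] by (simp add: per1_def)
          from stretch[OF cdp this] have "integral {0..T} (\<lambda>t. \<bar>deriv \<alpha> t\<bar>) = A * w * (T * I1)"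
            by (simp add: da intdp)
          also have "\<dots> = A * (real \<nu> * I1)" using T by (simp add: w_def)
          also have "\<dots> \<le> A * B" using A by (intro mult_left_mono) (auto simp: B_def)
          finally show ?thesis .
        qed
        show "integral {0..T} \<alpha> \<le> \<eta>" "integral {0..T} (\<lambda>t. \<alpha> t ^ q) \<le> \<eta>"
        proof -
          have "0 \<le> A * (T * (I0 / real k))" "0 \<le> A ^ q * (T * (I0 / real k))"
            by (rule mult_nonneg_nonneg[OF _ nn], use A in simp)+
          then show "integral {0..T} \<alpha> \<le> \<eta>" "integral {0..T} (\<lambda>t. \<alpha> t ^ q) \<le> \<eta>"
            using ia iaq small by linarith+
        qed
      qed
    qed
  qed
qed

text \<open>The boundary terms vanish with the bump. The mean of f'' f found here determines the
  sign and the normalising factor \<open>I2\<close> of the space profiles.\<close>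

lemma bump_by_parts:
  "integral {0..1} (\<lambda>s. deriv (deriv bump) s * bump s) = - integral {0..1} (\<lambda>s. (deriv bump s)\<^sup>2)"
proof -
  note sb = smooth1_bump smooth1_deriv[OF smooth1_bump] smooth1_deriv[OF smooth1_deriv[OF smooth1_bump]]
  have "((\<lambda>s. deriv (deriv bump) s * bump s + deriv bump s * deriv bump s) has_integral
      deriv bump 1 * bump 1 - deriv bump 0 * bump 0) {0..1}"
  proof (rule fundamental_theorem_of_calculus)
    fix x :: real
    have "((\<lambda>s. deriv bump s * bump s) has_real_derivative
        deriv (deriv bump) x * bump x + deriv bump x * deriv bump x) (at x)"
      using DERIV_mult[OF smooth1_has_deriv[OF sb(2)] smooth1_has_deriv[OF sb(1)]] .
    then show "((\<lambda>s. deriv bump s * bump s) has_vector_derivative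
        deriv (deriv bump) x * bump x + deriv bump x * deriv bump x) (at x within {0..1})"
      by (simp add: has_real_derivative_iff_has_vector_derivative has_vector_derivative_at_within)
  qed simp
  then have "integral {0..1} (\<lambda>s. deriv (deriv bump) s * bump s + deriv bump s * deriv bump s) = 0"
    using supp01_bump by (simp add: integral_unique supp01_def)
  then show ?thesis
    by (subst (asm) integral_add)
       (auto intro!: integrable_continuous_real smooth1_continuous smooth1_mult sb simp: power2_eq_square)
qed

text \<open>\<Phi>' \<Psi> has mean 1, yet the L^1 norm of \<Phi> times the L^p norm of \<Psi>' is
  small: both functions live on a fraction 1/\<mu> of the period, which gains the factor
  \<mu>^(-1/p). \<open>A\<close> splits this smallness into \<delta> / A for \<Phi> and \<delta> A
  for \<Psi>. \<open>K\<close> is a primitive of the oscillating part of \<Phi>' \<Psi>,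
  \<open>K2\<close> the same for its modulus with mean \<open>m\<close>; the bound \<open>C\<close>
  of \<open>m\<close> depends neither on \<open>p\<close> nor on \<delta>.\<close>

lemma space_profile:
  obtains C :: real where "0 < C" and
    "\<And>p \<delta>. 0 < p \<Longrightarrow> 0 < \<delta> \<Longrightarrow> \<exists>\<Phi> \<Psi> K K2 A m. smooth1 \<Phi> \<and> per1 \<Phi> \<and> smooth1 \<Psi> \<and> per1 \<Psi> \<and>
      smooth1 K \<and> per1 K \<and> per1 K2 \<and> 0 < A \<and> 0 \<le> m \<and> m \<le> C \<and>
      (\<forall>s. deriv \<Phi> s * \<Psi> s = 1 + deriv K s \<and>
        (K2 has_real_derivative \<bar>deriv \<Phi> s * \<Psi> s\<bar> - m) (at s) \<and>
        \<bar>K s\<bar> \<le> \<delta> \<and> \<bar>K2 s\<bar> \<le> \<delta> \<and> \<bar>\<Phi> s * \<Psi> s\<bar> \<le> \<delta> \<and> \<bar>\<Psi> s\<bar> \<le> \<delta> * A) \<and>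
      A * integral {0..1} (\<lambda>s. \<bar>\<Phi> s\<bar>) \<le> \<delta> \<and>
      (\<forall>q. 1 \<le> q \<and> q \<le> real p \<longrightarrow> integral {0..1} (\<lambda>s. \<bar>deriv \<Psi> s\<bar> powr q) \<le> (\<delta> * A) powr q)"
proof -
  note sb = smooth1_bump smooth1_deriv[OF smooth1_bump] smooth1_deriv[OF smooth1_deriv[OF smooth1_bump]]
  note cb = sb[THEN smooth1_continuous, of UNIV]
  note zb = supp01_bump supp01_deriv[OF smooth1_bump supp01_bump]
     supp01_deriv[OF sb(2) supp01_deriv[OF smooth1_bump supp01_bump]]
  define I1 where "I1 = integral {0..1} (\<lambda>s. \<bar>deriv bump s\<bar>)"
  define I2 where "I2 = integral {0..1} (\<lambda>s. (deriv bump s)\<^sup>2)"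
  define J where "J = integral {0..1} (\<lambda>s. \<bar>deriv (deriv bump) s * bump s\<bar>) / I2"
  obtain B1 where B1: "1 \<le> B1" "\<And>s. \<bar>deriv bump s\<bar> \<le> B1"
    using supp01_bounded[OF cb(2) zb(2)] by blast
  have intg: "g integrable_on {a..b}" if "continuous_on UNIV g" for g :: "real \<Rightarrow> real" and a b
    by (intro integrable_continuous_real continuous_on_subset[OF that]) auto
  have I2: "0 < I2" using bump_integrals by (simp add: I2_def)
  have I1: "0 \<le> I1" unfolding I1_def by (rule integral_nonneg) (auto intro!: intg continuous_intros cb)
  have J: "0 \<le> J" unfolding J_def using I2
    by (intro divide_nonneg_pos integral_nonneg) (auto intro!: intg continuous_intros cb)
  show thesis
  proof (rule that[of "J + 1"])
    show "0 < J + 1" using J by simp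
    fix p :: nat and \<delta> :: real assume pp: "0 < p" and \<delta>: "0 < \<delta>"
    \<comment> \<open>1/M is the gain left from the concentration after taking p-th roots. It has to
      beat \<delta>^2, since A times the L^1 norm of \<Phi> will be I1 B1 / (I2 \<delta> M).\<close>
    obtain M0 :: nat where "I1 * B1 / I2 / \<delta>\<^sup>2 \<le> real M0" using real_arch_simple by blast
    then obtain M :: nat where M: "0 < M" "I1 * B1 / I2 / \<delta>\<^sup>2 \<le> real M"
      using that[of "Suc M0"] by (intro that[of "Suc M0"]) auto
    \<comment> \<open>Then M^q is at most \<mu> for every q <= p, so that one profile serves all
      these exponents.\<close>
    define \<mu> where "\<mu> = M ^ p"
    have \<mu>: "0 < \<mu>" using M by (simp add: \<mu>_def)
    \<comment> \<open>The oscillation with frequency \<open>l\<close> makes \<open>K\<close>,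
      \<open>K2\<close> and \<Phi> \<Psi> small. Before division by \<open>l\<close> their bounds
      are J + 1, 2 J and B1 / I2, all covered by this numerator.\<close>
    define X where "X = (3 * J + 1 + B1 / I2) / \<delta>"
    have X: "0 < X" using J B1 I2 \<delta> by (auto simp: X_def intro!: divide_pos_pos add_nonneg_pos)
    obtain l :: nat where "X \<le> real l" using real_arch_simple by blast
    with X have l: "0 < l" "X \<le> real l" by (auto intro: Nat.gr0I)
    have lX: "(3 * J + 1 + B1 / I2) / real l \<le> \<delta>" using l \<delta> by (simp add: X_def field_simps)
    define f where "f s = bump (real \<mu> * s)" for s
    define g where "g s = deriv bump (real \<mu> * s)" for s
    define k where "k s = deriv (deriv bump) (real \<mu> * s)" for s
    have z: "supp01 f" "supp01 g" "supp01 k"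
      unfolding f_def[abs_def] g_def[abs_def] k_def[abs_def] by (intro supp01_scale zb \<mu>)+
    have s: "smooth1 f" "smooth1 g" "smooth1 k"
      unfolding f_def[abs_def] g_def[abs_def] k_def[abs_def] by (intro smooth1_scale sb)+
    have df: "deriv f s = \<mu> * g s" for s unfolding f_def g_def by (simp add: deriv_scale sb)
    have dg: "deriv g s = \<mu> * k s" for s unfolding k_def g_def by (simp add: deriv_scale sb)
    note c = s[THEN smooth1_continuous, of UNIV]
    have sp: "smooth1 (per f)" "smooth1 (per g)" by (intro smooth1_per s z)+
    have dpf: "deriv (per f) s = \<mu> * per g s" for s by (simp add: deriv_per s z per_def df)
    have dpg: "deriv (per g) s = \<mu> * per k s" for s by (simp add: deriv_per s z per_def dg)
    \<comment> \<open>\<Phi> carries the derivative of the bump and \<Psi> the bump itself, so that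
      \<Phi>' \<Psi> is a multiple of f'' f. The minus sign makes its mean positive; the weights
      \<mu> and 1/\<mu> put the large amplitude on \<Phi>.\<close>
    define \<Phi> where "\<Phi> s = - (\<mu> / I2 / l) * per g (real l * s)" for s
    define \<Psi> where "\<Psi> s = 1 / \<mu> * per f (real l * s)" for s
    define Q where "Q s = - (\<mu> / I2) * per (\<lambda>s. k s * f s) s" for s
    have s\<Phi>: "smooth1 \<Phi>" unfolding \<Phi>_def[abs_def] by (intro smooth1_cmult smooth1_scale sp)
    have s\<Psi>: "smooth1 \<Psi>" unfolding \<Psi>_def[abs_def] by (intro smooth1_cmult smooth1_scale sp)
    have d\<Phi>: "deriv \<Phi> s = - (\<mu> / I2) * (\<mu> * per k (real l * s))" for s
      unfolding \<Phi>_def using l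
      by (subst deriv_cmult1[OF smooth1_scale[OF sp(2)]]) (simp add: deriv_scale sp dpg)
    have d\<Psi>: "deriv \<Psi> s = l * per g (real l * s)" for s
      unfolding \<Psi>_def using \<mu>
      by (subst deriv_cmult1[OF smooth1_scale[OF sp(1)]]) (simp add: deriv_scale sp dpf)
    have QQ: "deriv \<Phi> s * \<Psi> s = Q (real l * s)" for s
      using \<mu> by (simp add: d\<Phi> \<Psi>_def Q_def per_mult[symmetric])
    have skf: "smooth1 (\<lambda>s. k s * f s)" "supp01 (\<lambda>s. k s * f s)"
      using s z by (auto intro: smooth1_mult simp: supp01_def)
    have sQ: "smooth1 Q" "per1 Q" unfolding Q_def[abs_def]
      by (intro smooth1_cmult smooth1_per skf) (simp add: per1_def per_def frac_1_eq)
    note cQ = smooth1_continuous[OF sQ(1), of UNIV]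
    have scale: "integral {0..1} (per (\<lambda>s. G (real \<mu> * s))) = integral {0..1} G / \<mu>"
      if "continuous_on UNIV G" "supp01 G" for G :: "real \<Rightarrow> real"
      using integral_per[OF supp01_scale[OF that(2) \<mu>]] integral_bump_scale[OF that \<mu>] by simp
    have stretch: "integral {0..1} (\<lambda>t. P (real l * t)) = integral {0..1} P"
        if "continuous_on UNIV P" "per1 P" for P :: "real \<Rightarrow> real"
      using integral_per1_stretch[OF that zero_less_one l(1)] by simp
    have "integral {0..1} Q = - (\<mu> / I2) * (integral {0..1} (\<lambda>s. deriv (deriv bump) s * bump s) / \<mu>)"
      unfolding Q_def k_def f_def
      by (subst scale[symmetric]) (use zb in \<open>auto simp: supp01_def intro!: continuous_intros cb\<close>)
    then have iQ: "integral {0..1} Q = 1"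
      using I2 \<mu> unfolding bump_by_parts by (simp add: I2_def)
    have "integral {0..1} (\<lambda>s. \<bar>Q s\<bar>) = integral {0..1} (\<lambda>s. \<mu> / I2 * per (\<lambda>s. \<bar>k s * f s\<bar>) s)"
      using \<mu> I2 by (intro integral_cong) (simp add: Q_def per_def abs_mult)
    also have "\<dots> = \<mu> / I2 * (integral {0..1} (\<lambda>s. \<bar>deriv (deriv bump) s * bump s\<bar>) / \<mu>)"
      unfolding k_def f_def
      by (subst scale[symmetric]) (use zb in \<open>auto simp: supp01_def intro!: continuous_intros cb\<close>)
    finally have aQ: "integral {0..1} (\<lambda>s. \<bar>Q s\<bar>) = J" using \<mu> by (simp add: J_def)
    have z1: "integral {0..1} (\<lambda>s. Q s - 1) = 0"
      by (subst integral_diff) (auto intro!: intg cQ continuous_intros simp: iQ)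
    have z2: "integral {0..1} (\<lambda>s. \<bar>Q s\<bar> - J) = 0"
      by (subst integral_diff) (auto intro!: intg cQ continuous_intros simp: aQ)
    have per: "per1 (\<lambda>s. Q s - 1)" "per1 (\<lambda>s. \<bar>Q s\<bar> - J)" using sQ by (auto simp: per1_def)
    have c1: "continuous_on UNIV (\<lambda>s. Q s - 1)" "continuous_on UNIV (\<lambda>s. \<bar>Q s\<bar> - J)"
      by (intro continuous_intros cQ)+
    obtain H where H: "\<And>x. (H has_real_derivative Q x - 1) (at x)" "per1 H"
        "\<And>x. \<bar>H x\<bar> \<le> integral {0..1} (\<lambda>t. \<bar>Q t - 1\<bar>)"
      by (rule per1_antideriv[OF c1(1) per(1) z1]) blast
    obtain H2 where H2: "\<And>x. (H2 has_real_derivative \<bar>Q x\<bar> - J) (at x)" "per1 H2"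
        "\<And>x. \<bar>H2 x\<bar> \<le> integral {0..1} (\<lambda>t. \<bar>\<bar>Q t\<bar> - J\<bar>)"
      by (rule per1_antideriv[OF c1(2) per(2) z2]) blast
    have "integral {0..1} (\<lambda>t. \<bar>Q t - 1\<bar>) \<le> integral {0..1} (\<lambda>t. \<bar>Q t\<bar> + 1)"
      by (rule integral_le) (auto intro!: intg cQ continuous_intros)
    also have "\<dots> = J + 1" by (subst integral_add) (auto intro!: intg cQ continuous_intros simp: aQ)
    finally have HJ: "\<bar>H x\<bar> \<le> J + 1" for x using H(3)[of x] by linarith
    have "integral {0..1} (\<lambda>t. \<bar>\<bar>Q t\<bar> - J\<bar>) \<le> integral {0..1} (\<lambda>t. \<bar>Q t\<bar> + J)"
      using J by (intro integral_le) (auto intro!: intg cQ continuous_intros)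
    also have "\<dots> = J + J" by (subst integral_add) (auto intro!: intg cQ continuous_intros simp: aQ)
    finally have HJ2: "\<bar>H2 x\<bar> \<le> J + J" for x using H2(3)[of x] by linarith
    have sH: "smooth1 H"
      by (rule smooth1_of_deriv[OF H(1)]) (use smooth1_add[OF sQ(1) smooth1_const[of "-1"]] in simp)
    define K where "K s = 1 / l * H (real l * s)" for s
    define K2 where "K2 s = 1 / l * H2 (real l * s)" for s
    \<comment> \<open>Chosen so that \<delta> A equals l B1 / M, which is the bound for the L^q
      norms of \<Psi>'.\<close>
    define A where "A = l * B1 / (M * \<delta>)"
    have A: "0 < A" "\<delta> * A = l * B1 / M" using l B1 M \<delta> by (auto simp: A_def)
    have f1: "\<bar>per f s\<bar> \<le> 1" "\<bar>per g s\<bar> \<le> B1" for s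
      using bump_nonneg bump_le_1 B1 by (auto simp: per_def f_def g_def)
    have pl: "per1 (\<lambda>t. P (real l * t))" if "per1 P" for P :: "real \<Rightarrow> real" using per1_scale[OF that] .
    show "\<exists>\<Phi> \<Psi> K K2 A m. smooth1 \<Phi> \<and> per1 \<Phi> \<and> smooth1 \<Psi> \<and> per1 \<Psi> \<and>
      smooth1 K \<and> per1 K \<and> per1 K2 \<and> 0 < A \<and> 0 \<le> m \<and> m \<le> J + 1 \<and>
      (\<forall>s. deriv \<Phi> s * \<Psi> s = 1 + deriv K s \<and>
        (K2 has_real_derivative \<bar>deriv \<Phi> s * \<Psi> s\<bar> - m) (at s) \<and>
        \<bar>K s\<bar> \<le> \<delta> \<and> \<bar>K2 s\<bar> \<le> \<delta> \<and> \<bar>\<Phi> s * \<Psi> s\<bar> \<le> \<delta> \<and> \<bar>\<Psi> s\<bar> \<le> \<delta> * A) \<and>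
      A * integral {0..1} (\<lambda>s. \<bar>\<Phi> s\<bar>) \<le> \<delta> \<and>
      (\<forall>q. 1 \<le> q \<and> q \<le> real p \<longrightarrow> integral {0..1} (\<lambda>s. \<bar>deriv \<Psi> s\<bar> powr q) \<le> (\<delta> * A) powr q)"
    proof (rule exI[of _ \<Phi>], rule exI[of _ \<Psi>], rule exI[of _ K], rule exI[of _ K2], rule exI[of _ A],
        rule exI[of _ J], intro conjI allI impI)
      show "smooth1 \<Phi>" "smooth1 \<Psi>" by fact+
      show "smooth1 K" unfolding K_def[abs_def] by (intro smooth1_cmult smooth1_scale sH)
      show "per1 \<Phi>" "per1 \<Psi>" using pl[OF per1_per[of g]] pl[OF per1_per[of f]] by (simp_all add: per1_def \<Phi>_def \<Psi>_def)
      show "per1 K" "per1 K2" using pl[OF H(2)] pl[OF H2(2)] by (simp_all add: per1_def K_def K2_def)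
      show "0 < A" "0 \<le> J" "J \<le> J + 1" using A J by auto
      show "deriv \<Phi> s * \<Psi> s = 1 + deriv K s" for s
      proof -
        have "(K has_real_derivative 1 / l * ((Q (real l * s) - 1) * real l)) (at s)"
          unfolding K_def by (intro DERIV_cmult DERIV_chain2[OF H(1)] DERIV_cmult_Id)
        from DERIV_imp_deriv[OF this] show ?thesis using l by (simp add: QQ)
      qed
      show "(K2 has_real_derivative \<bar>deriv \<Phi> s * \<Psi> s\<bar> - J) (at s)" for s
        unfolding QQ K2_def
        by (rule DERIV_cong[OF DERIV_cmult[OF DERIV_chain2[OF H2(1) DERIV_cmult_Id]]]) (use l in simp)
      have le: "a / l \<le> \<delta>" if "a \<le> 3 * J + 1 + B1 / I2" for a
        using lX l that by (meson divide_right_mono of_nat_0_le_iff order_trans)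
      show "\<bar>K s\<bar> \<le> \<delta>" for s
      proof -
        have "\<bar>K s\<bar> = \<bar>H (real l * s)\<bar> / l" using l by (simp add: K_def abs_mult)
        also have "\<dots> \<le> \<delta>" by (rule le) (use HJ[of "real l * s"] J B1 I2 in \<open>smt (verit) divide_nonneg_pos\<close>)
        finally show ?thesis .
      qed
      show "\<bar>K2 s\<bar> \<le> \<delta>" for s
      proof -
        have "\<bar>K2 s\<bar> = \<bar>H2 (real l * s)\<bar> / l" using l by (simp add: K2_def abs_mult)
        also have "\<dots> \<le> \<delta>" by (rule le) (use HJ2[of "real l * s"] J B1 I2 in \<open>smt (verit) divide_nonneg_pos\<close>)
        finally show ?thesis .
      qed
      show "\<bar>\<Phi> s * \<Psi> s\<bar> \<le> \<delta>" for s
      proof -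
        have "\<bar>\<Phi> s * \<Psi> s\<bar> = (\<bar>per g (real l * s)\<bar> * \<bar>per f (real l * s)\<bar> / I2) / l"
          using \<mu> I2 by (simp add: \<Phi>_def \<Psi>_def abs_mult)
        also have "\<dots> \<le> \<delta>"
        proof (rule le)
          have "\<bar>per g (real l * s)\<bar> * \<bar>per f (real l * s)\<bar> \<le> B1 * 1"
            using f1 B1 by (intro mult_mono) auto
          then have "\<bar>per g (real l * s)\<bar> * \<bar>per f (real l * s)\<bar> / I2 \<le> B1 / I2"
            using I2 by (simp add: divide_right_mono)
          then show "\<bar>per g (real l * s)\<bar> * \<bar>per f (real l * s)\<bar> / I2 \<le> 3 * J + 1 + B1 / I2" using J by simp
        qed
        finally show ?thesis .
      qed
      show "\<bar>\<Psi> s\<bar> \<le> \<delta> * A" for s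
      proof -
        have "\<bar>\<Psi> s\<bar> \<le> 1 / \<mu>" using f1(1)[of "real l * s"] \<mu> by (simp add: \<Psi>_def abs_mult divide_right_mono)
        also have "\<dots> \<le> 1 / M"
        proof (rule divide_left_mono)
          have "M ^ 1 \<le> M ^ p" using M pp by (intro power_increasing) auto
          then show "real M \<le> real \<mu>" by (simp add: \<mu>_def)
        qed (use M \<mu> in auto)
        also have "\<dots> \<le> l * B1 / M"
        proof (rule divide_right_mono)
          show "1 \<le> l * B1" using mult_mono[of 1 "real l" 1 B1] l B1 by simp
        qed (use M in auto)
        finally show ?thesis by (simp add: A)
      qed
      have "integral {0..1} (\<lambda>s. \<bar>\<Phi> s\<bar>) = integral {0..1} (\<lambda>s. \<mu> / I2 / l * per (\<lambda>s. \<bar>g s\<bar>) (real l * s))"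
        using I2 by (intro integral_cong) (simp add: \<Phi>_def per_def abs_mult)
      also have "\<dots> = \<mu> / I2 / l * integral {0..1} (\<lambda>s. \<bar>per g (real l * s)\<bar>)"
        by (simp add: per_def)
      also have "integral {0..1} (\<lambda>s. \<bar>per g (real l * s)\<bar>) = integral {0..1} (\<lambda>s. \<bar>per g s\<bar>)"
        by (rule stretch[OF continuous_on_rabs[OF smooth1_continuous[OF sp(2)]]])
           (use per1_per[of g] in \<open>simp add: per1_def\<close>)
      also have "\<dots> = integral {0..1} (per (\<lambda>s. \<bar>deriv bump (real \<mu> * s)\<bar>))"
        by (rule integral_cong) (simp add: per_def g_def)
      also have "\<dots> = I1 / \<mu>" unfolding I1_def
        by (rule scale[OF continuous_on_rabs[OF cb(2)]]) (use zb(2) in \<open>simp add: supp01_def\<close>)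
      finally have "A * integral {0..1} (\<lambda>s. \<bar>\<Phi> s\<bar>) = I1 * B1 / I2 / \<delta> / M"
        using \<mu> l \<delta> by (simp add: A_def mult_ac)
      also have "\<dots> = (I1 * B1 / I2 / \<delta>\<^sup>2) * \<delta> / M" using \<delta> by (simp add: power2_eq_square)
      also have "\<dots> \<le> real M * \<delta> / M"
        by (intro divide_right_mono mult_right_mono M) (use \<delta> in auto)
      also have "\<dots> = \<delta>" using M by simp
      finally show "A * integral {0..1} (\<lambda>s. \<bar>\<Phi> s\<bar>) \<le> \<delta>" .
      fix q :: real assume "1 \<le> q \<and> q \<le> real p"
      then have q: "1 \<le> q" "q \<le> real p" by auto
      have cpow: "continuous_on UNIV (\<lambda>s. \<bar>G s\<bar> powr q)" if "continuous_on UNIV G" for G :: "real \<Rightarrow> real"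
        using q by (intro continuous_on_powr' continuous_intros that) auto
      have "integral {0..1} (\<lambda>s. \<bar>deriv \<Psi> s\<bar> powr q) = integral {0..1} (\<lambda>s. l powr q * \<bar>per g (real l * s)\<bar> powr q)"
        by (intro integral_cong) (simp add: d\<Psi> abs_mult powr_mult)
      also have "\<dots> = l powr q * integral {0..1} (\<lambda>s. \<bar>per g (real l * s)\<bar> powr q)" by simp
      also have "integral {0..1} (\<lambda>s. \<bar>per g (real l * s)\<bar> powr q) = integral {0..1} (\<lambda>s. \<bar>per g s\<bar> powr q)"
        by (rule stretch[OF cpow[OF smooth1_continuous[OF sp(2)]]]) (use per1_per[of g] in \<open>simp add: per1_def\<close>)
      also have "\<dots> = integral {0..1} (per (\<lambda>s. \<bar>deriv bump (real \<mu> * s)\<bar> powr q))"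
        by (rule integral_cong) (simp add: per_def g_def)
      also have "\<dots> = integral {0..1} (\<lambda>s. \<bar>deriv bump s\<bar> powr q) / \<mu>"
        by (rule scale[OF cpow[OF cb(2)]]) (use zb(2) in \<open>simp add: supp01_def\<close>)
      also have "l powr q * \<dots> \<le> l powr q * (B1 powr q / \<mu>)"
      proof (intro mult_left_mono divide_right_mono)
        have "integral {0..1} (\<lambda>s. \<bar>deriv bump s\<bar> powr q) \<le> integral {0..1::real} (\<lambda>s. B1 powr q)"
          by (rule integral_le) (use q B1 in \<open>auto intro!: powr_mono2 intg[OF cpow[OF cb(2)]]\<close>)
        then show "integral {0..1} (\<lambda>s. \<bar>deriv bump s\<bar> powr q) \<le> B1 powr q" by simp
      qed auto
      also have "\<dots> \<le> l powr q * (B1 powr q / M powr q)"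
      proof (intro mult_left_mono divide_left_mono)
        have "M powr q \<le> M powr (real p)" using M q by (intro powr_mono) auto
        then show "M powr q \<le> real \<mu>" using M by (simp add: \<mu>_def powr_realpow)
      qed (use M \<mu> in auto)
      also have "\<dots> = (\<delta> * A) powr q"
        unfolding A(2) powr_divide powr_mult by simp
      finally show "integral {0..1} (\<lambda>s. \<bar>deriv \<Psi> s\<bar> powr q) \<le> (\<delta> * A) powr q" .
    qed
  qed
qed

subsection \<open>Integration over the fundamental cell\<close>

lemma periodicD: "periodic f \<Longrightarrow> f (x + axis i 1) = f x"
  by (simp add: periodic_def)

lemma mem_cbox_split_at: "x \<in> cbox a b \<longleftrightarrow> (a $ j \<le> x $ j \<and> x $ j \<le> b $ j) \<and>
    (\<forall>i. i \<noteq> j \<longrightarrow> a $ i \<le> x $ i \<and> x $ i \<le> b $ i)"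
  for x :: "real ^ 'd::finite"
  unfolding mem_box_cart by metis

lemma content_cell: "measure lborel (cell :: (real ^ 'd::finite) set) = 1"
proof -
  have "(0 :: real ^ 'd) \<in> cell" by (simp add: mem_box_cart)
  then have "(cell :: (real ^ 'd) set) \<noteq> {}" by blast
  from content_cbox_cart[OF this] show ?thesis by simp
qed

lemma integral_cell_const: "integral (cell :: (real ^ 'd::finite) set) (\<lambda>x. c :: real) = c"
  using content_cell[where 'd='d] by simp

lemma cell_integrable:
  fixes f :: "real ^ 'd::finite \<Rightarrow> real"
  assumes "continuous_on UNIV f" shows "f integrable_on cbox a b"
  by (rule integrable_continuous, rule continuous_on_subset[OF assms]) simp

text \<open>The translated cell is cut at x_j = 1; the part beyond is moved back by one period and
  fills the gap left where x_j < s.\<close>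

lemma integral_cell_translate:
  fixes f :: "real ^ 'd::finite \<Rightarrow> real"
  assumes f: "periodic f" "continuous_on UNIV f" and s: "0 \<le> s" "s \<le> 1"
  shows "integral cell (\<lambda>x. f (x + s *\<^sub>R axis j 1)) = integral cell f"
proof -
  let ?e = "axis j (1::real) :: real^'d"
  have B: "?e \<in> Basis" by (simp add: axis_in_Basis_iff)
  note int = cell_integrable[OF f(2)]
  have "integral cell (\<lambda>x. f (x + s *\<^sub>R ?e)) = integral (cbox (s *\<^sub>R ?e) (1 + s *\<^sub>R ?e)) f"
    using integral_shift_cbox_plus[of 0 1 f "s *\<^sub>R ?e"] by (simp add: o_def add.commute)
  also have "\<dots> = integral (cbox (s *\<^sub>R ?e) (1 + s *\<^sub>R ?e) \<inter> {x. x \<bullet> ?e \<le> 1}) f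
      + integral (cbox (s *\<^sub>R ?e) (1 + s *\<^sub>R ?e) \<inter> {x. x \<bullet> ?e \<ge> 1}) f"
    by (rule integral_split[OF int B])
  also have "cbox (s *\<^sub>R ?e) (1 + s *\<^sub>R ?e) \<inter> {x. x \<bullet> ?e \<le> 1} = cbox (s *\<^sub>R ?e) 1"
    unfolding set_eq_iff Int_iff mem_Collect_eq mem_cbox_split_at[of _ _ _ j] inner_axis
    using s by (auto simp: axis_def)
  also have "cbox (s *\<^sub>R ?e) (1 + s *\<^sub>R ?e) \<inter> {x. x \<bullet> ?e \<ge> 1} = cbox (0 + ?e) (1 + (s - 1) *\<^sub>R ?e + ?e)"
    unfolding set_eq_iff Int_iff mem_Collect_eq mem_cbox_split_at[of _ _ _ j] inner_axis
    using s by (auto simp: axis_def)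
  also have "integral (cbox (0 + ?e) (1 + (s - 1) *\<^sub>R ?e + ?e)) f = integral (cbox 0 (1 + (s - 1) *\<^sub>R ?e)) f"
    unfolding integral_shift_cbox_plus[symmetric] using periodicD[OF f(1), of _ j]
    by (simp add: o_def add.commute[of ?e])
  also have "cbox (s *\<^sub>R ?e) 1 = cell \<inter> {x. x \<bullet> ?e \<ge> s}"
    unfolding set_eq_iff Int_iff mem_Collect_eq mem_cbox_split_at[of _ _ _ j] inner_axis
    using s by (auto simp: axis_def)
  also have "cbox 0 (1 + (s - 1) *\<^sub>R ?e) = cell \<inter> {x. x \<bullet> ?e \<le> s}"
    unfolding set_eq_iff Int_iff mem_Collect_eq mem_cbox_split_at[of _ _ _ j] inner_axis
    using s by (auto simp: axis_def)
  finally show ?thesis using integral_split[OF int B, of 0 1 s] by simp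
qed

text \<open>Averaging over translations in direction \<open>j\<close> produces an inner
  one-dimensional integral over a full period, which plays the role of splitting off the coordinate
  x_j.\<close>

lemma integral_cell_average:
  fixes f :: "real ^ 'd::finite \<Rightarrow> real"
  assumes f: "periodic f" "continuous_on UNIV f"
  shows "integral cell f = integral cell (\<lambda>x. integral {0..1} (\<lambda>s. f (x + s *\<^sub>R axis j 1)))"
proof -
  have "integral cell f = integral {0..1::real} (\<lambda>s. integral cell f)" by simp
  also have "\<dots> = integral {0..1} (\<lambda>s. integral cell (\<lambda>x. f (x + s *\<^sub>R axis j 1)))"
    by (rule integral_cong) (simp add: integral_cell_translate[OF f])
  also have "\<dots> = integral cell (\<lambda>x. integral {0..1} (\<lambda>s. f (x + s *\<^sub>R axis j 1)))"
    unfolding cbox_interval[symmetric]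
    by (rule integral_swap_continuous)
       (auto simp: case_prod_beta intro!: continuous_on_compose2[OF f(2)] continuous_intros)
  finally show ?thesis .
qed

text \<open>After averaging, the inner integral is that of a derivative over a full period.
  \<open>f'\<close> inherits periodicity from \<open>f\<close> by uniqueness of derivatives.\<close>

lemma integral_cell_partial_0:
  fixes f f' :: "real ^ 'd::finite \<Rightarrow> real"
  assumes f: "periodic f" "continuous_on UNIV f'"
    and d: "\<And>x. ((\<lambda>s. f (x + s *\<^sub>R axis j 1)) has_real_derivative f' x) (at 0)"
  shows "integral cell f' = 0"
proof -
  have d': "((\<lambda>s. f (x + s *\<^sub>R axis j 1)) has_real_derivative f' (x + s *\<^sub>R axis j 1)) (at s)" for x s
    using d[of "x + s *\<^sub>R axis j 1"] DERIV_at_within_shift[of "\<lambda>r. f (x + r *\<^sub>R axis j 1)" _ s 0 UNIV]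
    by (simp add: algebra_simps)
  have p': "periodic f'"
    unfolding periodic_def
  proof (intro allI)
    fix x i
    have "((\<lambda>s. f (x + s *\<^sub>R axis j 1)) has_real_derivative f' (x + axis i 1)) (at 0)"
    proof -
      have "f (x + axis i 1 + s *\<^sub>R axis j 1) = f (x + s *\<^sub>R axis j 1)" for s
        using periodicD[OF f(1), of "x + s *\<^sub>R axis j 1" i] by (simp add: add_ac)
      then show ?thesis using d[of "x + axis i 1"] by simp
    qed
    then show "f' (x + axis i 1) = f' x" using d DERIV_unique by blast
  qed
  have "integral {0..1} (\<lambda>s. f' (x + s *\<^sub>R axis j 1)) = 0" for x
  proof -
    have "((\<lambda>s. f' (x + s *\<^sub>R axis j 1)) has_integral f (x + 1 *\<^sub>R axis j 1) - f (x + 0 *\<^sub>R axis j 1)) {0..1}"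
    proof (rule fundamental_theorem_of_calculus)
      fix s show "((\<lambda>s. f (x + s *\<^sub>R axis j 1)) has_vector_derivative f' (x + s *\<^sub>R axis j 1)) (at s within {0..1})"
        using d'[of x s] by (simp add: has_real_derivative_iff_has_vector_derivative has_vector_derivative_at_within)
    qed simp
    then show ?thesis using periodicD[OF f(1)] by (simp add: integral_unique)
  qed
  then show ?thesis using integral_cell_average[OF p' f(2), of j] by simp
qed

lemma integral_cell_by_parts:
  fixes f f' g g' :: "real ^ 'd::finite \<Rightarrow> real"
  assumes f: "periodic f" "continuous_on UNIV f" "continuous_on UNIV f'"
      "\<And>x. ((\<lambda>s. f (x + s *\<^sub>R axis j 1)) has_real_derivative f' x) (at 0)"
    and g: "periodic g" "continuous_on UNIV g" "continuous_on UNIV g'"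
      "\<And>x. ((\<lambda>s. g (x + s *\<^sub>R axis j 1)) has_real_derivative g' x) (at 0)"
  shows "integral cell (\<lambda>x. f' x * g x) = - integral cell (\<lambda>x. f x * g' x)"
proof -
  have "integral cell (\<lambda>x. f' x * g x + f x * g' x) = 0"
  proof (rule integral_cell_partial_0[of "\<lambda>x. f x * g x" _ j])
    show "periodic (\<lambda>x. f x * g x)" using f(1) g(1) by (simp add: periodic_def)
    show "continuous_on UNIV (\<lambda>x. f' x * g x + f x * g' x)" by (intro continuous_intros f g)
    show "((\<lambda>s. f (x + s *\<^sub>R axis j 1) * g (x + s *\<^sub>R axis j 1)) has_real_derivative f' x * g x + f x * g' x) (at 0)" for x
      using DERIV_mult[OF f(4)[of x] g(4)[of x]] by (simp add: mult.commute)
  qed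
  moreover have "(\<lambda>x. f' x * g x) integrable_on cell" "(\<lambda>x. f x * g' x) integrable_on cell"
    by (intro cell_integrable continuous_intros f g)+
  ultimately show ?thesis by (simp add: integral_add)
qed

text \<open>With the mean subtracted, \<open>P\<close> has a periodic primitive, so its integral
  over any interval of length 1 vanishes.\<close>

lemma integral_per1_shift:
  fixes P :: "real \<Rightarrow> real"
  assumes P: "continuous_on UNIV P" "per1 P"
  shows "integral {0..1} (\<lambda>s. P (c + s)) = integral {0..1} P"
proof -
  define m where "m = integral {0..1} P"
  have int: "P integrable_on {0..1}" by (rule integrable_continuous_real, rule continuous_on_subset[OF P(1)]) simp
  have c: "continuous_on UNIV (\<lambda>s. P s - m)" by (intro continuous_intros P)
  have p: "per1 (\<lambda>s. P s - m)" using P(2) by (simp add: per1_def)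
  have 0: "integral {0..1} (\<lambda>s. P s - m) = 0"
    by (subst integral_diff) (use int in \<open>auto simp: m_def\<close>)
  obtain K where K: "\<And>x. (K has_real_derivative P x - m) (at x)" "per1 K"
    by (rule per1_antideriv[OF c p 0]) blast
  have "((\<lambda>s. P (c + s) - m) has_integral K (c + 1) - K (c + 0)) {0..1}"
  proof (rule fundamental_theorem_of_calculus)
    fix s
    have "((\<lambda>s. K (c + s)) has_real_derivative P (c + s) - m) (at s)"
      using K(1)[of "c + s"] DERIV_at_within_shift[of K _ c s UNIV] by simp
    then show "((\<lambda>s. K (c + s)) has_vector_derivative P (c + s) - m) (at s within {0..1})"
      by (simp add: has_real_derivative_iff_has_vector_derivative has_vector_derivative_at_within)
  qed simp
  then have "((\<lambda>s. P (c + s) - m) has_integral 0) {0..1}"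
    using K(2) by (simp add: per1_def)
  from has_integral_add[OF this has_integral_const_real[of m 0 1]]
  show ?thesis by (simp add: m_def integral_unique)
qed

lemma periodic_coord: "per1 P \<Longrightarrow> periodic (\<lambda>x :: real ^ 'd::finite. P (x $ j))"
  by (auto simp: periodic_def per1_def axis_def)

lemma continuous_coord: "continuous_on UNIV P \<Longrightarrow> continuous_on A (\<lambda>x :: real ^ 'd::finite. P (x $ j))"
  for P :: "real \<Rightarrow> real"
  by (rule continuous_on_compose2) (auto intro!: continuous_intros)

lemma integral_cell_coord:
  fixes P :: "real \<Rightarrow> real"
  assumes "continuous_on UNIV P" "per1 P"
  shows "integral cell (\<lambda>x :: real ^ 'd::finite. P (x $ j)) = integral {0..1} P"
proof -
  have "integral cell (\<lambda>x :: real ^ 'd::finite. P (x $ j)) =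
      integral cell (\<lambda>x :: real ^ 'd::finite. integral {0..1} (\<lambda>s. P ((x + s *\<^sub>R axis j 1) $ j)))"
    by (rule integral_cell_average) (intro periodic_coord continuous_coord assms)+
  also have "\<dots> = integral cell (\<lambda>x :: real ^ 'd::finite. integral {0..1} P)"
    using integral_per1_shift[OF assms] by simp
  finally show ?thesis by (simp only: integral_cell_const)
qed

subsection \<open>A differential algebra of space-time functions\<close>

text \<open>The algebra generated by smooth functions of time and smooth periodic functions of a
  single coordinate. All approximate solutions lie in it and it is closed under every derivative, so
  regularity, periodicity, boundedness and the symmetry of mixed derivatives are obtained by
  induction over the generators.\<close>

inductive tfun :: "(real \<Rightarrow> real ^ 'd::finite \<Rightarrow> real) \<Rightarrow> bool" where
  time: "smooth1 a \<Longrightarrow> tfun (\<lambda>t x. a t)"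
| space: "smooth1 b \<Longrightarrow> per1 b \<Longrightarrow> tfun (\<lambda>t x. b (x $ i))"
| add: "tfun f \<Longrightarrow> tfun g \<Longrightarrow> tfun (\<lambda>t x. f t x + g t x)"
| mult: "tfun f \<Longrightarrow> tfun g \<Longrightarrow> tfun (\<lambda>t x. f t x * g t x)"

definition pD :: "'d \<Rightarrow> (real \<Rightarrow> real ^ 'd::finite \<Rightarrow> real) \<Rightarrow> real \<Rightarrow> real ^ 'd \<Rightarrow> real" where
  "pD i f = (\<lambda>t. partial i (f t))"

definition pT :: "(real \<Rightarrow> real ^ 'd::finite \<Rightarrow> real) \<Rightarrow> real \<Rightarrow> real ^ 'd \<Rightarrow> real" where
  "pT f = (\<lambda>t x. deriv (\<lambda>s. f s x) t)"

lemma tfun_const [simp]: "tfun (\<lambda>t x. c)" by (rule tfun.time) simp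

lemma tfun_uminus: "tfun f \<Longrightarrow> tfun (\<lambda>t x. - f t x)"
  using tfun.mult[OF tfun_const[of "-1"]] by simp

lemma tfun_diff: "tfun f \<Longrightarrow> tfun g \<Longrightarrow> tfun (\<lambda>t x. f t x - g t x)"
  using tfun.add[OF _ tfun_uminus] by simp

lemma tfun_sum: "(\<And>i. i \<in> I \<Longrightarrow> tfun (f i)) \<Longrightarrow> tfun (\<lambda>t x. \<Sum>i\<in>I. f i t x)"
  by (induction I rule: infinite_finite_induct) (auto intro: tfun.add)

lemma tfun_periodic: "tfun f \<Longrightarrow> periodic (f t)"
  by (induction rule: tfun.induct) (auto simp: periodic_def per1_def axis_def)

lemma tfun_continuous: "tfun f \<Longrightarrow> continuous_on UNIV (\<lambda>z. f (fst z) (snd z))"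
proof (induction rule: tfun.induct)
  case (time a)
  show ?case by (rule continuous_on_compose2[OF smooth1_continuous[OF time, of UNIV]]) (auto intro!: continuous_intros)
next
  case (space b i)
  show ?case by (rule continuous_on_compose2[OF smooth1_continuous[OF space(1), of UNIV]]) (auto intro!: continuous_intros)
qed (auto intro!: continuous_intros)

lemma tfun_continuous_space: "tfun f \<Longrightarrow> continuous_on A (f t)"
  using continuous_on_compose2[OF tfun_continuous continuous_on_Pair[OF continuous_on_const continuous_on_id], of f t A]
  by simp

lemma per1_bounded:
  fixes b :: "real \<Rightarrow> real"
  assumes "continuous_on UNIV b" "per1 b"
  obtains B where "\<And>s. \<bar>b s\<bar> \<le> B"
proof -
  have "bounded (b ` {0..1})"
    by (intro compact_imp_bounded compact_continuous_image continuous_on_subset[OF assms(1)]) auto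
  then obtain B where B: "\<And>s. s \<in> {0..1} \<Longrightarrow> \<bar>b s\<bar> \<le> B"
    unfolding bounded_iff by (metis imageI real_norm_def)
  have "\<bar>b s\<bar> \<le> B" for s
    using B[of "frac s"] per1_frac[OF assms(2), of s] frac_lt_1[of s] by (simp add: less_imp_le)
  then show ?thesis by (rule that)
qed

lemma tfun_bounded:
  assumes "tfun f" shows "\<exists>M\<ge>0. \<forall>t\<in>{0..T}. \<forall>x. \<bar>f t x\<bar> \<le> M"
  using assms
proof induction
  case (time a)
  have "bounded (a ` {0..T})"
    by (intro compact_imp_bounded compact_continuous_image smooth1_continuous time) auto
  then obtain B where "\<And>s. s \<in> {0..T} \<Longrightarrow> \<bar>a s\<bar> \<le> B"
    unfolding bounded_iff by (metis imageI real_norm_def)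
  then show ?case by (intro exI[of _ "max 0 B"]) (auto simp: le_max_iff_disj)
next
  case (space b i)
  obtain B where "\<And>s. \<bar>b s\<bar> \<le> B"
    using per1_bounded[OF smooth1_continuous[OF space(1)] space(2)] by blast
  then show ?case by (intro exI[of _ "max 0 B"]) (auto simp: le_max_iff_disj)
next
  case (add f g)
  then obtain M N where "0 \<le> M" "\<forall>t\<in>{0..T}. \<forall>x. \<bar>f t x\<bar> \<le> M" "0 \<le> N" "\<forall>t\<in>{0..T}. \<forall>x. \<bar>g t x\<bar> \<le> N"
    by blast
  then show ?case
    by (intro exI[of _ "M + N"]) (auto intro!: order_trans[OF abs_triangle_ineq] add_mono)
next
  case (mult f g)
  then obtain M N where "0 \<le> M" "\<forall>t\<in>{0..T}. \<forall>x. \<bar>f t x\<bar> \<le> M" "0 \<le> N" "\<forall>t\<in>{0..T}. \<forall>x. \<bar>g t x\<bar> \<le> N"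
    by blast
  then show ?case
    by (intro exI[of _ "M * N"]) (auto simp: abs_mult intro!: mult_mono)
qed

lemma tfun_pT_ex:
  assumes "tfun f" shows "\<exists>g. tfun g \<and> (\<forall>t x. ((\<lambda>s. f s x) has_real_derivative g t x) (at t))"
  using assms
proof induction
  case (time a)
  show ?case
    by (rule exI[of _ "\<lambda>t x. deriv a t"])
       (intro conjI tfun.time smooth1_deriv time allI smooth1_has_deriv)
next
  case (space b i)
  show ?case by (rule exI[of _ "\<lambda>t x. 0"]) simp
next
  case (add f g)
  then obtain f' g' where "tfun f'" "\<forall>t x. ((\<lambda>s. f s x) has_real_derivative f' t x) (at t)"
    "tfun g'" "\<forall>t x. ((\<lambda>s. g s x) has_real_derivative g' t x) (at t)" by blast
  then show ?case
    by (intro exI[of _ "\<lambda>t x. f' t x + g' t x"] conjI tfun.add allI DERIV_add) auto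
next
  case (mult f g)
  then obtain f' g' where "tfun f'" "\<forall>t x. ((\<lambda>s. f s x) has_real_derivative f' t x) (at t)"
    "tfun g'" "\<forall>t x. ((\<lambda>s. g s x) has_real_derivative g' t x) (at t)" by blast
  with mult.hyps show ?case
    by (intro exI[of _ "\<lambda>t x. f' t x * g t x + g' t x * f t x"] conjI tfun.add tfun.mult allI DERIV_mult) auto
qed

lemma tfun_pT_has_deriv: "tfun f \<Longrightarrow> ((\<lambda>s. f s x) has_real_derivative pT f t x) (at t)"
  and tfun_pT: "tfun f \<Longrightarrow> tfun (pT f)"
proof -
  assume "tfun f"
  from tfun_pT_ex[OF this] obtain g where
    g: "tfun g" "\<And>t x. ((\<lambda>s. f s x) has_real_derivative g t x) (at t)" by blast
  have "pT f = g" unfolding pT_def using DERIV_imp_deriv[OF g(2)] by (intro ext)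
  with g show "((\<lambda>s. f s x) has_real_derivative pT f t x) (at t)" "tfun (pT f)" by auto
qed

lemma has_derivative_imp_partial:
  fixes f :: "real ^ 'd::finite \<Rightarrow> real"
  assumes "(f has_derivative (\<lambda>h. \<Sum>i\<in>UNIV. g i * h $ i)) (at x)"
  shows "partial i f x = g i"
proof -
  have "partial i f x = (\<Sum>k\<in>UNIV. g k * axis i 1 $ k)"
    unfolding partial_def frechet_derivative_at[OF assms, symmetric] ..
  also have "\<dots> = (\<Sum>k\<in>UNIV. if k = i then g k else 0)"
    by (intro sum.cong) (auto simp: axis_def)
  finally show ?thesis by simp
qed

text \<open>The total derivative is produced together with the membership of its components in the
  algebra; the rules for \<open>pD\<close> then follow from uniqueness of derivatives.\<close>

lemma tfun_pD_ex:
  fixes f :: "real \<Rightarrow> real ^ 'd::finite \<Rightarrow> real"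
  assumes "tfun f"
  shows "\<exists>G. (\<forall>i. tfun (G i)) \<and> (\<forall>t x. (f t has_derivative (\<lambda>h. \<Sum>i\<in>UNIV. G i t x * h $ i)) (at x))"
  using assms
proof induction
  case (time a)
  show ?case by (rule exI[of _ "\<lambda>i t x. 0"]) simp
next
  case (space b j)
  have *: "((\<lambda>x. b (x $ j)) has_derivative (\<lambda>h. \<Sum>i\<in>UNIV. (if i = j then deriv b (x $ j) else 0) * h $ i)) (at x)"
    for x :: "real ^ 'd"
  proof -
    have "(b has_derivative (*) (deriv b (x $ j))) (at (x $ j))"
      using smooth1_has_deriv[OF space(1)] by (simp add: has_field_derivative_def)
    moreover have "((\<lambda>x::real^'d. x $ j) has_derivative (\<lambda>h. h $ j)) (at x)"
      by (rule bounded_linear_imp_has_derivative[OF bounded_linear_vec_nth])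
    ultimately have "((\<lambda>x. b (x $ j)) has_derivative (\<lambda>h. deriv b (x $ j) * h $ j)) (at x)"
      using diff_chain_at[of "\<lambda>x::real^'d. x $ j" _ x b] by (simp add: o_def)
    moreover have "(\<Sum>i\<in>UNIV. (if i = j then deriv b (x $ j) else 0) * h $ i) = deriv b (x $ j) * h $ j" for h :: "real^'d"
    proof -
      have "(\<Sum>i\<in>UNIV. (if i = j then deriv b (x $ j) else 0) * h $ i) = (\<Sum>i\<in>UNIV. if i = j then deriv b (x $ j) * h $ j else 0)"
        by (intro sum.cong) auto
      then show ?thesis by simp
    qed
    ultimately show ?thesis by simp
  qed
  have "tfun (\<lambda>t x :: real^'d. if i = j then deriv b (x $ j) else 0)" for i
    using tfun.space[OF smooth1_deriv per1_deriv, OF space(1) space] by (cases "i = j") auto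
  with * show ?case
    by (intro exI[of _ "\<lambda>i t x. if i = j then deriv b (x $ j) else 0"]) auto
next
  case (add f g)
  then obtain F G where "\<And>i. tfun (F i)" "\<And>t x. (f t has_derivative (\<lambda>h. \<Sum>i\<in>UNIV. F i t x * h $ i)) (at x)"
    "\<And>i. tfun (G i)" "\<And>t x. (g t has_derivative (\<lambda>h. \<Sum>i\<in>UNIV. G i t x * h $ i)) (at x)" by blast
  then show ?case
    by (intro exI[of _ "\<lambda>i t x. F i t x + G i t x"])
       (auto intro!: tfun.add has_derivative_add simp: ring_distribs sum.distrib)
next
  case (mult f g)
  then obtain F G where *: "\<And>i. tfun (F i)" "\<And>t x. (f t has_derivative (\<lambda>h. \<Sum>i\<in>UNIV. F i t x * h $ i)) (at x)"
    "\<And>i. tfun (G i)" "\<And>t x. (g t has_derivative (\<lambda>h. \<Sum>i\<in>UNIV. G i t x * h $ i)) (at x)" by blast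
  have "((\<lambda>x. f t x * g t x) has_derivative (\<lambda>h. \<Sum>i\<in>UNIV. (F i t x * g t x + f t x * G i t x) * h $ i)) (at x)" for t x
    by (rule has_derivative_eq_rhs[OF has_derivative_mult[OF *(2) *(4)]])
       (auto simp: ring_distribs sum.distrib sum_distrib_left sum_distrib_right mult_ac)
  then show ?case
    by (intro exI[of _ "\<lambda>i t x. F i t x * g t x + f t x * G i t x"])
       (auto intro!: tfun.add tfun.mult * mult.hyps)
qed

lemma tfun_pD_has_deriv: "tfun f \<Longrightarrow> (f t has_derivative (\<lambda>h. \<Sum>i\<in>UNIV. pD i f t x * h $ i)) (at x)"
  and tfun_pD: "tfun f \<Longrightarrow> tfun (pD j f)"
proof -
  assume "tfun f"
  from tfun_pD_ex[OF this] obtain G where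
    G: "\<And>i. tfun (G i)" "\<And>t x. (f t has_derivative (\<lambda>h. \<Sum>i\<in>UNIV. G i t x * h $ i)) (at x)" by blast
  have "pD i f = G i" for i unfolding pD_def using has_derivative_imp_partial[OF G(2)] by (intro ext)
  with G show "(f t has_derivative (\<lambda>h. \<Sum>i\<in>UNIV. pD i f t x * h $ i)) (at x)" "tfun (pD j f)" by auto
qed

lemma pD_eqI:
  assumes "\<And>t x. (f t has_derivative (\<lambda>h. \<Sum>i\<in>UNIV. G i t x * h $ i)) (at x)"
  shows "pD i f = G i"
  unfolding pD_def using has_derivative_imp_partial[OF assms] by (intro ext)

lemma pD_add: "tfun f \<Longrightarrow> tfun g \<Longrightarrow> pD i (\<lambda>t x. f t x + g t x) = (\<lambda>t x. pD i f t x + pD i g t x)"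
  by (rule pD_eqI[of _ "\<lambda>i t x. pD i f t x + pD i g t x"])
     (auto simp: ring_distribs sum.distrib intro!: has_derivative_add tfun_pD_has_deriv)

lemma pD_mult:
  assumes "tfun f" "tfun g"
  shows "pD i (\<lambda>t x. f t x * g t x) = (\<lambda>t x. pD i f t x * g t x + f t x * pD i g t x)"
  by (rule pD_eqI[of _ "\<lambda>i t x. pD i f t x * g t x + f t x * pD i g t x"],
      rule has_derivative_eq_rhs[OF has_derivative_mult[OF tfun_pD_has_deriv[OF assms(1)] tfun_pD_has_deriv[OF assms(2)]]])
     (auto simp: ring_distribs sum.distrib sum_distrib_left sum_distrib_right mult_ac)

lemma pD_time: "pD i (\<lambda>t x. a t) = (\<lambda>t x. 0)"
  by (rule pD_eqI[of _ "\<lambda>i t x. 0"]) simp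

lemma pD_space:
  fixes i j :: "'d::finite"
  assumes "smooth1 b" "per1 b"
  shows "pD i (\<lambda>t x. b (x $ j)) = (\<lambda>t x. if i = j then deriv b (x $ j) else 0)"
proof (intro ext)
  fix t and x :: "real ^ 'd"
  have "(b has_derivative (*) (deriv b (x $ j))) (at (x $ j))"
    using smooth1_has_deriv[OF assms(1)] by (simp add: has_field_derivative_def)
  moreover have "((\<lambda>x::real^'d. x $ j) has_derivative (\<lambda>h. h $ j)) (at x)"
    by (rule bounded_linear_imp_has_derivative[OF bounded_linear_vec_nth])
  ultimately have "((\<lambda>x. b (x $ j)) has_derivative (\<lambda>h. deriv b (x $ j) * h $ j)) (at x)"
    using diff_chain_at[of "\<lambda>x::real^'d. x $ j" _ x b] by (simp add: o_def)
  from frechet_derivative_at[OF this, symmetric]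
  show "pD i (\<lambda>t x. b (x $ j)) t x = (if i = j then deriv b (x $ j) else 0)"
    by (auto simp: pD_def partial_def axis_def)
qed

lemma pT_add: "tfun f \<Longrightarrow> tfun g \<Longrightarrow> pT (\<lambda>t x. f t x + g t x) = (\<lambda>t x. pT f t x + pT g t x)"
  unfolding pT_def[of "\<lambda>t x. f t x + g t x"]
  by (intro ext DERIV_imp_deriv DERIV_add tfun_pT_has_deriv)

lemma pT_mult: "tfun f \<Longrightarrow> tfun g \<Longrightarrow> pT (\<lambda>t x. f t x * g t x) = (\<lambda>t x. pT f t x * g t x + f t x * pT g t x)"
  unfolding pT_def[of "\<lambda>t x. f t x * g t x"]
  by (intro ext DERIV_imp_deriv DERIV_cong[OF DERIV_mult[OF tfun_pT_has_deriv tfun_pT_has_deriv]]) auto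

lemma pT_time: "pT (\<lambda>t x. a t) = (\<lambda>t x. deriv a t)" and pT_space: "pT (\<lambda>t x. b (x $ j)) = (\<lambda>t x. 0)"
  by (auto simp: pT_def)

text \<open>Induction takes the place of Schwarz's theorem: on functions of one variable both sides
  are explicit, and the product rule preserves the symmetry.\<close>

lemma pD_commute: "tfun f \<Longrightarrow> pD i (pD j f) = pD j (pD i f)"
proof (induction rule: tfun.induct)
  case (time a)
  show ?case by (simp add: pD_time)
next
  case (space b k)
  then show ?case
    by (cases "j = k"; cases "i = k")
       (simp_all add: pD_space pD_time smooth1_deriv per1_deriv)
next
  case (add f g)
  then show ?case by (simp add: pD_add tfun_pD)
next
  case (mult f g)
  then show ?case by (simp add: pD_add pD_mult tfun_pD tfun.mult algebra_simps)
qed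

lemma pT_pD: "tfun f \<Longrightarrow> pT (pD j f) = pD j (pT f)"
proof (induction rule: tfun.induct)
  case (time a)
  show ?case by (simp add: pD_time pT_time)
next
  case (space b k)
  then show ?case by (cases "j = k") (simp_all add: pD_space pD_time pT_space pT_time)
next
  case (add f g)
  then show ?case by (simp add: pD_add pT_add tfun_pD tfun_pT)
next
  case (mult f g)
  then show ?case by (simp add: pD_add pD_mult pT_add pT_mult tfun_pD tfun_pT tfun.mult algebra_simps)
qed

section \<open>Iterated derivatives along words and the operator L\<close>

definition pDs :: "'d list \<Rightarrow> (real \<Rightarrow> real ^ 'd::finite \<Rightarrow> real) \<Rightarrow> real \<Rightarrow> real ^ 'd \<Rightarrow> real" where
  "pDs w f = foldr pD w f"

lemma pDs_Nil [simp]: "pDs [] f = f" and pDs_Cons [simp]: "pDs (i # w) f = pD i (pDs w f)"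
  by (auto simp: pDs_def)

lemma tfun_pDs: "tfun f \<Longrightarrow> tfun (pDs w f)"
  by (induction w) (auto intro: tfun_pD)

lemma pDs_add: "tfun f \<Longrightarrow> tfun g \<Longrightarrow> pDs w (\<lambda>t x. f t x + g t x) = (\<lambda>t x. pDs w f t x + pDs w g t x)"
  by (induction w) (simp_all add: pD_add tfun_pDs)

lemma pDs_time_mult: "smooth1 a \<Longrightarrow> tfun f \<Longrightarrow> pDs w (\<lambda>t x. a t * f t x) = (\<lambda>t x. a t * pDs w f t x)"
  by (induction w) (simp_all add: pD_mult[OF tfun.time] tfun_pDs pD_time)

lemma pDs_pD: "tfun f \<Longrightarrow> pDs w (pD i f) = pD i (pDs w f)"
proof (induction w)
  case (Cons a w)
  then show ?case using pD_commute[OF tfun_pDs[of f w], of a i] by simp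
qed simp

lemma pDs_append: "pDs (v @ w) f = pDs v (pDs w f)"
  by (simp add: pDs_def)

lemma pDs_rev: "tfun f \<Longrightarrow> pDs (rev w) f = pDs w f"
  by (induction w) (simp_all add: pDs_append pDs_pD)

lemma pDs_slice: "pDs w f t = foldr partial w (f t)"
  by (induction w) (simp_all add: pD_def)

text \<open>Spells a multi-index as a word in the order fixed by \<open>coords\<close>. Words lose
  one letter at a time in inductions, and their length is the order of the derivative.\<close>

definition mi_word :: "('d::finite \<Rightarrow> nat) \<Rightarrow> 'd list" where
  "mi_word \<alpha> = concat (map (\<lambda>i. replicate (\<alpha> i) i) coords)"

lemma mi_deriv_word: "mi_deriv \<alpha> f = foldr partial (mi_word \<alpha>) f"
proof -
  have r: "foldr partial (replicate n i) g = (partial i ^^ n) g" for n i and g :: "real^'a \<Rightarrow> 'b"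
    by (induction n) auto
  have "foldr (\<lambda>i. partial i ^^ \<alpha> i) is f = foldr partial (concat (map (\<lambda>i. replicate (\<alpha> i) i) is)) f" for "is"
    by (induction "is") (simp_all add: r)
  then show ?thesis by (simp add: mi_deriv_def mi_word_def)
qed

lemma length_mi_word:
  fixes \<alpha> :: "'d::finite \<Rightarrow> nat"
  shows "length (mi_word \<alpha>) = mi_size \<alpha>"
proof -
  have "length (mi_word \<alpha>) = sum_list (map \<alpha> coords)"
    by (simp add: mi_word_def length_concat o_def)
  also have "\<dots> = (\<Sum>i\<in>set coords. \<alpha> i)"
    using coords[where 'd='d] by (intro sum_list_distinct_conv_sum_set) auto
  finally show ?thesis using coords[where 'd='d] by (simp add: mi_size_def)
qed

definition Lop :: "nat \<Rightarrow> (('d::finite \<Rightarrow> nat) \<Rightarrow> real) \<Rightarrow> (real \<Rightarrow> real ^ 'd \<Rightarrow> real) \<Rightarrow> real \<Rightarrow> real ^ 'd \<Rightarrow> real" where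
  "Lop m c f t x = (\<Sum>\<alpha> | mi_size \<alpha> \<le> m. c \<alpha> * pDs (mi_word \<alpha>) f t x)"

lemma Lop_diff_op: "Lop m c f t x = diff_op m c (f t) x"
  by (simp add: Lop_def diff_op_def mi_deriv_word pDs_slice)

lemma tfun_Lop: "tfun f \<Longrightarrow> tfun (Lop m c f)"
  unfolding Lop_def[abs_def] by (intro tfun_sum tfun.mult tfun_const tfun_pDs)

lemma Lop_add: "tfun f \<Longrightarrow> tfun g \<Longrightarrow> Lop m c (\<lambda>t x. f t x + g t x) = (\<lambda>t x. Lop m c f t x + Lop m c g t x)"
  by (intro ext) (simp add: Lop_def pDs_add ring_distribs sum.distrib)

lemma Lop_time_mult: "smooth1 a \<Longrightarrow> tfun f \<Longrightarrow> Lop m c (\<lambda>t x. a t * f t x) = (\<lambda>t x. a t * Lop m c f t x)"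
  by (intro ext) (simp add: Lop_def pDs_time_mult sum_distrib_left mult_ac)

lemma pD_sum: "finite I \<Longrightarrow> (\<And>i. i \<in> I \<Longrightarrow> tfun (f i)) \<Longrightarrow>
    pD j (\<lambda>t x. \<Sum>i\<in>I. f i t x) = (\<lambda>t x. \<Sum>i\<in>I. pD j (f i) t x)"
  by (induction I rule: finite_induct) (simp_all add: pD_time pD_add tfun_sum)

lemma pD_cmult: "tfun f \<Longrightarrow> pD j (\<lambda>t x. c * f t x) = (\<lambda>t x. c * pD j f t x)"
  by (simp add: pD_mult pD_time)

lemma Lop_pD: "tfun f \<Longrightarrow> Lop m c (pD j f) = pD j (Lop m c f)"
proof -
  assume f: "tfun f"
  have "pD j (Lop m c f) = (\<lambda>t x. \<Sum>\<alpha> | mi_size \<alpha> \<le> m. pD j (\<lambda>t x. c \<alpha> * pDs (mi_word \<alpha>) f t x) t x)"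
    unfolding Lop_def[abs_def] by (rule pD_sum) (auto intro!: finite_mi_size_le tfun.mult tfun_pDs f)
  then show ?thesis
    unfolding pD_cmult[OF tfun_pDs[OF f]] Lop_def[abs_def] pDs_pD[OF f] by simp
qed

subsection \<open>The transport equation with a defect\<close>

text \<open>The defect is kept as a vector field, so no inverse of the divergence is ever taken. The
  condition at time 0 makes the initial datum of the limit equal to 0. That \<open>U\<close> is
  divergence-free is shown separately, in \<open>U_div\<close>, from its form as a sum of
  shears.\<close>

definition defect_eq ::
    "nat \<Rightarrow> (('d::finite \<Rightarrow> nat) \<Rightarrow> real) \<Rightarrow> (real \<Rightarrow> real ^ 'd \<Rightarrow> real) \<Rightarrow>
     ('d \<Rightarrow> real \<Rightarrow> real ^ 'd \<Rightarrow> real) \<Rightarrow> ('d \<Rightarrow> real \<Rightarrow> real ^ 'd \<Rightarrow> real) \<Rightarrow> bool" where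
  "defect_eq m c \<rho> U R \<longleftrightarrow> tfun \<rho> \<and> (\<forall>k. tfun (U k)) \<and> (\<forall>k. tfun (R k)) \<and> (\<forall>x. \<rho> 0 x = 0) \<and>
     (\<forall>t x. pT \<rho> t x - Lop m c \<rho> t x + (\<Sum>k\<in>UNIV. pD k (\<lambda>t x. \<rho> t x * U k t x) t x) =
       (\<Sum>k\<in>UNIV. pD k (R k) t x))"

lemma pD_time_mult: "smooth1 a \<Longrightarrow> tfun f \<Longrightarrow> pD i (\<lambda>t x. a t * f t x) = (\<lambda>t x. a t * pD i f t x)"
  by (simp add: pD_mult[OF tfun.time] pD_time)

lemma pT_time_mult: "smooth1 a \<Longrightarrow> tfun f \<Longrightarrow>
    pT (\<lambda>t x. a t * f t x) = (\<lambda>t x. deriv a t * f t x + a t * pT f t x)"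
  by (simp add: pT_mult[OF tfun.time] pT_time)

lemma pD_coord_mult:
  assumes "smooth1 b" "per1 b" "tfun f"
  shows "pD i (\<lambda>t x. b (x $ j) * f t x) =
    (\<lambda>t x. (if i = j then deriv b (x $ j) * f t x else 0) + b (x $ j) * pD i f t x)"
  using pD_mult[OF tfun.space[OF assms(1,2)] assms(3)] assms by (auto simp: pD_space fun_eq_iff)

lemma pD_uminus: "tfun f \<Longrightarrow> pD i (\<lambda>t x. - f t x) = (\<lambda>t x. - pD i f t x)"
  using pD_cmult[of f i "-1"] by simp

lemma pT_uminus: "tfun f \<Longrightarrow> pT (\<lambda>t x. - f t x) = (\<lambda>t x. - pT f t x)"
  using pT_time_mult[of "\<lambda>t. -1" f] by simp

lemma Lop_uminus: "tfun f \<Longrightarrow> Lop m c (\<lambda>t x. - f t x) = (\<lambda>t x. - Lop m c f t x)"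
  using Lop_time_mult[of "\<lambda>t. -1" f] by simp

lemma pD_diff: "tfun f \<Longrightarrow> tfun g \<Longrightarrow> pD i (\<lambda>t x. f t x - g t x) = (\<lambda>t x. pD i f t x - pD i g t x)"
  using pD_add[of f "\<lambda>t x. - g t x" i] by (simp add: pD_uminus tfun_uminus)

text \<open>By \<open>ab\<close> and \<open>PP\<close> the leading part \<open>- \<alpha> \<beta> (\<Phi>' \<Psi>) R\<^sub>i\<close> of \<open>\<theta> w\<close> equals \<open>- R\<^sub>i\<close> up to terms with \<open>h'\<close> and
  \<open>K'\<close>.  The former are cancelled by the corrector \<open>h \<partial>\<^sub>i R\<^sub>i\<close> of \<open>\<theta>\<close>, the latter are integrated by
  parts in \<open>x\<^sub>j\<close>, where \<open>i \<noteq> j\<close> moves them to the component \<open>j\<close> of the defect.\<close>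

lemma defect_eq_step:
  fixes \<rho> :: "real \<Rightarrow> real ^ 'd::finite \<Rightarrow> real"
  assumes inv: "defect_eq m c \<rho> U R" and ij: "i \<noteq> j"
    and s: "smooth1 \<alpha>" "smooth1 \<beta>" "smooth1 h" "smooth1 \<Phi>" "smooth1 \<Psi>" "smooth1 K"
    and p: "per1 \<Phi>" "per1 \<Psi>" "per1 K"
    and ab: "\<And>t. \<alpha> t * \<beta> t = 1 + deriv h t" and PP: "\<And>s. deriv \<Phi> s * \<Psi> s = 1 + deriv K s"
    and 0: "\<alpha> 0 = 0" "h 0 = 0"
  defines "Z \<equiv> \<lambda>t x. \<alpha> t * (\<Phi> (x $ j) * R i t x)"
    and "w \<equiv> \<lambda>t x :: real ^ 'd. \<beta> t * \<Psi> (x $ j)"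
  defines "\<theta> \<equiv> \<lambda>t x. - pD j Z t x + h t * pD i (R i) t x"
  defines "E1 \<equiv> \<lambda>t x. h t * pT (R i) t x + \<rho> t x * w t x
      + (\<alpha> t * \<beta> t) * ((K (x $ j) - \<Phi> (x $ j) * \<Psi> (x $ j)) * pD j (R i) t x)
      + (h t * \<beta> t) * (\<Psi> (x $ j) * pD i (R i) t x) - h t * Lop m c (R i) t x"
    and "E2 \<equiv> \<lambda>t x. - pT Z t x - (\<alpha> t * \<beta> t) * (K (x $ j) * pD i (R i) t x) + Lop m c Z t x"
  shows "defect_eq m c (\<lambda>t x. \<rho> t x + \<theta> t x) (\<lambda>k t x. U k t x + (if k = i then w t x else 0))
    (\<lambda>k t x. (if k = i then 0 else R k t x) + \<theta> t x * U k t x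
        + (if k = i then E1 t x else 0) + (if k = j then E2 t x else 0))"
proof -
  note I = inv[unfolded defect_eq_def]
  have t\<rho>: "tfun \<rho>" and tU: "\<And>k. tfun (U k)" and tR: "\<And>k. tfun (R k)" using I by auto
  define Q where "Q = R i"
  have tQ: "tfun Q" using tR by (simp add: Q_def)
  have sab: "smooth1 (\<lambda>t. \<alpha> t * \<beta> t)" "smooth1 (\<lambda>t. h t * \<beta> t)" by (intro smooth1_mult s)+
  \<comment> \<open>Both coefficients of \<partial>_i \<partial>_j Q end up in the component
    \<open>i\<close>: \<open>K\<close> comes from integrating K' by parts, \<Phi> \<Psi> from the
    derivative falling on \<open>Q\<close> in \<partial>_j Z.\<close>
  define P where "P s = K s - \<Phi> s * \<Psi> s" for s
  have sP: "smooth1 P" unfolding P_def[abs_def]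
    using smooth1_add[OF s(6) smooth1_cmult[OF smooth1_mult[OF s(4,5)], of "-1"]] by simp
  have pP: "per1 P" using p by (simp add: per1_def P_def)
  note tt = tfun.time[OF s(1)] tfun.time[OF s(2)] tfun.time[OF s(3)] tfun.time[OF sab(1)] tfun.time[OF sab(2)]
  note ts = tfun.space[OF s(4) p(1)] tfun.space[OF s(5) p(2)] tfun.space[OF s(6) p(3)] tfun.space[OF sP pP]
  have tZ: "tfun Z" unfolding Z_def by (intro tfun.mult tt ts tR)
  have tw: "tfun w" unfolding w_def by (intro tfun.mult tt ts)
  have t\<theta>: "tfun \<theta>" unfolding \<theta>_def by (intro tfun.add tfun_uminus tfun.mult tt tfun_pD tZ tR)
  note E1' = E1_def[folded Q_def P_def]
  have tE1: "tfun E1" unfolding E1'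
    by (intro tfun.add tfun_diff tfun.mult tt ts tfun_pD tfun_pT tfun_Lop tQ t\<rho> tw)
  have tE2: "tfun E2" unfolding E2_def
    by (intro tfun.add tfun_diff tfun_uminus tfun.mult tt ts tfun_pD tfun_pT tfun_Lop tR tZ)
  have tif: "tfun (\<lambda>t x. if b then f t x else 0)" "tfun (\<lambda>t x. if b then 0 else f t x)" if "tfun f" for b and f :: "real \<Rightarrow> real ^ 'd \<Rightarrow> real"
    using that by (cases b; simp)+
  have pDif: "pD k (\<lambda>t x. if b then f t x else 0) = (\<lambda>t x. if b then pD k f t x else 0)"
    "pD k (\<lambda>t x. if b then 0 else f t x) = (\<lambda>t x. if b then 0 else pD k f t x)"
     for b k and f :: "real \<Rightarrow> real ^ 'd \<Rightarrow> real"
    by (cases b; simp add: pD_time)+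
  have pD_Z: "pD k Z = (\<lambda>t x. \<alpha> t * ((if k = j then deriv \<Phi> (x $ j) * Q t x else 0) + \<Phi> (x $ j) * pD k Q t x))" for k
    unfolding Z_def Q_def[symmetric]
    by (subst pD_time_mult[OF s(1)]) (auto intro!: tfun.mult ts tQ simp: pD_coord_mult s p tQ)
  have pT_\<theta>: "pT \<theta> t x = - pD j (pT Z) t x + deriv h t * pD i Q t x + h t * pD i (pT Q) t x" for t x
    unfolding \<theta>_def Q_def[symmetric]
    by (subst pT_add) (auto intro!: tfun.mult tfun_uminus tfun_pD tZ tQ tt
        simp: pT_uminus pT_time_mult s tfun_pD tZ tQ pT_pD)
  have Lop_\<theta>: "Lop m c \<theta> t x = - pD j (Lop m c Z) t x + h t * pD i (Lop m c Q) t x" for t x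
    unfolding \<theta>_def Q_def[symmetric]
    by (subst Lop_add) (auto intro!: tfun.mult tfun_uminus tfun_pD tZ tQ tt
        simp: Lop_uminus Lop_time_mult s tfun_pD tZ tQ Lop_pD)
  have \<theta>w: "\<theta> t x * w t x = - ((\<alpha> t * \<beta> t) * Q t x + (\<alpha> t * \<beta> t) * (deriv K (x $ j) * Q t x)
      + (\<alpha> t * \<beta> t) * ((\<Phi> (x $ j) * \<Psi> (x $ j)) * pD j Q t x)) + (h t * \<beta> t) * (\<Psi> (x $ j) * pD i Q t x)" for t x
  proof -
    have "\<theta> t x * w t x = - ((\<alpha> t * \<beta> t) * ((deriv \<Phi> (x $ j) * \<Psi> (x $ j)) * Q t x)
      + (\<alpha> t * \<beta> t) * ((\<Phi> (x $ j) * \<Psi> (x $ j)) * pD j Q t x)) + (h t * \<beta> t) * (\<Psi> (x $ j) * pD i Q t x)"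
      unfolding \<theta>_def pD_Z w_def Q_def[symmetric] by (simp add: algebra_simps)
    then show ?thesis unfolding PP by (simp add: algebra_simps)
  qed
  have sPP: "smooth1 (\<lambda>s. \<Phi> s * \<Psi> s)" "per1 (\<lambda>s. \<Phi> s * \<Psi> s)"
    using p by (auto simp: per1_def intro!: smooth1_mult s)
  have sK': "smooth1 (deriv K)" "per1 (deriv K)" by (intro smooth1_deriv per1_deriv s p)+
  \<comment> \<open>The product of the corrector h \<partial>_i Q with the shear. It is small
    already and enters E1 unchanged.\<close>
  define Y where "Y = (\<lambda>t x. (h t * \<beta> t) * (\<Psi> (x $ j) * pD i Q t x))"
  have tY: "tfun Y" unfolding Y_def by (intro tfun.mult tfun_pD tt ts tQ)
  have pD_\<theta>w: "pD i (\<lambda>t x. \<theta> t x * w t x) = (\<lambda>t x. - ((\<alpha> t * \<beta> t) * pD i Q t x + (\<alpha> t * \<beta> t) * (deriv K (x $ j) * pD i Q t x)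
      + (\<alpha> t * \<beta> t) * ((\<Phi> (x $ j) * \<Psi> (x $ j)) * pD i (pD j Q) t x)) + pD i Y t x)"
  proof -
    note t1 = tfun.mult[OF tt(4) tQ]
      tfun.mult[OF tt(4) tfun.mult[OF tfun.space[OF sK', of j] tQ]]
      tfun.mult[OF tt(4) tfun.mult[OF tfun.space[OF sPP, of j] tfun_pD[OF tQ, of j]]]
    have e1: "(\<lambda>t x. \<theta> t x * w t x) = (\<lambda>t x. - ((\<alpha> t * \<beta> t) * Q t x + (\<alpha> t * \<beta> t) * (deriv K (x $ j) * Q t x)
      + (\<alpha> t * \<beta> t) * ((\<Phi> (x $ j) * \<Psi> (x $ j)) * pD j Q t x)) + Y t x)"
      by (intro ext) (simp add: \<theta>w Y_def)
    have "pD i (\<lambda>t x. \<theta> t x * w t x) = (\<lambda>t x. - (pD i (\<lambda>t x. (\<alpha> t * \<beta> t) * Q t x) t x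
       + pD i (\<lambda>t x. (\<alpha> t * \<beta> t) * (deriv K (x $ j) * Q t x)) t x
       + pD i (\<lambda>t x. (\<alpha> t * \<beta> t) * ((\<Phi> (x $ j) * \<Psi> (x $ j)) * pD j Q t x)) t x) + pD i Y t x)"
      unfolding e1 pD_add[OF tfun_uminus[OF tfun.add[OF tfun.add[OF t1(1,2)] t1(3)]] tY]
        pD_uminus[OF tfun.add[OF tfun.add[OF t1(1,2)] t1(3)]]
        pD_add[OF tfun.add[OF t1(1,2)] t1(3)] pD_add[OF t1(1,2)] ..
    \<comment> \<open>Since i and j differ, the factors depending on x_j are constants for
      \<partial>_i.\<close>
    then show ?thesis
      unfolding pD_time_mult[OF sab(1) tQ]
          pD_time_mult[OF sab(1) tfun.mult[OF tfun.space[OF sK', of j] tQ]]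
          pD_time_mult[OF sab(1) tfun.mult[OF tfun.space[OF sPP, of j] tfun_pD[OF tQ, of j]]]
          pD_coord_mult[OF sK' tQ] pD_coord_mult[OF sPP tfun_pD[OF tQ]]
      using ij by simp
  qed
  have pD_E1: "pD i E1 t x = h t * pD i (pT Q) t x + pD i (\<lambda>t x. \<rho> t x * w t x) t x
      + (\<alpha> t * \<beta> t) * ((K (x $ j) - \<Phi> (x $ j) * \<Psi> (x $ j)) * pD i (pD j Q) t x) + pD i Y t x
      - h t * pD i (Lop m c Q) t x" for t x
  proof -
    note t1 = tfun.mult[OF tt(3) tfun_pT[OF tQ]] tfun.mult[OF t\<rho> tw]
       tfun.mult[OF tt(4) tfun.mult[OF ts(4)[of j] tfun_pD[OF tQ, of j]]]
       tfun.mult[OF tt(3) tfun_Lop[OF tQ, of m c]]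
    have "E1 = (\<lambda>t x. h t * pT Q t x + \<rho> t x * w t x
      + (\<alpha> t * \<beta> t) * (P (x $ j) * pD j Q t x) + Y t x - h t * Lop m c Q t x)"
      unfolding E1' Y_def ..
    then have "pD i E1 = (\<lambda>t x. pD i (\<lambda>t x. h t * pT Q t x) t x + pD i (\<lambda>t x. \<rho> t x * w t x) t x
      + pD i (\<lambda>t x. (\<alpha> t * \<beta> t) * (P (x $ j) * pD j Q t x)) t x + pD i Y t x - pD i (\<lambda>t x. h t * Lop m c Q t x) t x)"
      using pD_diff[OF tfun.add[OF tfun.add[OF tfun.add[OF t1(1,2)] t1(3)] tY] t1(4), of i]
        pD_add[OF tfun.add[OF tfun.add[OF t1(1,2)] t1(3)] tY, of i]
        pD_add[OF tfun.add[OF t1(1,2)] t1(3), of i] pD_add[OF t1(1,2), of i] by simp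
    then show ?thesis
      unfolding pD_time_mult[OF s(3) tfun_pT[OF tQ]] pD_time_mult[OF s(3) tfun_Lop[OF tQ]]
        pD_time_mult[OF sab(1) tfun.mult[OF ts(4)[of j] tfun_pD[OF tQ, of j]]]
        pD_coord_mult[OF sP pP tfun_pD[OF tQ]]
      using ij by (simp add: P_def)
  qed
  have pD_E2: "pD j E2 t x = - pD j (pT Z) t x - ((\<alpha> t * \<beta> t) * (deriv K (x $ j) * pD i Q t x + K (x $ j) * pD i (pD j Q) t x))
      + pD j (Lop m c Z) t x" for t x
  proof -
    note t1 = tfun_uminus[OF tfun_pT[OF tZ]] tfun_pT[OF tZ] tfun_Lop[OF tZ, of m c]
      tfun.mult[OF tt(4) tfun.mult[OF ts(3)[of j] tfun_pD[OF tQ, of i]]]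
    have "pD j E2 = (\<lambda>t x. - pD j (pT Z) t x - pD j (\<lambda>t x. (\<alpha> t * \<beta> t) * (K (x $ j) * pD i Q t x)) t x + pD j (Lop m c Z) t x)"
      unfolding E2_def Q_def[symmetric]
        pD_add[OF tfun_diff[OF t1(1,4)] t1(3)] pD_diff[OF t1(1,4)] pD_uminus[OF t1(2)] ..
    then show ?thesis
      unfolding pD_time_mult[OF sab(1) tfun.mult[OF ts(3)[of j] tfun_pD[OF tQ, of i]]]
        pD_coord_mult[OF s(6) p(3) tfun_pD[OF tQ]] pD_commute[OF tQ, of j i] by simp
  qed
  \<comment> \<open>After replacing \<alpha> \<beta> by 1 + h', the 1 leaves -\<partial>_i Q and the
    h' cancels against the time derivative of the corrector; the remaining terms are exactly the
    divergences of E1 and E2.\<close>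
  have key: "pT \<theta> t x - Lop m c \<theta> t x + pD i (\<lambda>t x. \<rho> t x * w t x) t x + pD i (\<lambda>t x. \<theta> t x * w t x) t x
    = - pD i Q t x + pD i E1 t x + pD j E2 t x" for t x
    unfolding pT_\<theta> Lop_\<theta> pD_\<theta>w pD_E1 pD_E2 by (simp only: ab) (simp add: algebra_simps)
  show ?thesis unfolding defect_eq_def
  proof (intro conjI allI)
    show "tfun (\<lambda>t x. \<rho> t x + \<theta> t x)" by (intro tfun.add t\<rho> t\<theta>)
    show "tfun (\<lambda>t x. U k t x + (if k = i then w t x else 0))" for k
      by (intro tfun.add tif tU tw)
    show "tfun (\<lambda>t x. (if k = i then 0 else R k t x) + \<theta> t x * U k t x
        + (if k = i then E1 t x else 0) + (if k = j then E2 t x else 0))" for k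
      by (intro tfun.add tif tU tR tE1 tE2 tfun.mult t\<theta>)
    \<comment> \<open>\<alpha> vanishes at time 0 and so does \<open>h\<close>, hence both parts of
      the perturbation do.\<close>
    show "\<rho> 0 x + \<theta> 0 x = 0" for x using I 0 by (simp add: \<theta>_def pD_Z)
    fix t x
    have A: "pD k (\<lambda>t x. (\<rho> t x + \<theta> t x) * (U k t x + (if k = i then w t x else 0))) t x
      = pD k (\<lambda>t x. \<rho> t x * U k t x) t x + pD k (\<lambda>t x. \<theta> t x * U k t x) t x
        + (if k = i then pD i (\<lambda>t x. \<rho> t x * w t x) t x + pD i (\<lambda>t x. \<theta> t x * w t x) t x else 0)" for k
    proof (cases "k = i")
      case True
      have "(\<lambda>t x. (\<rho> t x + \<theta> t x) * (U i t x + w t x)) =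
        (\<lambda>t x. \<rho> t x * U i t x + \<theta> t x * U i t x + (\<rho> t x * w t x + \<theta> t x * w t x))"
        by (intro ext) (simp add: algebra_simps)
      then show ?thesis using True
        by (simp add: pD_add tfun.add tfun.mult t\<rho> t\<theta> tU tw)
    next
      case False
      have "(\<lambda>t x. (\<rho> t x + \<theta> t x) * U k t x) = (\<lambda>t x. \<rho> t x * U k t x + \<theta> t x * U k t x)"
        by (intro ext) (simp add: algebra_simps)
      then show ?thesis using False by (simp add: pD_add tfun.mult t\<rho> t\<theta> tU)
    qed
    have B: "pD k (\<lambda>t x. (if k = i then 0 else R k t x) + \<theta> t x * U k t x
        + (if k = i then E1 t x else 0) + (if k = j then E2 t x else 0)) t x
      = pD k (R k) t x + pD k (\<lambda>t x. \<theta> t x * U k t x) t x + (if k = i then - pD i Q t x + pD i E1 t x else 0)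
        + (if k = j then pD j E2 t x else 0)" for k
    proof -
      have "pD k (\<lambda>t x. (if k = i then 0 else R k t x) + \<theta> t x * U k t x
        + (if k = i then E1 t x else 0) + (if k = j then E2 t x else 0)) t x =
        pD k (\<lambda>t x. if k = i then 0 else R k t x) t x + pD k (\<lambda>t x. \<theta> t x * U k t x) t x
        + pD k (\<lambda>t x. if k = i then E1 t x else 0) t x + pD k (\<lambda>t x. if k = j then E2 t x else 0) t x"
        unfolding pD_add[OF tfun.add[OF tfun.add[OF tif(2)[OF tR] tfun.mult[OF t\<theta> tU]] tif(1)[OF tE1]] tif(1)[OF tE2]]
          pD_add[OF tfun.add[OF tif(2)[OF tR] tfun.mult[OF t\<theta> tU]] tif(1)[OF tE1]]
          pD_add[OF tif(2)[OF tR] tfun.mult[OF t\<theta> tU]] ..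
      then show ?thesis by (simp add: pDif Q_def)
    qed
    have "(\<Sum>k\<in>UNIV. pD k (\<lambda>t x. (\<rho> t x + \<theta> t x) * (U k t x + (if k = i then w t x else 0))) t x) =
      (\<Sum>k\<in>UNIV. pD k (\<lambda>t x. \<rho> t x * U k t x) t x) + (\<Sum>k\<in>UNIV. pD k (\<lambda>t x. \<theta> t x * U k t x) t x) +
      (pD i (\<lambda>t x. \<rho> t x * w t x) t x + pD i (\<lambda>t x. \<theta> t x * w t x) t x)"
      unfolding A sum.distrib by simp
    moreover have "(\<Sum>k\<in>UNIV. pD k (\<lambda>t x. (if k = i then 0 else R k t x) + \<theta> t x * U k t x
        + (if k = i then E1 t x else 0) + (if k = j then E2 t x else 0)) t x)
      = (\<Sum>k\<in>UNIV. pD k (R k) t x) + (\<Sum>k\<in>UNIV. pD k (\<lambda>t x. \<theta> t x * U k t x) t x)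
        + (- pD i Q t x + pD i E1 t x) + pD j E2 t x"
      unfolding B sum.distrib by simp
    moreover have "pT (\<lambda>t x. \<rho> t x + \<theta> t x) t x = pT \<rho> t x + pT \<theta> t x"
      "Lop m c (\<lambda>t x. \<rho> t x + \<theta> t x) t x = Lop m c \<rho> t x + Lop m c \<theta> t x"
      by (simp_all add: pT_add Lop_add t\<rho> t\<theta>)
    moreover have "pT \<rho> t x - Lop m c \<rho> t x + (\<Sum>k\<in>UNIV. pD k (\<lambda>t x. \<rho> t x * U k t x) t x) =
       (\<Sum>k\<in>UNIV. pD k (R k) t x)" using I by blast
    ultimately show "pT (\<lambda>t x. \<rho> t x + \<theta> t x) t x - Lop m c (\<lambda>t x. \<rho> t x + \<theta> t x) t x +
       (\<Sum>k\<in>UNIV. pD k (\<lambda>t x. (\<rho> t x + \<theta> t x) * (U k t x + (if k = i then w t x else 0))) t x) =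
       (\<Sum>k\<in>UNIV. pD k (\<lambda>t x. (if k = i then 0 else R k t x) + \<theta> t x * U k t x
        + (if k = i then E1 t x else 0) + (if k = j then E2 t x else 0)) t x)"
      using key[of t x] by linarith
  qed
qed

subsection \<open>Space-time estimates\<close>

text \<open>Joint continuity is all that the integrals require; unlike \<open>tfun\<close> it is
  stable under absolute values and it covers the test functions too.\<close>

definition jcont :: "(real \<Rightarrow> real ^ 'd::finite \<Rightarrow> real) \<Rightarrow> bool" where
  "jcont f \<longleftrightarrow> continuous_on UNIV (\<lambda>z. f (fst z) (snd z))"

definition n1 :: "real \<Rightarrow> (real \<Rightarrow> real ^ 'd::finite \<Rightarrow> real) \<Rightarrow> real" where
  "n1 T f = integral {0..T} (\<lambda>t. integral cell (\<lambda>x. \<bar>f t x\<bar>))"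

lemma jcont_tfun: "tfun f \<Longrightarrow> jcont f"
  by (simp add: jcont_def tfun_continuous)

lemma jcont_intros:
  "continuous_on UNIV a \<Longrightarrow> jcont (\<lambda>t x. a t)"
  "continuous_on UNIV P \<Longrightarrow> jcont (\<lambda>t x. P (x $ j))"
  "jcont f \<Longrightarrow> jcont g \<Longrightarrow> jcont (\<lambda>t x. f t x + g t x)"
  "jcont f \<Longrightarrow> jcont g \<Longrightarrow> jcont (\<lambda>t x. f t x * g t x)"
  "jcont f \<Longrightarrow> jcont (\<lambda>t x. \<bar>f t x\<bar>)"
  unfolding jcont_def
  by (auto intro!: continuous_intros continuous_on_compose2[of UNIV a] continuous_on_compose2[of UNIV P])

lemma jcont_space: "jcont f \<Longrightarrow> continuous_on A (f t)"
  using continuous_on_compose2[OF _ continuous_on_Pair[OF continuous_on_const continuous_on_id], of UNIV "\<lambda>z. f (fst z) (snd z)" t A]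
  by (simp add: jcont_def)

lemma jcont_time: "jcont f \<Longrightarrow> continuous_on A (\<lambda>t. f t x)"
  using continuous_on_compose2[OF _ continuous_on_Pair[OF continuous_on_id continuous_on_const], of UNIV "\<lambda>z. f (fst z) (snd z)" x A]
  by (simp add: jcont_def)

lemma jcont_integral: "jcont f \<Longrightarrow> continuous_on A (\<lambda>t. integral cell (f t))"
  by (rule integral_continuous_on_param)
     (auto simp: jcont_def case_prod_beta intro: continuous_on_subset)

lemma jcont_integrable: "jcont f \<Longrightarrow> f t integrable_on cell"
  by (rule cell_integrable[OF jcont_space])

lemma n1_integrable: "jcont f \<Longrightarrow> (\<lambda>t. integral cell (\<lambda>x. \<bar>f t x\<bar>)) integrable_on {0..T}"
  by (intro integrable_continuous_real jcont_integral jcont_intros)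

lemma integral_cell_bound:
  fixes g :: "real ^ 'd::finite \<Rightarrow> real"
  assumes "continuous_on UNIV g" "\<And>x. \<bar>g x\<bar> \<le> B"
  shows "\<bar>integral cell g\<bar> \<le> B"
proof -
  have "\<bar>integral cell g\<bar> \<le> integral cell (\<lambda>x :: real^'d. B)"
    using integral_norm_bound_integral[of g cell "\<lambda>x. B"] assms(2) cell_integrable[OF assms(1)]
    by (simp add: cell_integrable)
  then show ?thesis by (simp only: integral_cell_const)
qed

text \<open>The last term of the pointwise bound is integrated as a product of a time and a space
  integral. This is how the small L^1 norm of \<Phi> enters, which a bound by the supremum would
  lose.\<close>

lemma n1_le:
  fixes f g :: "real \<Rightarrow> real ^ 'd::finite \<Rightarrow> real"
  assumes fg: "jcont f" "jcont g" and c: "continuous_on UNIV a" "continuous_on UNIV b" "continuous_on UNIV P"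
    and P: "per1 P"
    and le: "\<And>t x. 0 \<le> t \<Longrightarrow> t \<le> T \<Longrightarrow> \<bar>f t x\<bar> \<le> \<bar>g t x\<bar> + a t + b t * P (x $ j)"
  shows "n1 T f \<le> n1 T g + integral {0..T} a + integral {0..T} b * integral {0..1} P"
proof -
  have intc: "(\<lambda>x. \<bar>h t x\<bar>) integrable_on cell" if "jcont h" for h :: "real \<Rightarrow> real ^ 'd \<Rightarrow> real" and t
    by (intro cell_integrable continuous_intros jcont_space that)
  have intr: "g integrable_on {0..T}" if "continuous_on UNIV g" for g :: "real \<Rightarrow> real"
    by (intro integrable_continuous_real continuous_on_subset[OF that]) auto
  have "integral cell (\<lambda>x. \<bar>f t x\<bar>) \<le> integral cell (\<lambda>x. \<bar>g t x\<bar>) + a t + b t * integral {0..1} P"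
    if t: "t \<in> {0..T}" for t
  proof -
    have cf: "continuous_on UNIV (f t)" "continuous_on UNIV (g t)" by (intro jcont_space fg)+
    have cP: "continuous_on UNIV (\<lambda>x :: real^'d. P (x $ j))" by (intro continuous_coord c)
    have "integral cell (\<lambda>x. \<bar>f t x\<bar>) \<le> integral cell (\<lambda>x. \<bar>g t x\<bar> + a t + b t * P (x $ j))"
      by (rule integral_le) (use t in \<open>auto intro!: le cell_integrable continuous_intros cf cP\<close>)
    also have "\<dots> = integral cell (\<lambda>x. \<bar>g t x\<bar> + a t) + integral cell (\<lambda>x :: real^'d. b t * P (x $ j))"
      by (rule integral_add) (auto intro!: cell_integrable continuous_intros cf cP)
    also have "integral cell (\<lambda>x. \<bar>g t x\<bar> + a t) = integral cell (\<lambda>x. \<bar>g t x\<bar>) + integral cell (\<lambda>x :: real^'d. a t)"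
      by (rule integral_add) (auto intro!: cell_integrable continuous_intros cf)
    also have "integral cell (\<lambda>x :: real^'d. a t) = a t" by (rule integral_cell_const)
    also have "integral cell (\<lambda>x :: real^'d. b t * P (x $ j)) = b t * integral cell (\<lambda>x :: real^'d. P (x $ j))"
      using integral_mult_right[of cell "b t" "\<lambda>x :: real^'d. P (x $ j)"] by simp
    also have "integral cell (\<lambda>x :: real^'d. P (x $ j)) = integral {0..1} P"
      by (rule integral_cell_coord[OF c(3) P])
    finally show ?thesis .
  qed
  then have "n1 T f \<le> integral {0..T} (\<lambda>t. integral cell (\<lambda>x. \<bar>g t x\<bar>) + a t + b t * integral {0..1} P)"
    unfolding n1_def
    by (intro integral_le n1_integrable fg integrable_add intr c integrable_on_mult_left) auto
  also have "\<dots> = integral {0..T} (\<lambda>t. integral cell (\<lambda>x. \<bar>g t x\<bar>) + a t) + integral {0..T} (\<lambda>t. b t * integral {0..1} P)"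
    by (intro integral_add integrable_add n1_integrable fg intr c integrable_on_mult_left)
  also have "integral {0..T} (\<lambda>t. integral cell (\<lambda>x. \<bar>g t x\<bar>) + a t) = n1 T g + integral {0..T} a"
    unfolding n1_def by (intro integral_add n1_integrable fg intr c)
  finally show ?thesis by simp
qed

lemma DERIV_shift_0: "((\<lambda>s. K (c + s)) has_real_derivative d) (at 0)"
  if "(K has_real_derivative d) (at c)" for K :: "real \<Rightarrow> real"
  using that DERIV_at_within_shift[of K d c 0 UNIV] by simp

lemma tfun_dir_deriv:
  assumes "tfun f"
  shows "((\<lambda>s. f t (x + s *\<^sub>R axis j 1)) has_real_derivative pD j f t x) (at 0)"
proof -
  have l: "((\<lambda>s. x + s *\<^sub>R axis j 1) has_derivative (\<lambda>s. s *\<^sub>R axis j 1)) (at 0)"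
    using has_derivative_add[OF has_derivative_const has_derivative_scaleR_left[OF has_derivative_ident]] by simp
  have d: "(f t has_derivative (\<lambda>h. \<Sum>i\<in>UNIV. pD i f t x * h $ i)) (at (x + 0 *\<^sub>R axis j 1))"
    using tfun_pD_has_deriv[OF assms, of t x] by simp
  have "((\<lambda>s. f t (x + s *\<^sub>R axis j 1)) has_derivative (\<lambda>s. \<Sum>i\<in>UNIV. pD i f t x * (s *\<^sub>R axis j 1) $ i)) (at 0)"
    by (rule has_derivative_compose[OF l d])
  moreover have "(\<Sum>i\<in>UNIV. pD i f t x * (s *\<^sub>R axis j 1) $ i) = pD j f t x * s" for s :: real
  proof -
    have "(\<Sum>i\<in>UNIV. pD i f t x * (s *\<^sub>R axis j 1) $ i) = (\<Sum>i\<in>UNIV. if i = j then pD j f t x * s else 0)"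
      by (intro sum.cong) (auto simp: axis_def)
    then show ?thesis by simp
  qed
  ultimately show ?thesis by (simp add: has_field_derivative_def)
qed

section \<open>L^1 norms of products with fast oscillations\<close>

lemma sqrt_reg_bounds:
  fixes r d :: real
  assumes "0 < d"
  shows "0 < sqrt (d\<^sup>2 + r\<^sup>2)" "\<bar>r\<bar> \<le> sqrt (d\<^sup>2 + r\<^sup>2)" "sqrt (d\<^sup>2 + r\<^sup>2) \<le> \<bar>r\<bar> + d"
    "\<bar>r * r' / sqrt (d\<^sup>2 + r\<^sup>2)\<bar> \<le> \<bar>r'\<bar>"
proof -
  show p: "0 < sqrt (d\<^sup>2 + r\<^sup>2)" using assms by (simp add: add_pos_nonneg)
  show b: "\<bar>r\<bar> \<le> sqrt (d\<^sup>2 + r\<^sup>2)" by (rule real_le_rsqrt) simp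
  show "sqrt (d\<^sup>2 + r\<^sup>2) \<le> \<bar>r\<bar> + d"
    by (rule real_le_lsqrt) (use assms in \<open>auto simp: power2_sum\<close>)
  have "\<bar>r\<bar> * \<bar>r'\<bar> \<le> \<bar>r'\<bar> * sqrt (d\<^sup>2 + r\<^sup>2)"
    using mult_right_mono[OF b, of "\<bar>r'\<bar>"] by (simp add: mult.commute)
  then show "\<bar>r * r' / sqrt (d\<^sup>2 + r\<^sup>2)\<bar> \<le> \<bar>r'\<bar>"
    using p by (simp add: abs_mult pos_divide_le_eq)
qed

lemma sqrt_reg_deriv:
  assumes "0 < (d::real)" "(f has_real_derivative f') (at x)"
  shows "((\<lambda>s. sqrt (d\<^sup>2 + (f s)\<^sup>2)) has_real_derivative f x * f' / sqrt (d\<^sup>2 + (f x)\<^sup>2)) (at x)"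
proof -
  have "0 < d\<^sup>2 + (f x)\<^sup>2" using assms(1) by (simp add: add_pos_nonneg)
  note p = DERIV_real_sqrt[OF this]
  have q: "((\<lambda>s. d\<^sup>2 + (f s)\<^sup>2) has_real_derivative 2 * (f x * f')) (at x)"
    by (rule DERIV_cong[OF DERIV_add[OF DERIV_const DERIV_power[OF assms(2), of 2]]]) simp
  have "inverse s / 2 * (2 * a) = a / s" for s a :: real by (simp add: inverse_eq_divide)
  then show ?thesis
    by (rule DERIV_cong[OF DERIV_chain2[where f=sqrt and g="\<lambda>s. d\<^sup>2 + (f s)\<^sup>2", OF p q]])
qed

text \<open>A product of a fixed function with rapidly oscillating factors in \<open>t\<close> and \<open>x\<^sub>j\<close> has
  \<open>L\<^sup>1\<close>-norm close to the product of the \<open>L\<^sup>1\<close>-norm with the means of the factors; \<open>\<bar>R\<bar>\<close> is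
  regularised to \<open>sqrt (\<delta>\<^sup>2 + R\<^sup>2)\<close> so that one can integrate by parts.\<close>

lemma n1_oscillation:
  fixes R :: "real \<Rightarrow> real ^ 'd::finite \<Rightarrow> real"
  assumes T: "0 < T" and R: "tfun R"
    and M: "\<And>t x. 0 \<le> t \<Longrightarrow> t \<le> T \<Longrightarrow> \<bar>R t x\<bar> \<le> M \<and> \<bar>pT R t x\<bar> \<le> M \<and> \<bar>pD j R t x\<bar> \<le> M"
    and g: "continuous_on UNIV g" "\<And>t. 0 \<le> g t" "\<And>t. g t = 1 + deriv h t" "integral {0..T} g \<le> C"
    and h: "smooth1 h" "\<And>t. \<bar>h t\<bar> \<le> \<delta>" "h 0 = 0" "0 < \<delta>"
    and P: "continuous_on UNIV P" "per1 P" "\<And>s. 0 \<le> P s"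
    and K: "\<And>s. (K has_real_derivative P s - \<mu>) (at s)" "per1 K" "\<And>s. \<bar>K s\<bar> \<le> \<delta>'" and \<mu>: "0 \<le> \<mu>"
  shows "n1 T (\<lambda>t x. g t * P (x $ j) * R t x) \<le> \<mu> * (n1 T R + \<delta> * (T + M + \<delta> + T * M)) + C * (\<delta>' * M)"
proof -
  have M0: "0 \<le> M" using M[of 0 0] T by auto
  have d0: "0 \<le> \<delta>'" using K(3)[of 0] by auto
  define S where "S t x = sqrt (\<delta>\<^sup>2 + (R t x)\<^sup>2)" for t x
  define Sj where "Sj t x = R t x * pD j R t x / S t x" for t x
  define St where "St t x = R t x * pT R t x / S t x" for t x
  note sb = sqrt_reg_bounds[OF h(4)]
  have S: "0 < S t x" "\<bar>R t x\<bar> \<le> S t x" "S t x \<le> \<bar>R t x\<bar> + \<delta>" for t x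
    unfolding S_def by (rule sb)+
  have Sjb: "\<bar>Sj t x\<bar> \<le> M" "\<bar>St t x\<bar> \<le> M" if "0 \<le> t" "t \<le> T" for t x
    unfolding Sj_def St_def S_def using M[OF that, of x] sb(4) by (meson order_trans)+
  have jR: "jcont R" "jcont (pD j R)" "jcont (pT R)" by (intro jcont_tfun R tfun_pD tfun_pT)+
  have jS: "jcont S" using jR(1) unfolding jcont_def S_def by (intro continuous_intros)
  have S0: "S t x \<noteq> 0" for t x using S(1)[of t x] by simp
  have jSj: "jcont Sj" "jcont St" using jR jS S0 unfolding jcont_def Sj_def St_def
    by (auto intro!: continuous_intros)
  have cK: "continuous_on UNIV K" using K(1) by (meson DERIV_isCont continuous_at_imp_continuous_on)
  have perS: "periodic (S t)" for t using tfun_periodic[OF R, of t] by (simp add: periodic_def S_def)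
  have perK: "periodic (\<lambda>x :: real^'d. K (x $ j))" by (rule periodic_coord[OF K(2)])
  note cS = jcont_space[OF jS] and cSj = jcont_space[OF jSj(1)]
  have cP: "continuous_on A (\<lambda>x :: real^'d. P (x $ j))" "continuous_on A (\<lambda>x :: real^'d. K (x $ j))" for A
    by (intro continuous_coord P cK)+
  define G where "G t = integral cell (S t)" for t
  have cG: "continuous_on A G" for A unfolding G_def by (rule jcont_integral[OF jS])
  \<comment> \<open>Along x_j, P = \<mu> + K'. The part with K' is integrated by parts and costs
    only \<delta>' M, because the derivative of the regularised modulus is bounded by that of
    R.\<close>
  have inner: "integral cell (\<lambda>x. P (x $ j) * \<bar>R t x\<bar>) \<le> \<mu> * G t + \<delta>' * M" if t: "0 \<le> t" "t \<le> T" for t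
  proof -
    have "integral cell (\<lambda>x. P (x $ j) * \<bar>R t x\<bar>) \<le> integral cell (\<lambda>x. P (x $ j) * S t x)"
      by (intro integral_le cell_integrable continuous_intros cP cS jcont_space jR mult_left_mono S P)
    also have "\<dots> = integral cell (\<lambda>x. \<mu> * S t x + (P (x $ j) - \<mu>) * S t x)"
      by (simp add: algebra_simps)
    also have "\<dots> = \<mu> * G t + integral cell (\<lambda>x. (P (x $ j) - \<mu>) * S t x)"
      unfolding G_def
      by (subst integral_add) (auto intro!: cell_integrable continuous_intros cP cS)
    also have "integral cell (\<lambda>x. (P (x $ j) - \<mu>) * S t x) = - integral cell (\<lambda>x. K (x $ j) * Sj t x)"
    proof (rule integral_cell_by_parts[where j=j])
      show "((\<lambda>s. K ((x + s *\<^sub>R axis j 1) $ j)) has_real_derivative P (x $ j) - \<mu>) (at 0)" for x :: "real^'d"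
        using DERIV_shift_0[OF K(1)[of "x $ j"]] by simp
      show "((\<lambda>s. S t (x + s *\<^sub>R axis j 1)) has_real_derivative Sj t x) (at 0)" for x
        using sqrt_reg_deriv[OF h(4) tfun_dir_deriv[OF R, of t x j]] by (simp add: S_def Sj_def)
    qed (intro perK perS cP cS cSj continuous_intros)+
    also have "- integral cell (\<lambda>x. K (x $ j) * Sj t x) \<le> \<delta>' * M"
    proof -
      have "\<bar>integral cell (\<lambda>x. K (x $ j) * Sj t x)\<bar> \<le> \<delta>' * M"
        by (rule integral_cell_bound)
           (auto intro!: continuous_intros cP cSj mult_mono K(3) Sjb t d0 simp: abs_mult)
      then show ?thesis by linarith
    qed
    finally show ?thesis by simp
  qed
  have intr: "f integrable_on {0..T}" if "continuous_on UNIV f" for f :: "real \<Rightarrow> real"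
    by (intro integrable_continuous_real continuous_on_subset[OF that]) auto
  have ch': "continuous_on UNIV (deriv h)" by (intro smooth1_continuous smooth1_deriv h)
  \<comment> \<open>The same in time for h': the boundary term at 0 vanishes with \<open>h\<close>,
    the one at T and the interior term are of order \<delta>.\<close>
  have hG: "integral {0..T} (\<lambda>t. deriv h t * G t) \<le> \<delta> * (M + \<delta>) + \<delta> * (T * M)"
  proof -
    have "integral {0..T} (\<lambda>t. deriv h t * G t) = integral (cbox 0 T) (\<lambda>t. integral cell (\<lambda>x. deriv h t * S t x))"
      by (simp add: G_def)
    \<comment> \<open>With the time integral inside, the fundamental theorem applies for each fixed
      x.\<close>
    also have "\<dots> = integral cell (\<lambda>x. integral (cbox 0 T) (\<lambda>t. deriv h t * S t x))"
    proof (rule integral_swap_continuous)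
      have "jcont (\<lambda>t x. deriv h t * S t x)" by (intro jcont_intros ch' jS)
      then show "continuous_on (cbox (0, 0) (T, 1)) (\<lambda>(t, x). deriv h t * S t x)"
        unfolding jcont_def by (auto simp: case_prod_beta intro: continuous_on_subset)
    qed
    also have "\<dots> \<le> integral cell (\<lambda>x :: real^'d. \<delta> * (M + \<delta>) + \<delta> * (T * M))"
    proof (rule integral_le)
      have "jcont (\<lambda>t x. deriv h t * S t x)" by (intro jcont_intros ch' jS)
      then have "continuous_on (UNIV \<times> cbox 0 T) (\<lambda>(x, t). deriv h t * S t x)"
        unfolding jcont_def case_prod_beta
        by (intro continuous_on_compose2[where f="\<lambda>z. (snd z, fst z)" and t=UNIV and g="\<lambda>z. deriv h (fst z) * S (fst z) (snd z)", simplified])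
           (auto intro!: continuous_intros)
      from integral_continuous_on_param[OF this]
      show "(\<lambda>x. integral (cbox 0 T) (\<lambda>t. deriv h t * S t x)) integrable_on cell"
        by (rule cell_integrable)
      fix x :: "real ^ 'd"
      have "((\<lambda>t. deriv h t * S t x + St t x * h t) has_integral h T * S T x - h 0 * S 0 x) {0..T}"
      proof (rule fundamental_theorem_of_calculus)
        fix t
        have "((\<lambda>t. S t x) has_real_derivative St t x) (at t)"
          using sqrt_reg_deriv[OF h(4) tfun_pT_has_deriv[OF R, of x t]] by (simp add: S_def St_def)
        from DERIV_mult[OF smooth1_has_deriv[OF h(1)] this]
        show "((\<lambda>t. h t * S t x) has_vector_derivative deriv h t * S t x + St t x * h t) (at t within {0..T})"
          by (simp add: has_real_derivative_iff_has_vector_derivative has_vector_derivative_at_within)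
      qed (use T in simp)
      then have "integral {0..T} (\<lambda>t. deriv h t * S t x + St t x * h t) = h T * S T x"
        by (simp add: integral_unique h(3))
      moreover have "integral {0..T} (\<lambda>t. deriv h t * S t x + St t x * h t) =
         integral {0..T} (\<lambda>t. deriv h t * S t x) + integral {0..T} (\<lambda>t. St t x * h t)"
        by (intro integral_add intr continuous_intros jcont_time jS jSj ch' smooth1_continuous h)
      moreover have "\<bar>integral {0..T} (\<lambda>t. St t x * h t)\<bar> \<le> integral {0..T} (\<lambda>t. M * \<delta>)"
        using Sjb(2) h(2) M0 h(4)
        by (intro integral_norm_bound_integral[where 'a=real, simplified real_norm_def] intr continuous_intros
             jcont_time jSj smooth1_continuous h) (auto simp: abs_mult intro!: mult_mono)
      moreover have "h T * S T x \<le> \<delta> * (M + \<delta>)"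
      proof -
        have "h T * S T x \<le> \<delta> * S T x" using h(2)[of T] S(1)[of T x] by (intro mult_right_mono) auto
        also have "\<dots> \<le> \<delta> * (M + \<delta>)" using S(3)[of T x] M[of T x] T h(4) by (intro mult_left_mono) auto
        finally show ?thesis .
      qed
      moreover have "integral {0..T} (\<lambda>t. M * \<delta>) = \<delta> * (T * M)" using T by simp
      ultimately show "integral (cbox 0 T) (\<lambda>t. deriv h t * S t x) \<le> \<delta> * (M + \<delta>) + \<delta> * (T * M)"
        unfolding cbox_interval by linarith
    qed (rule cell_integrable, rule continuous_on_const)
    also have "\<dots> = \<delta> * (M + \<delta>) + \<delta> * (T * M)" by (rule integral_cell_const)
    finally show ?thesis .
  qed
  have Gn: "integral {0..T} G \<le> n1 T R + \<delta> * T"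
  proof -
    have "n1 T S \<le> n1 T R + integral {0..T} (\<lambda>t. \<delta>) + integral {0..T} (\<lambda>t. 0) * integral {0..1} (\<lambda>s::real. 0)"
      by (rule n1_le[where j=j and a="\<lambda>t. \<delta>" and b="\<lambda>t. 0" and P="\<lambda>s. 0"]) (use S in \<open>auto simp: per1_def abs_of_pos intro!: jS jR\<close>)
    moreover have "n1 T S = integral {0..T} G" unfolding n1_def G_def using S(1) by (simp add: abs_of_pos)
    ultimately show ?thesis using T by (simp add: mult.commute)
  qed
  have "n1 T (\<lambda>t x. g t * P (x $ j) * R t x) = integral {0..T} (\<lambda>t. g t * integral cell (\<lambda>x. P (x $ j) * \<bar>R t x\<bar>))"
    unfolding n1_def using g(2) P(3) by (simp add: abs_mult mult.assoc)
  also have "\<dots> \<le> integral {0..T} (\<lambda>t. \<mu> * (g t * G t) + (\<delta>' * M) * g t)"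
  proof (rule integral_le)
    have "jcont (\<lambda>t x. P (x $ j) * \<bar>R t x\<bar>)" by (intro jcont_intros P jR)
    from jcont_integral[OF this, of UNIV]
    show "(\<lambda>t. g t * integral cell (\<lambda>x. P (x $ j) * \<bar>R t x\<bar>)) integrable_on {0..T}"
      by (intro intr continuous_intros g)
    show "(\<lambda>t. \<mu> * (g t * G t) + (\<delta>' * M) * g t) integrable_on {0..T}"
      by (intro intr continuous_intros g cG)
    fix t assume "t \<in> {0..T}"
    then show "g t * integral cell (\<lambda>x. P (x $ j) * \<bar>R t x\<bar>) \<le> \<mu> * (g t * G t) + (\<delta>' * M) * g t"
      using mult_left_mono[OF inner[of t] g(2)[of t]] by (simp add: algebra_simps)
  qed
  also have "\<dots> = integral {0..T} (\<lambda>t. \<mu> * (g t * G t)) + integral {0..T} (\<lambda>t. (\<delta>' * M) * g t)"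
    by (intro integral_add intr continuous_intros g cG)
  also have "\<dots> = \<mu> * integral {0..T} (\<lambda>t. g t * G t) + (\<delta>' * M) * integral {0..T} g" by simp
  also have "integral {0..T} (\<lambda>t. g t * G t) = integral {0..T} (\<lambda>t. G t + deriv h t * G t)"
    by (simp add: g(3) algebra_simps)
  also have "\<dots> = integral {0..T} G + integral {0..T} (\<lambda>t. deriv h t * G t)"
    by (intro integral_add intr continuous_intros ch' cG)
  finally have "n1 T (\<lambda>t x. g t * P (x $ j) * R t x) \<le>
      \<mu> * (integral {0..T} G + integral {0..T} (\<lambda>t. deriv h t * G t)) + (\<delta>' * M) * integral {0..T} g" .
  also have "\<dots> \<le> \<mu> * ((n1 T R + \<delta> * T) + (\<delta> * (M + \<delta>) + \<delta> * (T * M))) + (\<delta>' * M) * C"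
    using Gn hG g(4) \<mu> d0 M0 by (intro add_mono mult_left_mono) auto
  also have "\<dots> = \<mu> * (n1 T R + \<delta> * (T + M + \<delta> + T * M)) + C * (\<delta>' * M)" by (simp add: algebra_simps)
  finally show ?thesis .
qed

lemma tfun_family_bounded:
  assumes "finite F" "\<And>f. f \<in> F \<Longrightarrow> tfun f"
  obtains M where "1 \<le> M" "\<And>f t x. f \<in> F \<Longrightarrow> 0 \<le> t \<Longrightarrow> t \<le> T \<Longrightarrow> \<bar>f t x\<bar> \<le> M"
proof -
  have "\<exists>M\<ge>1. \<forall>f\<in>F. \<forall>t\<in>{0..T}. \<forall>x. \<bar>f t x\<bar> \<le> M"
    using assms
  proof (induction F rule: finite_induct)
    case (insert f F)
    from insert.IH insert.prems obtain M where M: "1 \<le> M" "\<forall>f\<in>F. \<forall>t\<in>{0..T}. \<forall>x. \<bar>f t x\<bar> \<le> M"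
      by blast
    obtain N where N: "0 \<le> N" "\<forall>t\<in>{0..T}. \<forall>x. \<bar>f t x\<bar> \<le> N"
      using tfun_bounded[of f T] insert.prems by blast
    show ?case using M N by (intro exI[of _ "max M N"]) (auto simp: le_max_iff_disj)
  qed (auto intro!: exI[of _ 1])
  then show ?thesis using that by fastforce
qed

lemma power_sum_le:
  fixes x y :: real assumes "0 \<le> x" "0 \<le> y" shows "(x + y) ^ q \<le> 2 ^ q * (x ^ q + y ^ q)"
proof -
  have "(x + y) ^ q \<le> (2 * max x y) ^ q" using assms by (intro power_mono) auto
  also have "\<dots> = 2 ^ q * max x y ^ q" by (simp add: power_mult_distrib)
  also have "max x y ^ q \<le> x ^ q + y ^ q" using assms by (auto simp: max_def)
  finally show ?thesis by simp
qed

text \<open>Makes one parameter small against finitely many constants at once; the list given at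
  each use is the list of requirements on that parameter.\<close>

lemma small_scale:
  assumes \<epsilon>: "(0::real) < \<epsilon>" and "\<forall>w\<in>set ws. 0 \<le> w"
  obtains \<delta> where "0 < \<delta>" "\<delta> \<le> 1" "\<forall>w\<in>set ws. \<delta> * w \<le> \<epsilon>"
proof -
  note assms = \<epsilon> assms(2)[rule_format]
  define W where "W = 1 + sum_list ws"
  have "(\<forall>w\<in>set ws. w \<le> sum_list ws) \<and> 0 \<le> sum_list ws" using \<open>\<forall>w\<in>set ws. 0 \<le> w\<close>
  proof (induction ws)
    case (Cons v ws)
    then have "\<forall>w\<in>set ws. w \<le> sum_list ws" "0 \<le> sum_list ws" "0 \<le> v" by auto
    then show ?case by fastforce
  qed simp
  then have s: "w \<le> sum_list ws" "0 \<le> sum_list ws" if "w \<in> set ws" for w using that by auto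
  have W: "1 \<le> W" using assms(2) by (simp add: W_def sum_list_nonneg)
  show ?thesis
  proof (rule that[of "min 1 (\<epsilon> / W)"])
    show "0 < min 1 (\<epsilon> / W)" using assms W by simp
    show "\<forall>w\<in>set ws. min 1 (\<epsilon> / W) * w \<le> \<epsilon>"
    proof
    fix w assume w: "w \<in> set ws"
    have "min 1 (\<epsilon> / W) * w \<le> \<epsilon> / W * w" using assms w by (intro mult_right_mono) auto
    also have "\<dots> \<le> \<epsilon> / W * W" using s[OF w] assms W by (intro mult_left_mono) (auto simp: W_def)
    also have "\<dots> = \<epsilon>" using W by simp
    finally show "min 1 (\<epsilon> / W) * w \<le> \<epsilon>" .
    qed
  qed simp
qed

subsection \<open>The perturbation step\<close>

text \<open>Step \<open>n\<close> with accuracy \<open>\<epsilon>\<close>: a shear flow in direction \<open>i\<close>, varying along \<open>j\<close>, is added to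
  \<open>U\<close> in order to remove the component \<open>R i\<close> of the defect.  The flux \<open>\<rho> U\<close> changes by as much
  as the size of \<open>R i\<close>, whereas the changes of \<open>\<rho>\<close> and of \<open>U\<close> are as small as desired in the
  norms of the theorem.\<close>

definition ci_step :: "real \<Rightarrow> nat \<Rightarrow> real \<Rightarrow> real \<Rightarrow> 'd::finite \<Rightarrow> 'd \<Rightarrow>
    (real \<Rightarrow> real ^ 'd \<Rightarrow> real) \<Rightarrow> ('d \<Rightarrow> real \<Rightarrow> real ^ 'd \<Rightarrow> real) \<Rightarrow> ('d \<Rightarrow> real \<Rightarrow> real ^ 'd \<Rightarrow> real) \<Rightarrow>
    (real \<Rightarrow> real ^ 'd \<Rightarrow> real) \<Rightarrow> ('d \<Rightarrow> real \<Rightarrow> real ^ 'd \<Rightarrow> real) \<Rightarrow> ('d \<Rightarrow> real \<Rightarrow> real ^ 'd \<Rightarrow> real) \<Rightarrow>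
    (real \<Rightarrow> real) \<Rightarrow> (real \<Rightarrow> real) \<Rightarrow> (real \<Rightarrow> real) \<Rightarrow> real \<Rightarrow> bool" where
  "ci_step T n \<epsilon> C i j \<rho> U R \<rho>' U' R' a \<gamma> \<Psi> s \<longleftrightarrow>
        continuous_on UNIV a \<and> (\<forall>t. 0 \<le> a t) \<and>
        (\<forall>w t x. length w \<le> n \<and> 0 \<le> t \<and> t \<le> T \<longrightarrow> \<bar>pDs w (\<lambda>t x. \<rho>' t x - \<rho> t x) t x\<bar> \<le> a t) \<and>
        integral {0..T} (\<lambda>t. (2 ^ n * a t) ^ Suc n) \<le> \<epsilon> \<and>
        smooth1 \<gamma> \<and> (\<forall>t. 0 \<le> \<gamma> t) \<and> smooth1 \<Psi> \<and> per1 \<Psi> \<and> 0 \<le> s \<and> (\<forall>y. \<bar>\<Psi> y\<bar> \<le> s) \<and>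
        (\<forall>q. 1 \<le> q \<and> q \<le> real (Suc n) \<longrightarrow> integral {0..1} (\<lambda>y. \<bar>deriv \<Psi> y\<bar> powr q) \<le> s powr q) \<and>
        integral {0..T} (\<lambda>t. \<gamma> t * s) \<le> \<epsilon> \<and>
        (\<forall>k t x. U' k t x = U k t x + (if k = i then \<gamma> t * \<Psi> (x $ j) else 0)) \<and>
        n1 T (R' i) \<le> \<epsilon> \<and> (\<forall>k. n1 T (R' k) \<le> n1 T (R k) + \<epsilon>) \<and>
        (\<forall>k. n1 T (\<lambda>t x. \<rho>' t x * U' k t x - \<rho> t x * U k t x) \<le> C * n1 T (R i) + \<epsilon>)"

text \<open>The parameters are chosen in the order \<delta>, then \<open>B\<close>, then \<delta>2
  with \<open>A\<close> and the space profiles, then \<eta> with the time profiles; each has to be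
  small against constants produced by the earlier choices. \<open>C\<close> bounds the mean of the
  modulus of \<Phi>' \<Psi>. It is the same for all steps, so the total change of the flux is
  governed by the sum of the defects and errors.\<close>

proposition convex_integration_step:
  fixes T :: real and m :: nat and c :: "('d::finite \<Rightarrow> nat) \<Rightarrow> real"
  assumes T: "0 < T"
  obtains C :: real where "0 < C" and
    "\<And>\<rho> U R i j n \<epsilon>. \<lbrakk>defect_eq m c \<rho> U R; i \<noteq> j; 0 < \<epsilon>\<rbrakk> \<Longrightarrow>
      \<exists>\<rho>' U' R' a \<gamma> \<Psi> s. defect_eq m c \<rho>' U' R' \<and>
        ci_step T n \<epsilon> C i j \<rho> U R \<rho>' U' R' a \<gamma> \<Psi> s"
proof -
  obtain Ct where Ct: "0 < Ct" and time: "\<And>\<delta>. 0 < \<delta> \<Longrightarrow> \<exists>B>0. \<forall>A>0. \<forall>\<eta>>0. \<forall>q::nat. 1 \<le> q \<longrightarrow>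
      (\<exists>\<alpha> \<beta> h. smooth1 \<alpha> \<and> smooth1 \<beta> \<and> smooth1 h \<and>
        (\<forall>t. 0 \<le> \<alpha> t \<and> 0 \<le> \<beta> t \<and> \<alpha> t * \<beta> t = 1 + deriv h t \<and> \<bar>h t\<bar> \<le> \<delta>) \<and> \<alpha> 0 = 0 \<and> h 0 = 0 \<and>
        integral {0..T} (\<lambda>t. \<alpha> t * \<beta> t) \<le> Ct \<and> integral {0..T} \<beta> \<le> Ct / A \<and>
        integral {0..T} (\<lambda>t. \<bar>deriv \<alpha> t\<bar>) \<le> A * B \<and>
        integral {0..T} \<alpha> \<le> \<eta> \<and> integral {0..T} (\<lambda>t. \<alpha> t ^ q) \<le> \<eta>)"
    using time_profile[OF T] by blast
  obtain Cs where Cs: "0 < Cs" and space: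
    "\<And>p \<delta>. 0 < p \<Longrightarrow> 0 < \<delta> \<Longrightarrow> \<exists>\<Phi> \<Psi> K K2 A m. smooth1 \<Phi> \<and> per1 \<Phi> \<and> smooth1 \<Psi> \<and> per1 \<Psi> \<and>
      smooth1 K \<and> per1 K \<and> per1 K2 \<and> 0 < A \<and> 0 \<le> m \<and> m \<le> Cs \<and>
      (\<forall>s. deriv \<Phi> s * \<Psi> s = 1 + deriv K s \<and>
        (K2 has_real_derivative \<bar>deriv \<Phi> s * \<Psi> s\<bar> - m) (at s) \<and>
        \<bar>K s\<bar> \<le> \<delta> \<and> \<bar>K2 s\<bar> \<le> \<delta> \<and> \<bar>\<Phi> s * \<Psi> s\<bar> \<le> \<delta> \<and> \<bar>\<Psi> s\<bar> \<le> \<delta> * A) \<and>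
      A * integral {0..1} (\<lambda>s. \<bar>\<Phi> s\<bar>) \<le> \<delta> \<and>
      (\<forall>q. 1 \<le> q \<and> q \<le> real p \<longrightarrow> integral {0..1} (\<lambda>s. \<bar>deriv \<Psi> s\<bar> powr q) \<le> (\<delta> * A) powr q)"
    using space_profile by blast
  have intr: "f integrable_on {0..T}" if "continuous_on UNIV f" for f :: "real \<Rightarrow> real"
    by (intro integrable_continuous_real continuous_on_subset[OF that]) auto
  show thesis
  proof (rule that[OF Cs])
    fix \<rho> U R and i j :: 'd and n :: nat and \<epsilon> :: real
    assume inv: "defect_eq m c \<rho> U R" and ij: "i \<noteq> j" and \<epsilon>: "0 < \<epsilon>"
    have t\<rho>: "tfun \<rho>" and tU: "\<And>k. tfun (U k)" and tR: "\<And>k. tfun (R k)"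
      using inv by (auto simp: defect_eq_def)
    define Q where "Q = R i"
    have tQ: "tfun Q" by (simp add: Q_def tR)
    have fw: "finite {w :: 'd list. length w \<le> n}"
      using finite_lists_length_le[of "UNIV :: 'd set" n] by simp
    \<comment> \<open>The data of the step whose suprema on [0,T] enter the estimates; none of them
      involves the profiles.\<close>
    define F where "F = {\<rho>, Q, pT Q, pD i Q, pD j Q, Lop m c Q} \<union> range U \<union> (\<lambda>w. pDs w (pD i Q)) ` {w. length w \<le> n}"
    have "finite F" unfolding F_def using fw by auto
    moreover have "tfun f" if "f \<in> F" for f
      using that by (auto simp: F_def intro!: t\<rho> tQ tU tfun_pT tfun_pD tfun_Lop tfun_pDs)
    ultimately obtain M where M1: "1 \<le> M" and M: "\<And>f t x. f \<in> F \<Longrightarrow> 0 \<le> t \<Longrightarrow> t \<le> T \<Longrightarrow> \<bar>f t x\<bar> \<le> M"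
      using tfun_family_bounded[of F T] by blast
    define q where "q = Suc n"
    \<comment> \<open>2^(n q) comes from the weight 2^n in front of \<open>a\<close>, 2^q from
      splitting the power of a sum.\<close>
    define D :: real where "D = 2 ^ (n * q) * 2 ^ q"
    have D0: "0 \<le> D" by (simp add: D_def)
    \<comment> \<open>Shares of the error budget; no estimate below collects more than five of the
      eight.\<close>
    define e where "e = \<epsilon> / 8"
    have e: "0 < e" using \<epsilon> by (simp add: e_def)
    have w1: "0 \<le> M" "0 \<le> (M\<^sup>2 + 2 * M) * T" "0 \<le> Cs * (T + M + 1 + T * M)" "0 \<le> D * T * M"
      using D0 T M1 Cs by (auto intro!: mult_nonneg_nonneg add_nonneg_nonneg)
    have "0 < min 1 e" using e by simp
    \<comment> \<open>Requirements on the bound \<delta> of \<open>h\<close>, in order: the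
      corrector is at most 1, its contribution to defect and flux, the error of averaging in time,
      and its contribution to the L^q norm in time.\<close>
    then obtain \<delta> where \<delta>: "0 < \<delta>" "\<delta> \<le> 1"
        "\<forall>w\<in>set [M, (M\<^sup>2 + 2 * M) * T, Cs * (T + M + 1 + T * M), D * T * M]. \<delta> * w \<le> min 1 e"
      by (rule small_scale[of "min 1 e" "[M, (M\<^sup>2 + 2 * M) * T, Cs * (T + M + 1 + T * M), D * T * M]"])
         (simp only: list.set ball_simps, intro conjI w1 TrueI)
    have \<delta>M: "\<delta> * M \<le> 1" and \<delta>1: "\<delta> * ((M\<^sup>2 + 2 * M) * T) \<le> e" "\<delta> * (Cs * (T + M + 1 + T * M)) \<le> e" "\<delta> * (D * T * M) \<le> e"
      using \<delta>(3) by (simp_all only: list.set ball_simps min.bounded_iff)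
    \<comment> \<open>\<open>B\<close> bounds the variation of \<alpha> per unit of height. It must
      be known before \<delta>2 is chosen, while \<open>A\<close> and \<eta> are still open; hence
      the nested quantifiers of the time profile.\<close>
    from time[OF \<delta>(1)] obtain B where B': "0 < B \<and> (\<forall>A>0. \<forall>\<eta>>0. \<forall>q::nat. 1 \<le> q \<longrightarrow>
      (\<exists>\<alpha> \<beta> h. smooth1 \<alpha> \<and> smooth1 \<beta> \<and> smooth1 h \<and>
        (\<forall>t. 0 \<le> \<alpha> t \<and> 0 \<le> \<beta> t \<and> \<alpha> t * \<beta> t = 1 + deriv h t \<and> \<bar>h t\<bar> \<le> \<delta>) \<and> \<alpha> 0 = 0 \<and> h 0 = 0 \<and>
        integral {0..T} (\<lambda>t. \<alpha> t * \<beta> t) \<le> Ct \<and> integral {0..T} \<beta> \<le> Ct / A \<and>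
        integral {0..T} (\<lambda>t. \<bar>deriv \<alpha> t\<bar>) \<le> A * B \<and>
        integral {0..T} \<alpha> \<le> \<eta> \<and> integral {0..T} (\<lambda>t. \<alpha> t ^ q) \<le> \<eta>))"
      by (rule exE)
    then have B: "0 < B" by (rule conjunct1)
    have w2: "0 \<le> 5 * M * Ct" "0 \<le> M * B" "0 \<le> Ct * M" "0 \<le> Ct"
      using M1 Ct B by (auto intro!: mult_nonneg_nonneg)
    \<comment> \<open>Requirements on \<delta>2, in order: the terms of the defect with \<beta> or
      \<alpha> \<beta>, the term with \<alpha>', the error of averaging in space, and the size of
      the new shear.\<close>
    obtain \<delta>2 where \<delta>2: "0 < \<delta>2" "\<delta>2 \<le> 1" "\<forall>w\<in>set [5 * M * Ct, M * B, Ct * M, Ct]. \<delta>2 * w \<le> e"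
      by (rule small_scale[OF e, of "[5 * M * Ct, M * B, Ct * M, Ct]"])
         (simp only: list.set ball_simps, intro conjI w2 TrueI)
    have \<delta>21: "\<delta>2 * (5 * M * Ct) \<le> e" "\<delta>2 * (M * B) \<le> e" "\<delta>2 * (Ct * M) \<le> e" "\<delta>2 * Ct \<le> e"
      using \<delta>2(3) by (simp_all only: list.set ball_simps)
    obtain \<Phi> \<Psi> K K2 A \<mu> where s: "smooth1 \<Phi>" "smooth1 \<Psi>" "smooth1 K" and p: "per1 \<Phi>" "per1 \<Psi>" "per1 K" "per1 K2"
      and A: "0 < A" and \<mu>: "0 \<le> \<mu>" "\<mu> \<le> Cs"
      and PP: "\<And>s. deriv \<Phi> s * \<Psi> s = 1 + deriv K s"
      and K2: "\<And>s. (K2 has_real_derivative \<bar>deriv \<Phi> s * \<Psi> s\<bar> - \<mu>) (at s)"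
      and bd: "\<And>s. \<bar>K s\<bar> \<le> \<delta>2" "\<And>s. \<bar>K2 s\<bar> \<le> \<delta>2" "\<And>s. \<bar>\<Phi> s * \<Psi> s\<bar> \<le> \<delta>2" "\<And>s. \<bar>\<Psi> s\<bar> \<le> \<delta>2 * A"
      and A\<Phi>: "A * integral {0..1} (\<lambda>s. \<bar>\<Phi> s\<bar>) \<le> \<delta>2"
      and \<Psi>q: "\<And>r. 1 \<le> r \<Longrightarrow> r \<le> real q \<Longrightarrow> integral {0..1} (\<lambda>s. \<bar>deriv \<Psi> s\<bar> powr r) \<le> (\<delta>2 * A) powr r"
      using space[of q \<delta>2] \<delta>2(1) unfolding q_def by blast
    \<comment> \<open>The main perturbation without its factor \<alpha> and before \<partial>_j is
      applied. Its derivatives may be huge but are fixed now, so that \<eta> can still be chosen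
      against their bound \<open>X\<close>.\<close>
    define G where "G = (\<lambda>t x. \<Phi> (x $ j) * Q t x)"
    have tG: "tfun G" unfolding G_def by (intro tfun.mult tfun.space s p tQ)
    define F2 where "F2 = {G, pT G, Lop m c G} \<union> (\<lambda>w. pDs w (pD j G)) ` {w. length w \<le> n}
       \<union> {\<lambda>t x. \<Phi> (x $ j) * pT Q t x}"
    have "finite F2" unfolding F2_def using fw by auto
    moreover have "tfun f" if "f \<in> F2" for f
      using that by (auto simp: F2_def intro!: tG tQ tfun_pT tfun_pD tfun_Lop tfun_pDs tfun.mult tfun.space s p)
    ultimately obtain X where X1: "1 \<le> X" and X: "\<And>f t x. f \<in> F2 \<Longrightarrow> 0 \<le> t \<Longrightarrow> t \<le> T \<Longrightarrow> \<bar>f t x\<bar> \<le> X"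
      using tfun_family_bounded[of F2 T] by blast
    have w3: "0 \<le> (M + 2) * X" "0 \<le> D * X ^ q" using M1 X1 D0 by (auto intro!: mult_nonneg_nonneg)
    obtain \<eta> where \<eta>: "0 < \<eta>" "\<eta> \<le> 1" "\<forall>w\<in>set [(M + 2) * X, D * X ^ q]. \<eta> * w \<le> e"
      by (rule small_scale[OF e, of "[(M + 2) * X, D * X ^ q]"])
         (simp only: list.set ball_simps, intro conjI w3 TrueI)
    have \<eta>1: "\<eta> * ((M + 2) * X) \<le> e" "\<eta> * (D * X ^ q) \<le> e"
      using \<eta>(3) by (simp_all only: list.set ball_simps)
    obtain \<alpha> \<beta> h where st: "smooth1 \<alpha>" "smooth1 \<beta>" "smooth1 h"
      and nn: "\<And>t. 0 \<le> \<alpha> t" "\<And>t. 0 \<le> \<beta> t" and ab: "\<And>t. \<alpha> t * \<beta> t = 1 + deriv h t"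
      and h: "\<And>t. \<bar>h t\<bar> \<le> \<delta>" and 0: "\<alpha> 0 = 0" "h 0 = 0"
      and i: "integral {0..T} (\<lambda>t. \<alpha> t * \<beta> t) \<le> Ct" "integral {0..T} \<beta> \<le> Ct / A"
        "integral {0..T} (\<lambda>t. \<bar>deriv \<alpha> t\<bar>) \<le> A * B"
        "integral {0..T} \<alpha> \<le> \<eta>" "integral {0..T} (\<lambda>t. \<alpha> t ^ q) \<le> \<eta>"
    proof -
      have "1 \<le> q" by (simp add: q_def)
      from B'[THEN conjunct2, rule_format, OF A \<eta>(1) this] show ?thesis
        using that by blast
    qed
    note ct = st[THEN smooth1_continuous, of UNIV] smooth1_continuous[OF smooth1_deriv[OF st(1)], of UNIV]
    note cs = s[THEN smooth1_continuous, of UNIV] smooth1_continuous[OF smooth1_deriv[OF s(1)], of UNIV]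
    \<comment> \<open>Bounds \<Psi> as well as the L^r norms of \<Psi>' for r <= q. It contains the
      height \<open>A\<close>, which cancels against the bound Ct / A for the integral of
      \<beta>.\<close>
    define sg where "sg = \<delta>2 * A"
    have sg: "0 \<le> sg" using \<delta>2 A by (simp add: sg_def)
    define Z where "Z = (\<lambda>t x. \<alpha> t * (\<Phi> (x $ j) * Q t x))"
    define w where "w = (\<lambda>t (x :: real ^ 'd). \<beta> t * \<Psi> (x $ j))"
    define \<theta> where "\<theta> = (\<lambda>t x. - pD j Z t x + h t * pD i Q t x)"
    define E1 where "E1 = (\<lambda>t x. h t * pT Q t x + \<rho> t x * w t x
      + (\<alpha> t * \<beta> t) * ((K (x $ j) - \<Phi> (x $ j) * \<Psi> (x $ j)) * pD j Q t x)
      + (h t * \<beta> t) * (\<Psi> (x $ j) * pD i Q t x) - h t * Lop m c Q t x)"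
    define E2 where "E2 = (\<lambda>t x. - pT Z t x - (\<alpha> t * \<beta> t) * (K (x $ j) * pD i Q t x) + Lop m c Z t x)"
    define R' where "R' = (\<lambda>k t x. (if k = i then 0 else R k t x) + \<theta> t x * U k t x
        + (if k = i then E1 t x else 0) + (if k = j then E2 t x else 0))"
    define U' where "U' = (\<lambda>k t x. U k t x + (if k = i then w t x else 0))"
    define \<rho>' where "\<rho>' = (\<lambda>t x. \<rho> t x + \<theta> t x)"
    have inv': "defect_eq m c \<rho>' U' R'"
      using defect_eq_step[OF inv ij st s p(1-3) ab PP 0]
      unfolding \<rho>'_def U'_def R'_def E1_def E2_def \<theta>_def w_def Z_def Q_def .
    have t\<rho>': "tfun \<rho>'" and tU': "\<And>k. tfun (U' k)" and tR': "\<And>k. tfun (R' k)"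
      using inv' by (auto simp: defect_eq_def)
    have ZG: "Z = (\<lambda>t x. \<alpha> t * G t x)" by (simp add: Z_def G_def)
    have \<theta>G: "\<theta> = (\<lambda>t x. (- \<alpha> t) * pD j G t x + h t * pD i Q t x)"
      unfolding \<theta>_def ZG by (simp add: pD_time_mult st tG)
    have sna: "smooth1 (\<lambda>t. - \<alpha> t)" using smooth1_cmult[OF st(1), of "-1"] by simp
    \<comment> \<open>Bounds every space derivative of \<theta> up to order \<open>n\<close> at time
      t: X \<alpha> for the main part, \<delta> M for the corrector.\<close>
    define a where "a t = X * \<alpha> t + \<delta> * M" for t
    have a0: "0 \<le> a t" for t using X1 M1 nn \<delta> by (simp add: a_def)
    have ca: "continuous_on UNIV a" unfolding a_def by (intro continuous_intros ct)
    have \<theta>b: "\<bar>pDs v \<theta> t x\<bar> \<le> a t" if "length v \<le> n" "0 \<le> t" "t \<le> T" for v t x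
    proof -
      have "pDs v \<theta> = (\<lambda>t x. (- \<alpha> t) * pDs v (pD j G) t x + h t * pDs v (pD i Q) t x)"
        unfolding \<theta>G pDs_add[OF tfun.mult[OF tfun.time[OF sna] tfun_pD[OF tG]] tfun.mult[OF tfun.time[OF st(3)] tfun_pD[OF tQ]]]
          pDs_time_mult[OF sna tfun_pD[OF tG]] pDs_time_mult[OF st(3) tfun_pD[OF tQ]] ..
      then have "pDs v \<theta> t x = (- \<alpha> t) * pDs v (pD j G) t x + h t * pDs v (pD i Q) t x" by simp
      also have "\<bar>\<dots>\<bar> \<le> \<alpha> t * \<bar>pDs v (pD j G) t x\<bar> + \<bar>h t\<bar> * \<bar>pDs v (pD i Q) t x\<bar>"
        using nn(1)[of t] by (intro order_trans[OF abs_triangle_ineq]) (simp add: abs_mult)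
      also have "\<dots> \<le> \<alpha> t * X + \<delta> * M"
      proof (intro add_mono mult_mono)
        show "\<bar>pDs v (pD j G) t x\<bar> \<le> X" by (rule X) (use that in \<open>auto simp: F2_def\<close>)
        show "\<bar>pDs v (pD i Q) t x\<bar> \<le> M" by (rule M) (use that in \<open>auto simp: F_def\<close>)
      qed (use nn h \<delta> in auto)
      finally show ?thesis by (simp add: a_def mult.commute)
    qed
    have \<theta>b0: "\<bar>\<theta> t x\<bar> \<le> a t" if "0 \<le> t" "t \<le> T" for t x using \<theta>b[of "[]" t x] that by simp
    have aq: "integral {0..T} (\<lambda>t. (2 ^ n * a t) ^ Suc n) \<le> \<epsilon>"
    proof -
      have "integral {0..T} (\<lambda>t. (2 ^ n * a t) ^ q) \<le> integral {0..T} (\<lambda>t. D * X ^ q * \<alpha> t ^ q + D * (\<delta> * M))"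
      proof (rule integral_le)
        fix t
        have "(2 ^ n * a t) ^ q = 2 ^ (n * q) * a t ^ q" by (simp add: power_mult_distrib power_mult)
        also have "\<dots> \<le> 2 ^ (n * q) * (2 ^ q * ((X * \<alpha> t) ^ q + (\<delta> * M) ^ q))"
          unfolding a_def using X1 M1 nn \<delta> by (intro mult_left_mono power_sum_le) auto
        \<comment> \<open>As \<delta> M <= 1, the power may be dropped, so that linear smallness in
          \<delta> suffices.\<close>
        also have "(\<delta> * M) ^ q \<le> \<delta> * M"
          using power_decreasing[of 1 q "\<delta> * M"] \<delta>M \<delta> M1 by (simp add: q_def)
        finally show "(2 ^ n * a t) ^ q \<le> D * X ^ q * \<alpha> t ^ q + D * (\<delta> * M)"
          by (simp add: D_def power_mult_distrib algebra_simps)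
      qed (auto intro!: intr continuous_intros ca ct)
      also have "\<dots> = integral {0..T} (\<lambda>t. D * X ^ q * \<alpha> t ^ q) + integral {0..T} (\<lambda>t. D * (\<delta> * M))"
        by (intro integral_add intr continuous_intros ct)
      also have "integral {0..T} (\<lambda>t. D * X ^ q * \<alpha> t ^ q) = D * X ^ q * integral {0..T} (\<lambda>t. \<alpha> t ^ q)"
        by (rule integral_mult_right)
      also have "integral {0..T} (\<lambda>t. D * (\<delta> * M)) = \<delta> * (D * T * M)" using T by simp
      also have "D * X ^ q * integral {0..T} (\<lambda>t. \<alpha> t ^ q) \<le> D * X ^ q * \<eta>"
        using i(5) D0 X1 by (intro mult_left_mono) auto
      finally have "integral {0..T} (\<lambda>t. (2 ^ n * a t) ^ q) \<le> D * X ^ q * \<eta> + \<delta> * (D * T * M)" by simp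
      then show ?thesis using \<eta>1(2) \<delta>1(3) e \<epsilon> by (simp add: q_def e_def mult.commute)
    qed
    have Mb: "\<bar>\<rho> t x\<bar> \<le> M" "\<bar>Q t x\<bar> \<le> M" "\<bar>pT Q t x\<bar> \<le> M" "\<bar>pD i Q t x\<bar> \<le> M" "\<bar>pD j Q t x\<bar> \<le> M"
      "\<bar>Lop m c Q t x\<bar> \<le> M" "\<bar>U k t x\<bar> \<le> M" if "0 \<le> t" "t \<le> T" for t x k
      by (rule M; use that in \<open>simp add: F_def\<close>)+
    have Xb: "\<bar>pT G t x\<bar> \<le> X" "\<bar>Lop m c G t x\<bar> \<le> X" if "0 \<le> t" "t \<le> T" for t x
      by (rule X; use that in \<open>simp add: F2_def\<close>)+
    have \<theta>U: "\<bar>\<theta> t x * U k t x\<bar> \<le> M * X * \<alpha> t + \<delta> * M\<^sup>2" if "0 \<le> t" "t \<le> T" for t x k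
    proof -
      have "\<bar>\<theta> t x * U k t x\<bar> \<le> a t * M" unfolding abs_mult
        using \<theta>b0[OF that] Mb(7)[OF that] a0 by (intro mult_mono) auto
      then show ?thesis by (simp add: a_def algebra_simps power2_eq_square)
    qed
    have \<rho>w: "\<bar>\<rho> t x * w t x\<bar> \<le> M * sg * \<beta> t" if "0 \<le> t" "t \<le> T" for t x
    proof -
      have "\<bar>\<rho> t x * w t x\<bar> = \<bar>\<rho> t x\<bar> * (\<beta> t * \<bar>\<Psi> (x $ j)\<bar>)" using nn(2)[of t] by (simp add: w_def abs_mult)
      also have "\<dots> \<le> M * (\<beta> t * sg)"
        using Mb(1)[OF that] bd(4) M1 nn(2) unfolding sg_def by (intro mult_mono) auto
      finally show ?thesis by (simp add: mult_ac)
    qed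
    have hw: "\<bar>(h t * \<beta> t) * (\<Psi> (x $ j) * pD i Q t x)\<bar> \<le> M * sg * \<beta> t" if "0 \<le> t" "t \<le> T" for t x
    proof -
      have "\<bar>(h t * \<beta> t) * (\<Psi> (x $ j) * pD i Q t x)\<bar> = (\<bar>h t\<bar> * \<beta> t) * (\<bar>\<Psi> (x $ j)\<bar> * \<bar>pD i Q t x\<bar>)"
        using nn(2)[of t] by (simp add: abs_mult)
      also have "\<dots> \<le> (1 * \<beta> t) * (sg * M)"
      proof -
        have "\<bar>\<Psi> (x $ j)\<bar> \<le> sg" using bd(4) by (simp add: sg_def)
        moreover have "\<bar>h t\<bar> \<le> 1" using h[of t] \<delta>(2) by linarith
        ultimately show ?thesis using Mb(4)[OF that] M1 nn(2) sg by (intro mult_mono) auto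
      qed
      finally show ?thesis by (simp add: mult_ac)
    qed
    have abK: "\<bar>(\<alpha> t * \<beta> t) * (f * g)\<bar> \<le> r * (M * (\<alpha> t * \<beta> t))" if "\<bar>f\<bar> \<le> r" "\<bar>g\<bar> \<le> M" for t f g r
    proof -
      have "\<bar>(\<alpha> t * \<beta> t) * (f * g)\<bar> = (\<alpha> t * \<beta> t) * (\<bar>f\<bar> * \<bar>g\<bar>)" using nn(1,2)[of t] by (simp add: abs_mult)
      also have "\<dots> \<le> (\<alpha> t * \<beta> t) * (r * M)"
        using that nn(1,2)[of t] by (intro mult_left_mono mult_mono) auto
      finally show ?thesis by (simp add: mult_ac)
    qed
    have hM: "\<bar>h t * y\<bar> \<le> \<delta> * M" if "\<bar>y\<bar> \<le> M" for t y
      unfolding abs_mult using h[of t] that \<delta> by (intro mult_mono) auto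
    \<comment> \<open>Collects all errors that are bounded uniformly in x. Only \<alpha>' \<Phi> Q
      is left out, which is small merely on average in x_j.\<close>
    define A0 where "A0 t = ((M + 2) * X) * \<alpha> t + \<delta> * (M\<^sup>2 + 2 * M) + (2 * M * sg) * \<beta> t + (3 * M * \<delta>2) * (\<alpha> t * \<beta> t)" for t
    have cA0: "continuous_on UNIV A0" unfolding A0_def by (intro continuous_intros ct)
    have E1b: "\<bar>E1 t x\<bar> \<le> 2 * (\<delta> * M) + 2 * (M * sg * \<beta> t) + 2 * (\<delta>2 * (M * (\<alpha> t * \<beta> t)))" if "0 \<le> t" "t \<le> T" for t x
    proof -
      have "\<bar>K (x $ j) - \<Phi> (x $ j) * \<Psi> (x $ j)\<bar> \<le> 2 * \<delta>2"
        using bd(1)[of "x $ j"] bd(3)[of "x $ j"] by linarith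
      from abK[OF this Mb(5)[OF that, of x], of t]
      have "\<bar>(\<alpha> t * \<beta> t) * ((K (x $ j) - \<Phi> (x $ j) * \<Psi> (x $ j)) * pD j Q t x)\<bar> \<le> 2 * (\<delta>2 * (M * (\<alpha> t * \<beta> t)))"
        by (simp only: mult.assoc)
      then show ?thesis
        using hM[OF Mb(3)[OF that, of x], of t] hM[OF Mb(6)[OF that, of x], of t] \<rho>w[OF that, of x] hw[OF that, of x]
        unfolding E1_def by linarith
    qed
    have E2b: "\<bar>E2 t x\<bar> \<le> \<bar>deriv \<alpha> t\<bar> * (M * \<bar>\<Phi> (x $ j)\<bar>) + 2 * (X * \<alpha> t) + \<delta>2 * (M * (\<alpha> t * \<beta> t))" if "0 \<le> t" "t \<le> T" for t x
    proof -
      \<comment> \<open>The derivative of \<alpha> is split off; what remains is \<alpha> times a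
        function fixed before \<eta>.\<close>
      have 1: "pT Z t x = deriv \<alpha> t * (\<Phi> (x $ j) * Q t x) + \<alpha> t * pT G t x"
        unfolding ZG by (simp add: pT_time_mult st tG) (simp add: G_def)
      have 2: "Lop m c Z t x = \<alpha> t * Lop m c G t x" unfolding ZG by (simp add: Lop_time_mult st tG)
      have "\<bar>deriv \<alpha> t * (\<Phi> (x $ j) * Q t x)\<bar> \<le> \<bar>deriv \<alpha> t\<bar> * (M * \<bar>\<Phi> (x $ j)\<bar>)"
        unfolding abs_mult using Mb(2)[OF that, of x] by (subst mult.commute[of M], intro mult_left_mono) auto
      moreover have "\<bar>\<alpha> t * pT G t x\<bar> \<le> X * \<alpha> t" "\<bar>\<alpha> t * Lop m c G t x\<bar> \<le> X * \<alpha> t"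
        using mult_left_mono[OF Xb(1)[OF that, of x] nn(1)[of t]] mult_left_mono[OF Xb(2)[OF that, of x] nn(1)[of t]] nn(1)[of t]
        by (simp_all only: abs_mult abs_of_nonneg mult.commute[of X])
      ultimately show ?thesis
        using abK[OF bd(1)[of "x $ j"] Mb(4)[OF that, of x], of t] unfolding E2_def 1 2 by linarith
    qed
    have R'b: "\<bar>R' k t x\<bar> \<le> \<bar>(if k = i then 0 else R k t x)\<bar> + A0 t + \<bar>deriv \<alpha> t\<bar> * (M * \<bar>\<Phi> (x $ j)\<bar>)"
      if "0 \<le> t" "t \<le> T" for k t x
    proof -
      have pos: "0 \<le> \<bar>deriv \<alpha> t\<bar> * (M * \<bar>\<Phi> (x $ j)\<bar>)" "0 \<le> X * \<alpha> t" "0 \<le> M * sg * \<beta> t" "0 \<le> \<delta> * M"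
        "0 \<le> \<delta>2 * (M * (\<alpha> t * \<beta> t))"
        using M1 X1 nn(1,2)[of t] sg \<delta> \<delta>2 by (auto intro!: mult_nonneg_nonneg)
      have "\<bar>R' k t x\<bar> \<le> \<bar>(if k = i then 0 else R k t x)\<bar> + \<bar>\<theta> t x * U k t x\<bar> + \<bar>E1 t x\<bar> + \<bar>E2 t x\<bar>"
        unfolding R'_def by auto
      also have "\<dots> \<le> \<bar>(if k = i then 0 else R k t x)\<bar> + (M * X * \<alpha> t + \<delta> * M\<^sup>2) +
         (2 * (\<delta> * M) + 2 * (M * sg * \<beta> t) + 2 * (\<delta>2 * (M * (\<alpha> t * \<beta> t)))) +
         (\<bar>deriv \<alpha> t\<bar> * (M * \<bar>\<Phi> (x $ j)\<bar>) + 2 * (X * \<alpha> t) + \<delta>2 * (M * (\<alpha> t * \<beta> t)))"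
        by (intro add_mono \<theta>U E1b E2b that order_refl)
      also have "\<dots> = \<bar>(if k = i then 0 else R k t x)\<bar> + A0 t + \<bar>deriv \<alpha> t\<bar> * (M * \<bar>\<Phi> (x $ j)\<bar>)"
        unfolding A0_def by (simp add: algebra_simps)
      finally show ?thesis .
    qed
    have iA0: "integral {0..T} A0 \<le> 3 * e"
    proof -
      have "integral {0..T} A0 = integral {0..T} (\<lambda>t. ((M + 2) * X) * \<alpha> t) + integral {0..T} (\<lambda>t. \<delta> * (M\<^sup>2 + 2 * M))
         + integral {0..T} (\<lambda>t. (2 * M * sg) * \<beta> t) + integral {0..T} (\<lambda>t. (3 * M * \<delta>2) * (\<alpha> t * \<beta> t))"
        unfolding A0_def by (simp only: integral_add intr continuous_intros ct continuous_on_mult continuous_on_add continuous_on_const)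
      also have "integral {0..T} (\<lambda>t. ((M + 2) * X) * \<alpha> t) = ((M + 2) * X) * integral {0..T} \<alpha>" by (rule integral_mult_right)
      also have "integral {0..T} (\<lambda>t. \<delta> * (M\<^sup>2 + 2 * M)) = \<delta> * ((M\<^sup>2 + 2 * M) * T)" using T by simp
      also have "integral {0..T} (\<lambda>t. (2 * M * sg) * \<beta> t) = (2 * M * sg) * integral {0..T} \<beta>" by (rule integral_mult_right)
      also have "integral {0..T} (\<lambda>t. (3 * M * \<delta>2) * (\<alpha> t * \<beta> t)) = (3 * M * \<delta>2) * integral {0..T} (\<lambda>t. \<alpha> t * \<beta> t)" by (rule integral_mult_right)
      also have "((M + 2) * X) * integral {0..T} \<alpha> + \<delta> * ((M\<^sup>2 + 2 * M) * T) + (2 * M * sg) * integral {0..T} \<beta>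
          + (3 * M * \<delta>2) * integral {0..T} (\<lambda>t. \<alpha> t * \<beta> t)
          \<le> ((M + 2) * X) * \<eta> + \<delta> * ((M\<^sup>2 + 2 * M) * T) + (2 * M * sg) * (Ct / A) + (3 * M * \<delta>2) * Ct"
        by (intro add_mono mult_left_mono i order_refl) (use M1 X1 sg \<delta>2(1) in \<open>auto intro!: mult_nonneg_nonneg\<close>)
      finally have "integral {0..T} A0 \<le> ((M + 2) * X) * \<eta> + \<delta> * ((M\<^sup>2 + 2 * M) * T) + ((2 * M * sg) * (Ct / A) + (3 * M * \<delta>2) * Ct)"
        by (simp only: add.assoc)
      also have "(2 * M * sg) * (Ct / A) + (3 * M * \<delta>2) * Ct = \<delta>2 * (5 * M * Ct)" using A by (simp add: sg_def)
      finally show ?thesis using \<eta>1(1) \<delta>1(1) \<delta>21(1) by (simp add: mult.commute)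
    qed
    \<comment> \<open>Here the factor \<open>A\<close> in the variation of \<alpha> meets the bound
      \<delta>2 / A for the L^1 norm of \<Phi>.\<close>
    have i\<Phi>: "integral {0..T} (\<lambda>t. \<bar>deriv \<alpha> t\<bar>) * integral {0..1} (\<lambda>y. M * \<bar>\<Phi> y\<bar>) \<le> e"
    proof -
      have I0: "0 \<le> integral {0..1} (\<lambda>y. \<bar>\<Phi> y\<bar>)"
        by (intro integral_nonneg integrable_continuous_real continuous_intros continuous_on_subset[OF cs(1)]) auto
      have "integral {0..T} (\<lambda>t. \<bar>deriv \<alpha> t\<bar>) * integral {0..1} (\<lambda>y. M * \<bar>\<Phi> y\<bar>) \<le> (A * B) * (M * integral {0..1} (\<lambda>y. \<bar>\<Phi> y\<bar>))"
        using i(3) M1 I0 by (simp add: mult_right_mono)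
      also have "\<dots> = (M * B) * (A * integral {0..1} (\<lambda>y. \<bar>\<Phi> y\<bar>))" by (simp add: mult_ac)
      also have "\<dots> \<le> (M * B) * \<delta>2" using A\<Phi> M1 B by (intro mult_left_mono) auto
      finally show ?thesis using \<delta>21(2) by (simp add: mult.commute)
    qed
    have n1R': "n1 T (R' k) \<le> n1 T (\<lambda>t x. if k = i then 0 else R k t x) + 4 * e" for k
    proof -
      have "n1 T (R' k) \<le> n1 T (\<lambda>t x. if k = i then 0 else R k t x) + integral {0..T} A0 +
         integral {0..T} (\<lambda>t. \<bar>deriv \<alpha> t\<bar>) * integral {0..1} (\<lambda>y. M * \<bar>\<Phi> y\<bar>)"
      proof (rule n1_le[where j=j])
        show "jcont (\<lambda>t x. if k = i then 0 else R k t x)"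
          using jcont_tfun[OF tR[of k]] jcont_tfun[OF tfun_const[of 0]] by (cases "k = i") simp_all
        show "per1 (\<lambda>y. M * \<bar>\<Phi> y\<bar>)" using p(1) by (simp add: per1_def)
        show "continuous_on UNIV (\<lambda>t. \<bar>deriv \<alpha> t\<bar>)" "continuous_on UNIV (\<lambda>y. M * \<bar>\<Phi> y\<bar>)"
          by (intro continuous_intros ct cs)+
      qed (use R'b in \<open>auto intro!: jcont_tfun tR' cA0\<close>)
      with iA0 i\<Phi> show ?thesis by linarith
    qed
    have prod: "n1 T (\<lambda>t x. \<rho>' t x * U' k t x - \<rho> t x * U k t x) \<le> Cs * n1 T (R i) + \<epsilon>" for k
    proof -
      \<comment> \<open>Has the same modulus as the leading part of \<theta> w. It is not small,
        since that part is the flux compensating R_i; \<open>n1_oscillation\<close> compares its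
        norm with that of R_i.\<close>
      define H where "H = (\<lambda>t x. (\<alpha> t * \<beta> t) * \<bar>deriv \<Phi> (x $ j) * \<Psi> (x $ j)\<bar> * Q t x)"
      have cP: "continuous_on UNIV (\<lambda>s. \<bar>deriv \<Phi> s * \<Psi> s\<bar>)"
        by (intro continuous_intros cs)
      have jH: "jcont H" unfolding H_def
        by (intro jcont_intros jcont_tfun tQ cP continuous_intros ct)
      have "\<bar>\<rho>' t x * U' k t x - \<rho> t x * U k t x\<bar> \<le> \<bar>H t x\<bar> + A0 t + 0 * 0" if "0 \<le> t" "t \<le> T" for t x
      proof -
        have pos: "0 \<le> X * \<alpha> t" "0 \<le> M * sg * \<beta> t" "0 \<le> \<delta> * M"
          "0 \<le> \<delta>2 * (M * (\<alpha> t * \<beta> t))"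
          using M1 X1 nn(1,2)[of t] sg \<delta> \<delta>2 by (auto intro!: mult_nonneg_nonneg)
        have "pD j Z t x = \<alpha> t * (deriv \<Phi> (x $ j) * Q t x + \<Phi> (x $ j) * pD j Q t x)"
          unfolding ZG pD_time_mult[OF st(1) tG] unfolding G_def pD_coord_mult[OF s(1) p(1) tQ] by simp
        then have \<theta>w: "\<theta> t x * w t x = - ((\<alpha> t * \<beta> t) * (deriv \<Phi> (x $ j) * \<Psi> (x $ j)) * Q t x)
            - (\<alpha> t * \<beta> t) * ((\<Phi> (x $ j) * \<Psi> (x $ j)) * pD j Q t x) + (h t * \<beta> t) * (\<Psi> (x $ j) * pD i Q t x)"
          unfolding \<theta>_def w_def by (simp add: algebra_simps)
        have "\<bar>(\<alpha> t * \<beta> t) * (deriv \<Phi> (x $ j) * \<Psi> (x $ j)) * Q t x\<bar> = \<bar>H t x\<bar>"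
          unfolding H_def by (simp add: abs_mult)
        then have \<theta>wb: "\<bar>\<theta> t x * w t x\<bar> \<le> \<bar>H t x\<bar> + \<delta>2 * (M * (\<alpha> t * \<beta> t)) + M * sg * \<beta> t"
          using abK[OF bd(3)[of "x $ j"] Mb(5)[OF that, of x], of t] hw[OF that, of x] unfolding \<theta>w by linarith
        have "\<rho>' t x * U' k t x - \<rho> t x * U k t x = \<theta> t x * U k t x + (if k = i then \<rho> t x * w t x + \<theta> t x * w t x else 0)"
          unfolding \<rho>'_def U'_def by (simp add: algebra_simps)
        then have "\<bar>\<rho>' t x * U' k t x - \<rho> t x * U k t x\<bar> \<le> \<bar>\<theta> t x * U k t x\<bar> + (\<bar>\<rho> t x * w t x\<bar> + \<bar>\<theta> t x * w t x\<bar>)"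
          by auto
        also have "\<dots> \<le> (M * X * \<alpha> t + \<delta> * M\<^sup>2) + (M * sg * \<beta> t + (\<bar>H t x\<bar> + \<delta>2 * (M * (\<alpha> t * \<beta> t)) + M * sg * \<beta> t))"
          by (intro add_mono \<theta>U \<rho>w \<theta>wb that)
        also have "\<dots> \<le> (M * X * \<alpha> t + \<delta> * M\<^sup>2) + (M * sg * \<beta> t + (\<bar>H t x\<bar> + \<delta>2 * (M * (\<alpha> t * \<beta> t)) + M * sg * \<beta> t))
            + 2 * (X * \<alpha> t) + 2 * (\<delta> * M) + 2 * (\<delta>2 * (M * (\<alpha> t * \<beta> t)))"
          using pos by linarith
        also have "\<dots> = \<bar>H t x\<bar> + A0 t" unfolding A0_def by (simp add: algebra_simps)
        finally show ?thesis by simp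
      qed
      then have "n1 T (\<lambda>t x. \<rho>' t x * U' k t x - \<rho> t x * U k t x) \<le> n1 T H + integral {0..T} A0
          + integral {0..T} (\<lambda>t. 0) * integral {0..1} (\<lambda>s::real. 0)"
        by (intro n1_le[where j=j and b="\<lambda>t. 0" and P="\<lambda>s. 0"])
           (auto intro!: jH cA0 jcont_tfun tfun_diff tfun.mult t\<rho> t\<rho>' tU tU' simp: per1_def)
      moreover have "n1 T H \<le> \<mu> * (n1 T Q + \<delta> * (T + M + \<delta> + T * M)) + Ct * (\<delta>2 * M)"
        unfolding H_def
      proof (rule n1_oscillation[OF T tQ, where h=h and K=K2])
        show "\<bar>Q t x\<bar> \<le> M \<and> \<bar>pT Q t x\<bar> \<le> M \<and> \<bar>pD j Q t x\<bar> \<le> M" if "0 \<le> t" "t \<le> T" for t x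
          using Mb[OF that] by blast
        show "per1 (\<lambda>s. \<bar>deriv \<Phi> s * \<Psi> s\<bar>)" using p per1_deriv[OF s(1) p(1)] by (simp add: per1_def)
        show "continuous_on UNIV (\<lambda>t. \<alpha> t * \<beta> t)" by (intro continuous_intros ct)
        show "0 \<le> \<alpha> t * \<beta> t" for t by (rule mult_nonneg_nonneg[OF nn])
        show "\<alpha> t * \<beta> t = 1 + deriv h t" for t by (rule ab)
        show "integral {0..T} (\<lambda>t. \<alpha> t * \<beta> t) \<le> Ct" by (rule i(1))
      qed (fact st h 0 \<delta> cP K2 p bd \<mu> | simp)+
      moreover have "\<mu> * (n1 T Q + \<delta> * (T + M + \<delta> + T * M)) \<le> Cs * n1 T Q + e"
      proof -
        have n0: "0 \<le> n1 T Q" unfolding n1_def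
          by (intro integral_nonneg n1_integrable jcont_tfun tQ cell_integrable continuous_intros tfun_continuous_space) auto
        have "\<mu> * (n1 T Q + \<delta> * (T + M + \<delta> + T * M)) \<le> Cs * (n1 T Q + \<delta> * (T + M + 1 + T * M))"
          using \<mu> \<delta> T M1 n0 by (intro mult_mono add_mono mult_left_mono) auto
        then show ?thesis using \<delta>1(2) by (simp add: algebra_simps)
      qed
      ultimately show ?thesis using iA0 \<delta>21(3) e unfolding Q_def e_def by (simp add: mult_ac)
    qed
    show "\<exists>\<rho>' U' R' a \<gamma> \<Psi> s. defect_eq m c \<rho>' U' R' \<and>
        ci_step T n \<epsilon> Cs i j \<rho> U R \<rho>' U' R' a \<gamma> \<Psi> s"
      unfolding ci_step_def
    proof (rule exI[of _ \<rho>'], rule exI[of _ U'], rule exI[of _ R'], rule exI[of _ a], rule exI[of _ \<beta>],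
        rule exI[of _ \<Psi>], rule exI[of _ sg], intro conjI allI impI)
      show "defect_eq m c \<rho>' U' R'" by fact
      show "continuous_on UNIV a" by fact
      show "0 \<le> a t" for t by (rule a0)
      show "\<bar>pDs v (\<lambda>t x. \<rho>' t x - \<rho> t x) t x\<bar> \<le> a t" if "length v \<le> n \<and> 0 \<le> t \<and> t \<le> T" for v t x
        using \<theta>b[of v t x] that by (simp add: \<rho>'_def)
      show "integral {0..T} (\<lambda>t. (2 ^ n * a t) ^ Suc n) \<le> \<epsilon>" by (rule aq)
      show "smooth1 \<beta>" "0 \<le> \<beta> t" "smooth1 \<Psi>" "per1 \<Psi>" "0 \<le> sg" for t by (fact st nn s p sg)+
      show "\<bar>\<Psi> y\<bar> \<le> sg" for y using bd(4) by (simp add: sg_def)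
      show "integral {0..1} (\<lambda>y. \<bar>deriv \<Psi> y\<bar> powr r) \<le> sg powr r" if "1 \<le> r \<and> r \<le> real (Suc n)" for r
        using \<Psi>q[of r] that unfolding sg_def q_def by blast
      have "integral {0..T} (\<lambda>t. \<beta> t * sg) = integral {0..T} \<beta> * sg" by (rule integral_mult_left)
      also have "\<dots> \<le> Ct / A * sg" using i(2) sg by (intro mult_right_mono)
      also have "\<dots> = \<delta>2 * Ct" using A by (simp add: sg_def)
      also have "\<dots> \<le> \<epsilon>" using \<delta>21(4) \<epsilon> by (simp add: e_def)
      finally show "integral {0..T} (\<lambda>t. \<beta> t * sg) \<le> \<epsilon>" .
      show "U' k t x = U k t x + (if k = i then \<beta> t * \<Psi> (x $ j) else 0)" for k t x
        by (simp add: U'_def w_def)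
      have "n1 T (\<lambda>t (x :: real^'d). 0) = 0" by (simp add: n1_def)
      then show "n1 T (R' i) \<le> \<epsilon>" using n1R'[of i] e by (simp add: e_def)
      show "n1 T (R' k) \<le> n1 T (R k) + \<epsilon>" for k
      proof -
        have "n1 T (\<lambda>t x. if k = i then 0 else R k t x) \<le> n1 T (R k)"
        proof (cases "k = i")
          case True
          have "0 \<le> n1 T (R k)" unfolding n1_def
            by (intro integral_nonneg n1_integrable jcont_tfun tR cell_integrable continuous_intros tfun_continuous_space) auto
          then show ?thesis using True by (simp add: n1_def)
        qed simp
        then show ?thesis using n1R'[of k] \<epsilon> by (simp add: e_def)
      qed
      show "n1 T (\<lambda>t x. \<rho>' t x * U' k t x - \<rho> t x * U k t x) \<le> Cs * n1 T (R i) + \<epsilon>" for k by (rule prod)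
    qed
  qed
qed

subsection \<open>Weak derivatives on the torus are unique\<close>

lemma tfun_C_k: "tfun f \<Longrightarrow> C_k k (f t)"
proof (induction k arbitrary: f)
  case 0
  then show ?case by (simp add: tfun_continuous_space)
next
  case (Suc k)
  have "(\<lambda>x. frechet_derivative (f t) (at x) b) = pD i f t" if "b = axis i 1" for b i
    using that by (simp add: pD_def partial_def)
  moreover have "C_k k (pD i f t)" for i by (rule Suc.IH[OF tfun_pD[OF Suc.prems]])
  ultimately have "C_k k (\<lambda>x. frechet_derivative (f t) (at x) b)" if "b \<in> Basis" for b
    using that by (auto simp: Basis_vec_def)
  moreover have "f t differentiable (at x)" for x
    using tfun_pD_has_deriv[OF Suc.prems] differentiableI by blast
  ultimately show ?case by simp
qed

lemma tfun_smooth: "tfun f \<Longrightarrow> smooth (f t)"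
  by (simp add: smooth_def tfun_C_k)

lemma tfun_prod: "(\<And>i. i \<in> I \<Longrightarrow> tfun (f i)) \<Longrightarrow> tfun (\<lambda>t x. \<Prod>i\<in>I. f i t x)"
  by (induction I rule: infinite_finite_induct) (auto intro: tfun.mult)

text \<open>A smooth approximation of the indicator of (a,b): flat (n r) tends to 1 for r > 0 and is
  0 otherwise.\<close>

definition bumpn :: "real \<Rightarrow> real \<Rightarrow> nat \<Rightarrow> real \<Rightarrow> real" where
  "bumpn a b n s = flat (real n * (s - a)) * flat (real n * (b - s))"

lemma bumpn: assumes "0 \<le> a" "b \<le> 1"
  shows "smooth1 (bumpn a b n)" "supp01 (bumpn a b n)" "0 \<le> bumpn a b n s" "bumpn a b n s \<le> 1"
    "s \<in> {0..1} \<Longrightarrow> per (bumpn a b n) s = bumpn a b n s"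
    "(\<lambda>n. bumpn a b n s) \<longlonglongrightarrow> indicator {a<..<b} s"
proof -
  have "smooth1 (\<lambda>s. flat (real n * s + (- real n * a)) * flat ((- real n) * s + real n * b))"
    by (intro smooth1_mult smooth1_affine smooth1_flat)
  then show "smooth1 (bumpn a b n)" by (simp add: bumpn_def[abs_def] algebra_simps)
  show s: "supp01 (bumpn a b n)"
    using assms by (auto simp: supp01_def bumpn_def flat_0 mult_nonneg_nonpos)
  show "0 \<le> bumpn a b n s" "bumpn a b n s \<le> 1"
    by (auto simp: bumpn_def flat_nonneg flat_le_1 mult_le_one)
  show "per (bumpn a b n) s = bumpn a b n s" if "s \<in> {0..1}"
  proof (cases "s = 1")
    case True
    then show ?thesis using s by (simp add: per_def supp01_def)
  next
    case False
    then have "frac s = s" using that by (simp add: frac_eq)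
    then show ?thesis by (simp add: per_def)
  qed
  show "(\<lambda>n. bumpn a b n s) \<longlonglongrightarrow> indicator {a<..<b} s"
  proof (cases "a < s \<and> s < b")
    case True
    have f: "(\<lambda>n. flat (real n * r)) \<longlonglongrightarrow> 1" if "0 < r" for r :: real
    proof -
      have "(\<lambda>n. exp (- (inverse r * (1 / real n)))) \<longlonglongrightarrow> exp (- (inverse r * 0))"
        by (intro tendsto_intros lim_1_over_n)
      moreover have "\<forall>\<^sub>F n in sequentially. exp (- (inverse r * (1 / real n))) = flat (real n * r)"
        using eventually_gt_at_top[of 0] by eventually_elim (use that in \<open>simp add: flat_def field_simps\<close>)
      ultimately show ?thesis by (simp add: tendsto_cong)
    qed
    have "(\<lambda>n. bumpn a b n s) \<longlonglongrightarrow> 1 * 1"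
      unfolding bumpn_def by (intro tendsto_mult f) (use True in auto)
    then show ?thesis using True by simp
  next
    case False
    then have "bumpn a b n s = 0" for n
      by (auto simp: bumpn_def flat_0 mult_nonneg_nonpos not_less)
    then show ?thesis using False by (auto simp: indicator_def)
  qed
qed

text \<open>The sets on which the integral vanishes form a Dynkin system, and open boxes are an
  intersection-stable generator of the Borel sets. The vanishing total integral serves the
  complements.\<close>

lemma zero_AE_of_boxes:
  fixes g :: "'a::euclidean_space \<Rightarrow> real"
  assumes g: "integrable lborel g" and z: "integral\<^sup>L lborel g = 0"
    and box: "\<And>a b. (LINT x:box a b|lborel. g x) = 0"
  shows "AE x in lborel. g x = 0"
proof -
  have si: "set_integrable lborel A g" if "A \<in> sets borel" for A
    using g that unfolding set_integrable_def by (intro integrable_mult_indicator) auto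
  have "(LINT x:A|lborel. g x) = 0" if "A \<in> sets borel" for A
  proof -
    let ?G = "range (\<lambda>(a, b). box a b :: 'a set)"
    have "Int_stable ?G"
    proof (rule Int_stableI)
      fix A B assume "A \<in> ?G" "B \<in> ?G"
      then obtain a b c d :: 'a where "A = box a b" "B = box c d" by auto
      then have "A \<inter> B = (\<lambda>(a, b). box a b) (\<Sum>i\<in>Basis. max (a \<bullet> i) (c \<bullet> i) *\<^sub>R i, \<Sum>i\<in>Basis. min (b \<bullet> i) (d \<bullet> i) *\<^sub>R i)"
        by (simp add: box_Int_box)
      then show "A \<inter> B \<in> ?G" by (rule range_eqI)
    qed
    moreover have "?G \<subseteq> Pow UNIV" by simp
    moreover have "A \<in> sigma_sets UNIV ?G" using that by (subst (asm) borel_eq_box) simp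
    ultimately show ?thesis
    proof (induction rule: sigma_sets_induct_disjoint[consumes 3])
      case (basic A) then show ?case using box by auto
    next
      case empty show ?case by (simp add: set_lebesgue_integral_def)
    next
      case (compl A)
      have A: "A \<in> sets borel" using compl.hyps by (subst borel_eq_box) simp
      have "(LINT x:UNIV|lborel. g x) = (LINT x:A|lborel. g x) + (LINT x:UNIV - A|lborel. g x)"
        by (subst set_integral_Un[symmetric]) (use A in \<open>auto intro!: si\<close>)
      moreover have "(LINT x:UNIV|lborel. g x) = 0" using z by (simp add: set_lebesgue_integral_def)
      ultimately show ?case using compl.IH by simp
    next
      case (union A)
      have A: "A i \<in> sets borel" for i using union.hyps by (subst borel_eq_box) auto
      have "(LINT x:(\<Union>i. A i)|lborel. g x) = (\<Sum>i. (LINT x:(A i)|lborel. g x))"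
        by (rule lebesgue_integral_countable_add)
           (use A union.hyps in \<open>auto intro!: si sets.countable_UN simp: disjoint_family_on_def\<close>)
      then show ?case using union.IH by simp
    qed
  qed
  then have "AE x in lborel. g x = (\<lambda>x. 0) x"
    by (intro density_unique_real g) (auto simp: set_lebesgue_integral_def)
  then show ?thesis by simp
qed

text \<open>The lemma of du Bois-Reymond on the torus: products of periodised one-dimensional bumps
  are admissible test functions and converge boundedly to the indicators of boxes inside the
  cell.\<close>

lemma fundamental_lemma:
  fixes h :: "real ^ 'd::finite \<Rightarrow> real"
  assumes h: "set_integrable lebesgue cell h"
    and 0: "\<And>\<phi>. smooth \<phi> \<Longrightarrow> periodic \<phi> \<Longrightarrow> (LINT x:cell|lebesgue. \<phi> x * h x) = 0"
  shows "AE x in lebesgue. x \<in> cell \<longrightarrow> h x = 0"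
proof -
  define k where "k = (\<lambda>x. indicator cell x * h x)"
  have k: "integrable lebesgue k" using h unfolding set_integrable_def k_def by simp
  \<comment> \<open>The argument with boxes takes place in \<open>lborel\<close>, hence a Borel
    representative.\<close>
  then obtain g where g: "g \<in> borel_measurable lborel" "AE x in lborel. k x = g x"
    using completion_ex_borel_measurable_real[of k lborel] by blast
  have gk: "AE x in lebesgue. k x = g x" using g(2) by (rule AE_completion)
  have gl: "g \<in> borel_measurable lebesgue" using g(1) by (rule measurable_completion)
  have "integrable lebesgue g"
    using k integrable_cong_AE[OF borel_measurable_integrable[OF k] gl gk] by simp
  then have gi: "integrable lborel g" using integrable_completion[OF g(1)] by simp
  have tr: "(LINT x|lborel. \<phi> x * g x) = (LINT x:cell|lebesgue. \<phi> x * h x)" if "\<phi> \<in> borel_measurable borel" for \<phi>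
  proof -
    have "(LINT x|lborel. \<phi> x * g x) = (LINT x|lebesgue. \<phi> x * g x)"
      using that g(1) by (intro integral_completion[symmetric]) measurable
    also have "\<dots> = (LINT x|lebesgue. \<phi> x * k x)"
    proof (rule integral_cong_AE)
      have pl: "\<phi> \<in> borel_measurable lebesgue" using that by (intro measurable_completion) simp
      show "(\<lambda>x. \<phi> x * g x) \<in> borel_measurable lebesgue" "(\<lambda>x. \<phi> x * k x) \<in> borel_measurable lebesgue"
        using pl gl borel_measurable_integrable[OF k] by measurable
      show "AE x in lebesgue. \<phi> x * g x = \<phi> x * k x" using gk by auto
    qed
    also have "\<dots> = (LINT x:cell|lebesgue. \<phi> x * h x)"
      by (simp add: set_lebesgue_integral_def k_def mult_ac)
    finally show ?thesis .
  qed
  have cb: "AE x in lborel. x \<notin> cell - box (0 :: real^'d) 1"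
  proof -
    have "cell - box (0 :: real^'d) 1 \<in> null_sets lebesgue"
      using negligible_frontier_interval[of "0 :: real^'d" 1] by (simp add: negligible_iff_null_sets)
    from AE_not_in[OF this] show ?thesis by (simp only: AE_completion_iff)
  qed
  have g0: "AE x in lborel. x \<notin> box 0 1 \<longrightarrow> g x = 0"
    using g(2) cb by eventually_elim (auto simp: k_def indicator_def)
  have "AE x in lborel. g x = 0"
  proof (rule zero_AE_of_boxes[OF gi])
    have "smooth (\<lambda>x :: real^'d. 1 :: real)" using tfun_smooth[OF tfun_const[of 1]] .
    moreover have "periodic (\<lambda>x :: real^'d. 1 :: real)" by (simp add: periodic_def)
    ultimately have "(LINT x|lborel. 1 * g x) = 0" unfolding tr[OF borel_measurable_const] by (rule 0)
    then show "integral\<^sup>L lborel g = 0" by simp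
    fix a b :: "real ^ 'd"
    \<comment> \<open>The box is clipped to the cell so that the bumps in each coordinate vanish off
      the unit interval and can be periodised. Nothing is lost, as \<open>g\<close> vanishes almost
      everywhere outside the open cell.\<close>
    define \<alpha> where "\<alpha> i = max 0 (a $ i)" for i
    define \<beta> where "\<beta> i = min 1 (b $ i)" for i
    have ab: "0 \<le> \<alpha> i" "\<beta> i \<le> 1" for i by (auto simp: \<alpha>_def \<beta>_def)
    define \<phi> where "\<phi> n x = (\<Prod>i\<in>UNIV. per (bumpn (\<alpha> i) (\<beta> i) n) (x $ i))" for n and x :: "real ^ 'd"
    have t\<phi>: "tfun (\<lambda>t. \<phi> n)" for n
      unfolding \<phi>_def by (intro tfun_prod tfun.space smooth1_per bumpn ab per1_per)
    have m\<phi>: "\<phi> n \<in> borel_measurable borel" for n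
      by (rule borel_measurable_continuous_onI[OF tfun_continuous_space[OF t\<phi>]])
    have int0: "(LINT x|lborel. \<phi> n x * g x) = 0" for n
      unfolding tr[OF m\<phi>] by (rule 0) (use tfun_smooth[OF t\<phi>] tfun_periodic[OF t\<phi>] in blast)+
    have \<phi>b: "\<bar>\<phi> n x\<bar> \<le> 1" for n x
      unfolding \<phi>_def abs_prod
      by (intro prod_le_1) (auto simp: per_def bumpn[OF ab])
    have lim: "(\<lambda>n. \<phi> n x * g x) \<longlonglongrightarrow> indicator (box a b) x * g x" if x: "x \<notin> box 0 1 \<longrightarrow> g x = 0" for x
    proof (cases "x \<in> box 0 1")
      case True
      then have xi: "0 < x $ i" "x $ i < 1" for i by (auto simp: mem_box_cart)
      have "(\<lambda>n. \<phi> n x) \<longlonglongrightarrow> (\<Prod>i\<in>UNIV. indicator {\<alpha> i<..<\<beta> i} (x $ i))"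
        unfolding \<phi>_def
      proof (intro tendsto_prod)
        fix i
        have "x $ i \<in> {0..1}" using xi[of i] by simp
        then show "(\<lambda>n. per (bumpn (\<alpha> i) (\<beta> i) n) (x $ i)) \<longlonglongrightarrow> indicator {\<alpha> i<..<\<beta> i} (x $ i)"
          using bumpn(5)[OF ab] bumpn(6)[OF ab] by simp
      qed
      also have "(\<Prod>i\<in>UNIV. indicator {\<alpha> i<..<\<beta> i} (x $ i)) = (indicator (box a b) x :: real)"
      proof (cases "x \<in> box a b")
        case True
        then show ?thesis using xi by (auto simp: mem_box_cart \<alpha>_def \<beta>_def indicator_def)
      next
        case False
        then obtain i where "\<not> (a $ i < x $ i \<and> x $ i < b $ i)" by (auto simp: mem_box_cart)
        then have "indicator {\<alpha> i<..<\<beta> i} (x $ i) = (0 :: real)" by (auto simp: \<alpha>_def \<beta>_def indicator_def)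
        then have "(\<Prod>i\<in>UNIV. indicator {\<alpha> i<..<\<beta> i} (x $ i)) = (0 :: real)" by (intro prod_zero) auto
        then show ?thesis using False by simp
      qed
      finally show ?thesis by (rule tendsto_mult_right)
    next
      case False
      then show ?thesis using x by simp
    qed
    have "(\<lambda>n. LINT x|lborel. \<phi> n x * g x) \<longlonglongrightarrow> (LINT x|lborel. indicator (box a b) x * g x)"
    proof (rule integral_dominated_convergence[where w="\<lambda>x. \<bar>g x\<bar>"])
      show "AE x in lborel. (\<lambda>n. \<phi> n x * g x) \<longlonglongrightarrow> indicator (box a b) x * g x"
        using g0 by eventually_elim (rule lim)
      show "AE x in lborel. norm (\<phi> n x * g x) \<le> \<bar>g x\<bar>" for n
        using \<phi>b by (auto simp: abs_mult intro!: mult_left_le_one_le)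
      show "(\<lambda>x. \<phi> n x * g x) \<in> borel_measurable lborel" for n
        using m\<phi> g(1) by measurable
      show "(\<lambda>x. indicator (box a b) x * g x) \<in> borel_measurable lborel" using g(1) by measurable
    qed (use gi in simp)
    then show "(LINT x:box a b|lborel. g x) = 0"
      unfolding int0 set_lebesgue_integral_def by (simp add: LIMSEQ_const_iff)
  qed
  then have "AE x in lborel. k x = 0" using g(2) by eventually_elim simp
  then have "AE x in lebesgue. k x = 0" by (rule AE_completion)
  then show ?thesis by eventually_elim (auto simp: k_def)
qed

lemma Lp_torus_1_integrable:
  assumes "f \<in> Lp_torus 1" shows "set_integrable lebesgue cell f"
proof -
  have f: "f \<in> borel_measurable lebesgue" "set_integrable lebesgue cell (\<lambda>x. norm (f x) powr 1)"
    using assms by (auto simp: Lp_torus_def)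
  have "(\<lambda>x. indicator cell x *\<^sub>R f x) \<in> borel_measurable lebesgue"
    by (intro borel_measurable_scaleR borel_measurable_indicator f) simp
  moreover have "integrable lebesgue (\<lambda>x. norm (indicator cell x *\<^sub>R f x))"
    using f(2) by (simp add: set_integrable_def)
  ultimately show ?thesis unfolding set_integrable_def by (rule integrable_norm_cancel[rotated])
qed

text \<open>Componentwise reduction to the fundamental lemma: the difference of two weak derivatives
  integrates to 0 against every test function.\<close>

lemma is_weak_partial_unique:
  fixes f g g' :: "real ^ 'd::finite \<Rightarrow> 'b::euclidean_space"
  assumes "is_weak_partial i f g" "is_weak_partial i f g'"
  shows "AE x in lebesgue. x \<in> cell \<longrightarrow> g x = g' x"
proof -
  have gi: "set_integrable lebesgue cell g" "set_integrable lebesgue cell g'"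
    using assms by (auto simp: is_weak_partial_def intro: Lp_torus_1_integrable)
  have "AE x in lebesgue. x \<in> cell \<longrightarrow> (g x - g' x) \<bullet> b = 0" for b
  proof (rule fundamental_lemma)
    have d: "set_integrable lebesgue cell (\<lambda>x. g x - g' x)" by (rule set_integral_diff(1)[OF gi])
    then have "integrable lebesgue (\<lambda>x. (indicator cell x *\<^sub>R (g x - g' x)) \<bullet> b)"
      unfolding set_integrable_def by (rule integrable_inner_left)
    then show "set_integrable lebesgue cell (\<lambda>x. (g x - g' x) \<bullet> b)" by (simp add: set_integrable_def)
    fix \<phi> :: "real ^ 'd \<Rightarrow> real" assume \<phi>: "smooth \<phi>" "periodic \<phi>"
    have "C_k 0 \<phi>" using \<phi>(1) unfolding smooth_def by blast
    then have c: "continuous_on UNIV \<phi>" by simp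
    then have m: "\<phi> \<in> borel_measurable lebesgue"
      by (intro measurable_completion) (simp add: borel_measurable_continuous_onI)
    have "bounded (\<phi> ` cell)"
      by (intro compact_imp_bounded compact_continuous_image continuous_on_subset[OF c]) auto
    then obtain B where B: "\<And>x. x \<in> cell \<Longrightarrow> \<bar>\<phi> x\<bar> \<le> B" unfolding bounded_iff by (metis imageI real_norm_def)
    have pi: "set_integrable lebesgue cell (\<lambda>x. \<phi> x *\<^sub>R k x)" if "set_integrable lebesgue cell k" for k :: "_ \<Rightarrow> 'b"
      unfolding set_integrable_def
    proof (rule Bochner_Integration.integrable_bound)
      show "integrable lebesgue (\<lambda>x. B *\<^sub>R (indicator cell x *\<^sub>R k x))"
        using that unfolding set_integrable_def by (rule integrable_scaleR_right)
      have "(\<lambda>x. \<phi> x *\<^sub>R (indicator cell x *\<^sub>R k x)) \<in> borel_measurable lebesgue"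
        by (intro borel_measurable_scaleR[OF m] borel_measurable_integrable that[unfolded set_integrable_def])
      then show "(\<lambda>x. indicator cell x *\<^sub>R \<phi> x *\<^sub>R k x) \<in> borel_measurable lebesgue"
        by (simp add: mult.commute)
      have "norm (indicator cell x *\<^sub>R \<phi> x *\<^sub>R k x) \<le> norm (B *\<^sub>R indicator cell x *\<^sub>R k x)" for x
        using B[of x] by (cases "x \<in> cell") (auto intro!: mult_right_mono)
      then show "AE x in lebesgue. norm (indicator cell x *\<^sub>R \<phi> x *\<^sub>R k x) \<le> norm (B *\<^sub>R indicator cell x *\<^sub>R k x)"
        by simp
    qed
    have "(LINT x:cell|lebesgue. \<phi> x *\<^sub>R g x) = (LINT x:cell|lebesgue. \<phi> x *\<^sub>R g' x)"
    proof -
      have e1: "(LINT x:cell|lebesgue. partial i \<phi> x *\<^sub>R f x) = - (LINT x:cell|lebesgue. \<phi> x *\<^sub>R g x)"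
        using assms(1) \<phi> unfolding is_weak_partial_def by blast
      have e2: "(LINT x:cell|lebesgue. partial i \<phi> x *\<^sub>R f x) = - (LINT x:cell|lebesgue. \<phi> x *\<^sub>R g' x)"
        using assms(2) \<phi> unfolding is_weak_partial_def by blast
      from trans[OF e1[symmetric] e2] show ?thesis by (simp only: neg_equal_iff_equal)
    qed
    then have z: "(LINT x:cell|lebesgue. \<phi> x *\<^sub>R (g x - g' x)) = 0"
      using set_integral_diff(2)[OF pi[OF gi(1)] pi[OF gi(2)]] by (simp only: scaleR_diff_right diff_self)
    have "(LINT x:cell|lebesgue. \<phi> x * ((g x - g' x) \<bullet> b)) =
        (LINT x|lebesgue. (indicator cell x *\<^sub>R \<phi> x *\<^sub>R (g x - g' x)) \<bullet> b)"
      by (simp add: set_lebesgue_integral_def mult.assoc)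
    also have "\<dots> = (LINT x:cell|lebesgue. \<phi> x *\<^sub>R (g x - g' x)) \<bullet> b"
      unfolding set_lebesgue_integral_def
      by (rule integral_inner_left) (use pi[OF d] in \<open>simp add: set_integrable_def\<close>)
    finally show "(LINT x:cell|lebesgue. \<phi> x * ((g x - g' x) \<bullet> b)) = 0" using z by simp
  qed
  then have "AE x in lebesgue. \<forall>b\<in>Basis. x \<in> cell \<longrightarrow> (g x - g' x) \<bullet> b = 0"
    by (intro AE_finite_allI) auto
  then show ?thesis
  proof eventually_elim
    case (elim x)
    then show ?case by (auto intro!: euclidean_eqI[where 'a='b] simp: inner_diff_left)
  qed
qed

text \<open>Replaces the arbitrary choice inside \<open>weak_partial\<close> by an explicit weak
  derivative, for which norm and measurability can be computed.\<close>

lemma Lp_norm_weak_partial: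
  assumes "is_weak_partial i f g"
  shows "Lp_norm p (weak_partial i f) = Lp_norm p g"
proof -
  have w: "is_weak_partial i f (weak_partial i f)"
    unfolding weak_partial_def by (rule someI[of "is_weak_partial i f", OF assms])
  have m: "g \<in> borel_measurable lebesgue" "weak_partial i f \<in> borel_measurable lebesgue"
    using w assms by (auto simp: is_weak_partial_def Lp_torus_def)
  have "(LINT x:cell|lebesgue. norm (weak_partial i f x) powr p) = (LINT x:cell|lebesgue. norm (g x) powr p)"
    unfolding set_lebesgue_integral_def
  proof (rule integral_cong_AE)
    show "AE x in lebesgue. indicator cell x *\<^sub>R norm (weak_partial i f x) powr p = indicator cell x *\<^sub>R norm (g x) powr p"
      using is_weak_partial_unique[OF w assms] by eventually_elim (auto simp: indicator_def)
    have p: "(\<lambda>x. norm (f x) powr p) \<in> borel_measurable lebesgue" if "f \<in> borel_measurable lebesgue"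
      for f :: "real ^ 'a \<Rightarrow> 'b"
      using powr_real_measurable[OF measurable_compose[OF that borel_measurable_norm] borel_measurable_const] .
    show "(\<lambda>x. indicator cell x *\<^sub>R norm (weak_partial i f x) powr p) \<in> borel_measurable lebesgue"
      "(\<lambda>x. indicator cell x *\<^sub>R norm (g x) powr p) \<in> borel_measurable lebesgue"
      by (intro borel_measurable_scaleR borel_measurable_indicator p m; simp)+
  qed
  then show ?thesis by (simp add: Lp_norm_def)
qed

subsection \<open>Superpositions of shear flows\<close>

text \<open>Monotone convergence for series, carried out in \<open>ennreal\<close> so that
  convergence almost everywhere comes out of the summable integrals.\<close>

lemma AE_summable_of_integrals:
  fixes f :: "nat \<Rightarrow> 'a \<Rightarrow> real"
  assumes f: "\<And>n. integrable M (f n)" "\<And>n x. 0 \<le> f n x" and s: "summable (\<lambda>n. integral\<^sup>L M (f n))"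
  shows "AE x in M. summable (\<lambda>n. f n x)"
    and "integrable M (\<lambda>x. \<Sum>n. f n x)" and "integral\<^sup>L M (\<lambda>x. \<Sum>n. f n x) = (\<Sum>n. integral\<^sup>L M (f n))"
proof -
  have m: "\<And>n. f n \<in> borel_measurable M" using f(1) by auto
  have "(\<integral>\<^sup>+ x. (\<Sum>n. ennreal (f n x)) \<partial>M) = (\<Sum>n. \<integral>\<^sup>+ x. ennreal (f n x) \<partial>M)"
    by (rule nn_integral_suminf) (use m in measurable)
  also have "\<dots> = (\<Sum>n. ennreal (integral\<^sup>L M (f n)))"
    by (intro suminf_cong nn_integral_eq_integral f) (simp add: f)
  also have "\<dots> = ennreal (\<Sum>n. integral\<^sup>L M (f n))"
    by (rule suminf_ennreal2) (use f s in \<open>auto intro: integral_nonneg_AE\<close>)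
  finally have "(\<integral>\<^sup>+ x. (\<Sum>n. ennreal (f n x)) \<partial>M) \<noteq> \<infinity>" by simp
  from nn_integral_PInf_AE[OF _ this]
  have "AE x in M. (\<Sum>n. ennreal (f n x)) \<noteq> \<infinity>" using m by measurable
  then show AE: "AE x in M. summable (\<lambda>n. f n x)"
    by eventually_elim (rule summable_suminf_not_top, use f in auto)
  have AE': "AE x in M. summable (\<lambda>n. norm (f n x))" using AE f(2) by simp
  have s': "summable (\<lambda>n. \<integral>x. norm (f n x) \<partial>M)" using s f(2) by simp
  show "integrable M (\<lambda>x. \<Sum>n. f n x)" by (rule integrable_suminf[OF f(1) AE' s'])
  show "integral\<^sup>L M (\<lambda>x. \<Sum>n. f n x) = (\<Sum>n. integral\<^sup>L M (f n))"
    by (rule integral_suminf[OF f(1) AE' s'])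
qed

lemma set_integral_cell: "(LINT x:cell|lebesgue. f x) = integral\<^sup>L (lebesgue_on cell) f"
  for f :: "real ^ 'd::finite \<Rightarrow> 'b::euclidean_space"
  by (simp add: set_lebesgue_integral_def integral_restrict_space)

lemma set_integrable_cell: "set_integrable lebesgue cell f \<longleftrightarrow> integrable (lebesgue_on cell) f"
  for f :: "real ^ 'd::finite \<Rightarrow> 'b::euclidean_space"
  by (simp add: set_integrable_def integrable_restrict_space)

lemma cell_finite: "finite_measure (lebesgue_on (cell :: (real ^ 'd::finite) set))"
  by (rule finite_measure_lebesgue_on) simp

lemma cell_measure: "measure (lebesgue_on (cell :: (real ^ 'd::finite) set)) cell = 1"
  using content_cell by (simp add: measure_restrict_space)

lemma cell_integrable_const [simp]: "integrable (lebesgue_on (cell :: (real ^ 'd::finite) set)) (\<lambda>x. c :: real)"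
  by (rule finite_measure.integrable_const[OF cell_finite])

lemma cell_integral_const [simp]: "integral\<^sup>L (lebesgue_on (cell :: (real ^ 'd::finite) set)) (\<lambda>x. c :: real) = c"
proof -
  have "space (lebesgue_on (cell :: (real ^ 'd) set)) = cell" by simp
  then show ?thesis using cell_measure[where 'd='d] by simp
qed

lemma cell_cont_integrable:
  "continuous_on UNIV f \<Longrightarrow> integrable (lebesgue_on cell) f"
  for f :: "real ^ 'd::finite \<Rightarrow> 'b::euclidean_space"
  by (rule continuous_imp_integrable) (rule continuous_on_subset, auto)

lemma cell_cont_integral:
  "continuous_on UNIV f \<Longrightarrow> integral\<^sup>L (lebesgue_on cell) f = integral cell f"
  for f :: "real ^ 'd::finite \<Rightarrow> 'b::euclidean_space"
  by (rule lebesgue_integral_eq_integral[OF cell_cont_integrable]) auto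

lemma borel_imp_lebesgue_on: "f \<in> borel_measurable borel \<Longrightarrow> f \<in> borel_measurable (lebesgue_on cell)"
  for f :: "real ^ 'd::finite \<Rightarrow> 'b::euclidean_space"
  by (intro measurable_restrict_space1 measurable_completion) simp

lemma partial_dir_deriv:
  fixes f :: "real ^ 'd::finite \<Rightarrow> real"
  assumes "f differentiable (at x)"
  shows "((\<lambda>s. f (x + s *\<^sub>R axis j 1)) has_real_derivative partial j f x) (at 0)"
proof -
  have l: "((\<lambda>s. x + s *\<^sub>R axis j 1) has_derivative (\<lambda>s. s *\<^sub>R axis j 1)) (at (0 :: real))"
    using has_derivative_add[OF has_derivative_const has_derivative_scaleR_left[OF has_derivative_ident]] by simp
  have d: "(f has_derivative frechet_derivative f (at x)) (at (x + 0 *\<^sub>R axis j 1))"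
    using assms by (simp add: frechet_derivative_works)
  have "((\<lambda>s. f (x + s *\<^sub>R axis j 1)) has_derivative (\<lambda>s. frechet_derivative f (at x) (s *\<^sub>R axis j 1))) (at 0)"
    by (rule has_derivative_compose[OF l d])
  moreover have "frechet_derivative f (at x) (s *\<^sub>R axis j 1) = partial j f x * s" for s
    using linear_scale[OF linear_frechet_derivative[OF assms]] by (simp add: partial_def)
  ultimately show ?thesis by (simp add: has_field_derivative_def)
qed

lemma smooth_partial:
  fixes \<phi> :: "real ^ 'd::finite \<Rightarrow> real"
  assumes "smooth \<phi>"
  shows "\<phi> differentiable (at x)" "continuous_on UNIV \<phi>" "continuous_on UNIV (partial j \<phi>)"
proof -
  have "C_k 0 \<phi>" "C_k (Suc 0) \<phi>" using assms unfolding smooth_def by blast+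
  moreover have "axis j 1 \<in> (Basis :: (real^'d) set)" by (simp add: axis_in_Basis_iff)
  ultimately show "\<phi> differentiable (at x)" "continuous_on UNIV \<phi>" "continuous_on UNIV (partial j \<phi>)"
    by (auto simp: partial_def)
qed

lemma cont_bounded_cell:
  fixes \<phi> :: "real ^ 'd::finite \<Rightarrow> real"
  assumes "continuous_on UNIV \<phi>"
  obtains B where "0 \<le> B" "\<And>x. x \<in> cell \<Longrightarrow> \<bar>\<phi> x\<bar> \<le> B"
proof -
  have "bounded (\<phi> ` cell)"
    by (intro compact_imp_bounded compact_continuous_image continuous_on_subset[OF assms]) auto
  then obtain B where "\<And>x. x \<in> cell \<Longrightarrow> \<bar>\<phi> x\<bar> \<le> B" unfolding bounded_iff by (metis imageI real_norm_def)
  then show ?thesis using that[of "max 0 B"] by (meson max.coboundedI2 max.cobounded1)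
qed

text \<open>With S the sum of the series, each power is at most S^(p-1) times the term
  itself.\<close>

lemma sum_powr_le:
  fixes z :: "nat \<Rightarrow> real"
  assumes z: "\<And>n. 0 \<le> z n" "summable z" and p: "1 \<le> p"
  shows "summable (\<lambda>n. z n powr p)" "(\<Sum>n. z n powr p) \<le> (\<Sum>n. z n) powr p"
proof -
  define S where "S = (\<Sum>n. z n)"
  have zS: "z n \<le> S" for n unfolding S_def using sum_le_suminf[OF z(2), of "{n}"] z(1) by auto
  have S0: "0 \<le> S" unfolding S_def by (intro suminf_nonneg z)
  have le: "z n powr p \<le> S powr (p - 1) * z n" for n
  proof (cases "z n = 0")
    case False
    then have "z n powr p = z n powr (p - 1) * z n powr 1" using powr_add[of "z n" "p - 1" 1] by simp
    also have "\<dots> \<le> S powr (p - 1) * z n powr 1"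
      by (intro mult_right_mono powr_mono2) (use z zS p in auto)
    finally show ?thesis using z(1)[of n] by simp
  qed simp
  have s2: "summable (\<lambda>n. S powr (p - 1) * z n)" by (intro summable_mult z)
  show s1: "summable (\<lambda>n. z n powr p)"
    by (rule summable_comparison_test'[OF s2, of 0]) (use le in auto)
  have "(\<Sum>n. z n powr p) \<le> (\<Sum>n. S powr (p - 1) * z n)" by (rule suminf_le[OF le s1 s2])
  also have "\<dots> = S powr (p - 1) * S" unfolding S_def by (rule suminf_mult[OF z(2)])
  also have "\<dots> = S powr p" using S0 powr_add[of S "p - 1" 1] by (cases "S = 0") auto
  finally show "(\<Sum>n. z n powr p) \<le> (\<Sum>n. z n) powr p" by (simp add: S_def)
qed

text \<open>The weights 2^n stand in for the triangle inequality in L^p for infinite sums: each term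
  is at most 2^(-n) times the p-th root of the weighted power sum, and that sum can be integrated
  term by term.\<close>

lemma sum_le_of_powr_sum:
  fixes w :: "nat \<Rightarrow> real"
  assumes w: "\<And>n. 0 \<le> w n" and s: "summable (\<lambda>n. (2 ^ n * w n) powr p)" and p: "1 \<le> p"
  shows "summable w" "(\<Sum>n. w n) \<le> 2 * (\<Sum>n. (2 ^ n * w n) powr p) powr (1 / p)"
proof -
  define Y where "Y = (\<Sum>n. (2 ^ n * w n) powr p)"
  have le: "w n \<le> Y powr (1/p) * (1/2) ^ n" for n
  proof -
    have "(2 ^ n * w n) powr p \<le> Y"
      unfolding Y_def using sum_le_suminf[OF s, of "{n}"] by auto
    then have "((2 ^ n * w n) powr p) powr (1/p) \<le> Y powr (1/p)"
      using p by (intro powr_mono2) auto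
    also have "((2 ^ n * w n) powr p) powr (1/p) = 2 ^ n * w n"
      using p w[of n] by (simp add: powr_powr)
    finally show ?thesis by (simp add: field_simps power_one_over)
  qed
  have g: "summable (\<lambda>n. Y powr (1/p) * (1/2) ^ n)" by (intro summable_mult summable_geometric) simp
  show s1: "summable w" by (rule summable_comparison_test'[OF g, of 0]) (use le w in auto)
  have "(\<Sum>n. w n) \<le> (\<Sum>n. Y powr (1/p) * (1/2) ^ n)" by (rule suminf_le[OF le s1 g])
  also have "\<dots> = Y powr (1/p) * (\<Sum>n. (1/2) ^ n)" by (rule suminf_mult) (simp add: summable_geometric)
  also have "(\<Sum>n. (1/2 :: real) ^ n) = 2" by (subst suminf_geometric) auto
  finally show "(\<Sum>n. w n) \<le> 2 * (\<Sum>n. (2 ^ n * w n) powr p) powr (1 / p)" by (simp add: Y_def)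
qed

lemma borel_measurable_vec:
  fixes f :: "'a \<Rightarrow> real ^ 'd::finite"
  assumes "\<And>k. (\<lambda>x. f x $ k) \<in> borel_measurable M" shows "f \<in> borel_measurable M"
proof (subst borel_measurable_euclidean_space, intro ballI)
  fix b :: "real^'d" assume "b \<in> Basis"
  then obtain k where "b = axis k 1" by (auto simp: Basis_vec_def)
  then show "(\<lambda>x. f x \<bullet> b) \<in> borel_measurable M" using assms[of k] by (simp add: inner_axis)
qed

lemma suminf_abs_le:
  fixes f g :: "nat \<Rightarrow> real"
  assumes "summable g" "\<And>n. \<bar>f n\<bar> \<le> g n"
  shows "summable f" "\<bar>\<Sum>n. f n\<bar> \<le> (\<Sum>n. g n)"
proof -
  have a: "summable (\<lambda>n. \<bar>f n\<bar>)" by (rule summable_comparison_test'[OF assms(1), of 0]) (use assms in auto)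
  show "summable f" by (rule summable_rabs_cancel[OF a])
  show "\<bar>\<Sum>n. f n\<bar> \<le> (\<Sum>n. g n)" using summable_rabs[OF a] suminf_le[OF assms(2) a assms(1)] by linarith
qed

text \<open>Each term acts on the single coordinate \<open>i n\<close>, so the l^1 norm of the
  vector is bounded by the sum of the \<open>w n\<close> with no dimensional factor.\<close>

lemma norm_vec_suminf_le:
  fixes a w :: "nat \<Rightarrow> real"
  assumes w: "summable w" "\<And>n. \<bar>a n\<bar> \<le> w n"
  shows "norm ((\<chi> k. \<Sum>n. if k = i n then a n else 0) :: real ^ 'd::finite) \<le> (\<Sum>n. w n)"
proof -
  have w0: "0 \<le> w n" for n using w(2)[of n] by linarith
  have s: "summable (\<lambda>n. if k = i n then w n else 0)" for k
    by (rule summable_comparison_test'[OF w(1), of 0]) (use w0 in auto)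
  have "norm ((\<chi> k. \<Sum>n. if k = i n then a n else 0) :: real ^ 'd) \<le> (\<Sum>k\<in>UNIV. \<bar>\<Sum>n. if k = i n then a n else 0\<bar>)"
    using norm_le_l1_cart[of "(\<chi> k. \<Sum>n. if k = i n then a n else 0) :: real ^ 'd"] by simp
  also have "\<dots> \<le> (\<Sum>k\<in>UNIV. \<Sum>n. if k = i n then w n else 0)"
    by (intro sum_mono suminf_abs_le(2)[OF s]) (use w in auto)
  also have "\<dots> = (\<Sum>n. \<Sum>k\<in>UNIV. if k = i n then w n else 0)"
    by (rule suminf_sum[symmetric]) (rule s)
  finally show ?thesis by simp
qed

text \<open>One time slice of the velocity, \<open>c n\<close> being the amplitudes at that time.
  \<open>s n\<close> controls both the supremum of the profile and the L^p norm of its derivative;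
  the weight 2^n pays for summing the derivatives pointwise.\<close>

lemma shear_superposition_W1p:
  fixes c s :: "nat \<Rightarrow> real" and \<Psi> :: "nat \<Rightarrow> real \<Rightarrow> real" and i j :: "nat \<Rightarrow> 'd::finite"
  assumes p: "1 \<le> p" and \<Psi>: "\<And>n. smooth1 (\<Psi> n)" "\<And>n. per1 (\<Psi> n)" "\<And>n y. \<bar>\<Psi> n y\<bar> \<le> s n"
    and \<Psi>': "\<And>n. integral {0..1} (\<lambda>y. \<bar>deriv (\<Psi> n) y\<bar> powr p) \<le> s n powr p"
    and sum: "summable (\<lambda>n. 2 ^ n * (\<bar>c n\<bar> * s n))"
  defines "u \<equiv> \<lambda>x :: real ^ 'd. (\<chi> k. \<Sum>n. if k = i n then c n * \<Psi> n (x $ j n) else 0)"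
  shows "u \<in> W1p p"
    "W1p_norm p u \<le> (1 + real CARD('d) * 2 powr p) powr (1 / p) * (\<Sum>n. 2 ^ n * (\<bar>c n\<bar> * s n))"
    "\<And>l. is_weak_partial l u
      (\<lambda>x. \<chi> k. \<Sum>n. if k = i n then (if l = j n then c n * deriv (\<Psi> n) (x $ j n) else 0) else 0)"
proof -
  let ?M = "lebesgue_on (cell :: (real ^ 'd) set)"
  define z where "z n = 2 ^ n * (\<bar>c n\<bar> * s n)" for n
  define S where "S = (\<Sum>n. z n)"
  have s0: "0 \<le> s n" for n using \<Psi>(3)[of n 0] by linarith
  have z0: "0 \<le> z n" for n using s0 by (simp add: z_def)
  have sz: "summable z" using sum by (simp add: z_def[abs_def])
  have S0: "0 \<le> S" unfolding S_def by (intro suminf_nonneg sz z0)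
  note zp = sum_powr_le[OF z0 sz p]
  have le1: "1 * (\<bar>c n\<bar> * s n) \<le> 2 ^ n * (\<bar>c n\<bar> * s n)" for n
    using s0 by (intro mult_right_mono) auto
  then have cs: "\<bar>c n\<bar> * s n \<le> z n" for n by (simp add: z_def)
  have sc: "summable (\<lambda>n. \<bar>c n\<bar> * s n)"
    by (rule summable_comparison_test'[OF sz, of 0]) (use cs s0 in auto)
  have ScS: "(\<Sum>n. \<bar>c n\<bar> * s n) \<le> S" unfolding S_def by (rule suminf_le[OF cs sc sz])
  have ab: "\<bar>c n * \<Psi> n y\<bar> \<le> \<bar>c n\<bar> * s n" for n y
    using \<Psi>(3) by (simp add: abs_mult mult_left_mono)
  have c\<Psi>: "continuous_on UNIV (\<Psi> n)" "continuous_on UNIV (deriv (\<Psi> n))" for n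
    by (intro smooth1_continuous smooth1_deriv \<Psi>)+
  have cc: "continuous_on UNIV (\<lambda>x :: real^'d. \<Psi> n (x $ j n))" "continuous_on UNIV (\<lambda>x :: real^'d. deriv (\<Psi> n) (x $ j n))" for n
    by (intro continuous_coord c\<Psi>)+
  have bm: "(\<lambda>x :: real^'d. if b then c n * \<Psi> n (x $ j n) else 0) \<in> borel_measurable borel"
    "(\<lambda>x :: real^'d. if b then c n * deriv (\<Psi> n) (x $ j n) else 0) \<in> borel_measurable borel" for n b
    by (cases b; simp; intro borel_measurable_continuous_onI continuous_intros cc)+
  have u_le: "norm (u x) \<le> S" for x
    unfolding u_def using norm_vec_suminf_le[OF sc ab, of i "\<lambda>n. x $ j n"] ScS by linarith
  have u_m: "u \<in> borel_measurable borel"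
    by (rule borel_measurable_vec) (simp add: u_def, rule borel_measurable_suminf, rule bm)
  have u_per: "periodic u"
    unfolding periodic_def
  proof (intro allI)
    fix x :: "real^'d" and l
    have "\<Psi> n ((x + axis l 1) $ j n) = \<Psi> n (x $ j n)" for n
      using periodicD[OF periodic_coord[where j="j n", OF \<Psi>(2)[of n]], of x l] .
    then show "u (x + axis l 1) = u x" by (simp only: u_def)
  qed
  have u_Lp_int: "integrable ?M (\<lambda>x. norm (u x) powr p)"
  proof (rule Bochner_Integration.integrable_bound)
    show "integrable ?M (\<lambda>x. S powr p)" by simp
    show "(\<lambda>x. norm (u x) powr p) \<in> borel_measurable ?M"
      by (intro borel_imp_lebesgue_on powr_real_measurable measurable_compose[OF u_m borel_measurable_norm] borel_measurable_const)
    show "AE x in ?M. norm (norm (u x) powr p) \<le> norm (S powr p)"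
      using u_le p by (auto intro!: powr_mono2)
  qed
  have u_Lp: "u \<in> Lp_torus p"
    unfolding Lp_torus_def using u_per u_Lp_int u_m
    by (auto simp: set_integrable_cell intro!: measurable_completion)
  have u_norm: "Lp_norm p u powr p \<le> S powr p"
  proof -
    have "integral\<^sup>L ?M (\<lambda>x. norm (u x) powr p) \<le> integral\<^sup>L ?M (\<lambda>x. S powr p)"
      using u_Lp_int u_le p by (intro integral_mono) (auto intro!: powr_mono2)
    then have "integral\<^sup>L ?M (\<lambda>x. norm (u x) powr p) \<le> S powr p" by (simp only: cell_integral_const)
    moreover have "0 \<le> integral\<^sup>L ?M (\<lambda>x. norm (u x) powr p)" by (intro integral_nonneg_AE) auto
    ultimately show ?thesis using p by (simp add: Lp_norm_def set_integral_cell powr_powr)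
  qed
  \<comment> \<open>\<open>w n\<close> dominates the derivative of the n-th shear. The sum
    \<open>Y\<close> of the weighted powers \<open>y n\<close> is integrable and dominates the p-th
    power of the sum of the \<open>w n\<close> up to the factor 2^p.\<close>
  define w where "w n x = \<bar>c n\<bar> * \<bar>deriv (\<Psi> n) (x $ j n)\<bar>" for n and x :: "real^'d"
  define y where "y n x = (2 ^ n * w n x) powr p" for n and x :: "real^'d"
  have w0: "0 \<le> w n x" for n x by (simp add: w_def)
  have cw: "continuous_on UNIV (w n)" for n unfolding w_def by (intro continuous_intros cc)
  have cy: "continuous_on UNIV (y n)" for n unfolding y_def
    using p w0 by (intro continuous_on_powr' continuous_intros cw) auto
  have iy: "integral\<^sup>L ?M (y n) \<le> z n powr p" for n
  proof -
    have yn: "y n = (\<lambda>x. (2 ^ n * \<bar>c n\<bar>) powr p * (\<bar>deriv (\<Psi> n) (x $ j n)\<bar> powr p))"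
      unfolding y_def w_def by (simp add: powr_mult flip: mult.assoc)
    have "integral\<^sup>L ?M (y n) = integral cell (y n)" by (rule cell_cont_integral[OF cy])
    also have "\<dots> = (2 ^ n * \<bar>c n\<bar>) powr p * integral cell (\<lambda>x :: real^'d. \<bar>deriv (\<Psi> n) (x $ j n)\<bar> powr p)"
      unfolding yn by (rule integral_mult_right)
    also have "integral cell (\<lambda>x :: real^'d. \<bar>deriv (\<Psi> n) (x $ j n)\<bar> powr p) = integral {0..1} (\<lambda>y. \<bar>deriv (\<Psi> n) y\<bar> powr p)"
    proof (rule integral_cell_coord[of "\<lambda>y. \<bar>deriv (\<Psi> n) y\<bar> powr p"])
      show "continuous_on UNIV (\<lambda>y. \<bar>deriv (\<Psi> n) y\<bar> powr p)"
        using p by (intro continuous_on_powr' continuous_intros c\<Psi>) auto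
      show "per1 (\<lambda>y. \<bar>deriv (\<Psi> n) y\<bar> powr p)" using per1_deriv[OF \<Psi>(1,2)] by (simp add: per1_def)
    qed
    also have "(2 ^ n * \<bar>c n\<bar>) powr p * \<dots> \<le> (2 ^ n * \<bar>c n\<bar>) powr p * s n powr p"
      by (intro mult_left_mono \<Psi>') simp
    also have "\<dots> = z n powr p" by (simp add: z_def powr_mult flip: mult.assoc)
    finally show ?thesis .
  qed
  have iy0: "0 \<le> integral\<^sup>L ?M (y n)" for n by (intro integral_nonneg_AE) (simp add: y_def)
  have sy: "summable (\<lambda>n. integral\<^sup>L ?M (y n))"
    by (rule summable_comparison_test'[OF zp(1), of 0]) (use iy iy0 in auto)
  define Y where "Y x = (\<Sum>n. y n x)" for x
  have y0: "0 \<le> y n x" for n x by (simp add: y_def)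
  note Yf = AE_summable_of_integrals[OF cell_cont_integrable[OF cy] y0 sy, folded Y_def]
  have iY: "integral\<^sup>L ?M Y \<le> S powr p"
  proof -
    have "integral\<^sup>L ?M Y = (\<Sum>n. integral\<^sup>L ?M (y n))" using Yf(3) .
    also have "\<dots> \<le> (\<Sum>n. z n powr p)" by (rule suminf_le[OF iy sy zp(1)])
    also have "\<dots> \<le> S powr p" using zp(2) by (simp add: S_def)
    finally show ?thesis .
  qed
  define g where "g l x = (\<chi> k. \<Sum>n. if k = i n then (if l = j n then c n * deriv (\<Psi> n) (x $ j n) else 0) else 0)"
    for l and x :: "real^'d"
  have g_m: "g l \<in> borel_measurable borel" for l
  proof (rule borel_measurable_vec)
    fix k
    have "(\<lambda>x :: real^'d. if k = i n then (if l = j n then c n * deriv (\<Psi> n) (x $ j n) else 0) else 0) \<in> borel_measurable borel" for n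
      using bm(2)[of "l = j n" n] by (cases "k = i n") auto
    then show "(\<lambda>x. g l x $ k) \<in> borel_measurable borel"
      by (simp add: g_def borel_measurable_suminf)
  qed
  have g_per: "periodic (g l)" for l
    unfolding periodic_def
  proof (intro allI)
    fix x :: "real^'d" and r
    have "deriv (\<Psi> n) ((x + axis r 1) $ j n) = deriv (\<Psi> n) (x $ j n)" for n
      using periodicD[OF periodic_coord[where j="j n", OF per1_deriv[OF \<Psi>(1)[of n] \<Psi>(2)[of n]]], of x r] .
    then show "g l (x + axis r 1) = g l x" by (simp only: g_def)
  qed
  have gw: "\<bar>if l = j n then c n * deriv (\<Psi> n) (x $ j n) else 0\<bar> \<le> w n x" for l n x
    by (simp add: w_def abs_mult)
  have Y0: "summable (\<lambda>n. y n x) \<Longrightarrow> 0 \<le> Y x" for x unfolding Y_def by (intro suminf_nonneg y0)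
  have good: "summable (\<lambda>n. w n x) \<and> (\<Sum>n. w n x) \<le> 2 * Y x powr (1/p) \<and> norm (g l x) \<le> 2 * Y x powr (1/p) \<and>
      norm (g l x) powr p \<le> 2 powr p * Y x" if x: "summable (\<lambda>n. y n x)" for l x
  proof -
    note sw = sum_le_of_powr_sum[OF w0 x[unfolded y_def] p, folded y_def, folded Y_def]
    have n: "norm (g l x) \<le> 2 * Y x powr (1/p)"
      unfolding g_def using norm_vec_suminf_le[where i=i, OF sw(1) gw[of l _ x]] sw(2) by linarith
    then have "norm (g l x) powr p \<le> (2 * Y x powr (1/p)) powr p" using p by (intro powr_mono2) auto
    also have "\<dots> = 2 powr p * Y x" using p Y0[OF x] by (simp add: powr_mult powr_powr)
    finally show ?thesis using sw n by simp
  qed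
  have g_int: "integrable ?M (\<lambda>x. norm (g l x) powr p)" for l
  proof (rule Bochner_Integration.integrable_bound)
    show "integrable ?M (\<lambda>x. 2 powr p * Y x)" using Yf(2) by simp
    show "(\<lambda>x. norm (g l x) powr p) \<in> borel_measurable ?M"
      by (intro borel_imp_lebesgue_on powr_real_measurable measurable_compose[OF g_m borel_measurable_norm] borel_measurable_const)
    show "AE x in ?M. norm (norm (g l x) powr p) \<le> norm (2 powr p * Y x)"
      using Yf(1) by eventually_elim (use good Y0 in \<open>simp add: abs_of_nonneg\<close>)
  qed
  have g_Lp: "g l \<in> Lp_torus p" for l
    unfolding Lp_torus_def using g_per g_int[of l] g_m[of l]
    by (auto simp: set_integrable_cell intro!: measurable_completion)
  \<comment> \<open>Turns the integrable majorant of the p-th power into one of the function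
    itself.\<close>
  have pow1: "r powr (1/p) \<le> 1 + r" if "0 \<le> r" for r
  proof (cases "r \<le> 1")
    case True
    then have "r powr (1/p) \<le> 1 powr (1/p)" using p that by (intro powr_mono2) auto
    then show ?thesis using that by simp
  next
    case False
    then have "r powr (1/p) \<le> r powr 1" using p by (intro powr_mono) auto
    then show ?thesis using that by simp
  qed
  have Y1: "integrable ?M (\<lambda>x. 2 * (1 + Y x))" using Yf(2) by (intro integrable_mult_right integrable_add) simp_all
  have gi1: "integrable ?M (\<lambda>x. g l x)" for l
  proof (rule Bochner_Integration.integrable_bound[OF Y1])
    show "g l \<in> borel_measurable ?M" by (intro borel_imp_lebesgue_on g_m)
    show "AE x in ?M. norm (g l x) \<le> norm (2 * (1 + Y x))"
      using Yf(1)
    proof eventually_elim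
      case (elim x)
      show ?case using good[OF elim, of l] pow1[OF Y0[OF elim]] Y0[OF elim] by simp
    qed
  qed
  have g_L1: "g l \<in> Lp_torus 1" for l
    unfolding Lp_torus_def using g_per g_m[of l] integrable_norm[OF gi1[of l]]
    by (auto simp: set_integrable_cell intro!: measurable_completion)
  have sw: "summable (\<lambda>n. integral\<^sup>L ?M (w n))"
  proof (rule summableI_nonneg_bounded)
    show "0 \<le> integral\<^sup>L ?M (w n)" for n by (intro integral_nonneg_AE) (simp add: w0)
    fix N
    have "(\<Sum>n<N. integral\<^sup>L ?M (w n)) = integral\<^sup>L ?M (\<lambda>x. \<Sum>n<N. w n x)"
      by (intro Bochner_Integration.integral_sum[symmetric] cell_cont_integrable cw)
    also have "\<dots> \<le> integral\<^sup>L ?M (\<lambda>x. 2 * (1 + Y x))"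
    proof (rule integral_mono_AE[OF _ Y1])
      show "integrable ?M (\<lambda>x. \<Sum>n<N. w n x)"
        by (intro Bochner_Integration.integrable_sum cell_cont_integrable cw)
      show "AE x in ?M. (\<Sum>n<N. w n x) \<le> 2 * (1 + Y x)"
        using Yf(1)
      proof eventually_elim
        case (elim x)
        \<comment> \<open>The part of \<open>good\<close> about \<open>w\<close> does not involve
          the direction \<open>l\<close>, hence the instance \<open>undefined\<close>.\<close>
        have "(\<Sum>n<N. w n x) \<le> (\<Sum>n. w n x)" using good[OF elim, of undefined] w0 by (intro sum_le_suminf) auto
        also have "\<dots> \<le> 2 * Y x powr (1 / p)" using good[OF elim, of undefined] by blast
        also have "\<dots> \<le> 2 * (1 + Y x)" by (intro mult_left_mono pow1 Y0[OF elim]) simp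
        finally show ?case .
      qed
    qed
    finally show "(\<Sum>n<N. integral\<^sup>L ?M (w n)) \<le> integral\<^sup>L ?M (\<lambda>x. 2 * (1 + Y x))" .
  qed
  have ui1: "integrable ?M u"
    by (rule Bochner_Integration.integrable_bound[of _ "\<lambda>x. S"])
       (use u_le S0 in \<open>auto intro!: borel_imp_lebesgue_on u_m\<close>)
  have wp: "is_weak_partial l u (g l)" for l
    unfolding is_weak_partial_def
  proof (intro conjI allI impI g_L1)
    fix \<phi> :: "real^'d \<Rightarrow> real" assume "smooth \<phi> \<and> periodic \<phi>"
    then have \<phi>: "smooth \<phi>" "periodic \<phi>" by auto
    note c\<phi> = smooth_partial(2,3)[OF \<phi>(1)]
    obtain B where B: "0 \<le> B" "\<And>x. x \<in> cell \<Longrightarrow> \<bar>\<phi> x\<bar> \<le> B" using cont_bounded_cell[OF c\<phi>(1)] by blast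
    obtain B' where B': "0 \<le> B'" "\<And>x. x \<in> cell \<Longrightarrow> \<bar>partial l \<phi> x\<bar> \<le> B'" using cont_bounded_cell[OF c\<phi>(2)] by blast
    have scale: "integrable ?M (\<lambda>x. f x *\<^sub>R k x)" if k: "integrable ?M k" and f: "continuous_on UNIV f" "\<And>x. x \<in> cell \<Longrightarrow> \<bar>f x\<bar> \<le> b"
      for k :: "real^'d \<Rightarrow> real^'d" and f b
    proof (rule Bochner_Integration.integrable_bound)
      show "integrable ?M (\<lambda>x. b *\<^sub>R k x)" by (rule integrable_scaleR_right) (rule k)
      show "(\<lambda>x. f x *\<^sub>R k x) \<in> borel_measurable ?M"
        by (intro borel_measurable_scaleR borel_imp_lebesgue_on borel_measurable_continuous_onI f borel_measurable_integrable[OF k])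
      have "norm (f x *\<^sub>R k x) \<le> norm (b *\<^sub>R k x)" if "x \<in> cell" for x
        using f(2)[OF that] by (auto intro!: mult_right_mono)
      then show "AE x in ?M. norm (f x *\<^sub>R k x) \<le> norm (b *\<^sub>R k x)"
        by (intro AE_I2) simp
    qed
    define a where "a k n x = (if k = i n then c n * \<Psi> n (x $ j n) else 0)" for k n and x :: "real^'d"
    define b where "b k n x = (if k = i n then (if l = j n then c n * deriv (\<Psi> n) (x $ j n) else 0) else 0)" for k n and x :: "real^'d"
    have ca: "continuous_on UNIV (a k n)" for k n
      unfolding a_def by (cases "k = i n") (auto intro!: continuous_intros cc)
    have cb: "continuous_on UNIV (b k n)" for k n
      unfolding b_def by (cases "k = i n"; cases "l = j n") (auto intro!: continuous_intros cc)
    have parts: "integral cell (\<lambda>x. partial l \<phi> x * a k n x) = - integral cell (\<lambda>x. \<phi> x * b k n x)" for k n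
    proof (rule integral_cell_by_parts[where j=l])
      show "periodic (a k n)"
        using periodic_coord[OF \<Psi>(2)[of n], of "j n"] by (simp add: a_def periodic_def)
      show "((\<lambda>s. \<phi> (x + s *\<^sub>R axis l 1)) has_real_derivative partial l \<phi> x) (at 0)" for x
        by (rule partial_dir_deriv[OF smooth_partial(1)[OF \<phi>(1)]])
      fix x :: "real^'d"
      have "((\<lambda>s. \<Psi> n ((x + s *\<^sub>R axis l 1) $ j n)) has_real_derivative (if l = j n then deriv (\<Psi> n) (x $ j n) else 0)) (at 0)"
        using DERIV_shift_0[OF smooth1_has_deriv[OF \<Psi>(1), of n "x $ j n"]]
        by (cases "l = j n") (simp_all add: axis_def)
      from DERIV_cmult[OF this, of "c n"]
      show "((\<lambda>s. a k n (x + s *\<^sub>R axis l 1)) has_real_derivative b k n x) (at 0)"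
        by (cases "k = i n"; cases "l = j n") (simp_all add: a_def b_def)
    qed (fact \<phi> c\<phi> ca cb)+
    \<comment> \<open>Classical integration by parts for each shear. The sum is interchanged with
      the integral by the suprema \<open>s n\<close> on one side and by the integrals of the
      \<open>w n\<close> on the other.\<close>
    have comp: "integral\<^sup>L ?M (\<lambda>x. partial l \<phi> x * u x $ k) = - integral\<^sup>L ?M (\<lambda>x. \<phi> x * g l x $ k)" for k
    proof -
      have ia: "integrable ?M (\<lambda>x. partial l \<phi> x * a k n x)" "integrable ?M (\<lambda>x. \<phi> x * b k n x)" for n
        by (intro cell_cont_integrable continuous_intros c\<phi> ca cb)+
      have aa: "\<bar>partial l \<phi> x * a k n x\<bar> \<le> B' * (\<bar>c n\<bar> * s n)" if "x \<in> cell" for x n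
        unfolding abs_mult using B'(2)[OF that] ab[of n] s0 B'(1) by (intro mult_mono) (auto simp: a_def)
      have bb: "\<bar>\<phi> x * b k n x\<bar> \<le> B * w n x" if "x \<in> cell" for x n
        unfolding abs_mult using B(2)[OF that] gw[of l n x] w0 B(1) by (intro mult_mono) (auto simp: b_def)
      have sa: "summable (\<lambda>n. integral\<^sup>L ?M (\<lambda>x. norm (partial l \<phi> x * a k n x)))"
      proof (rule summable_comparison_test'[of "\<lambda>n. B' * (\<bar>c n\<bar> * s n)" 0])
        show "summable (\<lambda>n. B' * (\<bar>c n\<bar> * s n))" by (intro summable_mult sc)
        fix n
        have "integral\<^sup>L ?M (\<lambda>x. norm (partial l \<phi> x * a k n x)) \<le> integral\<^sup>L ?M (\<lambda>x. B' * (\<bar>c n\<bar> * s n))"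
          by (rule integral_mono[OF integrable_norm[OF ia(1)]]) (use aa in auto)
        moreover have "0 \<le> integral\<^sup>L ?M (\<lambda>x. norm (partial l \<phi> x * a k n x))" by (intro integral_nonneg_AE) simp
        ultimately show "norm (integral\<^sup>L ?M (\<lambda>x. norm (partial l \<phi> x * a k n x))) \<le> B' * (\<bar>c n\<bar> * s n)"
          unfolding cell_integral_const by simp
      qed
      have sb: "summable (\<lambda>n. integral\<^sup>L ?M (\<lambda>x. norm (\<phi> x * b k n x)))"
      proof (rule summable_comparison_test'[of "\<lambda>n. B * integral\<^sup>L ?M (w n)" 0])
        show "summable (\<lambda>n. B * integral\<^sup>L ?M (w n))" by (intro summable_mult sw)
        fix n
        have "integral\<^sup>L ?M (\<lambda>x. norm (\<phi> x * b k n x)) \<le> integral\<^sup>L ?M (\<lambda>x. B * w n x)"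
          by (rule integral_mono[OF integrable_norm[OF ia(2)]])
             (use bb in \<open>auto intro!: cell_cont_integrable continuous_intros cw\<close>)
        moreover have "0 \<le> integral\<^sup>L ?M (\<lambda>x. norm (\<phi> x * b k n x))" by (intro integral_nonneg_AE) simp
        ultimately show "norm (integral\<^sup>L ?M (\<lambda>x. norm (\<phi> x * b k n x))) \<le> B * integral\<^sup>L ?M (w n)"
          by simp
      qed
      have sa': "AE x in ?M. summable (\<lambda>n. norm (partial l \<phi> x * a k n x))"
      proof (rule AE_I2)
        fix x assume "x \<in> space ?M"
        then have "x \<in> cell" by simp
        then show "summable (\<lambda>n. norm (partial l \<phi> x * a k n x))"
          using aa by (intro summable_comparison_test'[OF summable_mult[OF sc, of B'], of 0]) auto
      qed
      have sb': "AE x in ?M. summable (\<lambda>n. norm (\<phi> x * b k n x))"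
        using Yf(1) AE_space
      proof eventually_elim
        case (elim x)
        then have x: "x \<in> cell" by simp
        have s1: "summable (\<lambda>n. w n x)" using good[OF elim(1), of undefined] by blast
        show ?case
          by (rule summable_comparison_test'[OF summable_mult[OF s1, of B], of 0])
             (use bb[OF x] in \<open>simp only: real_norm_def abs_idempotent\<close>)
      qed
      have "integral\<^sup>L ?M (\<lambda>x. partial l \<phi> x * u x $ k) = integral\<^sup>L ?M (\<lambda>x. \<Sum>n. partial l \<phi> x * a k n x)"
      proof (rule Bochner_Integration.integral_cong[OF refl])
        fix x :: "real^'d"
        have "summable (\<lambda>n. a k n x)"
          by (rule suminf_abs_le(1)[OF sc]) (use ab s0 in \<open>auto simp: a_def\<close>)
        from suminf_mult[OF this] show "partial l \<phi> x * u x $ k = (\<Sum>n. partial l \<phi> x * a k n x)"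
          by (simp add: u_def a_def)
      qed
      also have "\<dots> = (\<Sum>n. integral\<^sup>L ?M (\<lambda>x. partial l \<phi> x * a k n x))"
        by (rule integral_suminf[OF ia(1) sa' sa])
      also have "\<dots> = (\<Sum>n. - integral\<^sup>L ?M (\<lambda>x. \<phi> x * b k n x))"
        by (intro suminf_cong) (simp add: cell_cont_integral continuous_intros c\<phi> ca cb parts)
      also have "\<dots> = - (\<Sum>n. integral\<^sup>L ?M (\<lambda>x. \<phi> x * b k n x))"
        by (rule suminf_minus) (rule summable_integral[OF ia(2) sb' sb])
      also have "(\<Sum>n. integral\<^sup>L ?M (\<lambda>x. \<phi> x * b k n x)) = integral\<^sup>L ?M (\<lambda>x. \<Sum>n. \<phi> x * b k n x)"
        by (rule integral_suminf[OF ia(2) sb' sb, symmetric])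
      also have "\<dots> = integral\<^sup>L ?M (\<lambda>x. \<phi> x * g l x $ k)"
      proof (rule integral_cong_AE)
        show "AE x in ?M. (\<Sum>n. \<phi> x * b k n x) = \<phi> x * g l x $ k"
          using Yf(1)
        proof eventually_elim
          case (elim x)
          have "summable (\<lambda>n. b k n x)"
            by (rule suminf_abs_le(1)[of "\<lambda>n. w n x"]) (use good[OF elim, of undefined] gw w0 in \<open>auto simp: b_def\<close>)
          from suminf_mult[OF this] show ?case by (simp add: g_def b_def)
        qed
        show "(\<lambda>x. \<Sum>n. \<phi> x * b k n x) \<in> borel_measurable ?M"
          by (rule borel_measurable_integrable[OF integrable_suminf[OF ia(2) sb' sb]])
        have "(\<lambda>x. g l x $ k) \<in> borel_measurable borel"
        proof -
          have "(\<lambda>v :: real^'d. v $ k) \<in> borel_measurable borel"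
            by (intro borel_measurable_continuous_onI continuous_intros)
          from measurable_compose[OF g_m[of l] this] show ?thesis .
        qed
        then show "(\<lambda>x. \<phi> x * g l x $ k) \<in> borel_measurable ?M"
          by (intro borel_imp_lebesgue_on borel_measurable_times[OF borel_measurable_continuous_onI[OF c\<phi>(1)]])
      qed
      finally show ?thesis .
    qed
    have vec: "integral\<^sup>L ?M (\<lambda>x. f x *\<^sub>R h x) $ k = integral\<^sup>L ?M (\<lambda>x. f x * h x $ k)"
      if "integrable ?M (\<lambda>x. f x *\<^sub>R h x)" for f and h :: "real^'d \<Rightarrow> real^'d" and k
    proof -
      have "integral\<^sup>L ?M (\<lambda>x. (f x *\<^sub>R h x) \<bullet> axis k 1) = integral\<^sup>L ?M (\<lambda>x. f x *\<^sub>R h x) \<bullet> axis k 1"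
        by (rule integral_inner_left) (use that in simp)
      then show ?thesis by (simp add: inner_axis)
    qed
    show "(LINT x:cell|lebesgue. partial l \<phi> x *\<^sub>R u x) = - (LINT x:cell|lebesgue. \<phi> x *\<^sub>R g l x)"
      unfolding set_integral_cell vec_eq_iff vector_uminus_component
    proof
      fix k
      have "integral\<^sup>L ?M (\<lambda>x. partial l \<phi> x *\<^sub>R u x) $ k = integral\<^sup>L ?M (\<lambda>x. partial l \<phi> x * u x $ k)"
        by (rule vec) (rule scale[OF ui1 c\<phi>(2) B'(2)])
      also have "\<dots> = - integral\<^sup>L ?M (\<lambda>x. \<phi> x * g l x $ k)" by (rule comp)
      also have "integral\<^sup>L ?M (\<lambda>x. \<phi> x * g l x $ k) = integral\<^sup>L ?M (\<lambda>x. \<phi> x *\<^sub>R g l x) $ k"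
        by (rule vec[symmetric]) (rule scale[OF gi1 c\<phi>(1) B(2)])
      finally show "integral\<^sup>L ?M (\<lambda>x. partial l \<phi> x *\<^sub>R u x) $ k = - integral\<^sup>L ?M (\<lambda>x. \<phi> x *\<^sub>R g l x) $ k" .
    qed
  qed
  show "u \<in> W1p p" unfolding W1p_def using u_Lp g_Lp wp by blast
  have g_norm: "Lp_norm p (weak_partial l u) powr p \<le> 2 powr p * S powr p" for l
  proof -
    have "integral\<^sup>L ?M (\<lambda>x. norm (g l x) powr p) \<le> integral\<^sup>L ?M (\<lambda>x. 2 powr p * Y x)"
    proof (rule integral_mono_AE[OF g_int])
      show "integrable ?M (\<lambda>x. 2 powr p * Y x)" using Yf(2) by simp
      show "AE x in ?M. norm (g l x) powr p \<le> 2 powr p * Y x"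
        using Yf(1) by eventually_elim (use good in blast)
    qed
    also have "\<dots> = 2 powr p * integral\<^sup>L ?M Y" by simp
    also have "\<dots> \<le> 2 powr p * S powr p" using iY by simp
    finally have "integral\<^sup>L ?M (\<lambda>x. norm (g l x) powr p) \<le> 2 powr p * S powr p" .
    moreover have "0 \<le> integral\<^sup>L ?M (\<lambda>x. norm (g l x) powr p)" by (intro integral_nonneg_AE) auto
    ultimately show ?thesis unfolding Lp_norm_weak_partial[OF wp]
      using p by (simp add: Lp_norm_def set_integral_cell powr_powr)
  qed
  have "W1p_norm p u \<le> ((1 + real CARD('d) * 2 powr p) * S powr p) powr (1 / p)"
    unfolding W1p_norm_def
  proof (rule powr_mono2)
    have "(\<Sum>l\<in>UNIV. Lp_norm p (weak_partial l u) powr p) \<le> (\<Sum>l\<in>(UNIV::'d set). 2 powr p * S powr p)"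
      by (rule sum_mono) (rule g_norm)
    then show "Lp_norm p u powr p + (\<Sum>l\<in>UNIV. Lp_norm p (weak_partial l u) powr p) \<le> (1 + real CARD('d) * 2 powr p) * S powr p"
      using u_norm by (simp add: algebra_simps)
  qed (use p in \<open>auto intro!: add_nonneg_nonneg sum_nonneg\<close>)
  also have "\<dots> = (1 + real CARD('d) * 2 powr p) powr (1 / p) * S"
    using p S0 by (simp add: powr_mult powr_powr)
  finally show "W1p_norm p u \<le> (1 + real CARD('d) * 2 powr p) powr (1 / p) * (\<Sum>n. 2 ^ n * (\<bar>c n\<bar> * s n))"
    by (simp add: S_def z_def)
  show "is_weak_partial l u
      (\<lambda>x. \<chi> k. \<Sum>n. if k = i n then (if l = j n then c n * deriv (\<Psi> n) (x $ j n) else 0) else 0)" for l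
    using wp[of l] unfolding g_def .
qed

subsection \<open>Limits in spaces of smooth functions\<close>

text \<open>Term m is controlled in the power m + 1 only, but x^p <= 1 + x^(m+1) as soon as 1 <= p
  <= m + 1. So from index \<open>K\<close> on a single sum bounds the p-th power of the tail; the
  factor 2 is the geometric series of the weights.\<close>

lemma geometric_tail_bound:
  fixes a :: "nat \<Rightarrow> real"
  assumes a: "\<And>m. 0 \<le> a m" and s: "summable (\<lambda>m. (2 ^ m * a m) ^ Suc m)" and p: "1 \<le> p" "p \<le> real (Suc K)"
  shows "summable a" "(\<Sum>m. a (m + K)) \<le> 2 * (1 + (\<Sum>m. (2 ^ m * a m) ^ Suc m)) powr (1 / p)"
proof -
  define E where "E = (\<Sum>m. (2 ^ m * a m) ^ Suc m)"
  have xE: "(2 ^ m * a m) ^ Suc m \<le> E" for m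
    unfolding E_def using sum_le_suminf[OF s, of "{m}"] a by (auto intro!: mult_nonneg_nonneg)
  have E0: "0 \<le> E" using xE[of 0] a[of 0] by simp
  have le: "a m \<le> (1 + E) powr (1/p) * (1/2) ^ m" if p: "1 \<le> p" and m: "p \<le> real (Suc m)" for m and p :: real
  proof -
    define x where "x = 2 ^ m * a m"
    have x0: "0 \<le> x" using a by (simp add: x_def)
    have "x powr p \<le> 1 + E"
    proof (cases "x \<le> 1")
      case True
      then have "x powr p \<le> 1 powr p" using x0 p by (intro powr_mono2) auto
      then show ?thesis using E0 by simp
    next
      case False
      then have "x powr p \<le> x powr real (Suc m)" using m by (intro powr_mono) auto
      also have "\<dots> = x ^ Suc m" using False by (intro powr_realpow) auto
      finally show ?thesis using xE[of m] by (simp add: x_def)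
    qed
    then have "(x powr p) powr (1/p) \<le> (1 + E) powr (1/p)" using p by (intro powr_mono2) auto
    moreover have "(x powr p) powr (1/p) = x" using p x0 by (simp add: powr_powr)
    ultimately have "x * (1/2) ^ m \<le> (1 + E) powr (1/p) * (1/2) ^ m" by (intro mult_right_mono) auto
    moreover have "x * (1/2) ^ m = a m" by (simp add: x_def power_one_over)
    ultimately show ?thesis by simp
  qed
  have g: "summable (\<lambda>m. (1 + E) powr (1/1) * (1/2) ^ m)" by (intro summable_mult summable_geometric) simp
  show sa: "summable a"
    by (rule summable_comparison_test'[OF g, of 0]) (use le[where p=1] a in auto)
  have g2: "summable (\<lambda>m. (1 + E) powr (1/p) * (1/2) ^ m)" by (intro summable_mult summable_geometric) simp
  have "(\<Sum>m. a (m + K)) \<le> (\<Sum>m. (1 + E) powr (1/p) * (1/2) ^ m)"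
  proof (rule suminf_le[OF _ summable_ignore_initial_segment[OF sa] g2])
    fix m
    have "a (m + K) \<le> (1 + E) powr (1/p) * (1/2) ^ (m + K)" by (rule le[OF p(1)]) (use p in auto)
    also have "\<dots> \<le> (1 + E) powr (1/p) * (1/2) ^ m"
      by (intro mult_left_mono power_decreasing) auto
    finally show "a (m + K) \<le> (1 + E) powr (1/p) * (1/2) ^ m" .
  qed
  also have "\<dots> = (1 + E) powr (1/p) * (\<Sum>m. (1/2) ^ m)" by (rule suminf_mult) (simp add: summable_geometric)
  also have "(\<Sum>m. (1/2 :: real) ^ m) = 2" by (subst suminf_geometric) auto
  finally show "(\<Sum>m. a (m + K)) \<le> 2 * (1 + (\<Sum>m. (2 ^ m * a m) ^ Suc m)) powr (1 / p)"
    by (simp add: E_def)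
qed

lemma telescoping_limit:
  fixes f a :: "nat \<Rightarrow> real"
  assumes s: "summable a" and le: "\<And>n. K \<le> n \<Longrightarrow> \<bar>f (Suc n) - f n\<bar> \<le> a n"
  shows "f \<longlonglongrightarrow> lim f" "\<And>n. K \<le> n \<Longrightarrow> \<bar>f n - lim f\<bar> \<le> (\<Sum>m. a (m + n))"
proof -
  have s': "summable (\<lambda>m. f (Suc (m + n)) - f (m + n))" "\<bar>\<Sum>m. f (Suc (m + n)) - f (m + n)\<bar> \<le> (\<Sum>m. a (m + n))" if "K \<le> n" for n
    using suminf_abs_le[OF summable_ignore_initial_segment[OF s, of n], of "\<lambda>m. f (Suc (m + n)) - f (m + n)"] le that by auto
  have lim: "(\<lambda>m. f (m + n)) \<longlonglongrightarrow> (\<Sum>m. f (Suc (m + n)) - f (m + n)) + f n" if "K \<le> n" for n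
  proof -
    have "(\<Sum>m<N. f (Suc (m + n)) - f (m + n)) = f (N + n) - f n" for N
      using sum_lessThan_telescope[of "\<lambda>m. f (m + n)" N] by simp
    then have "(\<lambda>N. f (N + n) - f n) \<longlonglongrightarrow> (\<Sum>m. f (Suc (m + n)) - f (m + n))"
      using summable_LIMSEQ[OF s'(1)[OF that]] by simp
    from tendsto_add[OF this tendsto_const[of "f n"]] show ?thesis by simp
  qed
  have l: "f \<longlonglongrightarrow> (\<Sum>m. f (Suc (m + n)) - f (m + n)) + f n" if "K \<le> n" for n
    using lim[OF that] by (rule LIMSEQ_offset)
  then show f: "f \<longlonglongrightarrow> lim f" using limI[OF l[of K]] by simp
  fix n assume n: "K \<le> n"
  have "lim f = (\<Sum>m. f (Suc (m + n)) - f (m + n)) + f n" by (rule limI[OF l[OF n]])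
  then show "\<bar>f n - lim f\<bar> \<le> (\<Sum>m. a (m + n))" using s'(2)[OF n] by simp
qed

lemma suminf_tail_tendsto_0:
  fixes a :: "nat \<Rightarrow> real" assumes "summable a" shows "(\<lambda>n. \<Sum>m. a (m + n)) \<longlonglongrightarrow> 0"
proof -
  have "(\<Sum>m. a (m + n)) = suminf a - sum a {..<n}" for n by (rule suminf_minus_initial_segment[OF assms])
  moreover have "(\<lambda>n. suminf a - sum a {..<n}) \<longlonglongrightarrow> suminf a - suminf a"
    by (intro tendsto_diff tendsto_const summable_LIMSEQ assms)
  ultimately show ?thesis by simp
qed

text \<open>Increments are bounded only for n >= k, because step n controls derivatives up to order
  n. The gradients converge uniformly in x, so the limits of derivatives are the derivatives of the
  limit.\<close>

lemma Ck_limit: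
  fixes F :: "nat \<Rightarrow> real \<Rightarrow> real ^ 'd::finite \<Rightarrow> real"
  assumes F: "\<And>n. tfun (F n)" and s: "summable a"
    and le: "\<And>n w x. length w \<le> k \<Longrightarrow> k \<le> n \<Longrightarrow> \<bar>pDs w (F (Suc n)) t x - pDs w (F n) t x\<bar> \<le> a n"
  defines "g \<equiv> \<lambda>x. lim (\<lambda>n. F n t x)"
  shows "g \<in> Ck_torus k"
    and "\<And>w x n. length w \<le> k \<Longrightarrow> k \<le> n \<Longrightarrow> \<bar>pDs w (F n) t x - foldr partial w g x\<bar> \<le> (\<Sum>m. a (m + n))"
proof -
  define G where "G w x = lim (\<lambda>n. pDs w (F n) t x)" for w x
  have lim: "(\<lambda>n. pDs w (F n) t x) \<longlonglongrightarrow> G w x" if "length w \<le> k" for w x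
    unfolding G_def by (rule telescoping_limit(1)[OF s]) (rule le[OF that])
  have tail: "\<bar>pDs w (F n) t x - G w x\<bar> \<le> (\<Sum>m. a (m + n))" if "length w \<le> k" "k \<le> n" for w x n
    unfolding G_def by (rule telescoping_limit(2)[OF s _ that(2)]) (rule le[OF that(1)])
  have der: "(G w has_derivative (\<lambda>h. \<Sum>i\<in>UNIV. G (i # w) x * h $ i)) (at x)" if w: "length w < k" for w x
  proof -
    have "\<exists>g. \<forall>x\<in>UNIV. (\<lambda>n. pDs w (F n) t x) \<longlonglongrightarrow> g x \<and>
        (g has_derivative (\<lambda>h. \<Sum>i\<in>UNIV. G (i # w) x * h $ i)) (at x within UNIV)"
    proof (rule has_derivative_sequence)
      show "(pDs w (F n) t has_derivative (\<lambda>h. \<Sum>i\<in>UNIV. pDs (i # w) (F n) t x * h $ i)) (at x within UNIV)" for n x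
        using tfun_pD_has_deriv[OF tfun_pDs[OF F, of w n], of t x] by simp
      show "(\<lambda>n. pDs w (F n) t 0) \<longlonglongrightarrow> G w 0" using w by (intro lim) simp
      fix e :: real assume e: "0 < e"
      define C where "C = real CARD('d) + 1"
      have C: "0 < C" by (simp add: C_def add_nonneg_pos)
      have "\<forall>\<^sub>F n in sequentially. (\<Sum>m. a (m + n)) < e / C"
        using order_tendstoD(2)[OF suminf_tail_tendsto_0[OF s], of "e / C"] e C by simp
      then show "\<forall>\<^sub>F n in sequentially. \<forall>x\<in>UNIV. \<forall>h. norm ((\<Sum>i\<in>UNIV. pDs (i # w) (F n) t x * h $ i) -
            (\<Sum>i\<in>UNIV. G (i # w) x * h $ i)) \<le> e * norm h"
        using eventually_ge_at_top[of k]
      proof eventually_elim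
        case (elim n)
        have t0: "0 \<le> (\<Sum>m. a (m + n))" using tail[of "[]" n 0] elim(2) by (auto intro: order_trans[OF abs_ge_zero])
        show ?case
        proof (intro ballI allI)
          fix x h :: "real ^ 'd"
          have "norm ((\<Sum>i\<in>UNIV. pDs (i # w) (F n) t x * h $ i) - (\<Sum>i\<in>UNIV. G (i # w) x * h $ i))
            = \<bar>\<Sum>i\<in>UNIV. (pDs (i # w) (F n) t x - G (i # w) x) * h $ i\<bar>"
            by (simp add: sum_subtractf left_diff_distrib)
          also have "\<dots> \<le> (\<Sum>i\<in>(UNIV::'d set). (\<Sum>m. a (m + n)) * norm h)"
          proof (rule order_trans[OF sum_abs], rule sum_mono)
            fix i
            show "\<bar>(pDs (i # w) (F n) t x - G (i # w) x) * h $ i\<bar> \<le> (\<Sum>m. a (m + n)) * norm h"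
              unfolding abs_mult using w elim(2)
              by (intro mult_mono tail component_le_norm_cart t0) auto
          qed
          also have "\<dots> = real CARD('d) * (\<Sum>m. a (m + n)) * norm h" by simp
          also have "\<dots> \<le> C * (e / C) * norm h"
            using elim(1) t0 C by (intro mult_right_mono mult_mono) (auto simp: C_def)
          also have "\<dots> = e * norm h" using C by simp
          finally show "norm ((\<Sum>i\<in>UNIV. pDs (i # w) (F n) t x * h $ i) - (\<Sum>i\<in>UNIV. G (i # w) x * h $ i)) \<le> e * norm h" .
        qed
      qed
    qed auto
    then obtain g' where g': "\<And>x. (\<lambda>n. pDs w (F n) t x) \<longlonglongrightarrow> g' x"
        "\<And>x. (g' has_derivative (\<lambda>h. \<Sum>i\<in>UNIV. G (i # w) x * h $ i)) (at x)" by auto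
    have "g' = G w" using LIMSEQ_unique[OF g'(1) lim] w by (intro ext) auto
    then show ?thesis using g'(2) by simp
  qed
  have cont: "continuous_on UNIV (G w)" if w: "length w \<le> k" for w
  proof (rule uniform_limit_theorem[where F=sequentially and f="\<lambda>n. pDs w (F n) t"])
    show "\<forall>\<^sub>F n in sequentially. continuous_on UNIV (pDs w (F n) t)"
      by (intro always_eventually allI tfun_continuous_space tfun_pDs F)
    show "uniform_limit UNIV (\<lambda>n. pDs w (F n) t) (G w) sequentially"
      unfolding uniform_limit_iff
    proof (intro allI impI)
      fix e :: real assume "0 < e"
      have "\<forall>\<^sub>F n in sequentially. (\<Sum>m. a (m + n)) < e"
        using order_tendstoD(2)[OF suminf_tail_tendsto_0[OF s] \<open>0 < e\<close>] .
      then show "\<forall>\<^sub>F n in sequentially. \<forall>x\<in>UNIV. dist (pDs w (F n) t x) (G w x) < e"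
        using eventually_ge_at_top[of k]
        by eventually_elim (use tail[OF w] in \<open>auto simp: dist_real_def intro: le_less_trans\<close>)
    qed
  qed simp
  have CG: "C_k r (G w)" if "length w + r \<le> k" for r w
    using that
  proof (induction r arbitrary: w)
    case 0
    then show ?case using cont by simp
  next
    case (Suc r)
    have d: "G w differentiable (at x)" for x using der[of w x] Suc.prems differentiableI by fastforce
    moreover have "(\<lambda>x. frechet_derivative (G w) (at x) (axis i 1)) = G (i # w)" for i
      using has_derivative_imp_partial[OF der[of w], of i] Suc.prems by (auto simp: partial_def)
    moreover have "C_k r (G (i # w))" for i by (rule Suc.IH) (use Suc.prems in simp)
    ultimately show ?case by (auto simp: Basis_vec_def)
  qed
  have gG: "g = G []" by (simp add: g_def G_def[abs_def])
  have fold: "foldr partial w g = G w" if "length w \<le> k" for w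
    using that
  proof (induction w)
    case Nil
    then show ?case by (simp add: gG)
  next
    case (Cons i w)
    then have "foldr partial (i # w) g = partial i (G w)" by simp
    also have "\<dots> = G (i # w)" using has_derivative_imp_partial[OF der[of w], of i] Cons.prems by (intro ext) simp
    finally show ?case .
  qed
  have "periodic g" using tfun_periodic[OF F] by (simp add: periodic_def g_def)
  then show "g \<in> Ck_torus k" using CG[of "[]" k] by (simp add: Ck_torus_def gG)
  show "\<And>w x n. length w \<le> k \<Longrightarrow> k \<le> n \<Longrightarrow> \<bar>pDs w (F n) t x - foldr partial w g x\<bar> \<le> (\<Sum>m. a (m + n))"
    using tail by (simp add: fold)
qed

text \<open>The type argument carries the dimension, which \<open>k\<close> does not
  determine.\<close>

definition mi_count :: "'d::finite itself \<Rightarrow> nat \<Rightarrow> real" where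
  "mi_count _ k = real (card {\<alpha> :: 'd \<Rightarrow> nat. mi_size \<alpha> \<le> k})"

lemma Ck_norm_le:
  fixes f :: "real ^ 'd::finite \<Rightarrow> real"
  assumes "\<And>w x. length w \<le> k \<Longrightarrow> \<bar>foldr partial w f x\<bar> \<le> B"
  shows "Ck_norm k f \<le> mi_count TYPE('d) k * B" "0 \<le> Ck_norm k f"
proof -
  have b: "\<bar>mi_deriv \<alpha> f x\<bar> \<le> B" if "mi_size \<alpha> \<le> k" for \<alpha> x
    using assms[of "mi_word \<alpha>" x] that by (simp add: mi_deriv_word length_mi_word)
  then show "Ck_norm k f \<le> mi_count TYPE('d) k * B"
    unfolding Ck_norm_def mi_count_def by (intro sum_bounded_above cSUP_least) auto
  show "0 \<le> Ck_norm k f" unfolding Ck_norm_def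
  proof (rule sum_nonneg)
    fix \<alpha> :: "'d \<Rightarrow> nat" assume "\<alpha> \<in> {\<alpha>. mi_size \<alpha> \<le> k}"
    then have "bdd_above (range (\<lambda>x. \<bar>mi_deriv \<alpha> f x\<bar>))" using b by (intro bdd_aboveI2[of _ _ B]) auto
    from cSUP_upper[OF _ this, of 0] show "0 \<le> (SUP x. \<bar>mi_deriv \<alpha> f x\<bar>)"
      by (intro order_trans[OF abs_ge_zero]) auto
  qed
qed

text \<open>The common bound \<open>M\<close> makes the ranges in \<open>Ck_norm\<close> bounded, so
  that their suprema can be compared through pointwise differences.\<close>

lemma Ck_norm_diff_le:
  fixes f g :: "real ^ 'd::finite \<Rightarrow> real"
  assumes d: "\<And>w x. length w \<le> k \<Longrightarrow> \<bar>foldr partial w f x - foldr partial w g x\<bar> \<le> B"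
    and b: "\<And>w x. length w \<le> k \<Longrightarrow> \<bar>foldr partial w f x\<bar> \<le> M" "\<And>w x. length w \<le> k \<Longrightarrow> \<bar>foldr partial w g x\<bar> \<le> M"
  shows "\<bar>Ck_norm k f - Ck_norm k g\<bar> \<le> mi_count TYPE('d) k * B"
proof -
  have S: "\<bar>(SUP x. \<bar>mi_deriv \<alpha> f x\<bar>) - (SUP x. \<bar>mi_deriv \<alpha> g x\<bar>)\<bar> \<le> B" if "mi_size \<alpha> \<le> k" for \<alpha>
  proof -
    have l: "length (mi_word \<alpha>) \<le> k" using that by (simp add: length_mi_word)
    have bd: "bdd_above (range (\<lambda>x. \<bar>mi_deriv \<alpha> f x\<bar>))" "bdd_above (range (\<lambda>x. \<bar>mi_deriv \<alpha> g x\<bar>))"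
      using b[OF l] by (auto intro!: bdd_aboveI2[of _ _ M] simp: mi_deriv_word)
    have "\<bar>mi_deriv \<alpha> f x\<bar> \<le> (SUP x. \<bar>mi_deriv \<alpha> g x\<bar>) + B" for x
      using cSUP_upper[OF _ bd(2), of x] d[OF l, of x] by (simp add: mi_deriv_word)
    then have 1: "(SUP x. \<bar>mi_deriv \<alpha> f x\<bar>) \<le> (SUP x. \<bar>mi_deriv \<alpha> g x\<bar>) + B" by (intro cSUP_least) auto
    have "\<bar>mi_deriv \<alpha> g x\<bar> \<le> (SUP x. \<bar>mi_deriv \<alpha> f x\<bar>) + B" for x
      using cSUP_upper[OF _ bd(1), of x] d[OF l, of x] by (simp add: mi_deriv_word)
    then have "(SUP x. \<bar>mi_deriv \<alpha> g x\<bar>) \<le> (SUP x. \<bar>mi_deriv \<alpha> f x\<bar>) + B" by (intro cSUP_least) auto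
    with 1 show ?thesis by linarith
  qed
  have "\<bar>Ck_norm k f - Ck_norm k g\<bar> \<le> (\<Sum>\<alpha> | mi_size \<alpha> \<le> k. \<bar>(SUP x. \<bar>mi_deriv \<alpha> f x\<bar>) - (SUP x. \<bar>mi_deriv \<alpha> g x\<bar>)\<bar>)"
    unfolding Ck_norm_def sum_subtractf[symmetric] by (rule sum_abs)
  also have "\<dots> \<le> mi_count TYPE('d) k * B"
    unfolding mi_count_def by (rule sum_bounded_above) (use S in auto)
  finally show ?thesis .
qed

section \<open>Approximation by step functions in time\<close>

lemma tfun_freeze: "tfun f \<Longrightarrow> tfun (\<lambda>t x. f \<tau> x)"
  by (induction rule: tfun.induct) (auto intro: tfun.intros)

lemma tfun_Lipschitz:
  assumes "tfun f"
  obtains M where "0 \<le> M" "\<And>s t x. 0 \<le> s \<Longrightarrow> s \<le> T \<Longrightarrow> 0 \<le> t \<Longrightarrow> t \<le> T \<Longrightarrow> \<bar>f s x - f t x\<bar> \<le> M * \<bar>s - t\<bar>"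
proof -
  obtain M where M: "0 \<le> M" "\<forall>t\<in>{0..T}. \<forall>x. \<bar>pT f t x\<bar> \<le> M"
    using tfun_bounded[OF tfun_pT[OF assms], of T] by blast
  have "\<bar>f s x - f t x\<bar> \<le> M * \<bar>s - t\<bar>" if "0 \<le> s" "s \<le> T" "0 \<le> t" "t \<le> T" for s t x
  proof -
    have "norm (f s x - f t x) \<le> M * norm (s - t)"
    proof (rule field_differentiable_bound[of "{0..T}" "\<lambda>t. f t x" "\<lambda>t. pT f t x"])
      show "((\<lambda>t. f t x) has_field_derivative pT f z x) (at z within {0..T})" for z
        using tfun_pT_has_deriv[OF assms] by (rule has_field_derivative_at_within)
    qed (use M that in auto)
    then show ?thesis by simp
  qed
  with M(1) show ?thesis by (rule that)
qed

lemma tfun_family_Lipschitz: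
  assumes "finite F" "\<And>f. f \<in> F \<Longrightarrow> tfun f"
  obtains M where "0 \<le> M"
    "\<And>f s t x. f \<in> F \<Longrightarrow> 0 \<le> s \<Longrightarrow> s \<le> T \<Longrightarrow> 0 \<le> t \<Longrightarrow> t \<le> T \<Longrightarrow> \<bar>f s x - f t x\<bar> \<le> M * \<bar>s - t\<bar>"
proof -
  have "\<forall>f\<in>F. \<exists>M\<ge>0. \<forall>s t x. 0 \<le> s \<and> s \<le> T \<and> 0 \<le> t \<and> t \<le> T \<longrightarrow> \<bar>f s x - f t x\<bar> \<le> M * \<bar>s - t\<bar>"
  proof
    fix f assume "f \<in> F"
    from assms(2)[OF this] obtain M where "0 \<le> M"
      "\<And>s t x. 0 \<le> s \<Longrightarrow> s \<le> T \<Longrightarrow> 0 \<le> t \<Longrightarrow> t \<le> T \<Longrightarrow> \<bar>f s x - f t x\<bar> \<le> M * \<bar>s - t\<bar>"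
      by (rule tfun_Lipschitz[where f=f and T=T]) blast
    then show "\<exists>M\<ge>0. \<forall>s t x. 0 \<le> s \<and> s \<le> T \<and> 0 \<le> t \<and> t \<le> T \<longrightarrow> \<bar>f s x - f t x\<bar> \<le> M * \<bar>s - t\<bar>" by blast
  qed
  from bchoice[OF this] obtain L where
    L: "\<forall>f\<in>F. 0 \<le> L f \<and> (\<forall>s t x. 0 \<le> s \<and> s \<le> T \<and> 0 \<le> t \<and> t \<le> T \<longrightarrow> \<bar>f s x - f t x\<bar> \<le> L f * \<bar>s - t\<bar>)"
    by blast
  show ?thesis
  proof (rule that[of "sum L F"])
    show "0 \<le> sum L F" using L by (intro sum_nonneg) auto
    fix f s t x assume h: "f \<in> F" "0 \<le> s" "s \<le> T" "0 \<le> t" "t \<le> T"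
    have "L f \<le> sum L F" using h L assms(1) by (intro member_le_sum) auto
    then have "L f * \<bar>s - t\<bar> \<le> sum L F * \<bar>s - t\<bar>" by (rule mult_right_mono) simp
    moreover have "\<bar>f s x - f t x\<bar> \<le> L f * \<bar>s - t\<bar>" using h L by blast
    ultimately show "\<bar>f s x - f t x\<bar> \<le> sum L F * \<bar>s - t\<bar>" by linarith
  qed
qed

text \<open>Rounds t down to the grid of mesh T/N. The end point T is itself a grid point, so [0,T]
  is mapped to N + 1 values.\<close>

definition tstep :: "real \<Rightarrow> nat \<Rightarrow> real \<Rightarrow> real" where
  "tstep T N t = of_int \<lfloor>real N * t / T\<rfloor> * T / real N"

lemma tstep_bounds:
  assumes "0 < T" "0 < N" "0 \<le> t" "t \<le> T"
  shows "0 \<le> tstep T N t" "tstep T N t \<le> T" "\<bar>tstep T N t - t\<bar> \<le> T / real N"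
proof -
  define y where "y = real N * t / T"
  have y0: "0 \<le> y" using assms by (simp add: y_def)
  have f: "of_int \<lfloor>y\<rfloor> \<le> y" "y < of_int \<lfloor>y\<rfloor> + 1" by linarith+
  have f0: "0 \<le> real_of_int \<lfloor>y\<rfloor>" using y0 by simp
  have ty: "t = y * (T / real N)" using assms by (simp add: y_def)
  have TN: "0 < T / real N" using assms by simp
  have e: "tstep T N t = of_int \<lfloor>y\<rfloor> * (T / real N)" by (simp add: tstep_def y_def)
  show "0 \<le> tstep T N t" unfolding e by (rule mult_nonneg_nonneg[OF f0 less_imp_le[OF TN]])
  have le: "tstep T N t \<le> t" unfolding e by (subst ty, intro mult_right_mono f) (use TN in simp)
  then show "tstep T N t \<le> T" using assms by simp
  have "t \<le> (of_int \<lfloor>y\<rfloor> + 1) * (T / real N)"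
    by (subst ty, intro mult_right_mono) (use f TN in auto)
  then have "t \<le> tstep T N t + T / real N" unfolding e by (simp only: distrib_right mult_1)
  then show "\<bar>tstep T N t - t\<bar> \<le> T / real N" using le by simp
qed

lemma tstep_uniform:
  assumes "0 < T" "finite F" "\<And>f. f \<in> F \<Longrightarrow> tfun f" "0 < e"
  obtains N where "0 < N" "\<And>f t x. f \<in> F \<Longrightarrow> 0 \<le> t \<Longrightarrow> t \<le> T \<Longrightarrow> \<bar>f (tstep T N t) x - f t x\<bar> \<le> e"
proof -
  obtain M where M: "0 \<le> M"
    "\<And>f s t x. f \<in> F \<Longrightarrow> 0 \<le> s \<Longrightarrow> s \<le> T \<Longrightarrow> 0 \<le> t \<Longrightarrow> t \<le> T \<Longrightarrow> \<bar>f s x - f t x\<bar> \<le> M * \<bar>s - t\<bar>"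
    using tfun_family_Lipschitz[where T=T, OF assms(2,3)] by blast
  obtain N0 :: nat where "M * T / e \<le> real N0" using real_arch_simple by blast
  then have N0: "M * T / e \<le> real (Suc N0)" by simp
  have "\<bar>f (tstep T (Suc N0) t) x - f t x\<bar> \<le> e" if "f \<in> F" "0 \<le> t" "t \<le> T" for f t x
  proof -
    note b = tstep_bounds[OF assms(1), of "Suc N0" t]
    have "\<bar>f (tstep T (Suc N0) t) x - f t x\<bar> \<le> M * \<bar>tstep T (Suc N0) t - t\<bar>"
      by (rule M(2)) (use b that in auto)
    also have "\<dots> \<le> M * (T / real (Suc N0))" using b that M(1) by (intro mult_left_mono) auto
    also have "\<dots> = M * T / real (Suc N0)" by simp
    also have "\<dots> \<le> e"
    proof (subst pos_divide_le_eq)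
      show "M * T \<le> e * real (Suc N0)" using N0 assms(4) by (simp only: pos_divide_le_eq mult.commute[of e])
    qed simp
    finally show ?thesis .
  qed
  then show ?thesis using that[of "Suc N0"] by simp
qed

text \<open>Sampling on a grid yields the simple functions of the definition of strong
  measurability. Level sets are preimages of sets of integers under a floor function, hence
  measurable for arbitrary \<open>H\<close>.\<close>

lemma simple_valued_tstep:
  assumes T: "0 < T" "0 < N" and X: "\<And>t. 0 \<le> t \<Longrightarrow> t \<le> T \<Longrightarrow> H t \<in> X"
  shows "simple_valued T X (\<lambda>t. H (tstep T N t))"
proof -
  have sub: "tstep T N ` {0..T} \<subseteq> (\<lambda>k. of_int k * T / real N) ` {0..int N}"
  proof
    fix s assume "s \<in> tstep T N ` {0..T}"
    then obtain t where t: "0 \<le> t" "t \<le> T" "s = tstep T N t" by auto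
    have "real N * t / T \<le> real N * T / T" using t T by (intro divide_right_mono mult_left_mono) auto
    then have "\<lfloor>real N * t / T\<rfloor> \<le> int N" using T by (simp add: floor_le_iff)
    moreover have "0 \<le> \<lfloor>real N * t / T\<rfloor>" using t T by simp
    ultimately show "s \<in> (\<lambda>k. of_int k * T / real N) ` {0..int N}"
      using t(3) by (auto simp: tstep_def intro!: image_eqI)
  qed
  have fin: "finite ((\<lambda>t. H (tstep T N t)) ` {0..T})"
    using finite_subset[OF sub] by (simp add: image_image[symmetric, of H "tstep T N"])
  have "{t \<in> {0..T}. H (tstep T N t) = v} \<in> sets lebesgue" for v
  proof -
    have m: "(\<lambda>t. \<lfloor>real N * t / T\<rfloor>) \<in> measurable borel (count_space UNIV)" by measurable
    have "{t. \<lfloor>real N * t / T\<rfloor> \<in> A} \<in> sets borel" for A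
      using measurable_sets[OF m, of A] by (simp add: vimage_def)
    then have "{0..T} \<inter> {t. \<lfloor>real N * t / T\<rfloor> \<in> {k. H (of_int k * T / real N) = v}} \<in> sets borel"
      by (intro sets.Int) auto
    also have "{0..T} \<inter> {t. \<lfloor>real N * t / T\<rfloor> \<in> {k. H (of_int k * T / real N) = v}} = {t \<in> {0..T}. H (tstep T N t) = v}"
      by (auto simp: tstep_def)
    finally show ?thesis by simp
  qed
  then show ?thesis unfolding simple_valued_def using fin X tstep_bounds[OF T] by auto
qed

subsection \<open>Weak formulation with a defect\<close>

lemma smooth_frechet:
  "smooth f \<Longrightarrow> b \<in> Basis \<Longrightarrow> smooth (\<lambda>x. frechet_derivative f (at x) b)"
  unfolding smooth_def by (metis C_k.simps(2))

text \<open>Test functions are smooth jointly in (t,x). Their derivatives along the basis vectors of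
  the product space are identified with \<open>pT\<close> and \<open>pD\<close>, which therefore
  remain smooth.\<close>

lemma spacetime_derivs:
  fixes \<phi> :: "real \<Rightarrow> real ^ 'd::finite \<Rightarrow> real"
  assumes s: "smooth (\<lambda>(t, x). \<phi> t x)"
  shows "((\<lambda>s. \<phi> s x) has_real_derivative pT \<phi> t x) (at t)"
    and "\<phi> t differentiable (at x)"
    and "smooth (\<lambda>(t, x). pT \<phi> t x)" and "smooth (\<lambda>(t, x). pD i \<phi> t x)" and "jcont \<phi>"
proof -
  define \<Phi> where "\<Phi> = (\<lambda>(t, x). \<phi> t x)"
  have C: "C_k 0 \<Phi>" "C_k (Suc 0) \<Phi>" using s unfolding smooth_def \<Phi>_def by blast+
  have c: "continuous_on UNIV \<Phi>" using C(1) by simp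
  have d: "\<Phi> differentiable (at z)" for z using C(2) unfolding C_k.simps by blast
  have D: "(\<Phi> has_derivative frechet_derivative \<Phi> (at z)) (at z)" for z
    using d frechet_derivative_works by blast
  have e: "\<Phi> (t, x) = \<phi> t x" for t x by (simp add: \<Phi>_def)
  have lin: "linear (frechet_derivative \<Phi> (at z))" for z by (rule linear_frechet_derivative[OF d])
  have T: "((\<lambda>s. \<phi> s x) has_real_derivative frechet_derivative \<Phi> (at (t, x)) (1, 0)) (at t)" for t x
  proof -
    have "((\<lambda>s. (s, x)) has_derivative (\<lambda>h. (h, 0))) (at t)"
      by (intro has_derivative_Pair has_derivative_ident has_derivative_const)
    from has_derivative_compose[OF this D, unfolded e]
    have d: "((\<lambda>s. \<phi> s x) has_derivative (\<lambda>h. frechet_derivative \<Phi> (at (t, x)) (h, 0))) (at t)" .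
    have eq: "(\<lambda>h. frechet_derivative \<Phi> (at (t, x)) (h, 0)) = (*) (frechet_derivative \<Phi> (at (t, x)) (1, 0))"
    proof
      fix h show "frechet_derivative \<Phi> (at (t, x)) (h, 0) = frechet_derivative \<Phi> (at (t, x)) (1, 0) * h"
        using linear_scale[OF lin, of "(t, x)" h "(1, 0)"] by simp
    qed
    show ?thesis using d unfolding has_field_derivative_def eq .
  qed
  have X: "(\<phi> t has_derivative (\<lambda>h. frechet_derivative \<Phi> (at (t, x)) (0, h))) (at x)" for t x
  proof -
    have "((\<lambda>y. (t, y)) has_derivative (\<lambda>h. (0, h))) (at x)"
      by (intro has_derivative_Pair has_derivative_ident has_derivative_const)
    from has_derivative_compose[OF this D, unfolded e] show ?thesis .
  qed
  have pT: "pT \<phi> t x = frechet_derivative \<Phi> (at (t, x)) (1, 0)" for t x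
    unfolding pT_def by (rule DERIV_imp_deriv[OF T])
  have pD: "pD i \<phi> t x = frechet_derivative \<Phi> (at (t, x)) (0, axis i 1)" for t x
    unfolding pD_def partial_def using frechet_derivative_at[OF X] by metis
  show "((\<lambda>s. \<phi> s x) has_real_derivative pT \<phi> t x) (at t)" unfolding pT by (rule T)
  show "\<phi> t differentiable (at x)" using X differentiableI by blast
  have B: "(1, 0) \<in> (Basis :: (real \<times> (real^'d)) set)" "(0, axis i 1) \<in> (Basis :: (real \<times> (real^'d)) set)"
    by (auto simp: Basis_prod_def axis_in_Basis_iff)
  have sm: "smooth \<Phi>" using s by (simp add: \<Phi>_def)
  have "(\<lambda>(t, x). pT \<phi> t x) = (\<lambda>z. frechet_derivative \<Phi> (at z) (1, 0))" by (auto simp: pT)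
  then show "smooth (\<lambda>(t, x). pT \<phi> t x)" using smooth_frechet[OF sm B(1)] by simp
  have "(\<lambda>(t, x). pD i \<phi> t x) = (\<lambda>z. frechet_derivative \<Phi> (at z) (0, axis i 1))" by (auto simp: pD)
  then show "smooth (\<lambda>(t, x). pD i \<phi> t x)" using smooth_frechet[OF sm B(2)] by simp
  show "jcont \<phi>" using c unfolding jcont_def \<Phi>_def by (simp add: case_prod_beta)
qed

lemma periodic_partial:
  fixes f :: "real ^ 'd::finite \<Rightarrow> real"
  assumes "periodic f" "\<And>x. f differentiable (at x)"
  shows "periodic (partial j f)"
  unfolding periodic_def
proof (intro allI)
  fix x i
  have e: "f (x + axis i 1 + s *\<^sub>R axis j 1) = f (x + s *\<^sub>R axis j 1)" for s
    using periodicD[OF assms(1), of "x + s *\<^sub>R axis j 1" i] by (simp add: add_ac)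
  have "((\<lambda>s. f (x + s *\<^sub>R axis j 1)) has_real_derivative partial j f (x + axis i 1)) (at 0)"
    using partial_dir_deriv[OF assms(2), of "x + axis i 1" j] unfolding e .
  then show "partial j f (x + axis i 1) = partial j f x"
    using partial_dir_deriv[OF assms(2), of x j] DERIV_unique by blast
qed

lemma spacetime_smooth_pD: "spacetime_smooth \<phi> \<Longrightarrow> spacetime_smooth (pD i \<phi>)"
  and spacetime_smooth_pT: "spacetime_smooth \<phi> \<Longrightarrow> spacetime_smooth (pT \<phi>)"
  and spacetime_smooth_jcont: "spacetime_smooth \<phi> \<Longrightarrow> jcont \<phi>"
proof -
  assume "spacetime_smooth \<phi>"
  then have s: "smooth (\<lambda>(t, x). \<phi> t x)" and p: "\<And>t. periodic (\<phi> t)" by (auto simp: spacetime_smooth_def)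
  show "spacetime_smooth (pD i \<phi>)"
    unfolding spacetime_smooth_def using spacetime_derivs(4)[OF s] periodic_partial[OF p spacetime_derivs(2)[OF s]]
    by (simp add: pD_def)
  show "spacetime_smooth (pT \<phi>)"
    unfolding spacetime_smooth_def using spacetime_derivs(3)[OF s] p by (simp add: periodic_def pT_def)
  show "jcont \<phi>" by (rule spacetime_derivs(5)[OF s])
qed

lemma spacetime_smooth_pDs: "spacetime_smooth \<phi> \<Longrightarrow> spacetime_smooth (pDs w \<phi>)"
  by (induction w) (auto intro: spacetime_smooth_pD)

lemma cell_by_parts_pD:
  assumes f: "tfun f" and \<phi>: "spacetime_smooth \<phi>"
  shows "integral cell (\<lambda>x. pD j f t x * \<phi> t x) = - integral cell (\<lambda>x. f t x * pD j \<phi> t x)"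
proof (rule integral_cell_by_parts[where j=j])
  have s: "smooth (\<lambda>(t, x). \<phi> t x)" and p: "periodic (\<phi> t)" using \<phi> by (auto simp: spacetime_smooth_def)
  show "periodic (f t)" "periodic (\<phi> t)" by (rule tfun_periodic[OF f], rule p)
  show "continuous_on UNIV (f t)" "continuous_on UNIV (pD j f t)"
    by (intro tfun_continuous_space tfun_pD f)+
  show "continuous_on UNIV (\<phi> t)" "continuous_on UNIV (pD j \<phi> t)"
    by (intro jcont_space spacetime_smooth_jcont spacetime_smooth_pD \<phi>)+
  show "((\<lambda>s. f t (x + s *\<^sub>R axis j 1)) has_real_derivative pD j f t x) (at 0)" for x
    by (rule tfun_dir_deriv[OF f])
  show "((\<lambda>s. \<phi> t (x + s *\<^sub>R axis j 1)) has_real_derivative pD j \<phi> t x) (at 0)" for x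
    unfolding pD_def by (rule partial_dir_deriv[OF spacetime_derivs(2)[OF s]])
qed

text \<open>Moving letters one at a time reverses the word. Derivatives are known to commute on
  \<open>f\<close>, a member of the algebra, so the reversal is undone there and not on the test
  function.\<close>

lemma cell_by_parts_pDs:
  assumes "tfun f" "spacetime_smooth \<phi>"
  shows "integral cell (\<lambda>x. pDs w f t x * \<phi> t x) = (-1) ^ length w * integral cell (\<lambda>x. f t x * pDs w \<phi> t x)"
proof -
  have "integral cell (\<lambda>x. pDs w f t x * \<phi> t x) = (-1) ^ length w * integral cell (\<lambda>x. f t x * pDs (rev w) \<phi> t x)"
    if "spacetime_smooth \<phi>" for w \<phi>
    using that
  proof (induction w arbitrary: \<phi>)
    case (Cons i w)
    have "integral cell (\<lambda>x. pDs (i # w) f t x * \<phi> t x) = - integral cell (\<lambda>x. pDs w f t x * pD i \<phi> t x)"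
      using cell_by_parts_pD[OF tfun_pDs[OF assms(1)] Cons.prems] by simp
    also have "\<dots> = - ((-1) ^ length w * integral cell (\<lambda>x. f t x * pDs (rev w) (pD i \<phi>) t x))"
      using Cons.IH[OF spacetime_smooth_pD[OF Cons.prems]] by simp
    finally show ?case by (simp add: pDs_append)
  qed simp
  from this[OF assms(2), of "rev w"] show ?thesis by (simp add: pDs_rev assms(1))
qed

lemma Lop_jcont: "spacetime_smooth \<phi> \<Longrightarrow> jcont (Lop m c \<phi>)"
  unfolding jcont_def Lop_def
  by (intro continuous_intros spacetime_smooth_jcont[OF spacetime_smooth_pDs, unfolded jcont_def])

lemma cell_by_parts_Lop:
  fixes c :: "('d::finite \<Rightarrow> nat) \<Rightarrow> real"
  assumes f: "tfun f" and \<phi>: "spacetime_smooth \<phi>"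
  shows "integral cell (\<lambda>x. Lop m c f t x * \<phi> t x) = integral cell (\<lambda>x. f t x * Lop m (adjoint_coeffs c) \<phi> t x)"
proof -
  let ?A = "{\<alpha> :: 'd \<Rightarrow> nat. mi_size \<alpha> \<le> m}"
  note cf = tfun_continuous_space[OF f] tfun_continuous_space[OF tfun_pDs[OF f]]
  note c\<phi> = jcont_space[OF spacetime_smooth_jcont[OF \<phi>]] jcont_space[OF spacetime_smooth_jcont[OF spacetime_smooth_pDs[OF \<phi>]]]
  have "integral cell (\<lambda>x. Lop m c f t x * \<phi> t x) = integral cell (\<lambda>x. \<Sum>\<alpha>\<in>?A. c \<alpha> * (pDs (mi_word \<alpha>) f t x * \<phi> t x))"
    by (simp add: Lop_def sum_distrib_right mult.assoc)
  also have "\<dots> = (\<Sum>\<alpha>\<in>?A. integral cell (\<lambda>x. c \<alpha> * (pDs (mi_word \<alpha>) f t x * \<phi> t x)))"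
    by (intro integral_sum finite_mi_size_le cell_integrable continuous_intros cf c\<phi>)
  also have "\<dots> = (\<Sum>\<alpha>\<in>?A. integral cell (\<lambda>x. adjoint_coeffs c \<alpha> * (f t x * pDs (mi_word \<alpha>) \<phi> t x)))"
  proof (rule sum.cong[OF refl])
    fix \<alpha>
    have "integral cell (\<lambda>x. c \<alpha> * (pDs (mi_word \<alpha>) f t x * \<phi> t x)) = c \<alpha> * integral cell (\<lambda>x. pDs (mi_word \<alpha>) f t x * \<phi> t x)"
      by (rule integral_mult_right)
    also have "\<dots> = adjoint_coeffs c \<alpha> * integral cell (\<lambda>x. f t x * pDs (mi_word \<alpha>) \<phi> t x)"
      by (simp add: cell_by_parts_pDs[OF f \<phi>] length_mi_word adjoint_coeffs_def)
    also have "\<dots> = integral cell (\<lambda>x. adjoint_coeffs c \<alpha> * (f t x * pDs (mi_word \<alpha>) \<phi> t x))"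
      by (rule integral_mult_right[symmetric])
    finally show "integral cell (\<lambda>x. c \<alpha> * (pDs (mi_word \<alpha>) f t x * \<phi> t x)) = \<dots>" .
  qed
  also have "\<dots> = integral cell (\<lambda>x. \<Sum>\<alpha>\<in>?A. adjoint_coeffs c \<alpha> * (f t x * pDs (mi_word \<alpha>) \<phi> t x))"
    by (intro integral_sum[symmetric] finite_mi_size_le cell_integrable continuous_intros cf c\<phi>)
  also have "\<dots> = integral cell (\<lambda>x. f t x * Lop m (adjoint_coeffs c) \<phi> t x)"
    by (simp add: Lop_def sum_distrib_left mult_ac)
  finally show ?thesis .
qed

definition iint :: "real \<Rightarrow> (real \<Rightarrow> real ^ 'd::finite \<Rightarrow> real) \<Rightarrow> real" where
  "iint T f = integral {0..T} (\<lambda>t. integral cell (f t))"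

lemma iint_add: "jcont f \<Longrightarrow> jcont g \<Longrightarrow> iint T (\<lambda>t x. f t x + g t x) = iint T f + iint T g"
proof -
  assume f: "jcont f" "jcont g"
  have "integral cell (\<lambda>x. f t x + g t x) = integral cell (f t) + integral cell (g t)" for t
    by (rule integral_add) (intro jcont_integrable f)+
  then show ?thesis unfolding iint_def
    by (simp, intro integral_add integrable_continuous_real jcont_integral f)
qed

text \<open>No boundary terms arise: \<open>f\<close> vanishes at time 0 and the test function at
  time T.\<close>

lemma iint_by_parts_time:
  assumes f: "tfun f" "\<And>x. f 0 x = 0" and \<phi>: "spacetime_smooth \<phi>" "\<And>x. \<phi> T x = 0" and T: "0 < T"
  shows "iint T (\<lambda>t x. pT f t x * \<phi> t x) = - iint T (\<lambda>t x. f t x * pT \<phi> t x)"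
proof -
  have s: "smooth (\<lambda>(t, x). \<phi> t x)" using \<phi> by (auto simp: spacetime_smooth_def)
  note j = jcont_tfun[OF f(1)] jcont_tfun[OF tfun_pT[OF f(1)]] spacetime_smooth_jcont[OF \<phi>(1)]
    spacetime_smooth_jcont[OF spacetime_smooth_pT[OF \<phi>(1)]]
  have jj: "jcont (\<lambda>t x. pT f t x * \<phi> t x)" "jcont (\<lambda>t x. f t x * pT \<phi> t x)" by (intro jcont_intros j)+
  have z: "integral {0..T} (\<lambda>t. pT f t x * \<phi> t x + f t x * pT \<phi> t x) = 0" for x
  proof -
    have "((\<lambda>t. pT f t x * \<phi> t x + f t x * pT \<phi> t x) has_integral f T x * \<phi> T x - f 0 x * \<phi> 0 x) {0..T}"
    proof (rule fundamental_theorem_of_calculus)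
      fix t
      have "((\<lambda>t. f t x * \<phi> t x) has_real_derivative pT f t x * \<phi> t x + f t x * pT \<phi> t x) (at t)"
        using DERIV_mult[OF tfun_pT_has_deriv[OF f(1)] spacetime_derivs(1)[OF s], where x=t] by (simp add: mult.commute)
      then show "((\<lambda>t. f t x * \<phi> t x) has_vector_derivative pT f t x * \<phi> t x + f t x * pT \<phi> t x) (at t within {0..T})"
        by (simp add: has_real_derivative_iff_has_vector_derivative has_vector_derivative_at_within)
    qed (use T in simp)
    then show ?thesis using f(2) \<phi>(2) by (simp add: integral_unique)
  qed
  have "iint T (\<lambda>t x. pT f t x * \<phi> t x + f t x * pT \<phi> t x) =
     integral (cbox 0 T) (\<lambda>t. integral cell (\<lambda>x. pT f t x * \<phi> t x + f t x * pT \<phi> t x))"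
    by (simp add: iint_def)
  also have "\<dots> = integral cell (\<lambda>x. integral (cbox 0 T) (\<lambda>t. pT f t x * \<phi> t x + f t x * pT \<phi> t x))"
  proof (rule integral_swap_continuous)
    have "jcont (\<lambda>t x. pT f t x * \<phi> t x + f t x * pT \<phi> t x)" by (intro jcont_intros j)
    then show "continuous_on (cbox (0, 0) (T, 1)) (\<lambda>(t, x). pT f t x * \<phi> t x + f t x * pT \<phi> t x)"
      unfolding jcont_def by (auto simp: case_prod_beta intro: continuous_on_subset)
  qed
  also have "\<dots> = 0" using z by simp
  finally show ?thesis using iint_add[OF jj] by simp
qed

text \<open>The defect equation tested with \<phi> and integrated by parts. There is no initial term
  because \<rho> vanishes at time 0.\<close>

lemma defect_weak_form:
  fixes c :: "('d::finite \<Rightarrow> nat) \<Rightarrow> real"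
  assumes inv: "defect_eq m c \<rho> U R" and T: "0 < T"
    and \<phi>: "spacetime_smooth \<phi>" "\<And>x. \<phi> T x = 0"
  shows "iint T (\<lambda>t x. \<rho> t x * (pT \<phi> t x + Lop m (adjoint_coeffs c) \<phi> t x) + (\<Sum>k\<in>UNIV. (\<rho> t x * U k t x) * pD k \<phi> t x)) =
    iint T (\<lambda>t x. \<Sum>k\<in>UNIV. R k t x * pD k \<phi> t x)"
proof -
  have t: "tfun \<rho>" "\<And>k. tfun (U k)" "\<And>k. tfun (R k)" "\<And>x. \<rho> 0 x = 0" using inv by (auto simp: defect_eq_def)
  have eq: "pT \<rho> t x = Lop m c \<rho> t x + (\<Sum>k\<in>UNIV. pD k (R k) t x) - (\<Sum>k\<in>UNIV. pD k (\<lambda>t x. \<rho> t x * U k t x) t x)" for t x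
  proof -
    have "pT \<rho> t x - Lop m c \<rho> t x + (\<Sum>k\<in>UNIV. pD k (\<lambda>t x. \<rho> t x * U k t x) t x) = (\<Sum>k\<in>UNIV. pD k (R k) t x)"
      using inv unfolding defect_eq_def by blast
    then show ?thesis by linarith
  qed
  have tU: "tfun (\<lambda>t x. \<rho> t x * U k t x)" for k by (intro tfun.mult t)
  note j\<phi> = spacetime_smooth_jcont[OF \<phi>(1)] spacetime_smooth_jcont[OF spacetime_smooth_pT[OF \<phi>(1)]]
    spacetime_smooth_jcont[OF spacetime_smooth_pD[OF \<phi>(1)]] Lop_jcont[OF \<phi>(1)]
  have jsum: "jcont (\<lambda>t x. \<Sum>k\<in>UNIV. f k t x * pD k \<phi> t x)" if "\<And>k. tfun (f k)" for f :: "'d \<Rightarrow> real \<Rightarrow> real ^ 'd \<Rightarrow> real"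
  proof -
    have "jcont (\<lambda>t x. f k t x * pD k \<phi> t x)" for k by (rule jcont_intros(4)[OF jcont_tfun[OF that] j\<phi>(3)])
    then show ?thesis unfolding jcont_def by (intro continuous_on_sum)
  qed
  note cs = jcont_space[OF j\<phi>(1)] jcont_space[OF j\<phi>(3)] jcont_space[OF j\<phi>(4)]
  have divparts: "integral cell (\<lambda>x. (\<Sum>k\<in>UNIV. pD k (f k) t x) * \<phi> t x) = - integral cell (\<lambda>x. \<Sum>k\<in>UNIV. f k t x * pD k \<phi> t x)"
    if f: "\<And>k. tfun (f k)" for f :: "'d \<Rightarrow> real \<Rightarrow> real ^ 'd \<Rightarrow> real" and t
  proof -
    have cf: "continuous_on UNIV (f k t)" "continuous_on UNIV (pD k (f k) t)" for k
      by (intro tfun_continuous_space tfun_pD f)+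
    have "integral cell (\<lambda>x. (\<Sum>k\<in>UNIV. pD k (f k) t x) * \<phi> t x) = (\<Sum>k\<in>UNIV. integral cell (\<lambda>x. pD k (f k) t x * \<phi> t x))"
      unfolding sum_distrib_right
      by (intro integral_sum cell_integrable continuous_intros cs cf) simp
    also have "\<dots> = (\<Sum>k\<in>UNIV. - integral cell (\<lambda>x. f k t x * pD k \<phi> t x))"
      by (intro sum.cong refl cell_by_parts_pD f \<phi>)
    also have "\<dots> = - integral cell (\<lambda>x. \<Sum>k\<in>UNIV. f k t x * pD k \<phi> t x)"
      unfolding sum_negf
      by (subst integral_sum) (auto intro!: cell_integrable continuous_intros cs cf)
    finally show ?thesis .
  qed
  have main: "integral cell (\<lambda>x. pT \<rho> t x * \<phi> t x) = integral cell (\<lambda>x. \<rho> t x * Lop m (adjoint_coeffs c) \<phi> t x)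
     - integral cell (\<lambda>x. \<Sum>k\<in>UNIV. R k t x * pD k \<phi> t x) + integral cell (\<lambda>x. \<Sum>k\<in>UNIV. (\<rho> t x * U k t x) * pD k \<phi> t x)" for t
  proof -
    have c1: "continuous_on UNIV (\<lambda>x. Lop m c \<rho> t x * \<phi> t x)"
      "continuous_on UNIV (\<lambda>x. (\<Sum>k\<in>UNIV. pD k (R k) t x) * \<phi> t x)"
      "continuous_on UNIV (\<lambda>x. (\<Sum>k\<in>UNIV. pD k (\<lambda>t x. \<rho> t x * U k t x) t x) * \<phi> t x)"
      by (intro continuous_intros cs tfun_continuous_space tfun_pD tfun_Lop tU t)+
    have "integral cell (\<lambda>x. pT \<rho> t x * \<phi> t x) = integral cell (\<lambda>x. Lop m c \<rho> t x * \<phi> t x +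
        (\<Sum>k\<in>UNIV. pD k (R k) t x) * \<phi> t x - (\<Sum>k\<in>UNIV. pD k (\<lambda>t x. \<rho> t x * U k t x) t x) * \<phi> t x)"
      unfolding eq by (simp add: algebra_simps)
    also have "\<dots> = integral cell (\<lambda>x. Lop m c \<rho> t x * \<phi> t x + (\<Sum>k\<in>UNIV. pD k (R k) t x) * \<phi> t x) -
       integral cell (\<lambda>x. (\<Sum>k\<in>UNIV. pD k (\<lambda>t x. \<rho> t x * U k t x) t x) * \<phi> t x)"
      by (rule integral_diff) (intro cell_integrable continuous_on_add c1)+
    also have "integral cell (\<lambda>x. Lop m c \<rho> t x * \<phi> t x + (\<Sum>k\<in>UNIV. pD k (R k) t x) * \<phi> t x) =
      integral cell (\<lambda>x. Lop m c \<rho> t x * \<phi> t x) + integral cell (\<lambda>x. (\<Sum>k\<in>UNIV. pD k (R k) t x) * \<phi> t x)"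
      by (rule integral_add) (intro cell_integrable c1)+
    finally show ?thesis
      unfolding divparts[OF t(3)] divparts[OF tU] cell_by_parts_Lop[OF t(1) \<phi>(1)] by simp
  qed
  define a where "a = (\<lambda>t x. \<rho> t x * pT \<phi> t x)"
  define b where "b = (\<lambda>t x. \<rho> t x * Lop m (adjoint_coeffs c) \<phi> t x)"
  define r where "r = (\<lambda>t x. \<Sum>k\<in>UNIV. R k t x * pD k \<phi> t x)"
  define v where "v = (\<lambda>t x. \<Sum>k\<in>UNIV. (\<rho> t x * U k t x) * pD k \<phi> t x)"
  have j: "jcont a" "jcont b" "jcont r" "jcont v"
    unfolding a_def b_def r_def v_def
    by (rule jcont_intros(4)[OF jcont_tfun[OF t(1)] j\<phi>(2)], rule jcont_intros(4)[OF jcont_tfun[OF t(1)] j\<phi>(4)],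
        rule jsum[OF t(3)], rule jsum[OF tU])
  have i: "(\<lambda>t. integral cell (f t)) integrable_on {0..T}" if "jcont f" for f :: "real \<Rightarrow> real ^ 'd \<Rightarrow> real"
    by (intro integrable_continuous_real jcont_integral that)
  have "iint T (\<lambda>t x. pT \<rho> t x * \<phi> t x) = integral {0..T} (\<lambda>t. integral cell (b t) - integral cell (r t) + integral cell (v t))"
    unfolding iint_def main b_def r_def v_def ..
  also have "\<dots> = integral {0..T} (\<lambda>t. integral cell (b t) - integral cell (r t)) + iint T v"
    unfolding iint_def by (intro integral_add integrable_diff i j)
  also have "integral {0..T} (\<lambda>t. integral cell (b t) - integral cell (r t)) = iint T b - iint T r"
    unfolding iint_def by (intro integral_diff i j)
  finally have 1: "- iint T a = iint T b - iint T r + iint T v"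
    using iint_by_parts_time[OF t(1,4) \<phi> T] by (simp add: a_def)
  have "iint T (\<lambda>t x. (a t x + b t x) + v t x) = iint T a + iint T b + iint T v"
    by (simp only: iint_add j jcont_intros)
  then show ?thesis using 1 by (simp add: a_def b_def v_def r_def distrib_left)
qed

lemma jcont_bounded:
  assumes "jcont f"
  obtains B where "0 \<le> B" "\<And>t x. 0 \<le> t \<Longrightarrow> t \<le> T \<Longrightarrow> x \<in> cell \<Longrightarrow> \<bar>f t x\<bar> \<le> B"
proof -
  have "bounded ((\<lambda>z. f (fst z) (snd z)) ` ({0..T} \<times> cell))"
    by (intro compact_imp_bounded compact_continuous_image compact_Times)
       (auto intro: continuous_on_subset[OF assms[unfolded jcont_def]])
  then obtain B where B: "\<forall>y\<in>(\<lambda>z. f (fst z) (snd z)) ` ({0..T} \<times> cell). norm y \<le> B"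
    unfolding bounded_iff by blast
  have "\<bar>f t x\<bar> \<le> max 0 B" if "0 \<le> t" "t \<le> T" "x \<in> cell" for t x
  proof -
    have "f t x \<in> (\<lambda>z. f (fst z) (snd z)) ` ({0..T} \<times> cell)"
      by (rule image_eqI[of _ _ "(t, x)"]) (use that in auto)
    with B have "norm (f t x) \<le> B" by (rule bspec)
    then show ?thesis by simp
  qed
  then show ?thesis using that[of "max 0 B"] by simp
qed

lemma iint_abs_le:
  fixes f g :: "real \<Rightarrow> real ^ 'd::finite \<Rightarrow> real"
  assumes "jcont f" "jcont g" and B: "0 \<le> B" "\<And>t x. 0 \<le> t \<Longrightarrow> t \<le> T \<Longrightarrow> x \<in> cell \<Longrightarrow> \<bar>g t x\<bar> \<le> B"
  shows "\<bar>iint T (\<lambda>t x. f t x * g t x)\<bar> \<le> n1 T f * B"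
proof -
  have j: "jcont (\<lambda>t x. f t x * g t x)" by (intro jcont_intros assms)
  have "\<bar>integral cell (\<lambda>x. f t x * g t x)\<bar> \<le> integral cell (\<lambda>x. \<bar>f t x\<bar>) * B" if t: "0 \<le> t" "t \<le> T" for t
  proof -
    have "\<bar>integral cell (\<lambda>x. f t x * g t x)\<bar> \<le> integral cell (\<lambda>x. \<bar>f t x\<bar> * B)"
    proof (rule integral_norm_bound_integral[where 'a=real and 'n="real^'d", simplified real_norm_def])
      show "\<bar>f t x * g t x\<bar> \<le> \<bar>f t x\<bar> * B" if "x \<in> cell" for x
        using B(2)[OF t that] by (simp add: abs_mult mult_left_mono)
    qed (intro jcont_integrable j cell_integrable continuous_intros jcont_space assms)+
    then show ?thesis by simp
  qed
  then have "\<bar>iint T (\<lambda>t x. f t x * g t x)\<bar> \<le> integral {0..T} (\<lambda>t. integral cell (\<lambda>x. \<bar>f t x\<bar>) * B)"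
    unfolding iint_def
    by (intro integral_norm_bound_integral[where 'a=real and 'n=real, simplified real_norm_def] integrable_continuous_real jcont_integral j
       integrable_on_mult_left n1_integrable assms) auto
  then show ?thesis by (simp add: n1_def)
qed

subsection \<open>Integration over space-time\<close>

abbreviation slab :: "real \<Rightarrow> (real \<times> (real ^ 'd::finite)) set" where
  "slab T \<equiv> {0..T} \<times> cell"

lemma slab_cbox: "slab T = cbox (0, 0) (T, 1)"
  by (simp add: cbox_Pair_eq)

lemma slab_borel [measurable]: "slab T \<in> sets borel"
  unfolding slab_cbox by simp

lemma jcont_borel: "jcont f \<Longrightarrow> (\<lambda>z. f (fst z) (snd z)) \<in> borel_measurable borel"
  unfolding jcont_def by (rule borel_measurable_continuous_onI)

lemma jcont_slab:
  fixes f :: "real \<Rightarrow> real ^ 'd::finite \<Rightarrow> real"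
  assumes "jcont f"
  shows "integrable lborel (\<lambda>z. indicator (slab T) z * f (fst z) (snd z))"
    and "(LINT z|lborel. indicator (slab T) z * f (fst z) (snd z)) = iint T f"
proof -
  have c: "continuous_on (cbox (0, 0) (T, 1)) (\<lambda>z. f (fst z) (snd z))"
    using assms unfolding jcont_def by (rule continuous_on_subset) simp
  have i: "set_integrable lborel (cbox (0, 0) (T, 1)) (\<lambda>z. f (fst z) (snd z))"
    unfolding set_integrable_def by (rule borel_integrable_compact[OF compact_cbox c])
  then show "integrable lborel (\<lambda>z. indicator (slab T) z * f (fst z) (snd z))"
    unfolding set_integrable_def slab_cbox by simp
  have "(LINT z:cbox (0, 0) (T, 1)|lborel. f (fst z) (snd z)) = integral (cbox (0, 0) (T, 1)) (\<lambda>z. f (fst z) (snd z))"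
    by (rule set_borel_integral_eq_integral(2)[OF i])
  also have "\<dots> = iint T f" unfolding integral_prod_continuous[OF c] iint_def by simp
  finally show "(LINT z|lborel. indicator (slab T) z * f (fst z) (snd z)) = iint T f"
    unfolding set_lebesgue_integral_def slab_cbox by simp
qed

lemma n1_slab: "jcont f \<Longrightarrow> (LINT z|lborel. indicator (slab T) z * \<bar>f (fst z) (snd z)\<bar>) = n1 T f"
  and n1_slab_integrable: "jcont f \<Longrightarrow> integrable lborel (\<lambda>z. indicator (slab T) z * \<bar>f (fst z) (snd z)\<bar>)"
  for f :: "real \<Rightarrow> real ^ 'd::finite \<Rightarrow> real"
  using jcont_slab[OF jcont_intros(5), of f T] by (simp_all add: iint_def n1_def)

text \<open>Summable increments provide an integrable majorant, the modulus of the first function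
  plus the sum of all increments. Dominated convergence then turns convergence almost everywhere
  into convergence of the integrals, also against continuous weights, which are bounded on the
  slab.\<close>

lemma slab_L1_limit:
  fixes f :: "nat \<Rightarrow> real \<Rightarrow> real ^ 'd::finite \<Rightarrow> real"
  assumes f: "\<And>n. jcont (f n)" and s: "summable (\<lambda>n. n1 T (\<lambda>t x. f (Suc n) t x - f n t x))"
    and F: "(\<lambda>z. F (fst z) (snd z)) \<in> borel_measurable borel"
    and lim: "AE z in lborel. z \<in> slab T \<longrightarrow> (\<lambda>n. f n (fst z) (snd z)) \<longlonglongrightarrow> F (fst z) (snd z)"
  shows "integrable lborel (\<lambda>z. indicator (slab T) z * F (fst z) (snd z))"
    and "\<And>\<psi>. jcont \<psi> \<Longrightarrow> integrable lborel (\<lambda>z. indicator (slab T) z * (F (fst z) (snd z) * \<psi> (fst z) (snd z)))"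
    and "\<And>\<psi>. jcont \<psi> \<Longrightarrow> (\<lambda>n. iint T (\<lambda>t x. f n t x * \<psi> t x)) \<longlonglongrightarrow>
          (LINT z|lborel. indicator (slab T) z * (F (fst z) (snd z) * \<psi> (fst z) (snd z)))"
    and "(\<lambda>n. n1 T (f n)) \<longlonglongrightarrow> (LINT z|lborel. indicator (slab T) z * \<bar>F (fst z) (snd z)\<bar>)"
proof -
  let ?I = "\<lambda>z. indicator (slab T) z :: real"
  define d where "d n z = ?I z * \<bar>f (Suc n) (fst z) (snd z) - f n (fst z) (snd z)\<bar>" for n z
  have jd: "jcont (\<lambda>t x. f (Suc n) t x - f n t x)" for n
    using f unfolding jcont_def by (intro continuous_intros)
  have di: "integrable lborel (d n)" "integral\<^sup>L lborel (d n) = n1 T (\<lambda>t x. f (Suc n) t x - f n t x)" for n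
    using n1_slab_integrable[OF jd] n1_slab[OF jd] by (simp_all add: d_def[abs_def])
  have d0: "0 \<le> d n z" for n z by (simp add: d_def)
  have sd: "summable (\<lambda>n. integral\<^sup>L lborel (d n))" using s by (simp add: di)
  note D = AE_summable_of_integrals[OF di(1) d0 sd]
  define w where "w z = ?I z * \<bar>f 0 (fst z) (snd z)\<bar> + (\<Sum>n. d n z)" for z
  have wi: "integrable lborel w"
    unfolding w_def by (rule Bochner_Integration.integrable_add[OF n1_slab_integrable[OF f] D(2)])
  have dom: "\<bar>?I z * f n (fst z) (snd z)\<bar> \<le> w z" if z: "summable (\<lambda>n. d n z)" for n z
  proof -
    have "\<bar>?I z * f n (fst z) (snd z)\<bar> \<le> ?I z * \<bar>f 0 (fst z) (snd z)\<bar> + (\<Sum>m<n. d m z)" for n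
    proof (induction n)
      case (Suc n)
      have "\<bar>?I z * f (Suc n) (fst z) (snd z)\<bar> \<le> \<bar>?I z * f n (fst z) (snd z)\<bar> + d n z"
        by (auto simp: d_def indicator_def)
      with Suc show ?case by simp
    qed (simp add: abs_mult)
    also have "(\<Sum>m<n. d m z) \<le> (\<Sum>m. d m z)" using d0 by (intro sum_le_suminf z) auto
    finally show ?thesis by (simp add: w_def)
  qed
  have fm: "(\<lambda>z. f n (fst z) (snd z)) \<in> borel_measurable borel" for n by (rule jcont_borel[OF f])
  have Flim: "AE z in lborel. (\<lambda>n. ?I z * f n (fst z) (snd z)) \<longlonglongrightarrow> ?I z * F (fst z) (snd z)"
    using lim
  proof eventually_elim
    case (elim z)
    then show ?case by (cases "z \<in> slab T") (auto intro: tendsto_mult_left)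
  qed
  have Fdom: "AE z in lborel. \<bar>?I z * F (fst z) (snd z)\<bar> \<le> w z"
    using Flim D(1)
  proof eventually_elim
    case (elim z)
    show ?case
      by (rule LIMSEQ_le_const2[OF tendsto_rabs[OF elim(1)]]) (use dom[OF elim(2)] in blast)
  qed
  have IFm: "(\<lambda>z. ?I z * F (fst z) (snd z)) \<in> borel_measurable lborel"
    using F by (intro borel_measurable_times borel_measurable_indicator) auto
  show "integrable lborel (\<lambda>z. ?I z * F (fst z) (snd z))"
    by (rule Bochner_Integration.integrable_bound[OF wi IFm])
       (use Fdom in \<open>eventually_elim, simp\<close>)
  have Fm': "(\<lambda>z. F (fst z) (snd z)) \<in> borel_measurable lborel" using F by simp
  have Im: "?I \<in> borel_measurable lborel" by (intro borel_measurable_indicator) simp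
  {
    fix \<psi> :: "real \<Rightarrow> real ^ 'd \<Rightarrow> real" assume \<psi>: "jcont \<psi>"
    obtain B where B: "0 \<le> B" "\<And>t x. 0 \<le> t \<Longrightarrow> t \<le> T \<Longrightarrow> x \<in> cell \<Longrightarrow> \<bar>\<psi> t x\<bar> \<le> B"
      using jcont_bounded[OF \<psi>, of T] by blast
    have \<psi>m: "(\<lambda>z. \<psi> (fst z) (snd z)) \<in> borel_measurable lborel" using jcont_borel[OF \<psi>] by simp
    have bd: "\<bar>?I z * (v * \<psi> (fst z) (snd z))\<bar> \<le> B * W" if "\<bar>?I z * v\<bar> \<le> W" for z v W
    proof (cases "z \<in> slab T")
      case True
      then have "\<bar>\<psi> (fst z) (snd z)\<bar> \<le> B" using B(2)[of "fst z" "snd z"] by auto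
      then have "\<bar>v\<bar> * \<bar>\<psi> (fst z) (snd z)\<bar> \<le> W * B" using True that B(1) by (intro mult_mono) auto
      then show ?thesis using True by (simp add: abs_mult mult.commute)
    next
      case False
      then show ?thesis using that B(1) by simp
    qed
    have m1: "(\<lambda>z. ?I z * (f n (fst z) (snd z) * \<psi> (fst z) (snd z))) \<in> borel_measurable lborel" for n
      using fm[of n] by (intro borel_measurable_times Im \<psi>m) simp
    have m2: "(\<lambda>z. ?I z * (F (fst z) (snd z) * \<psi> (fst z) (snd z))) \<in> borel_measurable lborel"
      by (intro borel_measurable_times Im \<psi>m Fm')
    have wB: "integrable lborel (\<lambda>z. B * w z)" using wi by (rule integrable_mult_right)
    show "integrable lborel (\<lambda>z. ?I z * (F (fst z) (snd z) * \<psi> (fst z) (snd z)))"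
    proof (rule Bochner_Integration.integrable_bound[OF wB m2])
      show "AE z in lborel. norm (?I z * (F (fst z) (snd z) * \<psi> (fst z) (snd z))) \<le> norm (B * w z)"
        using Fdom by eventually_elim (use bd in \<open>auto intro: order_trans[OF _ abs_ge_self]\<close>)
    qed
    have "(\<lambda>n. LINT z|lborel. ?I z * (f n (fst z) (snd z) * \<psi> (fst z) (snd z))) \<longlonglongrightarrow>
      (LINT z|lborel. ?I z * (F (fst z) (snd z) * \<psi> (fst z) (snd z)))"
    proof (rule integral_dominated_convergence[OF m2 m1 wB])
      show "AE z in lborel. (\<lambda>n. ?I z * (f n (fst z) (snd z) * \<psi> (fst z) (snd z))) \<longlonglongrightarrow> ?I z * (F (fst z) (snd z) * \<psi> (fst z) (snd z))"
        using Flim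
      proof eventually_elim
        case (elim z)
        from tendsto_mult_right[OF this, of "\<psi> (fst z) (snd z)"] show ?case by (simp add: mult.assoc)
      qed
      show "AE z in lborel. norm (?I z * (f n (fst z) (snd z) * \<psi> (fst z) (snd z))) \<le> B * w z" for n
        using D(1) by eventually_elim (use bd dom in simp)
    qed
    moreover have "jcont (\<lambda>t x. f n t x * \<psi> t x)" for n by (rule jcont_intros(4)[OF f \<psi>])
    ultimately show "(\<lambda>n. iint T (\<lambda>t x. f n t x * \<psi> t x)) \<longlonglongrightarrow>
          (LINT z|lborel. indicator (slab T) z * (F (fst z) (snd z) * \<psi> (fst z) (snd z)))"
      using jcont_slab(2)[of "\<lambda>t x. f _ t x * \<psi> t x" T] by simp
  }
  have "(\<lambda>n. LINT z|lborel. ?I z * \<bar>f n (fst z) (snd z)\<bar>) \<longlonglongrightarrow> (LINT z|lborel. ?I z * \<bar>F (fst z) (snd z)\<bar>)"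
  proof (rule integral_dominated_convergence[OF _ _ wi])
    show "(\<lambda>z. ?I z * \<bar>f n (fst z) (snd z)\<bar>) \<in> borel_measurable lborel" for n
      using fm[of n] by (intro borel_measurable_times Im borel_measurable_abs) simp
    show "(\<lambda>z. ?I z * \<bar>F (fst z) (snd z)\<bar>) \<in> borel_measurable lborel"
      by (intro borel_measurable_times Im borel_measurable_abs Fm')
    show "AE z in lborel. (\<lambda>n. ?I z * \<bar>f n (fst z) (snd z)\<bar>) \<longlonglongrightarrow> ?I z * \<bar>F (fst z) (snd z)\<bar>"
      using Flim
    proof eventually_elim
      case (elim z)
      from tendsto_rabs[OF this] show ?case by (simp add: abs_mult)
    qed
    show "AE z in lborel. norm (?I z * \<bar>f n (fst z) (snd z)\<bar>) \<le> w z" for n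
      using D(1) by eventually_elim (use dom in \<open>simp add: abs_mult\<close>)
  qed
  then show "(\<lambda>n. n1 T (f n)) \<longlonglongrightarrow> (LINT z|lborel. indicator (slab T) z * \<bar>F (fst z) (snd z)\<bar>)"
    by (simp add: n1_slab[OF f])
qed

text \<open>Fubini, in the form that links the iterated integrals over \<open>lebesgue\<close> in
  the definition of weak solutions to a single integral over \<open>lborel\<close>, where the limits
  are taken.\<close>

lemma iterated_integral_slab:
  fixes G :: "real \<Rightarrow> real ^ 'd::finite \<Rightarrow> real"
  assumes G: "(\<lambda>z. G (fst z) (snd z)) \<in> borel_measurable borel"
    and i: "integrable lborel (\<lambda>z. indicator (slab T) z * G (fst z) (snd z))"
  shows "(LINT t:{0..T}|lebesgue. LINT x:cell|lebesgue. G t x) = (LINT z|lborel. indicator (slab T) z * G (fst z) (snd z))"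
proof -
  have GP: "(\<lambda>z. G (fst z) (snd z)) \<in> borel_measurable (borel \<Otimes>\<^sub>M borel)"
    using G by (simp add: borel_prod)
  have sl: "G t \<in> borel_measurable borel" for t
    using measurable_compose[OF measurable_Pair1' GP, of t] by simp
  have inner: "(LINT x:cell|lebesgue. G t x) = (LINT x|lborel. indicator cell x * G t x)" for t
    unfolding set_lebesgue_integral_def
    by (subst integral_completion) (use sl in \<open>auto intro!: borel_measurable_times borel_measurable_indicator\<close>)
  have IGP: "(\<lambda>z. indicator cell (snd z) * G (fst z) (snd z)) \<in> borel_measurable (borel \<Otimes>\<^sub>M borel)"
  proof (intro borel_measurable_times GP)
    show "(\<lambda>z. indicator cell (snd z) :: real) \<in> borel_measurable (borel \<Otimes>\<^sub>M borel)"
      by (rule measurable_compose[OF measurable_snd]) (intro borel_measurable_indicator, simp)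
  qed
  have om: "(\<lambda>t. LINT x|lborel. indicator cell x * G t x) \<in> borel_measurable borel"
    by (rule lborel.borel_measurable_lebesgue_integral) (use IGP in \<open>simp add: case_prod_beta cong: measurable_cong_sets\<close>)
  have "(LINT t:{0..T}|lebesgue. LINT x:cell|lebesgue. G t x) = (LINT t|lborel. indicator {0..T} t * (LINT x|lborel. indicator cell x * G t x))"
    unfolding inner unfolding set_lebesgue_integral_def
    by (subst integral_completion) (use om in \<open>auto intro!: borel_measurable_times borel_measurable_indicator\<close>)
  also have "\<dots> = (LINT t|lborel. LINT x|lborel. indicator (slab T) (t, x) * G t x)"
    by (simp add: indicator_times mult.assoc)
  also have "\<dots> = (LINT z|(lborel \<Otimes>\<^sub>M lborel). indicator (slab T) z * G (fst z) (snd z))"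
    using lborel_pair.integral_fst'[of "\<lambda>z. indicator (slab T) z * G (fst z) (snd z)"] i by (simp add: lborel_prod)
  finally show ?thesis by (simp add: lborel_prod)
qed

lemma AE_lborel_fst:
  fixes P :: "real \<Rightarrow> bool"
  assumes "AE t in lborel. P t" and "{t. P t} \<in> sets borel"
  shows "AE z in (lborel :: (real \<times> (real ^ 'd::finite)) measure). P (fst z)"
proof -
  have "AE z in lborel \<Otimes>\<^sub>M (lborel :: (real ^ 'd) measure). P (fst z)"
  proof (rule lborel_pair.AE_pair_measure)
    have "fst -` {t. P t} \<inter> space (lborel \<Otimes>\<^sub>M (lborel :: (real ^ 'd) measure)) \<in> sets (lborel \<Otimes>\<^sub>M (lborel :: (real ^ 'd) measure))"
      by (rule measurable_sets[OF measurable_fst]) (use assms(2) in simp)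
    also have "fst -` {t. P t} \<inter> space (lborel \<Otimes>\<^sub>M (lborel :: (real ^ 'd) measure)) =
       {z \<in> space (lborel \<Otimes>\<^sub>M (lborel :: (real ^ 'd) measure)). P (fst z)}" by auto
    finally show "{z \<in> space (lborel \<Otimes>\<^sub>M (lborel :: (real ^ 'd) measure)). P (fst z)} \<in> sets (lborel \<Otimes>\<^sub>M lborel)" .
    show "AE t in lborel. AE x in (lborel :: (real ^ 'd) measure). P (fst (t, x))" using assms(1) by eventually_elim simp
  qed
  then show ?thesis unfolding lborel_prod .
qed

lemma L1_spacetime_real:
  fixes F :: "real \<Rightarrow> real ^ 'd::finite \<Rightarrow> real"
  assumes "\<And>t. periodic (F t)" "(\<lambda>z. F (fst z) (snd z)) \<in> borel_measurable borel"
    and "integrable lborel (\<lambda>z. indicator (slab T) z * F (fst z) (snd z))"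
  shows "F \<in> L1_spacetime T"
proof -
  have "(\<lambda>z. indicator (slab T) z * F (fst z) (snd z)) \<in> borel_measurable lborel"
    using assms(2) by (intro borel_measurable_times borel_measurable_indicator) auto
  from integrable_completion[OF this] assms(3)
  have "integrable lebesgue (\<lambda>z. indicator (slab T) z * F (fst z) (snd z))" by simp
  then show ?thesis using assms(1) by (simp add: L1_spacetime_def set_integrable_def case_prod_beta)
qed

lemma L1_spacetime_vec:
  fixes F :: "real \<Rightarrow> real ^ 'd::finite \<Rightarrow> real ^ 'd"
  assumes "\<And>t. periodic (F t)" and m: "\<And>k. (\<lambda>z. F (fst z) (snd z) $ k) \<in> borel_measurable borel"
    and i: "\<And>k. integrable lborel (\<lambda>z. indicator (slab T) z * (F (fst z) (snd z) $ k))"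
  shows "F \<in> L1_spacetime T"
proof -
  have Fm: "(\<lambda>z. F (fst z) (snd z)) \<in> borel_measurable borel" by (rule borel_measurable_vec[OF m])
  have IFm: "(\<lambda>z. indicator (slab T) z *\<^sub>R F (fst z) (snd z)) \<in> borel_measurable lborel"
    using Fm by (intro borel_measurable_scaleR borel_measurable_indicator) auto
  have "integrable lborel (\<lambda>z. \<Sum>k\<in>UNIV. \<bar>indicator (slab T) z * (F (fst z) (snd z) $ k)\<bar>)"
    by (intro Bochner_Integration.integrable_sum integrable_abs i)
  then have "integrable lborel (\<lambda>z. indicator (slab T) z *\<^sub>R F (fst z) (snd z))"
  proof (rule Bochner_Integration.integrable_bound[OF _ IFm])
    have "norm (indicator (slab T) z *\<^sub>R F (fst z) (snd z)) \<le> (\<Sum>k\<in>UNIV. \<bar>indicator (slab T) z * (F (fst z) (snd z) $ k)\<bar>)" for z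
      using norm_le_l1_cart[of "indicator (slab T) z *\<^sub>R F (fst z) (snd z)"] by simp
    then show "AE z in lborel. norm (indicator (slab T) z *\<^sub>R F (fst z) (snd z)) \<le> norm (\<Sum>k\<in>UNIV. \<bar>indicator (slab T) z * (F (fst z) (snd z) $ k)\<bar>)"
      by (intro AE_I2) (simp add: order_trans[OF _ abs_ge_self])
  qed
  with integrable_completion[OF IFm]
  have "integrable lebesgue (\<lambda>z. indicator (slab T) z *\<^sub>R F (fst z) (snd z))" by simp
  then show ?thesis using assms(1) by (simp add: L1_spacetime_def set_integrable_def case_prod_beta)
qed

subsection \<open>The iteration\<close>

text \<open>Round robin: among the d steps preceding \<open>n\<close> every component has had its
  turn.\<close>

lemma cyclic_index:
  obtains i :: "nat \<Rightarrow> 'd::finite" where "\<And>k n. CARD('d) \<le> n \<Longrightarrow> \<exists>l<CARD('d). i (n - Suc l) = k"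
proof -
  obtain e :: "nat \<Rightarrow> 'd" where e: "bij_betw e {0..<CARD('d)} UNIV"
    using ex_bij_betw_nat_finite[OF finite[of "UNIV :: 'd set"]] by blast
  define D where "D = CARD('d)"
  have D: "0 < D" by (simp add: D_def)
  have "\<exists>l<D. e ((n - Suc l) mod D) = k" if n: "D \<le> n" for k n
  proof -
    from e have "k \<in> e ` {0..<D}" by (simp add: bij_betw_def D_def)
    then obtain r where r: "r < D" "e r = k" by auto
    \<comment> \<open>Makes n - 1 - l congruent to \<open>r\<close> modulo \<open>D\<close>.\<close>
    define l where "l = (n - 1 - r) mod D"
    have l: "l < D" using D by (simp add: l_def)
    have "n - Suc l = r + D * ((n - 1 - r) div D)"
    proof -
      have "n - 1 - r = l + D * ((n - 1 - r) div D)" by (simp add: l_def)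
      moreover have "r \<le> n - 1" using r n by linarith
      ultimately show ?thesis by linarith
    qed
    then have "(n - Suc l) mod D = r" using r by simp
    then show ?thesis using l r by blast
  qed
  then show ?thesis using that[of "\<lambda>n. e (n mod D)"] by (simp add: D_def)
qed

text \<open>At its turn, in step n, a component of the defect drops to (1/4)^n, and a later step n'
  adds at most (1/4)^n'. At most d steps lie between a turn and the present, hence the factor 4^d.
  The geometric rate is what makes the fluxes converge.\<close>

lemma iteration:
  fixes T :: real and m :: nat and c :: "('d::finite \<Rightarrow> nat) \<Rightarrow> real"
  assumes T: "0 < T" and d2: "2 \<le> CARD('d)" and init: "defect_eq m c \<rho>0 (\<lambda>k t x. 0) R0"
  obtains C :: real and \<rho> U R a \<gamma> \<Psi> s and i j :: "nat \<Rightarrow> 'd" where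
    "0 < C" "\<rho> 0 = \<rho>0" "U 0 = (\<lambda>k t x. 0)" "\<And>n. defect_eq m c (\<rho> n) (U n) (R n)" "\<And>n. i n \<noteq> j n"
    "\<And>n. ci_step T n ((1/4) ^ n) C (i n) (j n) (\<rho> n) (U n) (R n) (\<rho> (Suc n)) (U (Suc n)) (R (Suc n)) (a n) (\<gamma> n) (\<Psi> n) (s n)"
    "\<And>n k. CARD('d) \<le> n \<Longrightarrow> n1 T (R n k) \<le> 2 * 4 ^ CARD('d) * (1/4) ^ n"
proof -
  obtain C where C: "0 < C" and step: "\<And>\<rho> U R i j n \<epsilon>. \<lbrakk>defect_eq m c \<rho> U R; i \<noteq> j; 0 < \<epsilon>\<rbrakk> \<Longrightarrow>
      \<exists>\<rho>' U' R' a \<gamma> \<Psi> s. defect_eq m c \<rho>' U' R' \<and> ci_step T n \<epsilon> C i j \<rho> U R \<rho>' U' R' a \<gamma> \<Psi> s"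
    by (rule convex_integration_step[OF T, of m c]) blast
  obtain i :: "nat \<Rightarrow> 'd" where i: "\<And>k n. CARD('d) \<le> n \<Longrightarrow> \<exists>l<CARD('d). i (n - Suc l) = k"
    using cyclic_index by blast
  have "\<exists>j. i n \<noteq> j" for n
  proof (rule ccontr)
    assume "\<not> ?thesis"
    then have "\<forall>x. x = i n" by metis
    then have "(UNIV :: 'd set) = {i n}" by blast
    then have "CARD('d) = 1" by (metis card_1_singleton_iff One_nat_def)
    then show False using d2 by simp
  qed
  then obtain j where j: "\<And>n. i n \<noteq> j n" by metis
  \<comment> \<open>The clause for n = 0 ties the dependent choice to the given initial
    data.\<close>
  define P where "P n x \<longleftrightarrow> defect_eq m c (fst x) (fst (snd x)) (snd (snd x)) \<and>
     (n = 0 \<longrightarrow> fst x = \<rho>0 \<and> fst (snd x) = (\<lambda>k t x. 0))" for n :: nat and x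
  define Q where "Q n x y \<longleftrightarrow> (\<exists>a \<gamma> \<Psi> s. ci_step T n ((1/4) ^ n) C (i n) (j n) (fst x) (fst (snd x)) (snd (snd x))
     (fst y) (fst (snd y)) (snd (snd y)) a \<gamma> \<Psi> s)" for n :: nat and x y
  have "\<exists>f. \<forall>n. P n (f n) \<and> Q n (f n) (f (Suc n))"
  proof (rule dependent_nat_choice)
    show "\<exists>x. P 0 x" using init by (intro exI[of _ "(\<rho>0, (\<lambda>k t x. 0), R0)"]) (simp add: P_def)
    fix x n assume "P n x"
    then have "defect_eq m c (fst x) (fst (snd x)) (snd (snd x))" by (simp add: P_def)
    from step[OF this j[of n], of "(1/4) ^ n" n]
    obtain \<rho>' U' R' a \<gamma> \<Psi> s where "defect_eq m c \<rho>' U' R'"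
      "ci_step T n ((1/4) ^ n) C (i n) (j n) (fst x) (fst (snd x)) (snd (snd x)) \<rho>' U' R' a \<gamma> \<Psi> s" by auto
    then show "\<exists>y. P (Suc n) y \<and> Q n x y"
      by (intro exI[of _ "(\<rho>', U', R')"]) (auto simp: P_def Q_def)
  qed
  then obtain f where f: "\<And>n. P n (f n)" "\<And>n. Q n (f n) (f (Suc n))" by blast
  define \<rho> where "\<rho> n = fst (f n)" for n
  define U where "U n = fst (snd (f n))" for n
  define R where "R n = snd (snd (f n))" for n
  have "\<forall>n. \<exists>y. ci_step T n ((1/4) ^ n) C (i n) (j n) (\<rho> n) (U n) (R n) (\<rho> (Suc n)) (U (Suc n)) (R (Suc n))
      (fst y) (fst (snd y)) (fst (snd (snd y))) (snd (snd (snd y)))"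
  proof
    fix n
    obtain a \<gamma> \<Psi> s where "ci_step T n ((1/4) ^ n) C (i n) (j n) (\<rho> n) (U n) (R n) (\<rho> (Suc n)) (U (Suc n)) (R (Suc n)) a \<gamma> \<Psi> s"
      using f(2)[of n] unfolding Q_def \<rho>_def U_def R_def by blast
    then show "\<exists>y. ci_step T n ((1/4) ^ n) C (i n) (j n) (\<rho> n) (U n) (R n) (\<rho> (Suc n)) (U (Suc n)) (R (Suc n))
      (fst y) (fst (snd y)) (fst (snd (snd y))) (snd (snd (snd y)))"
      by (intro exI[of _ "(a, \<gamma>, \<Psi>, s)"]) simp
  qed
  from choice[OF this] obtain y where y: "\<And>n. ci_step T n ((1/4) ^ n) C (i n) (j n) (\<rho> n) (U n) (R n) (\<rho> (Suc n)) (U (Suc n)) (R (Suc n))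
      (fst (y n)) (fst (snd (y n))) (fst (snd (snd (y n)))) (snd (snd (snd (y n))))" by blast
  have r: "n1 T (R (Suc n) (i n)) \<le> (1/4) ^ n" "n1 T (R (Suc n) k) \<le> n1 T (R n k) + (1/4) ^ n" for n k
    using y[of n] unfolding ci_step_def by blast+
  \<comment> \<open>The subtracted power of 1/2 lets the induction close; afterwards only the bound
    by 2 is used.\<close>
  have r1: "n1 T (R (Suc n + l) (i n)) \<le> (1/4) ^ n * (2 - (1/2) ^ l)" for n l
  proof (induction l)
    case 0
    then show ?case using r(1)[of n] by simp
  next
    case (Suc l)
    have "n1 T (R (Suc n + Suc l) (i n)) \<le> (1/4) ^ n * (2 - (1/2) ^ l) + (1/4) ^ (Suc n + l)"
      using r(2)[of "Suc n + l" "i n"] Suc by simp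
    also have "\<dots> = (1/4) ^ n * (2 - (1/2) ^ l + (1/4) ^ Suc l)" by (simp add: power_add distrib_left)
    also have "\<dots> \<le> (1/4) ^ n * (2 - (1/2) ^ Suc l)"
    proof (rule mult_left_mono)
      have "(1/4 :: real) ^ Suc l \<le> (1/2) ^ Suc l" by (intro power_mono) auto
      then show "2 - (1/2 :: real) ^ l + (1/4) ^ Suc l \<le> 2 - (1/2) ^ Suc l" by simp
    qed simp
    finally show ?case .
  qed
  have rate: "n1 T (R n k) \<le> 2 * 4 ^ CARD('d) * (1/4) ^ n" if n: "CARD('d) \<le> n" for n k
  proof -
    obtain l where l: "l < CARD('d)" "i (n - Suc l) = k" using i[OF n] by blast
    have "Suc (n - Suc l) + l = n" using l n by simp
    then have "n1 T (R n k) \<le> (1/4) ^ (n - Suc l) * (2 - (1/2) ^ l)" using r1[of "n - Suc l" l] l by simp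
    also have "\<dots> \<le> (1/4) ^ (n - CARD('d)) * 2"
    proof -
      have "(1/2 :: real) ^ l \<le> 1" by (simp add: power_le_one)
      then show ?thesis using l n by (intro mult_mono power_decreasing) auto
    qed
    also have "(1/4 :: real) ^ (n - CARD('d)) = 4 ^ CARD('d) * (1/4) ^ n"
      using n by (simp add: power_diff power_one_over field_simps)
    finally show ?thesis by simp
  qed
  have f0: "\<rho> 0 = \<rho>0" "U 0 = (\<lambda>k t x. 0)" using f(1)[of 0] by (auto simp: P_def \<rho>_def U_def)
  have fd: "defect_eq m c (\<rho> n) (U n) (R n)" for n using f(1)[of n] by (simp add: P_def \<rho>_def U_def R_def)
  show thesis by (rule that[OF C f0 fd j y rate])
qed

subsection \<open>The limit of the iteration\<close>

lemma Icc_lborel: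
  fixes f :: "real \<Rightarrow> real"
  assumes "continuous_on UNIV f"
  shows "integrable lborel (\<lambda>t. indicator {a..b} t * f t)"
    "(LINT t|lborel. indicator {a..b} t * f t) = integral {a..b} f"
proof -
  have i: "set_integrable lborel {a..b} f"
    unfolding set_integrable_def
    by (rule borel_integrable_compact) (auto intro: continuous_on_subset[OF assms])
  then show "integrable lborel (\<lambda>t. indicator {a..b} t * f t)" by (simp add: set_integrable_def)
  show "(LINT t|lborel. indicator {a..b} t * f t) = integral {a..b} f"
    using set_borel_integral_eq_integral(2)[OF i] by (simp add: set_lebesgue_integral_def)
qed

lemma set_integrable_Icc_lebesgueI:
  fixes h W :: "real \<Rightarrow> real"
  assumes h: "h \<in> borel_measurable borel" and W: "integrable lborel W"
    and le: "AE t in lborel. t \<in> {a..b} \<longrightarrow> \<bar>h t\<bar> \<le> W t"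
  shows "set_integrable lebesgue {a..b} h"
proof -
  have m: "(\<lambda>t. indicator {a..b} t *\<^sub>R h t) \<in> borel_measurable lborel"
    using h by (intro borel_measurable_scaleR borel_measurable_indicator) auto
  have "integrable lborel (\<lambda>t. indicator {a..b} t *\<^sub>R h t)"
  proof (rule Bochner_Integration.integrable_bound[OF integrable_abs[OF W] m])
    show "AE t in lborel. norm (indicator {a..b} t *\<^sub>R h t) \<le> norm \<bar>W t\<bar>"
      using le by eventually_elim (auto simp: indicator_def)
  qed
  then show ?thesis unfolding set_integrable_def using integrable_completion[OF m] by simp
qed

lemma pDs_diff: "tfun f \<Longrightarrow> tfun g \<Longrightarrow> pDs w (\<lambda>t x. f t x - g t x) = (\<lambda>t x. pDs w f t x - pDs w g t x)"
  by (induction w) (simp_all add: pD_diff tfun_pDs)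

text \<open>Turns summability into finiteness of an extended sum, a condition that defines a Borel
  set when the terms depend measurably on a parameter.\<close>

lemma suminf_ennreal_finite_iff:
  fixes f :: "nat \<Rightarrow> real" assumes "\<And>n. 0 \<le> f n"
  shows "(\<Sum>n. ennreal (f n)) \<noteq> top \<longleftrightarrow> summable f"
proof
  assume "summable f"
  then show "(\<Sum>n. ennreal (f n)) \<noteq> top" using suminf_ennreal2[OF assms] by simp
qed (rule summable_suminf_not_top[OF assms])

lemma Icc_AE_summable:
  fixes h :: "nat \<Rightarrow> real \<Rightarrow> real"
  assumes h: "\<And>n. continuous_on UNIV (h n)" "\<And>n t. 0 \<le> h n t" and s: "summable (\<lambda>n. integral {0..T} (h n))"
  shows "AE t in lborel. t \<in> {0..T} \<longrightarrow> summable (\<lambda>n. h n t)"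
    and "integrable lborel (\<lambda>t. \<Sum>n. indicator {0..T} t * h n t)"
proof -
  have s': "summable (\<lambda>n. LINT t|lborel. indicator {0..T} t * h n t)" using s by (simp only: Icc_lborel(2)[OF h(1)])
  have p: "0 \<le> indicator {0..T} t * h n t" for n t using h(2) by simp
  note A = AE_summable_of_integrals[OF Icc_lborel(1)[OF h(1)] p s']
  show "AE t in lborel. t \<in> {0..T} \<longrightarrow> summable (\<lambda>n. h n t)"
    using A(1) by eventually_elim auto
  show "integrable lborel (\<lambda>t. \<Sum>n. indicator {0..T} t * h n t)" by (rule A(2))
qed

lemma Icc_integral_nonneg: "continuous_on UNIV h \<Longrightarrow> (\<And>t. 0 \<le> h t) \<Longrightarrow> 0 \<le> integral {0..T} h" for h :: "real \<Rightarrow> real"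
  by (intro integral_nonneg integrable_continuous_real) (auto intro: continuous_on_subset)

lemma n1_bound:
  fixes f :: "real \<Rightarrow> real ^ 'd \<Rightarrow> real"
  assumes "jcont f" "continuous_on UNIV b" "\<And>t x. 0 \<le> t \<Longrightarrow> t \<le> T \<Longrightarrow> \<bar>f t x\<bar> \<le> b t"
  shows "n1 T f \<le> integral {0..T} b"
proof -
  have "n1 T f \<le> n1 T (\<lambda>t (x :: real^'d). 0) + integral {0..T} b + integral {0..T} (\<lambda>t. 0) * integral {0..1} (\<lambda>s::real. 0)"
    by (rule n1_le[where j=undefined and a=b and b="\<lambda>t. 0" and P="\<lambda>s. 0"])
       (use assms in \<open>auto simp: per1_def intro!: jcont_tfun tfun_const\<close>)
  then show ?thesis by (simp add: n1_def)
qed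

lemma n1_nonneg: "jcont f \<Longrightarrow> 0 \<le> n1 T f" for f :: "real \<Rightarrow> real ^ 'd \<Rightarrow> real"
  unfolding n1_def by (intro integral_nonneg n1_integrable jcont_integrable jcont_intros(5)) auto

lemma jcont_diff: "jcont (\<lambda>t x. f t x - h t x)" if "jcont f" "jcont h" for f h :: "real \<Rightarrow> real ^ 'd \<Rightarrow> real"
  using that unfolding jcont_def by (intro continuous_intros)

lemma grad_inner: "v \<bullet> grad (\<phi> t) x = (\<Sum>k\<in>UNIV. v $ k * pD k \<phi> t x)"
  by (simp add: inner_vec_def grad_def pD_def)

lemma iint_sum: "(\<And>k. jcont (f k)) \<Longrightarrow> iint T (\<lambda>t x. \<Sum>k\<in>(UNIV::'d set). f k t x) = (\<Sum>k\<in>UNIV. iint T (f k))"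
  for f :: "'d \<Rightarrow> real \<Rightarrow> real ^ 'd \<Rightarrow> real"
proof -
  assume f: "\<And>k. jcont (f k)"
  have "integral cell (\<lambda>x. \<Sum>k\<in>(UNIV::'d set). f k t x) = (\<Sum>k\<in>UNIV. integral cell (f k t))" for t
    by (rule integral_sum) (auto intro!: jcont_integrable f)
  then show ?thesis unfolding iint_def
    by (simp, intro integral_sum) (auto intro!: integrable_continuous_real jcont_integral f)
qed

text \<open>\<open>a\<close>, \<gamma>, \<Psi> and \<open>s\<close> are the witnesses of the single
  steps: the bounds in time of the density increments, and the time amplitudes, profiles and sizes
  of the shears.\<close>

locale ci_limit =
  fixes T C :: real and m :: nat and c :: "('d::finite \<Rightarrow> nat) \<Rightarrow> real"
    and \<rho> :: "nat \<Rightarrow> real \<Rightarrow> real ^ 'd \<Rightarrow> real" and U R :: "nat \<Rightarrow> 'd \<Rightarrow> real \<Rightarrow> real ^ 'd \<Rightarrow> real"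
    and a \<gamma> \<Psi> :: "nat \<Rightarrow> real \<Rightarrow> real" and s :: "nat \<Rightarrow> real" and i j :: "nat \<Rightarrow> 'd"
  assumes T: "0 < T" and C: "0 < C" and U0: "U 0 = (\<lambda>k t x. 0)"
    and inv: "\<And>n. defect_eq m c (\<rho> n) (U n) (R n)" and ij: "\<And>n. i n \<noteq> j n"
    and step: "\<And>n. ci_step T n ((1/4) ^ n) C (i n) (j n) (\<rho> n) (U n) (R n) (\<rho> (Suc n)) (U (Suc n)) (R (Suc n)) (a n) (\<gamma> n) (\<Psi> n) (s n)"
    and rate: "\<And>n k. CARD('d) \<le> n \<Longrightarrow> n1 T (R n k) \<le> 2 * 4 ^ CARD('d) * (1/4) ^ n"
begin

lemma t\<rho>: "tfun (\<rho> n)" and tU: "tfun (U n k)" and tR: "tfun (R n k)"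
  using inv[of n] by (auto simp: defect_eq_def)

lemma ca: "continuous_on UNIV (a n)" and a0: "0 \<le> a n t" and a_int: "integral {0..T} (\<lambda>t. (2 ^ n * a n t) ^ Suc n) \<le> (1/4) ^ n"
  and s\<gamma>: "smooth1 (\<gamma> n)" and \<gamma>0: "0 \<le> \<gamma> n t" and s\<Psi>: "smooth1 (\<Psi> n)" and p\<Psi>: "per1 (\<Psi> n)" and s0: "0 \<le> s n"
  and \<Psi>s: "\<bar>\<Psi> n y\<bar> \<le> s n" and \<gamma>_int: "integral {0..T} (\<lambda>t. \<gamma> n t * s n) \<le> (1/4) ^ n"
  and U_Suc: "U (Suc n) k t x = U n k t x + (if k = i n then \<gamma> n t * \<Psi> n (x $ j n) else 0)"
  and prod_diff: "n1 T (\<lambda>t x. \<rho> (Suc n) t x * U (Suc n) k t x - \<rho> n t x * U n k t x) \<le> C * n1 T (R n (i n)) + (1/4) ^ n"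
  using step[of n] unfolding ci_step_def by blast+

lemma \<Psi>q: "1 \<le> q \<Longrightarrow> q \<le> real (Suc n) \<Longrightarrow> integral {0..1} (\<lambda>y. \<bar>deriv (\<Psi> n) y\<bar> powr q) \<le> s n powr q"
  using step[of n] unfolding ci_step_def by blast

lemma a_diff:
  assumes "length w \<le> n" "0 \<le> t" "t \<le> T"
  shows "\<bar>pDs w (\<rho> (Suc n)) t x - pDs w (\<rho> n) t x\<bar> \<le> a n t"
proof -
  have "\<bar>pDs w (\<lambda>t x. \<rho> (Suc n) t x - \<rho> n t x) t x\<bar> \<le> a n t"
    using step[of n] assms unfolding ci_step_def by blast
  then show ?thesis by (simp add: pDs_diff t\<rho>)
qed

lemma c\<gamma>: "continuous_on A (\<gamma> n)" by (rule smooth1_continuous[OF s\<gamma>])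

text \<open>\<open>e\<close> measures the density increments in a growing power, \<open>g\<close>
  the shear amplitudes with the weight that \<open>shear_superposition_W1p\<close> demands. Both
  have summable integrals over [0,T].\<close>

definition e where "e n t = (2 ^ n * a n t) ^ Suc n"
definition g where "g n t = 2 ^ n * (\<gamma> n t * s n)"

lemma e0: "0 \<le> e n t" and g0: "0 \<le> g n t"
  using a0[of n t] \<gamma>0[of n t] s0[of n] by (auto simp: e_def g_def)

lemma ce: "continuous_on UNIV (e n)" and cg: "continuous_on UNIV (g n)"
  unfolding e_def g_def by (intro continuous_intros ca c\<gamma>)+

lemma e_int: "integral {0..T} (e n) \<le> (1/4) ^ n" and g_int: "integral {0..T} (g n) \<le> (1/2) ^ n"
proof -
  show "integral {0..T} (e n) \<le> (1/4) ^ n" unfolding e_def by (rule a_int)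
  have "integral {0..T} (g n) = 2 ^ n * integral {0..T} (\<lambda>t. \<gamma> n t * s n)" unfolding g_def by (rule integral_mult_right)
  also have "\<dots> \<le> 2 ^ n * (1/4) ^ n" by (intro mult_left_mono \<gamma>_int) simp
  also have "\<dots> = (1/2) ^ n" by (simp flip: power_mult_distrib)
  finally show "integral {0..T} (g n) \<le> (1/2) ^ n" .
qed

text \<open>The times at which both series converge, written with extended sums so that the set is
  Borel; \<open>Good_iff\<close> translates back.\<close>

definition Good where "Good = {t \<in> {0..T}. (\<Sum>n. ennreal (e n t)) \<noteq> top \<and> (\<Sum>n. ennreal (g n t)) \<noteq> top}"

lemma Good_borel: "Good \<in> sets borel"
proof -
  have "(\<lambda>t. ennreal (e n t)) \<in> borel_measurable borel" "(\<lambda>t. ennreal (g n t)) \<in> borel_measurable borel" for n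
    using borel_measurable_continuous_onI[OF ce[of n]] borel_measurable_continuous_onI[OF cg[of n]] by measurable
  then have m: "(\<lambda>t. \<Sum>n. ennreal (e n t)) \<in> borel_measurable borel" "(\<lambda>t. \<Sum>n. ennreal (g n t)) \<in> borel_measurable borel"
    by (intro borel_measurable_suminf_order; simp)+
  have "{t. (\<Sum>n. ennreal (e n t)) \<noteq> top} \<in> sets borel" "{t. (\<Sum>n. ennreal (g n t)) \<noteq> top} \<in> sets borel"
    using measurable_sets[OF m(1), of "- {top}"] measurable_sets[OF m(2), of "- {top}"] by (simp_all add: vimage_def)
  then have "{0..T} \<inter> ({t. (\<Sum>n. ennreal (e n t)) \<noteq> top} \<inter> {t. (\<Sum>n. ennreal (g n t)) \<noteq> top}) \<in> sets borel"
    by (intro sets.Int) auto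
  then show ?thesis by (simp add: Good_def Int_def)
qed

lemma Good_iff: "t \<in> Good \<longleftrightarrow> 0 \<le> t \<and> t \<le> T \<and> summable (\<lambda>n. e n t) \<and> summable (\<lambda>n. g n t)"
  by (simp only: Good_def mem_Collect_eq atLeastAtMost_iff conj_assoc
      suminf_ennreal_finite_iff[of "\<lambda>n. e n t", OF e0] suminf_ennreal_finite_iff[of "\<lambda>n. g n t", OF g0])

lemma Good_D:
  assumes "t \<in> Good"
  shows "0 \<le> t" "t \<le> T" "summable (\<lambda>n. e n t)" "summable (\<lambda>n. g n t)"
  using assms by (simp_all only: Good_iff)

lemma sum_e: "summable (\<lambda>n. integral {0..T} (e n))"
  by (rule summable_comparison_test'[OF summable_geometric[of "1/4"], of 0])
     (use e_int Icc_integral_nonneg[OF ce e0] in auto)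

lemma sum_g: "summable (\<lambda>n. integral {0..T} (g n))"
  by (rule summable_comparison_test'[OF summable_geometric[of "1/2"], of 0])
     (use g_int Icc_integral_nonneg[OF cg g0] in auto)

lemma AE_Good: "AE t in lborel. t \<in> {0..T} \<longrightarrow> t \<in> Good"
  using Icc_AE_summable(1)[OF ce e0 sum_e] Icc_AE_summable(1)[OF cg g0 sum_g]
  by eventually_elim (simp only: Good_iff atLeastAtMost_iff, blast)

lemma AE_Good_slab: "AE z in lborel. z \<in> (slab T :: (real \<times> (real ^ 'd)) set) \<longrightarrow> fst z \<in> Good"
proof -
  have "{t. t \<in> {0..T} \<longrightarrow> t \<in> Good} = - {0..T} \<union> Good" by auto
  then have "{t. t \<in> {0..T} \<longrightarrow> t \<in> Good} \<in> sets borel" using Good_borel by auto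
  from AE_lborel_fst[OF AE_Good this] show ?thesis by eventually_elim auto
qed

text \<open>Off the null complement of \<open>Good\<close> the limits are replaced by \<open>0\<close>; this makes all formulas for
  \<open>rho\<close> and \<open>u\<close>, and hence their measurability, valid for every \<open>t\<close>.\<close>

definition gg where "gg n t = indicator Good t * \<gamma> n t"
definition rho where "rho t x = lim (\<lambda>n. indicator Good t * \<rho> n t x)"
definition u where "u t x = (\<chi> k. \<Sum>n. if k = i n then gg n t * \<Psi> n (x $ j n) else 0)"

lemma Good_a:
  assumes t: "t \<in> Good" shows "summable (\<lambda>n. a n t)"
    "1 \<le> p \<Longrightarrow> p \<le> real (Suc K) \<Longrightarrow> (\<Sum>n. a (n + K) t) \<le> 2 * (1 + (\<Sum>n. e n t)) powr (1 / p)"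
  using geometric_tail_bound[of "\<lambda>n. a n t" 1 0] geometric_tail_bound[of "\<lambda>n. a n t" p K] Good_D(3)[OF t] a0
  by (auto simp: e_def)

lemma rho_lim: assumes t: "t \<in> Good" shows "(\<lambda>n. \<rho> n t x) \<longlonglongrightarrow> rho t x"
proof -
  have "(\<lambda>n. \<rho> n t x) \<longlonglongrightarrow> lim (\<lambda>n. \<rho> n t x)"
    by (rule telescoping_limit(1)[OF Good_a(1)[OF t], of 0]) (use a_diff[of "[]" _ t x] Good_D[OF t] in auto)
  then show ?thesis using t by (simp add: rho_def)
qed

lemma rho_bad: "t \<notin> Good \<Longrightarrow> rho t = (\<lambda>x. 0)"
  by (auto simp: rho_def)

lemma summable_gs: "summable (\<lambda>n. 2 ^ n * (\<bar>gg n t\<bar> * s n))"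
proof (cases "t \<in> Good")
  case True
  then show ?thesis using Good_D(4)[OF True] \<gamma>0 by (simp add: gg_def g_def)
qed (simp add: gg_def)

lemma summable_gs': "summable (\<lambda>n. \<bar>gg n t\<bar> * s n)"
proof (rule summable_comparison_test'[OF summable_gs, of 0])
  fix n
  have "1 * (\<bar>gg n t\<bar> * s n) \<le> 2 ^ n * (\<bar>gg n t\<bar> * s n)" using s0 by (intro mult_right_mono) auto
  then show "norm (\<bar>gg n t\<bar> * s n) \<le> 2 ^ n * (\<bar>gg n t\<bar> * s n)" using s0[of n] by simp
qed

lemma gg_abs: "\<bar>gg n t * \<Psi> n y\<bar> \<le> \<bar>gg n t\<bar> * s n"
  unfolding abs_mult by (intro mult_left_mono \<Psi>s) simp

lemma U_sum: "U n k t x = (\<Sum>q<n. if k = i q then \<gamma> q t * \<Psi> q (x $ j q) else 0)"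
  by (induction n) (simp_all add: U0 U_Suc)

lemma U_lim: assumes t: "t \<in> Good" shows "(\<lambda>n. U n k t x) \<longlonglongrightarrow> u t x $ k"
proof -
  have "summable (\<lambda>n. if k = i n then gg n t * \<Psi> n (x $ j n) else 0)"
    by (rule suminf_abs_le(1)[OF summable_gs'[of t]]) (use gg_abs s0 in auto)
  from summable_LIMSEQ[OF this] show ?thesis using t by (simp add: U_sum u_def gg_def cong: if_cong)
qed

lemma Good_indicator_borel: "(\<lambda>z :: real \<times> (real ^ 'd). indicator Good (fst z) :: real) \<in> borel_measurable borel"
proof -
  have "(\<lambda>z :: real \<times> (real ^ 'd). indicator Good (fst z) :: real) \<in> borel_measurable (borel \<Otimes>\<^sub>M borel)"
    by (rule measurable_compose[OF measurable_fst]) (use Good_borel in \<open>intro borel_measurable_indicator, simp\<close>)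
  then show ?thesis by (simp add: borel_prod)
qed

lemma rho_borel: "(\<lambda>z. rho (fst z) (snd z)) \<in> borel_measurable borel"
  unfolding rho_def
  by (intro borel_measurable_lim_metric borel_measurable_times Good_indicator_borel jcont_borel jcont_tfun t\<rho>)

lemma gg_jborel:
  assumes "continuous_on UNIV f"
  shows "(\<lambda>z :: real \<times> (real ^ 'd). if b then gg n (fst z) * f (snd z $ k) else 0) \<in> borel_measurable borel"
proof -
  have "continuous_on UNIV (\<lambda>z :: real \<times> (real ^ 'd). \<gamma> n (fst z) * f (snd z $ k))"
    by (intro continuous_on_mult continuous_on_compose2[OF c\<gamma>[of UNIV n]] continuous_on_compose2[OF assms])
       (auto intro!: continuous_intros)
  from borel_measurable_times[OF Good_indicator_borel borel_measurable_continuous_onI[OF this]]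
  show ?thesis by (cases b) (simp_all add: gg_def mult.assoc)
qed

lemma u_borel: "(\<lambda>z. u (fst z) (snd z) $ k) \<in> borel_measurable borel"
  unfolding u_def by (simp, intro borel_measurable_suminf gg_jborel smooth1_continuous[OF s\<Psi>])

lemma j\<rho>: "jcont (\<rho> n)" by (rule jcont_tfun[OF t\<rho>])

lemma j\<rho>_diff: "jcont (\<lambda>t x. \<rho> (Suc n) t x - \<rho> n t x)" by (rule jcont_diff[OF j\<rho> j\<rho>])

text \<open>From x <= 1 + x^(n+1) with x = 2^n a. The total change of the density in L^1 is thus at
  most 2 (T + 1), whatever the starting density.\<close>

lemma rho_n1_diff: "n1 T (\<lambda>t x. \<rho> (Suc n) t x - \<rho> n t x) \<le> (1/2) ^ n * (T + 1)"
proof -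
  have "n1 T (\<lambda>t x. \<rho> (Suc n) t x - \<rho> n t x) \<le> integral {0..T} (a n)"
    by (rule n1_bound[OF j\<rho>_diff ca]) (use a_diff[of "[]" n] in auto)
  also have "\<dots> \<le> integral {0..T} (\<lambda>t. (1/2) ^ n * (1 + e n t))"
  proof (rule integral_le)
    fix t
    define x where "x = 2 ^ n * a n t"
    have x0: "0 \<le> x" using a0 by (simp add: x_def)
    have "x \<le> 1 + x ^ Suc n"
    proof (cases "x \<le> 1")
      case False
      then have "x ^ 1 \<le> x ^ Suc n" by (intro power_increasing) auto
      then show ?thesis by simp
    qed (use x0 in \<open>auto intro: order_trans\<close>)
    then have "(1/2) ^ n * x \<le> (1/2) ^ n * (1 + e n t)" by (simp add: e_def x_def)
    then show "a n t \<le> (1/2) ^ n * (1 + e n t)" by (simp add: x_def power_one_over)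
  qed (auto intro!: integrable_continuous_real continuous_intros continuous_on_subset[OF ca] continuous_on_subset[OF ce])
  also have "\<dots> = (1/2) ^ n * integral {0..T} (\<lambda>t. 1 + e n t)" by (rule integral_mult_right)
  also have "integral {0..T} (\<lambda>t. 1 + e n t) = T + integral {0..T} (e n)"
    using T by (subst integral_add) (auto intro!: integrable_continuous_real continuous_on_subset[OF ce])
  also have "(1/2) ^ n * \<dots> \<le> (1/2) ^ n * (T + 1)"
    using e_int[of n] power_le_one[of "1/4 :: real" n] by (intro mult_left_mono add_left_mono) auto
  finally show ?thesis .
qed

lemma sum_rho: "summable (\<lambda>n. n1 T (\<lambda>t x. \<rho> (Suc n) t x - \<rho> n t x))"
  by (rule summable_comparison_test'[OF summable_mult2[OF summable_geometric[of "1/2"], of "T + 1"], of 0])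
     (use rho_n1_diff n1_nonneg[OF j\<rho>_diff] in auto)

lemma sum_U: "summable (\<lambda>n. n1 T (\<lambda>t x. U (Suc n) k t x - U n k t x))"
proof (rule summable_comparison_test'[OF summable_geometric[of "1/4"], of 0])
  fix n
  have j: "jcont (\<lambda>t x. U (Suc n) k t x - U n k t x)" by (intro jcont_diff jcont_tfun tU)
  have "n1 T (\<lambda>t x. U (Suc n) k t x - U n k t x) \<le> integral {0..T} (\<lambda>t. \<gamma> n t * s n)"
  proof (rule n1_bound[OF j])
    show "continuous_on UNIV (\<lambda>t. \<gamma> n t * s n)" by (intro continuous_intros c\<gamma>)
    have "\<gamma> n t * \<bar>\<Psi> n (x $ j n)\<bar> \<le> \<gamma> n t * s n" for t and x :: "real^'d" by (intro mult_left_mono \<Psi>s \<gamma>0)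
    then show "\<bar>U (Suc n) k t x - U n k t x\<bar> \<le> \<gamma> n t * s n" for t x
      using \<gamma>0[of n t] s0[of n] by (auto simp: U_Suc abs_mult)
  qed
  then show "norm (n1 T (\<lambda>t x. U (Suc n) k t x - U n k t x)) \<le> (1/4) ^ n"
    using \<gamma>_int[of n] n1_nonneg[OF j] by simp
qed simp

lemma jprod: "jcont (\<lambda>t x. \<rho> n t x * U n k t x)"
  by (intro jcont_tfun tfun.mult t\<rho> tU)

text \<open>Convergence of the densities in L^q and of the velocities in L^1 in time does not give
  convergence of the products. The flux estimate of the steps does: the increments are bounded by
  the defects, which decay geometrically once every component has been treated.\<close>

lemma sum_prod: "summable (\<lambda>n. n1 T (\<lambda>t x. \<rho> (Suc n) t x * U (Suc n) k t x - \<rho> n t x * U n k t x))"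
proof (rule summable_comparison_test'[OF summable_mult[OF summable_geometric[of "1/4"], of "C * (2 * 4 ^ CARD('d)) + 1"], of "CARD('d)"])
  fix n assume n: "CARD('d) \<le> n"
  have "n1 T (\<lambda>t x. \<rho> (Suc n) t x * U (Suc n) k t x - \<rho> n t x * U n k t x) \<le> C * n1 T (R n (i n)) + (1/4) ^ n"
    by (rule prod_diff)
  also have "\<dots> \<le> C * (2 * 4 ^ CARD('d) * (1/4) ^ n) + (1/4) ^ n"
    using rate[OF n] C by (intro add_right_mono mult_left_mono) auto
  also have "\<dots> = (C * (2 * 4 ^ CARD('d)) + 1) * (1/4) ^ n" by (simp add: algebra_simps)
  finally show "norm (n1 T (\<lambda>t x. \<rho> (Suc n) t x * U (Suc n) k t x - \<rho> n t x * U n k t x)) \<le> (C * (2 * 4 ^ CARD('d)) + 1) * (1/4) ^ n"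
    using n1_nonneg[OF jcont_diff[OF jprod[of "Suc n" k] jprod[of n k]], of T] by simp
qed simp

lemma lim_AE:
  "AE z in lborel. z \<in> slab T \<longrightarrow> (\<lambda>n. \<rho> n (fst z) (snd z)) \<longlonglongrightarrow> rho (fst z) (snd z)"
  "AE z in lborel. z \<in> slab T \<longrightarrow> (\<lambda>n. U n k (fst z) (snd z)) \<longlonglongrightarrow> u (fst z) (snd z) $ k"
  "AE z in lborel. z \<in> slab T \<longrightarrow> (\<lambda>n. \<rho> n (fst z) (snd z) * U n k (fst z) (snd z)) \<longlonglongrightarrow> rho (fst z) (snd z) * u (fst z) (snd z) $ k"
proof -
  show "AE z in lborel. z \<in> slab T \<longrightarrow> (\<lambda>n. \<rho> n (fst z) (snd z)) \<longlonglongrightarrow> rho (fst z) (snd z)"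
    using AE_Good_slab by eventually_elim (use rho_lim in auto)
  show "AE z in lborel. z \<in> slab T \<longrightarrow> (\<lambda>n. U n k (fst z) (snd z)) \<longlonglongrightarrow> u (fst z) (snd z) $ k"
    using AE_Good_slab by eventually_elim (use U_lim in auto)
  show "AE z in lborel. z \<in> slab T \<longrightarrow> (\<lambda>n. \<rho> n (fst z) (snd z) * U n k (fst z) (snd z)) \<longlonglongrightarrow> rho (fst z) (snd z) * u (fst z) (snd z) $ k"
    using AE_Good_slab by eventually_elim (use rho_lim U_lim in \<open>auto intro!: tendsto_mult\<close>)
qed

lemmas rho_L1 = slab_L1_limit[where F=rho, OF jcont_tfun[OF t\<rho>] sum_rho rho_borel lim_AE(1)]
lemmas u_L1 = slab_L1_limit[where F="\<lambda>t x. u t x $ k", OF jcont_tfun[OF tU] sum_U u_borel lim_AE(2)] for k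
lemmas prod_L1 = slab_L1_limit[where F="\<lambda>t x. rho t x * u t x $ k",
    OF jprod sum_prod borel_measurable_times[OF rho_borel u_borel] lim_AE(3)] for k

lemma rho_periodic: "periodic (rho t)"
  using tfun_periodic[OF t\<rho>] by (simp add: periodic_def rho_def)

lemma u_periodic: "periodic (u t)"
  unfolding periodic_def
proof (intro allI)
  fix x :: "real^'d" and l
  have "\<Psi> n ((x + axis l 1) $ j n) = \<Psi> n (x $ j n)" for n
    using periodicD[OF periodic_coord[where j="j n", OF p\<Psi>[of n]], of x l] .
  then show "u t (x + axis l 1) = u t x" by (simp only: u_def)
qed

lemma rho_spacetime: "rho \<in> L1_spacetime T"
  by (rule L1_spacetime_real[OF rho_periodic rho_borel rho_L1(1)])

lemma u_spacetime: "u \<in> L1_spacetime T"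
  by (rule L1_spacetime_vec[OF u_periodic u_borel u_L1(1)])

lemma prod_spacetime: "(\<lambda>t x. rho t x *\<^sub>R u t x) \<in> L1_spacetime T"
proof (rule L1_spacetime_vec)
  show "periodic (\<lambda>x. rho t x *\<^sub>R u t x)" for t
    using rho_periodic[of t] u_periodic[of t] by (simp add: periodic_def)
  show "(\<lambda>z. (rho (fst z) (snd z) *\<^sub>R u (fst z) (snd z)) $ k) \<in> borel_measurable borel" for k
    using borel_measurable_times[OF rho_borel u_borel[of k]] by simp
  show "integrable lborel (\<lambda>z. indicator (slab T) z * (rho (fst z) (snd z) *\<^sub>R u (fst z) (snd z)) $ k)" for k
    using prod_L1(1)[of k] by simp
qed

lemma R_tendsto: "(\<lambda>n. n1 T (R n k)) \<longlonglongrightarrow> 0"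
proof (rule tendsto_sandwich)
  show "\<forall>\<^sub>F n in sequentially. 0 \<le> n1 T (R n k)" by (intro always_eventually allI n1_nonneg jcont_tfun tR)
  show "\<forall>\<^sub>F n in sequentially. n1 T (R n k) \<le> 2 * 4 ^ CARD('d) * (1/4) ^ n"
    using eventually_ge_at_top[of "CARD('d)"] by eventually_elim (rule rate)
  show "(\<lambda>n. 2 * 4 ^ CARD('d) * (1/4 :: real) ^ n) \<longlonglongrightarrow> 0"
    by (intro tendsto_mult_right_zero LIMSEQ_power_zero) simp
qed simp

text \<open>The weak form with defect passes to the limit term by term: density and flux converge in
  L^1, the test functions have bounded derivatives on the slab, and the defect tends to 0.\<close>

lemma weak_rho: "weak_solution T m c u (\<lambda>x. 0) rho"
  unfolding weak_solution_def
proof (intro conjI ballI rho_spacetime prod_spacetime)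
  fix \<phi> :: "real \<Rightarrow> real ^ 'd \<Rightarrow> real" assume "\<phi> \<in> test_initial T"
  then have \<phi>: "spacetime_smooth \<phi>" and \<phi>T: "\<And>x. \<phi> T x = 0" by (auto simp: test_initial_def)
  define A where "A = (\<lambda>t x. pT \<phi> t x + Lop m (adjoint_coeffs c) \<phi> t x)"
  have jA: "jcont A" unfolding A_def
    by (intro jcont_intros(3) spacetime_smooth_jcont spacetime_smooth_pT Lop_jcont \<phi>)
  have jD: "jcont (pD k \<phi>)" for k by (intro spacetime_smooth_jcont spacetime_smooth_pD \<phi>)
  let ?I = "\<lambda>z. indicator (slab T) z :: real"
  define G where "G t x = rho t x * A t x + (\<Sum>k\<in>UNIV. rho t x * u t x $ k * pD k \<phi> t x)" for t x
  have Geq: "rho t x * (deriv (\<lambda>s. \<phi> s x) t + diff_op m (adjoint_coeffs c) (\<phi> t) x + u t x \<bullet> grad (\<phi> t) x) = G t x" for t x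
    unfolding G_def A_def grad_inner pT_def Lop_diff_op by (simp add: algebra_simps sum_distrib_left)
  have Gm: "(\<lambda>z. G (fst z) (snd z)) \<in> borel_measurable borel"
    unfolding G_def by (intro borel_measurable_add borel_measurable_sum borel_measurable_times rho_borel u_borel jcont_borel jA jD)
  have IG: "?I z * G (fst z) (snd z) = ?I z * (rho (fst z) (snd z) * A (fst z) (snd z)) +
     (\<Sum>k\<in>UNIV. ?I z * (rho (fst z) (snd z) * u (fst z) (snd z) $ k * pD k \<phi> (fst z) (snd z)))" for z
    by (simp add: G_def distrib_left sum_distrib_left)
  have Gi: "integrable lborel (\<lambda>z. ?I z * G (fst z) (snd z))"
    unfolding IG by (intro Bochner_Integration.integrable_add Bochner_Integration.integrable_sum rho_L1(2) prod_L1(2) jA jD)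
  have "(\<lambda>n. iint T (\<lambda>t x. \<rho> n t x * A t x) + (\<Sum>k\<in>UNIV. iint T (\<lambda>t x. \<rho> n t x * U n k t x * pD k \<phi> t x)))
     \<longlonglongrightarrow> (LINT z|lborel. ?I z * (rho (fst z) (snd z) * A (fst z) (snd z))) +
       (\<Sum>k\<in>UNIV. LINT z|lborel. ?I z * (rho (fst z) (snd z) * u (fst z) (snd z) $ k * pD k \<phi> (fst z) (snd z)))"
    by (intro tendsto_add tendsto_sum rho_L1(3) prod_L1(3) jA jD)
  also have "(LINT z|lborel. ?I z * (rho (fst z) (snd z) * A (fst z) (snd z))) +
       (\<Sum>k\<in>UNIV. LINT z|lborel. ?I z * (rho (fst z) (snd z) * u (fst z) (snd z) $ k * pD k \<phi> (fst z) (snd z))) =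
     (LINT z|lborel. ?I z * G (fst z) (snd z))"
  proof -
    have i1: "integrable lborel (\<lambda>z. ?I z * (rho (fst z) (snd z) * A (fst z) (snd z)))" by (rule rho_L1(2)[OF jA])
    have i2: "integrable lborel (\<lambda>z. ?I z * (rho (fst z) (snd z) * u (fst z) (snd z) $ k * pD k \<phi> (fst z) (snd z)))" for k
      by (rule prod_L1(2)[OF jD])
    show ?thesis unfolding IG
      by (subst Bochner_Integration.integral_add[OF i1 Bochner_Integration.integrable_sum[OF i2]])
         (subst Bochner_Integration.integral_sum[OF i2], rule refl)
  qed
  finally have lim: "(\<lambda>n. iint T (\<lambda>t x. \<rho> n t x * A t x) + (\<Sum>k\<in>UNIV. iint T (\<lambda>t x. \<rho> n t x * U n k t x * pD k \<phi> t x)))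
     \<longlonglongrightarrow> (LINT z|lborel. ?I z * G (fst z) (snd z))" .
  have eq: "iint T (\<lambda>t x. \<rho> n t x * A t x) + (\<Sum>k\<in>UNIV. iint T (\<lambda>t x. \<rho> n t x * U n k t x * pD k \<phi> t x))
     = (\<Sum>k\<in>UNIV. iint T (\<lambda>t x. R n k t x * pD k \<phi> t x))" for n
  proof -
    have j1: "jcont (\<lambda>t x. \<rho> n t x * A t x)" by (rule jcont_intros(4)[OF jcont_tfun[OF t\<rho>] jA])
    have j2: "jcont (\<lambda>t x. \<rho> n t x * U n k t x * pD k \<phi> t x)" for k by (rule jcont_intros(4)[OF jprod jD])
    have j3: "jcont (\<lambda>t x. R n k t x * pD k \<phi> t x)" for k by (rule jcont_intros(4)[OF jcont_tfun[OF tR] jD])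
    have js: "jcont (\<lambda>t x. \<Sum>k\<in>UNIV. \<rho> n t x * U n k t x * pD k \<phi> t x)"
      using j2 unfolding jcont_def by (intro continuous_on_sum)
    show ?thesis
      using defect_weak_form[OF inv T \<phi> \<phi>T, of n]
      unfolding iint_sum[OF j2, symmetric] iint_sum[OF j3, symmetric] iint_add[OF j1 js, symmetric]
      unfolding A_def by (simp only:)
  qed
  have "(\<lambda>n. \<Sum>k\<in>UNIV. iint T (\<lambda>t x. R n k t x * pD k \<phi> t x)) \<longlonglongrightarrow> (\<Sum>k\<in>(UNIV::'d set). 0)"
  proof (rule tendsto_sum)
    fix k
    obtain B where B: "0 \<le> B" "\<And>t x. 0 \<le> t \<Longrightarrow> t \<le> T \<Longrightarrow> x \<in> cell \<Longrightarrow> \<bar>pD k \<phi> t x\<bar> \<le> B"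
      using jcont_bounded[OF jD, of T] by blast
    show "(\<lambda>n. iint T (\<lambda>t x. R n k t x * pD k \<phi> t x)) \<longlonglongrightarrow> 0"
    proof (rule Lim_null_comparison)
      show "\<forall>\<^sub>F n in sequentially. norm (iint T (\<lambda>t x. R n k t x * pD k \<phi> t x)) \<le> n1 T (R n k) * B"
        using iint_abs_le[OF jcont_tfun[OF tR] jD B] by (simp add: always_eventually)
      show "(\<lambda>n. n1 T (R n k) * B) \<longlonglongrightarrow> 0" by (rule tendsto_mult_left_zero[OF R_tendsto])
    qed
  qed
  then have "(LINT z|lborel. ?I z * G (fst z) (snd z)) = 0"
    using LIMSEQ_unique[OF lim] unfolding eq by simp
  then have "(LINT t:{0..T}|lebesgue. LINT x:cell|lebesgue. G t x) = 0"
    using iterated_integral_slab[OF Gm Gi] by simp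
  then show "- (LINT x:cell|lebesgue. 0 * \<phi> 0 x) = (LINT t:{0..T}|lebesgue. LINT x:cell|lebesgue.
      rho t x * (deriv (\<lambda>s. \<phi> s x) t + diff_op m (adjoint_coeffs c) (\<phi> t) x + u t x \<bullet> grad (\<phi> t) x))"
    unfolding Geq by (simp add: set_lebesgue_integral_def)
qed

text \<open>Every shear points in direction \<open>i n\<close> and varies only along the different
  direction \<open>j n\<close>.\<close>

lemma U_div: "(\<Sum>k\<in>UNIV. pD k (U n k) t x) = 0"
proof (induction n)
  case 0
  show ?case by (simp add: U0 pD_time)
next
  case (Suc n)
  have tw: "tfun (\<lambda>t x :: real^'d. if k = i n then \<gamma> n t * \<Psi> n (x $ j n) else 0)" for k
    by (cases "k = i n") (auto intro!: tfun.mult tfun.time tfun.space s\<gamma> s\<Psi> p\<Psi>)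
  have U': "U (Suc n) k = (\<lambda>t x. U n k t x + (if k = i n then \<gamma> n t * \<Psi> n (x $ j n) else 0))" for k
    by (intro ext) (rule U_Suc)
  have "pD k (\<lambda>t x :: real^'d. if k = i n then \<gamma> n t * \<Psi> n (x $ j n) else 0) = (\<lambda>t x. 0)" for k
    using ij[of n] by (cases "k = i n") (auto simp: pD_time pD_time_mult tfun.space s\<gamma> s\<Psi> p\<Psi> pD_space)
  then have "pD k (U (Suc n) k) t x = pD k (U n k) t x" for k
    unfolding U' using pD_add[OF tU tw, of k n k] by simp
  then show ?case using Suc by simp
qed

lemma div_u: "div_free T u"
  unfolding div_free_def
proof (intro conjI ballI u_spacetime)
  fix \<phi> :: "real \<Rightarrow> real ^ 'd \<Rightarrow> real" assume "\<phi> \<in> test_interior T"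
  then have \<phi>: "spacetime_smooth \<phi>" by (auto simp: test_interior_def)
  have jD: "jcont (pD k \<phi>)" for k by (intro spacetime_smooth_jcont spacetime_smooth_pD \<phi>)
  let ?I = "\<lambda>z. indicator (slab T) z :: real"
  define G where "G t x = (\<Sum>k\<in>UNIV. u t x $ k * pD k \<phi> t x)" for t x
  have Gm: "(\<lambda>z. G (fst z) (snd z)) \<in> borel_measurable borel"
    unfolding G_def by (intro borel_measurable_sum borel_measurable_times u_borel jcont_borel jD)
  have IG: "?I z * G (fst z) (snd z) = (\<Sum>k\<in>UNIV. ?I z * (u (fst z) (snd z) $ k * pD k \<phi> (fst z) (snd z)))" for z
    by (simp add: G_def sum_distrib_left)
  have Gi: "integrable lborel (\<lambda>z. ?I z * G (fst z) (snd z))"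
    unfolding IG by (intro Bochner_Integration.integrable_sum u_L1(2) jD)
  have "(\<lambda>n. \<Sum>k\<in>UNIV. iint T (\<lambda>t x. U n k t x * pD k \<phi> t x))
     \<longlonglongrightarrow> (\<Sum>k\<in>UNIV. LINT z|lborel. ?I z * (u (fst z) (snd z) $ k * pD k \<phi> (fst z) (snd z)))"
    by (intro tendsto_sum u_L1(3) jD)
  moreover have "(\<Sum>k\<in>UNIV. iint T (\<lambda>t x. U n k t x * pD k \<phi> t x)) = 0" for n
  proof -
    have j2: "jcont (\<lambda>t x. U n k t x * pD k \<phi> t x)" for k by (rule jcont_intros(4)[OF jcont_tfun[OF tU] jD])
    have cf: "continuous_on UNIV (pD k (U n k) t)" "continuous_on UNIV (\<phi> t)" for k t
      by (intro tfun_continuous_space tfun_pD tU, intro jcont_space spacetime_smooth_jcont \<phi>)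
    have "integral cell (\<lambda>x. \<Sum>k\<in>UNIV. U n k t x * pD k \<phi> t x) = 0" for t
    proof -
      have "integral cell (\<lambda>x. \<Sum>k\<in>UNIV. U n k t x * pD k \<phi> t x) = (\<Sum>k\<in>UNIV. integral cell (\<lambda>x. U n k t x * pD k \<phi> t x))"
        by (rule integral_sum) (auto intro!: jcont_integrable[OF j2])
      also have "\<dots> = (\<Sum>k\<in>UNIV. - integral cell (\<lambda>x. pD k (U n k) t x * \<phi> t x))"
        by (simp add: cell_by_parts_pD[OF tU \<phi>])
      also have "\<dots> = - integral cell (\<lambda>x. \<Sum>k\<in>UNIV. pD k (U n k) t x * \<phi> t x)"
        unfolding sum_negf by (subst integral_sum) (auto intro!: cell_integrable continuous_intros cf)
      also have "\<dots> = 0" unfolding sum_distrib_right[symmetric] U_div by simp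
      finally show ?thesis .
    qed
    then show ?thesis unfolding iint_sum[OF j2, symmetric] unfolding iint_def by simp
  qed
  ultimately have z: "(\<Sum>k\<in>UNIV. LINT z|lborel. ?I z * (u (fst z) (snd z) $ k * pD k \<phi> (fst z) (snd z))) = 0"
    by (simp add: LIMSEQ_const_iff)
  have "(LINT z|lborel. ?I z * G (fst z) (snd z)) = 0"
    unfolding IG by (subst Bochner_Integration.integral_sum[OF u_L1(2)[OF jD]]) (rule z)
  then show "(LINT t:{0..T}|lebesgue. LINT x:cell|lebesgue. u t x \<bullet> grad (\<phi> t) x) = 0"
    unfolding grad_inner using iterated_integral_slab[OF Gm Gi] by (simp add: G_def)
qed

text \<open>All steps together lower the L^1 norm by at most 2 (T + 1), and the norms converge to
  that of \<open>rho\<close>, so a larger starting norm cannot be lost.\<close>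

lemma rho_nonzero:
  assumes "2 * (T + 1) < n1 T (\<rho> 0)"
  shows "\<not> (AE (t, x) in lebesgue_on ({0..T} \<times> cell). rho t x = (0 :: real))"
proof
  assume "AE (t, x) in lebesgue_on (slab T). rho t x = 0"
  then have "AE z in lebesgue. z \<in> slab T \<longrightarrow> rho (fst z) (snd z) = 0"
    using slab_borel[of T] by (subst (asm) AE_restrict_space_iff) (auto simp: case_prod_beta)
  then have "AE z in lborel. z \<in> slab T \<longrightarrow> rho (fst z) (snd z) = 0" by (simp only: AE_completion_iff)
  then have "(LINT z|lborel. indicator (slab T) z * \<bar>rho (fst z) (snd z)\<bar>) = (LINT z|(lborel :: (real \<times> (real^'d)) measure). 0)"
    using rho_borel
    by (intro integral_cong_AE borel_measurable_times borel_measurable_indicator borel_measurable_abs)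
       (auto simp: indicator_def)
  then have lim: "(\<lambda>n. n1 T (\<rho> n)) \<longlonglongrightarrow> 0" using rho_L1(4) by simp
  have "n1 T (\<rho> 0) - (T + 1) * (2 - 2 * (1/2) ^ n) \<le> n1 T (\<rho> n)" for n
  proof (induction n)
    case (Suc n)
    have "n1 T (\<rho> n) \<le> n1 T (\<rho> (Suc n)) + n1 T (\<lambda>t x. \<rho> (Suc n) t x - \<rho> n t x)"
    proof -
      note j = j\<rho>[of "Suc n"] j\<rho>_diff[of n] j\<rho>[of n]
      have "integral cell (\<lambda>x. \<bar>\<rho> n t x\<bar>) \<le> integral cell (\<lambda>x. \<bar>\<rho> (Suc n) t x\<bar>) + integral cell (\<lambda>x. \<bar>\<rho> (Suc n) t x - \<rho> n t x\<bar>)" for t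
        unfolding integral_add[OF jcont_integrable[OF jcont_intros(5)[OF j(1)]] jcont_integrable[OF jcont_intros(5)[OF j(2)]], symmetric]
        by (rule integral_le[OF jcont_integrable[OF jcont_intros(5)[OF j(3)]] integrable_add[OF jcont_integrable[OF jcont_intros(5)[OF j(1)]] jcont_integrable[OF jcont_intros(5)[OF j(2)]]]]) auto
      then show ?thesis
        unfolding n1_def integral_add[OF n1_integrable[OF j(1)] n1_integrable[OF j(2)], symmetric]
        by (intro integral_le integrable_add n1_integrable j)
    qed
    also have "\<dots> \<le> n1 T (\<rho> (Suc n)) + (1/2) ^ n * (T + 1)" by (intro add_left_mono rho_n1_diff)
    finally show ?case using Suc by (simp add: algebra_simps)
  qed simp
  moreover have "(T + 1) * (2 - 2 * (1/2) ^ n) \<le> 2 * (T + 1)" for n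
  proof -
    have "(T + 1) * (2 - 2 * (1/2) ^ n) \<le> (T + 1) * 2" using T by (intro mult_left_mono) auto
    then show ?thesis by simp
  qed
  ultimately have "n1 T (\<rho> 0) - 2 * (T + 1) \<le> n1 T (\<rho> n)" for n by (meson diff_left_mono order_trans)
  then have "n1 T (\<rho> 0) - 2 * (T + 1) \<le> 0" by (intro LIMSEQ_le_const[OF lim]) auto
  then show False using assms by simp
qed

end

subsection \<open>Membership in the Bochner spaces\<close>

lemma finite_pDs: "finite ((\<lambda>w. pDs w f) ` {w :: 'd::finite list. length w \<le> k})"
  using finite_lists_length_le[of "UNIV :: 'd set" k] by simp

text \<open>The derivatives up to order \<open>k\<close> are Lipschitz in time uniformly in space,
  hence so is the norm. It serves the measurability in time of the norm of the limit.\<close>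

lemma Ck_norm_continuous_on:
  fixes f :: "real \<Rightarrow> real ^ 'd::finite \<Rightarrow> real"
  assumes f: "tfun f" shows "continuous_on {0..T} (\<lambda>t. Ck_norm k (f t))"
proof -
  define F where "F = (\<lambda>w. pDs w f) ` {w. length w \<le> k}"
  have tF: "g \<in> F \<Longrightarrow> tfun g" and FI: "length w \<le> k \<Longrightarrow> pDs w f \<in> F" for g w
    using tfun_pDs[OF f] by (auto simp: F_def)
  have fF: "finite F" unfolding F_def by (rule finite_pDs)
  obtain M where M: "0 \<le> M"
    "\<And>g s t x. g \<in> F \<Longrightarrow> 0 \<le> s \<Longrightarrow> s \<le> T \<Longrightarrow> 0 \<le> t \<Longrightarrow> t \<le> T \<Longrightarrow> \<bar>g s x - g t x\<bar> \<le> M * \<bar>s - t\<bar>"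
    using tfun_family_Lipschitz[where T=T, OF fF tF] by blast
  obtain B where B: "1 \<le> B" "\<And>g t x. g \<in> F \<Longrightarrow> 0 \<le> t \<Longrightarrow> t \<le> T \<Longrightarrow> \<bar>g t x\<bar> \<le> B"
    using tfun_family_bounded[where T=T, OF fF tF] by blast
  have "(mi_count TYPE('d) k * M)-lipschitz_on {0..T} (\<lambda>t. Ck_norm k (f t))"
  proof (rule lipschitz_onI)
    fix s t assume h: "s \<in> {0..T}" "t \<in> {0..T}"
    have "\<bar>Ck_norm k (f s) - Ck_norm k (f t)\<bar> \<le> mi_count TYPE('d) k * (M * \<bar>s - t\<bar>)"
      by (rule Ck_norm_diff_le[of k _ _ _ B])
         (use h M(2)[OF FI] B(2)[OF FI] in \<open>simp_all flip: pDs_slice\<close>)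
    then show "dist (Ck_norm k (f s)) (Ck_norm k (f t)) \<le> mi_count TYPE('d) k * M * dist s t"
      by (simp add: dist_real_def mult.assoc)
  qed (use M in \<open>simp add: mi_count_def\<close>)
  then show ?thesis by (rule lipschitz_on_continuous_on)
qed

lemma pDs_zero: "pDs w (\<lambda>t x. 0) = (\<lambda>t x. 0)"
  by (induction w) (simp_all add: pD_time)

lemma Ck_norm_zero: "Ck_norm k (\<lambda>x :: real ^ 'd::finite. 0) = 0"
proof -
  have "foldr partial w (\<lambda>x :: real ^ 'd. 0 :: real) = (\<lambda>x. 0)" for w
    using pDs_slice[where w=w and f="\<lambda>t x. 0" and t=0] unfolding pDs_zero by (rule sym)
  then have "\<bar>foldr partial w (\<lambda>x :: real ^ 'd. 0 :: real) x\<bar> \<le> 0" for w x by simp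
  from Ck_norm_le[of k, OF this] show ?thesis by simp
qed

lemma zero_Bochner: "0 < T \<Longrightarrow> (\<lambda>t (x :: real ^ 'd::finite). 0) \<in> Bochner_Lp p T (Ck_torus k) (Ck_norm k)"
proof -
  assume T: "0 < T"
  have C: "(\<lambda>x :: real ^ 'd. 0 :: real) \<in> Ck_torus k"
    using tfun_C_k[where t=0, OF tfun_const[of 0]] by (simp add: Ck_torus_def periodic_def)
  have "simple_valued T (Ck_torus k) (\<lambda>t (x :: real ^ 'd). 0)"
    by (rule simple_valued_tstep[where N=1 and H="\<lambda>t x. 0", OF T]) (use C in auto)
  then have "strongly_measurable T (Ck_torus k) (Ck_norm k) (\<lambda>t (x :: real ^ 'd). 0)"
    unfolding strongly_measurable_def using C by (intro exI[of _ "\<lambda>n t x. 0"]) (simp add: Ck_norm_zero)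
  then show ?thesis by (simp add: Bochner_Lp_def Ck_norm_zero set_integrable_def)
qed

context ci_limit
begin

lemma AE_Good_lebesgue: "AE t in lebesgue_on {0..T}. t \<in> Good"
  using AE_completion[OF AE_Good] by (subst AE_restrict_space_iff) auto

lemma rho_freeze:
  assumes t: "t \<in> Good" and n: "k \<le> n"
    and d: "\<And>w x. length w \<le> k \<Longrightarrow> \<bar>pDs w (\<rho> n) \<tau> x - pDs w (\<rho> n) t x\<bar> \<le> \<delta>"
  shows "Ck_norm k (\<lambda>x. \<rho> n \<tau> x - rho t x) \<le> mi_count TYPE('d) k * (\<delta> + (\<Sum>m. a (m + n) t))"
    "0 \<le> Ck_norm k (\<lambda>x. \<rho> n \<tau> x - rho t x)"
proof -
  define F where "F q s x = \<rho> n \<tau> x - \<rho> q s x" for q s x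
  have tF: "tfun (F q)" for q unfolding F_def[abs_def] by (intro tfun_diff tfun_freeze t\<rho>)
  have pF: "pDs w (F q) t x = pDs w (\<rho> n) \<tau> x - pDs w (\<rho> q) t x" for w q x
    unfolding F_def[abs_def] by (simp add: pDs_diff[OF tfun_freeze[OF t\<rho>] t\<rho>] pDs_slice)
  have le: "\<bar>pDs w (F (Suc q)) t x - pDs w (F q) t x\<bar> \<le> a q t" if "length w \<le> k" "k \<le> q" for w q x
    using a_diff[of w q t x] that Good_D[OF t] by (simp add: pF)
  have lim: "(\<lambda>x. lim (\<lambda>q. F q t x)) = (\<lambda>x. \<rho> n \<tau> x - rho t x)"
    unfolding F_def by (intro ext limI tendsto_diff tendsto_const rho_lim t)
  have "\<bar>foldr partial w (\<lambda>x. \<rho> n \<tau> x - rho t x) x\<bar> \<le> \<delta> + (\<Sum>m. a (m + n) t)" if w: "length w \<le> k" for w x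
    using Ck_limit(2)[where F=F and t=t and k=k, OF tF Good_a(1)[OF t] le w n, of x] d[OF w, of x]
    unfolding lim pF by linarith
  from Ck_norm_le[of k, OF this]
  show "Ck_norm k (\<lambda>x. \<rho> n \<tau> x - rho t x) \<le> mi_count TYPE('d) k * (\<delta> + (\<Sum>m. a (m + n) t))"
    "0 \<le> Ck_norm k (\<lambda>x. \<rho> n \<tau> x - rho t x)" by auto
qed

lemma rho_approx:
  assumes t: "t \<in> Good"
  shows "rho t \<in> Ck_torus k"
    "length w \<le> k \<Longrightarrow> k \<le> n \<Longrightarrow> \<bar>foldr partial w (\<rho> n t) x - foldr partial w (rho t) x\<bar> \<le> (\<Sum>m. a (m + n) t)"
proof -
  have le: "\<bar>pDs w (\<rho> (Suc q)) t x - pDs w (\<rho> q) t x\<bar> \<le> a q t" if "length w \<le> k" "k \<le> q" for w q x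
    using a_diff[of w q t x] that Good_D[OF t] by simp
  have r: "(\<lambda>x. lim (\<lambda>n. \<rho> n t x)) = rho t" using t by (simp add: rho_def fun_eq_iff)
  note L = Ck_limit[where F=\<rho> and t=t and k=k, OF t\<rho> Good_a(1)[OF t] le, unfolded r]
  show "rho t \<in> Ck_torus k" by (rule L(1))
  show "length w \<le> k \<Longrightarrow> k \<le> n \<Longrightarrow> \<bar>foldr partial w (\<rho> n t) x - foldr partial w (rho t) x\<bar> \<le> (\<Sum>m. a (m + n) t)"
    using L(2)[of w n x] by (simp add: pDs_slice)
qed

lemma \<rho>_bounded:
  obtains B where "0 \<le> B" "\<And>w t x. length w \<le> k \<Longrightarrow> 0 \<le> t \<Longrightarrow> t \<le> T \<Longrightarrow> \<bar>foldr partial w (\<rho> n t) x\<bar> \<le> B"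
proof -
  define F where "F = (\<lambda>w. pDs w (\<rho> n)) ` {w. length w \<le> k}"
  have tF: "g \<in> F \<Longrightarrow> tfun g" and FI: "length w \<le> k \<Longrightarrow> pDs w (\<rho> n) \<in> F" for g w
    using tfun_pDs[OF t\<rho>] by (auto simp: F_def)
  have fF: "finite F" unfolding F_def by (rule finite_pDs)
  obtain B where B: "1 \<le> B" "\<And>g t x. g \<in> F \<Longrightarrow> 0 \<le> t \<Longrightarrow> t \<le> T \<Longrightarrow> \<bar>g t x\<bar> \<le> B"
    using tfun_family_bounded[where T=T, OF fF tF] by blast
  show ?thesis using B(1) B(2)[OF FI] by (intro that[of B]) (auto simp: pDs_slice)
qed

text \<open>A diagonal choice: the grid for the n-th density is so fine that its derivatives up to
  order \<open>n\<close> change by at most 1/(n+1) between a time and its grid point. One sequence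
  then serves every \<open>k\<close>, from n = k on.\<close>

lemma rho_strongly_measurable: "strongly_measurable T (Ck_torus k) (Ck_norm k) rho"
proof -
  have ex: "\<forall>n. \<exists>N. 0 < N \<and> (\<forall>w t x. length w \<le> n \<longrightarrow> 0 \<le> t \<longrightarrow> t \<le> T \<longrightarrow>
      \<bar>pDs w (\<rho> n) (tstep T N t) x - pDs w (\<rho> n) t x\<bar> \<le> 1 / (real n + 1))"
  proof
    fix n
    define F where "F = (\<lambda>w. pDs w (\<rho> n)) ` {w. length w \<le> n}"
    have tF: "g \<in> F \<Longrightarrow> tfun g" and FI: "length w \<le> n \<Longrightarrow> pDs w (\<rho> n) \<in> F" for g w
      using tfun_pDs[OF t\<rho>] by (auto simp: F_def)
    have fF: "finite F" unfolding F_def by (rule finite_pDs)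
    obtain N where "0 < N" "\<And>f t x. f \<in> F \<Longrightarrow> 0 \<le> t \<Longrightarrow> t \<le> T \<Longrightarrow> \<bar>f (tstep T N t) x - f t x\<bar> \<le> 1 / (real n + 1)"
      using tstep_uniform[where e="1 / (real n + 1)", OF T fF tF] by auto
    then show "\<exists>N. 0 < N \<and> (\<forall>w t x. length w \<le> n \<longrightarrow> 0 \<le> t \<longrightarrow> t \<le> T \<longrightarrow>
      \<bar>pDs w (\<rho> n) (tstep T N t) x - pDs w (\<rho> n) t x\<bar> \<le> 1 / (real n + 1))" using FI by blast
  qed
  from choice[OF ex] obtain N where N: "\<And>n. 0 < N n"
    "\<And>n w t x. length w \<le> n \<Longrightarrow> 0 \<le> t \<Longrightarrow> t \<le> T \<Longrightarrow>
      \<bar>pDs w (\<rho> n) (tstep T (N n) t) x - pDs w (\<rho> n) t x\<bar> \<le> 1 / (real n + 1)"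
    by blast
  show ?thesis
    unfolding strongly_measurable_def
  proof (intro exI[of _ "\<lambda>n t. \<rho> n (tstep T (N n) t)"] conjI allI)
    show "simple_valued T (Ck_torus k) (\<lambda>t. \<rho> n (tstep T (N n) t))" for n
      by (rule simple_valued_tstep[OF T N(1)]) (simp add: Ck_torus_def tfun_C_k tfun_periodic t\<rho>)
    show "AE t in lebesgue_on {0..T}. rho t \<in> Ck_torus k \<and> (\<lambda>n. Ck_norm k (\<lambda>x. \<rho> n (tstep T (N n) t) x - rho t x)) \<longlonglongrightarrow> 0"
      using AE_Good_lebesgue
    proof eventually_elim
      case (elim t)
      let ?b = "\<lambda>n. mi_count TYPE('d) k * (1 / (real n + 1) + (\<Sum>m. a (m + n) t))"
      have "(\<lambda>n. 1 / (real n + 1)) \<longlonglongrightarrow> 0" using LIMSEQ_inverse_real_of_nat by (simp add: inverse_eq_divide add.commute)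
      from tendsto_mult_right_zero[OF tendsto_add_zero[OF this suminf_tail_tendsto_0[OF Good_a(1)[OF elim]]]]
      have b: "?b \<longlonglongrightarrow> 0" .
      have "eventually (\<lambda>n. norm (Ck_norm k (\<lambda>x. \<rho> n (tstep T (N n) t) x - rho t x)) \<le> ?b n) sequentially"
        using eventually_ge_at_top[of k]
      proof eventually_elim
        case (elim n)
        have d: "\<bar>pDs w (\<rho> n) (tstep T (N n) t) x - pDs w (\<rho> n) t x\<bar> \<le> 1 / (real n + 1)" if "length w \<le> k" for w x
          using N(2)[of w n t x] that elim Good_D[OF \<open>t \<in> Good\<close>] by simp
        from rho_freeze[where \<tau>="tstep T (N n) t", OF \<open>t \<in> Good\<close> elim d] show ?case by simp
      qed
      from Lim_null_comparison[OF this b] show ?case using rho_approx(1)[OF elim] by blast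
    qed
  qed
qed

text \<open>A pointwise limit of Borel functions: off \<open>Good\<close> everything is 0, and on
  \<open>Good\<close> the norms of the approximations converge.\<close>

lemma Ck_norm_rho_borel: "(\<lambda>t. Ck_norm k (rho t)) \<in> borel_measurable borel"
proof (rule borel_measurable_LIMSEQ_real)
  fix n
  have "(\<lambda>t. indicator {0..T} t *\<^sub>R Ck_norm k (\<rho> n t)) \<in> borel_measurable borel"
    by (intro borel_measurable_continuous_on_indicator Ck_norm_continuous_on t\<rho>) simp
  then show "(\<lambda>t. indicator Good t * (indicator {0..T} t *\<^sub>R Ck_norm k (\<rho> n t))) \<in> borel_measurable borel"
    using Good_borel by (intro borel_measurable_times borel_measurable_indicator) auto
next
  fix t
  show "(\<lambda>n. indicator Good t * (indicator {0..T} t *\<^sub>R Ck_norm k (\<rho> n t))) \<longlonglongrightarrow> Ck_norm k (rho t)"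
  proof (cases "t \<in> Good")
    case True
    let ?tl = "\<lambda>n. \<Sum>m. a (m + n) t"
    have "eventually (\<lambda>n. norm (Ck_norm k (\<rho> n t) - Ck_norm k (rho t)) \<le> mi_count TYPE('d) k * ?tl n) sequentially"
      using eventually_ge_at_top[of k]
    proof eventually_elim
      case (elim n)
      obtain B where B: "0 \<le> B" "\<And>w x. length w \<le> k \<Longrightarrow> \<bar>foldr partial w (\<rho> n t) x\<bar> \<le> B"
        using \<rho>_bounded[of k n] Good_D[OF True] by metis
      note A = rho_approx(2)[OF True _ elim]
      have tl0: "0 \<le> ?tl n" by (intro suminf_nonneg summable_ignore_initial_segment Good_a(1) True a0)
      have "\<bar>foldr partial w (rho t) x\<bar> \<le> B + ?tl n" "\<bar>foldr partial w (\<rho> n t) x\<bar> \<le> B + ?tl n" if "length w \<le> k" for w x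
        using A[OF that, of x] B(2)[OF that, of x] tl0 by linarith+
      from Ck_norm_diff_le[OF A this(2) this(1)] show ?case by simp
    qed
    from Lim_null_comparison[OF this tendsto_mult_right_zero[OF suminf_tail_tendsto_0[OF Good_a(1)[OF True]]]]
    have "(\<lambda>n. Ck_norm k (\<rho> n t)) \<longlonglongrightarrow> Ck_norm k (rho t)" by (simp add: LIM_zero_iff)
    then show ?thesis using True Good_D[OF True] by simp
  qed (simp add: rho_bad Ck_norm_zero)
qed

lemma rho_Bochner:
  assumes p: "1 \<le> p" shows "rho \<in> Bochner_Lp p T (Ck_torus k) (Ck_norm k)"
proof -
  \<comment> \<open>From index K on the steps control \<open>k\<close> derivatives and the p-th
    power. The finitely many earlier steps are contained in the K-th density, which is bounded with
    its derivatives on [0,T].\<close>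
  define K where "K = max k (nat \<lceil>p\<rceil>)"
  have K: "k \<le> K" "p \<le> real (Suc K)" unfolding K_def by linarith+
  obtain B where B: "0 \<le> B" "\<And>w t x. length w \<le> k \<Longrightarrow> 0 \<le> t \<Longrightarrow> t \<le> T \<Longrightarrow> \<bar>foldr partial w (\<rho> K t) x\<bar> \<le> B"
    using \<rho>_bounded[of k K] by blast
  define D where "D = mi_count TYPE('d) k * (B + 2)"
  have mc: "0 \<le> mi_count TYPE('d) k" by (simp add: mi_count_def)
  have D0: "0 \<le> D" using B mc by (simp add: D_def)
  have le: "\<bar>Ck_norm k (rho t) powr p\<bar> \<le> D powr p * (1 + (\<Sum>n. e n t))" if t: "t \<in> Good" for t
  proof -
    define E where "E = 1 + (\<Sum>n. e n t)"
    have E: "1 \<le> E" using suminf_nonneg[OF Good_D(3)[OF t] e0] by (simp add: E_def)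
    have E1: "1 \<le> E powr (1/p)" using E p by (intro ge_one_powr_ge_zero) auto
    have "\<bar>foldr partial w (rho t) x\<bar> \<le> B + 2 * E powr (1/p)" if w: "length w \<le> k" for w x
      using rho_approx(2)[OF t w K(1), of x] B(2)[OF w, of t x] Good_D[OF t] Good_a(2)[OF t p K(2)]
      unfolding E_def by linarith
    note N = Ck_norm_le[of k, OF this]
    have "B * 1 \<le> B * E powr (1/p)" using B E1 by (intro mult_left_mono) auto
    then have "B + 2 * E powr (1/p) \<le> (B + 2) * E powr (1/p)" by (simp add: algebra_simps)
    then have "mi_count TYPE('d) k * (B + 2 * E powr (1/p)) \<le> D * E powr (1/p)"
      unfolding D_def mult.assoc by (rule mult_left_mono[OF _ mc])
    with N have "Ck_norm k (rho t) powr p \<le> (D * E powr (1/p)) powr p"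
      using p by (intro powr_mono2) auto
    also have "\<dots> = D powr p * E" using D0 E p by (simp add: powr_mult powr_powr)
    finally show ?thesis by (simp add: E_def)
  qed
  have "set_integrable lebesgue {0..T} (\<lambda>t. Ck_norm k (rho t) powr p)"
  proof (rule set_integrable_Icc_lebesgueI)
    show "(\<lambda>t. Ck_norm k (rho t) powr p) \<in> borel_measurable borel"
      using Ck_norm_rho_borel by measurable
    have "integrable lborel (\<lambda>t. indicator {0..T} t * 1 + (\<Sum>n. indicator {0..T} t * e n t))"
      by (intro Bochner_Integration.integrable_add Icc_lborel Icc_AE_summable(2)[OF ce e0 sum_e] continuous_intros)
    then show "integrable lborel (\<lambda>t. D powr p * (indicator {0..T} t * 1 + (\<Sum>n. indicator {0..T} t * e n t)))"
      by (rule integrable_mult_right)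
    show "AE t in lborel. t \<in> {0..T} \<longrightarrow>
        \<bar>Ck_norm k (rho t) powr p\<bar> \<le> D powr p * (indicator {0..T} t * 1 + (\<Sum>n. indicator {0..T} t * e n t))"
      using AE_Good
    proof eventually_elim
      case (elim t)
      show ?case
      proof
        assume t: "t \<in> {0..T}"
        with elim le[of t] show "\<bar>Ck_norm k (rho t) powr p\<bar> \<le> D powr p * (indicator {0..T} t * 1 + (\<Sum>n. indicator {0..T} t * e n t))"
          by simp
      qed
    qed
  qed
  then show ?thesis using rho_strongly_measurable by (simp add: Bochner_Lp_def)
qed

end

section \<open>The velocity in L^1(0,T; W^{1,p})\<close>

lemma W1p_norm_nonneg: "0 \<le> W1p_norm p v" by (simp add: W1p_norm_def)

lemma Lp_norm_borel:
  fixes F :: "real \<Rightarrow> real ^ 'd::finite \<Rightarrow> real ^ 'd"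
  assumes F: "\<And>k. (\<lambda>z. F (fst z) (snd z) $ k) \<in> borel_measurable borel"
  shows "(\<lambda>t. Lp_norm p (F t)) \<in> borel_measurable borel"
proof -
  have FP: "(\<lambda>z. F (fst z) (snd z)) \<in> borel_measurable (borel \<Otimes>\<^sub>M borel)"
    using borel_measurable_vec[OF F] by (simp add: borel_prod)
  then have GP: "(\<lambda>z. norm (F (fst z) (snd z)) powr p) \<in> borel_measurable (borel \<Otimes>\<^sub>M borel)" by measurable
  have sl: "(\<lambda>x. norm (F t x) powr p) \<in> borel_measurable borel" for t
    using measurable_compose[OF measurable_Pair1' GP, of t] by simp
  have inner: "(LINT x:cell|lebesgue. norm (F t x) powr p) = (LINT x|lborel. indicator cell x * norm (F t x) powr p)" for t
    unfolding set_lebesgue_integral_def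
    by (subst integral_completion) (use sl in \<open>auto intro!: borel_measurable_times borel_measurable_indicator\<close>)
  have "(\<lambda>z. indicator cell (snd z) * norm (F (fst z) (snd z)) powr p) \<in> borel_measurable (borel \<Otimes>\<^sub>M borel)"
  proof (intro borel_measurable_times GP)
    show "(\<lambda>z. indicator cell (snd z) :: real) \<in> borel_measurable (borel \<Otimes>\<^sub>M borel)"
      by (rule measurable_compose[OF measurable_snd]) (intro borel_measurable_indicator, simp)
  qed
  then have "(\<lambda>t. LINT x|lborel. indicator cell x * norm (F t x) powr p) \<in> borel_measurable borel"
    by (intro lborel.borel_measurable_lebesgue_integral) (simp add: case_prod_beta cong: measurable_cong_sets)
  then show ?thesis unfolding Lp_norm_def inner by measurable
qed

context ci_limit
begin

text \<open>The bound \<open>\<Psi>q\<close> is available for all but finitely many \<open>n\<close>; the others are absorbed here.\<close>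

definition sp where
  "sp p n = s n + (if p \<le> real (Suc n) then 0 else integral {0..1} (\<lambda>y. \<bar>deriv (\<Psi> n) y\<bar> powr p) powr (1 / p))"

text \<open>A superposition as a function of its amplitude sequence: the limit \<open>u\<close>, the
  approximations at a grid time and their differences all have this form.\<close>

definition shear where "shear b x = (\<chi> k. \<Sum>n. if k = i n then b n * \<Psi> n (x $ j n) else 0)" for x :: "real ^ 'd"

lemma sp_ge: "s n \<le> sp p n" by (simp add: sp_def)

lemma sp_0: "0 \<le> sp p n" using s0[of n] sp_ge[of n p] by linarith

lemma deriv_sp:
  assumes p: "1 \<le> p" shows "integral {0..1} (\<lambda>y. \<bar>deriv (\<Psi> n) y\<bar> powr p) \<le> sp p n powr p"
proof (cases "p \<le> real (Suc n)")
  case True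
  then show ?thesis using \<Psi>q[OF p] by (simp add: sp_def)
next
  case False
  let ?I = "integral {0..1} (\<lambda>y. \<bar>deriv (\<Psi> n) y\<bar> powr p)"
  have "continuous_on {0..1} (\<lambda>y. \<bar>deriv (\<Psi> n) y\<bar> powr p)"
    using p by (intro continuous_on_powr' continuous_intros smooth1_continuous smooth1_deriv s\<Psi>) auto
  then have I: "0 \<le> ?I" by (intro integral_nonneg integrable_continuous_real) auto
  then have "?I = (?I powr (1/p)) powr p" using p by (simp add: powr_powr)
  also have "\<dots> \<le> sp p n powr p" using p s0[of n] False by (intro powr_mono2) (auto simp: sp_def)
  finally show ?thesis .
qed

lemma shear_W1p:
  assumes p: "1 \<le> p" and b: "summable (\<lambda>n. 2 ^ n * (\<bar>b n\<bar> * sp p n))"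
  shows "shear b \<in> W1p p"
    "W1p_norm p (shear b) \<le> (1 + real CARD('d) * 2 powr p) powr (1 / p) * (\<Sum>n. 2 ^ n * (\<bar>b n\<bar> * sp p n))"
    "is_weak_partial l (shear b)
      (\<lambda>x. \<chi> k. \<Sum>n. if k = i n then (if l = j n then b n * deriv (\<Psi> n) (x $ j n) else 0) else 0)"
proof -
  have \<Psi>sp: "\<bar>\<Psi> n y\<bar> \<le> sp p n" for n y using \<Psi>s sp_ge by (rule order_trans)
  have eq: "shear b = (\<lambda>x. \<chi> k. \<Sum>n. if k = i n then b n * \<Psi> n (x $ j n) else 0)"
    by (simp add: shear_def[abs_def])
  note S = shear_superposition_W1p[where c=b and s="sp p" and i=i and j=j, OF p s\<Psi> p\<Psi> \<Psi>sp deriv_sp[OF p] b, folded eq]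
  show "shear b \<in> W1p p" by (rule S(1))
  show "W1p_norm p (shear b) \<le> (1 + real CARD('d) * 2 powr p) powr (1 / p) * (\<Sum>n. 2 ^ n * (\<bar>b n\<bar> * sp p n))" by (rule S(2))
  show "is_weak_partial l (shear b)
      (\<lambda>x. \<chi> k. \<Sum>n. if k = i n then (if l = j n then b n * deriv (\<Psi> n) (x $ j n) else 0) else 0)" by (rule S(3))
qed

lemma shear_diff:
  assumes "summable (\<lambda>n. \<bar>b n\<bar> * s n)" "summable (\<lambda>n. \<bar>b' n\<bar> * s n)"
  shows "(\<lambda>x. shear b x - shear b' x) = shear (\<lambda>n. b n - b' n)"
proof (rule ext, subst vec_eq_iff, rule allI)
  fix x :: "real ^ 'd" and k
  have s: "summable (\<lambda>n. if k = i n then b n * \<Psi> n (x $ j n) else 0)" if "summable (\<lambda>n. \<bar>b n\<bar> * s n)" for b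
    by (rule suminf_abs_le(1)[OF that]) (use s0 in \<open>auto simp: abs_mult intro!: mult_left_mono \<Psi>s\<close>)
  show "(shear b x - shear b' x) $ k = shear (\<lambda>n. b n - b' n) x $ k"
    unfolding shear_def by (simp add: suminf_diff[OF s[OF assms(1)] s[OF assms(2)]] if_distrib left_diff_distrib cong: if_cong)
qed

lemma u_shear: "u t = shear (\<lambda>n. gg n t)"
  by (intro ext) (simp add: u_def shear_def)

lemma U_shear: "(\<lambda>x. \<chi> k. U n k \<tau> x) = shear (\<lambda>q. if q < n then \<gamma> q \<tau> else 0)"
proof (rule ext, subst vec_eq_iff, rule allI)
  fix x :: "real ^ 'd" and k
  have "(\<Sum>q. if k = i q then (if q < n then \<gamma> q \<tau> else 0) * \<Psi> q (x $ j q) else 0) =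
    (\<Sum>q<n. if k = i q then (if q < n then \<gamma> q \<tau> else 0) * \<Psi> q (x $ j q) else 0)"
    by (rule suminf_finite) auto
  then show "(\<chi> k. U n k \<tau> x) $ k = shear (\<lambda>q. if q < n then \<gamma> q \<tau> else 0) x $ k"
    by (simp add: shear_def U_sum cong: if_cong)
qed

lemma sp_eventually: "eventually (\<lambda>n. sp p n = s n) sequentially"
  using eventually_ge_at_top[of "nat \<lceil>p\<rceil>"]
proof eventually_elim
  case (elim n)
  then have "p \<le> real (Suc n)" by linarith
  then show ?case by (simp add: sp_def)
qed

lemma summable_sp:
  assumes "summable (\<lambda>n. 2 ^ n * (\<bar>b n\<bar> * s n))" shows "summable (\<lambda>n. 2 ^ n * (\<bar>b n\<bar> * sp p n))"
proof -
  have "eventually (\<lambda>n. 2 ^ n * (\<bar>b n\<bar> * sp p n) = 2 ^ n * (\<bar>b n\<bar> * s n)) sequentially"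
    using sp_eventually[of p] by eventually_elim simp
  from summable_cong[OF this] show ?thesis using assms by simp
qed

text \<open>The majorant \<open>g\<close> with \<open>s\<close> replaced by \<open>sp\<close>. The
  two agree for all but finitely many \<open>n\<close>, so summability carries over to every
  exponent \<open>p\<close>.\<close>

definition h where "h p n t = 2 ^ n * (\<gamma> n t * sp p n)"

lemma ch: "continuous_on UNIV (h p n)" unfolding h_def by (intro continuous_intros c\<gamma>)

lemma h0: "0 \<le> h p n t" using \<gamma>0 sp_0 by (simp add: h_def)

lemma sum_h: "summable (\<lambda>n. integral {0..T} (h p n))"
proof -
  have "eventually (\<lambda>n. integral {0..T} (h p n) = integral {0..T} (g n)) sequentially"
    using sp_eventually[of p] by eventually_elim (simp add: h_def[abs_def] g_def[abs_def])
  from summable_cong[OF this] show ?thesis using sum_g by simp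
qed

lemma summable_u: "summable (\<lambda>n. 2 ^ n * (\<bar>gg n t\<bar> * sp p n))"
  by (rule summable_sp[OF summable_gs])

lemma summable_h: assumes "t \<in> Good" shows "summable (\<lambda>n. h p n t)"
  using summable_u[of t p] assms \<gamma>0 by (simp add: gg_def h_def)

text \<open>The difference is a shear superposition whose first \<open>n\<close> amplitudes are at
  most \<delta> and whose other amplitudes have the modulus of those of \<open>u\<close>.\<close>

lemma W1p_norm_U_diff:
  assumes p: "1 \<le> p" and t: "t \<in> Good" and \<delta>: "\<And>q. q < n \<Longrightarrow> \<bar>\<gamma> q \<tau> - \<gamma> q t\<bar> \<le> \<delta>"
  shows "W1p_norm p (\<lambda>x. (\<chi> k. U n k \<tau> x) - u t x) \<le>
    (1 + real CARD('d) * 2 powr p) powr (1 / p) * (\<delta> * (\<Sum>q<n. 2 ^ q * sp p q) + (\<Sum>m. h p (m + n) t))"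
proof -
  define b where "b q = (if q < n then \<gamma> q \<tau> else 0) - gg q t" for q
  have f: "summable (\<lambda>q. \<bar>if q < n then \<gamma> q \<tau> else 0\<bar> * s q)"
    by (rule summable_finite[of "{..<n}"]) auto
  have D: "(\<lambda>x. (\<chi> k. U n k \<tau> x) - u t x) = shear b"
    unfolding b_def using shear_diff[OF f summable_gs'[of t]]
    by (simp add: u_shear fun_cong[OF U_shear])
  have b_tail: "2 ^ (q + n) * (\<bar>b (q + n)\<bar> * sp p (q + n)) = h p (q + n) t" for q
    using t \<gamma>0[of "q + n" t] by (simp add: b_def gg_def h_def)
  have sb: "summable (\<lambda>q. 2 ^ q * (\<bar>b q\<bar> * sp p q))"
    using summable_ignore_initial_segment[OF summable_h[OF t, of p], of n] unfolding b_tail[symmetric]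
    by (subst (asm) summable_iff_shift)
  have "(\<Sum>q<n. 2 ^ q * (\<bar>b q\<bar> * sp p q)) \<le> (\<Sum>q<n. \<delta> * (2 ^ q * sp p q))"
  proof (rule sum_mono)
    fix q assume "q \<in> {..<n}"
    then have "\<bar>b q\<bar> \<le> \<delta>" using \<delta>[of q] t by (simp add: b_def gg_def)
    then have "\<bar>b q\<bar> * (2 ^ q * sp p q) \<le> \<delta> * (2 ^ q * sp p q)" using sp_0 by (intro mult_right_mono) auto
    then show "2 ^ q * (\<bar>b q\<bar> * sp p q) \<le> \<delta> * (2 ^ q * sp p q)" by (simp add: mult_ac)
  qed
  then have "(\<Sum>q. 2 ^ q * (\<bar>b q\<bar> * sp p q)) \<le> \<delta> * (\<Sum>q<n. 2 ^ q * sp p q) + (\<Sum>m. h p (m + n) t)"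
    using suminf_split_initial_segment[OF sb, of n] by (simp add: b_tail sum_distrib_left)
  then have "(1 + real CARD('d) * 2 powr p) powr (1 / p) * (\<Sum>q. 2 ^ q * (\<bar>b q\<bar> * sp p q)) \<le>
    (1 + real CARD('d) * 2 powr p) powr (1 / p) * (\<delta> * (\<Sum>q<n. 2 ^ q * sp p q) + (\<Sum>m. h p (m + n) t))"
    by (rule mult_left_mono) simp
  with shear_W1p(2)[OF p sb] show ?thesis unfolding D by linarith
qed

lemma u_strongly_measurable:
  assumes p: "1 \<le> p" shows "strongly_measurable T (W1p p) (W1p_norm p) u"
proof -
  \<comment> \<open>The factor by which an error in the first \<open>n\<close> amplitudes is
    multiplied. The grid accuracy is divided by 1 + S n, so that the product stays below
    1/(n+1).\<close>
  define S where "S n = (\<Sum>q<n. 2 ^ q * sp p q)" for n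
  have S0: "0 \<le> S n" for n unfolding S_def using sp_0 by (intro sum_nonneg) simp
  have ex: "\<forall>n. \<exists>N. 0 < N \<and> (\<forall>q<n. \<forall>t. 0 \<le> t \<longrightarrow> t \<le> T \<longrightarrow> \<bar>\<gamma> q (tstep T N t) - \<gamma> q t\<bar> \<le> 1 / ((real n + 1) * (1 + S n)))"
  proof
    fix n
    define F where "F = (\<lambda>q t (x :: real^'d). \<gamma> q t) ` {..<n}"
    have F: "finite F" "\<And>f. f \<in> F \<Longrightarrow> tfun f" and FI: "q < n \<Longrightarrow> (\<lambda>t x. \<gamma> q t) \<in> F" for q
      by (auto simp: F_def intro: tfun.time s\<gamma>)
    have "0 < 1 / ((real n + 1) * (1 + S n))" using S0[of n] by (intro divide_pos_pos mult_pos_pos) auto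
    from tstep_uniform[OF T F this] obtain N where
      N: "0 < N" "\<And>f t x. f \<in> F \<Longrightarrow> 0 \<le> t \<Longrightarrow> t \<le> T \<Longrightarrow> \<bar>f (tstep T N t) x - f t x\<bar> \<le> 1 / ((real n + 1) * (1 + S n))"
      by blast
    then show "\<exists>N. 0 < N \<and> (\<forall>q<n. \<forall>t. 0 \<le> t \<longrightarrow> t \<le> T \<longrightarrow> \<bar>\<gamma> q (tstep T N t) - \<gamma> q t\<bar> \<le> 1 / ((real n + 1) * (1 + S n)))"
      using N(2)[OF FI] by blast
  qed
  from choice[OF ex] obtain N where N: "\<And>n. 0 < N n"
    "\<And>n q t. q < n \<Longrightarrow> 0 \<le> t \<Longrightarrow> t \<le> T \<Longrightarrow> \<bar>\<gamma> q (tstep T (N n) t) - \<gamma> q t\<bar> \<le> 1 / ((real n + 1) * (1 + S n))"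
    by blast
  show ?thesis
    unfolding strongly_measurable_def
  proof (intro exI[of _ "\<lambda>n t x. \<chi> k. U n k (tstep T (N n) t) x"] conjI allI)
    fix n
    have fs: "summable (\<lambda>q. 2 ^ q * (\<bar>if q < n then \<gamma> q \<tau> else 0\<bar> * sp p q))" for \<tau>
      by (rule summable_finite[of "{..<n}"]) auto
    show "simple_valued T (W1p p) (\<lambda>t x. \<chi> k. U n k (tstep T (N n) t) x)"
      by (rule simple_valued_tstep[where H="\<lambda>\<tau> x. \<chi> k. U n k \<tau> x", OF T N(1)])
         (unfold U_shear, rule shear_W1p(1)[OF p fs])
  next
    show "AE t in lebesgue_on {0..T}. u t \<in> W1p p \<and>
        (\<lambda>n. W1p_norm p (\<lambda>x. (\<chi> k. U n k (tstep T (N n) t) x) - u t x)) \<longlonglongrightarrow> 0"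
      using AE_Good_lebesgue
    proof eventually_elim
      case (elim t)
      let ?K = "(1 + real CARD('d) * 2 powr p) powr (1 / p)"
      let ?b = "\<lambda>n. ?K * (1 / (real n + 1) + (\<Sum>m. h p (m + n) t))"
      have "(\<lambda>n. 1 / (real n + 1)) \<longlonglongrightarrow> 0" using LIMSEQ_inverse_real_of_nat by (simp add: inverse_eq_divide add.commute)
      from tendsto_mult_right_zero[OF tendsto_add_zero[OF this suminf_tail_tendsto_0[OF summable_h[OF elim]]]]
      have b: "?b \<longlonglongrightarrow> 0" .
      have "norm (W1p_norm p (\<lambda>x. (\<chi> k. U n k (tstep T (N n) t) x) - u t x)) \<le> ?b n" for n
      proof -
        have "W1p_norm p (\<lambda>x. (\<chi> k. U n k (tstep T (N n) t) x) - u t x) \<le>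
            ?K * (1 / ((real n + 1) * (1 + S n)) * S n + (\<Sum>m. h p (m + n) t))"
          using W1p_norm_U_diff[OF p elim, of n "tstep T (N n) t" "1 / ((real n + 1) * (1 + S n))"] N(2)[of _ n t] Good_D[OF elim]
          unfolding S_def by blast
        also have "\<dots> \<le> ?b n"
        proof (intro mult_left_mono add_right_mono)
          have "1 / ((real n + 1) * (1 + S n)) * S n = 1 / (real n + 1) * (S n / (1 + S n))" by simp
          also have "\<dots> \<le> 1 / (real n + 1) * 1" using S0[of n] by (intro mult_left_mono) auto
          finally show "1 / ((real n + 1) * (1 + S n)) * S n \<le> 1 / (real n + 1)" by simp
        qed simp
        finally show ?thesis by (simp add: abs_of_nonneg[OF W1p_norm_nonneg])
      qed
      then have "(\<lambda>n. W1p_norm p (\<lambda>x. (\<chi> k. U n k (tstep T (N n) t) x) - u t x)) \<longlonglongrightarrow> 0"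
        by (intro Lim_null_comparison[OF _ b] always_eventually allI)
      then show ?case using shear_W1p(1)[OF p summable_u] unfolding u_shear by blast
    qed
  qed
qed

text \<open>Nothing is known about how the choice in \<open>weak_partial\<close> depends on time.
  The explicit weak derivatives \<open>D\<close> are jointly measurable and have the same
  norms.\<close>

lemma W1p_norm_u_borel:
  assumes p: "1 \<le> p" shows "(\<lambda>t. W1p_norm p (u t)) \<in> borel_measurable borel"
proof -
  define D where "D l t x = (\<chi> k. \<Sum>n. if k = i n then (if l = j n then gg n t * deriv (\<Psi> n) (x $ j n) else 0) else 0)"
    for l t and x :: "real ^ 'd"
  have Dk: "(\<lambda>z. D l (fst z) (snd z) $ k) = (\<lambda>z. \<Sum>n. if k = i n \<and> l = j n then gg n (fst z) * deriv (\<Psi> n) (snd z $ j n) else 0)" for l k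
    by (simp add: D_def if_bool_eq_conj cong: if_cong) (intro ext suminf_cong; simp)
  have Dm: "(\<lambda>z. D l (fst z) (snd z) $ k) \<in> borel_measurable borel" for l k
    unfolding Dk by (intro borel_measurable_suminf gg_jborel smooth1_continuous smooth1_deriv s\<Psi>)
  have w: "Lp_norm p (weak_partial l (u t)) = Lp_norm p (D l t)" for l t
    using Lp_norm_weak_partial[OF shear_W1p(3)[OF p summable_u[of t p], of l]]
    by (simp add: u_shear D_def[abs_def])
  show ?thesis
    unfolding W1p_norm_def w using Lp_norm_borel[OF u_borel] Lp_norm_borel[OF Dm] by measurable
qed

lemma u_Bochner:
  assumes p: "1 \<le> p" shows "u \<in> Bochner_Lp 1 T (W1p p) (W1p_norm p)"
proof -
  let ?K = "(1 + real CARD('d) * 2 powr p) powr (1 / p)"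
  have "set_integrable lebesgue {0..T} (\<lambda>t. W1p_norm p (u t) powr 1)"
  proof (rule set_integrable_Icc_lebesgueI)
    show "(\<lambda>t. W1p_norm p (u t) powr 1) \<in> borel_measurable borel"
      using W1p_norm_u_borel[OF p] by measurable
    show "integrable lborel (\<lambda>t. ?K * (\<Sum>n. indicator {0..T} t * h p n t))"
      by (intro integrable_mult_right Icc_AE_summable(2)[OF ch h0 sum_h])
    show "AE t in lborel. t \<in> {0..T} \<longrightarrow> \<bar>W1p_norm p (u t) powr 1\<bar> \<le> ?K * (\<Sum>n. indicator {0..T} t * h p n t)"
      using AE_Good
    proof eventually_elim
      case (elim t)
      show ?case
      proof
        assume t: "t \<in> {0..T}"
        with elim have "t \<in> Good" by blast
        then have "2 ^ n * (\<bar>gg n t\<bar> * sp p n) = indicator {0..T} t * h p n t" for n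
          using t \<gamma>0[of n t] by (simp add: gg_def h_def)
        then show "\<bar>W1p_norm p (u t) powr 1\<bar> \<le> ?K * (\<Sum>n. indicator {0..T} t * h p n t)"
          using shear_W1p(2)[OF p summable_u[of t p]] by (simp add: u_shear abs_of_nonneg[OF W1p_norm_nonneg])
      qed
    qed
  qed
  then show ?thesis using u_strongly_measurable[OF p] by (simp add: Bochner_Lp_def)
qed

end

text \<open>The density is \<partial>_k0 F for F = t b(x_k0), so its time derivative and its image
  under L are both derivatives in direction k0. Without velocity the defect can simply be read
  off.\<close>

lemma initial_defect:
  fixes c :: "('d::finite \<Rightarrow> nat) \<Rightarrow> real" and k0 :: 'd
  assumes b: "smooth1 b" "per1 b"
  defines "F \<equiv> \<lambda>t (x :: real ^ 'd). t * b (x $ k0)"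
  shows "defect_eq m c (\<lambda>t x. t * deriv b (x $ k0)) (\<lambda>k t x. 0)
    (\<lambda>k t x. if k = k0 then b (x $ k0) - Lop m c F t x else 0)"
proof -
  have s: "tfun (\<lambda>t (x :: real ^ 'd). b (x $ k0))" by (rule tfun.space[OF b])
  have i: "smooth1 (\<lambda>t. t)" by (rule smooth1_ident)
  have F: "tfun F" unfolding F_def by (intro tfun.mult[OF tfun.time[OF i] s])
  have pF: "pD k0 F = (\<lambda>t x. t * deriv b (x $ k0))"
    unfolding F_def pD_time_mult[OF i s] by (simp add: pD_space[OF b])
  have tp: "tfun (\<lambda>t (x :: real ^ 'd). t * deriv b (x $ k0))" using tfun_pD[OF F, of k0] by (simp add: pF)
  have R: "(\<lambda>t x. if k = k0 then b (x $ k0) - Lop m c F t x else 0) = (if k = k0 then (\<lambda>t x. b (x $ k0) - Lop m c F t x) else (\<lambda>t x. 0))" for k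
    by auto
  have tR: "tfun (\<lambda>t x. if k = k0 then b (x $ k0) - Lop m c F t x else 0)" for k
    unfolding R by (cases "k = k0") (auto intro!: tfun_diff[OF s] tfun_Lop F)
  have L: "Lop m c (\<lambda>t x. t * deriv b (x $ k0)) = pD k0 (Lop m c F)" unfolding pF[symmetric] by (rule Lop_pD[OF F])
  have sd: "tfun (\<lambda>t (x :: real ^ 'd). deriv b (x $ k0))" using tfun_pD[OF s, of k0] by (simp add: pD_space[OF b])
  have pTd: "pT (\<lambda>t x :: real ^ 'd. t * deriv b (x $ k0)) t x = deriv b (x $ k0)" for t x
    unfolding pT_time_mult[OF i sd] by (simp add: pT_def)
  have pR: "pD k (\<lambda>t x. if k = k0 then b (x $ k0) - Lop m c F t x else 0) t x =
      (if k = k0 then deriv b (x $ k0) - pD k0 (Lop m c F) t x else 0)" for k t x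
    unfolding R by (cases "k = k0") (simp_all add: pD_diff[OF s tfun_Lop[OF F]] pD_space[OF b] pD_time)
  show ?thesis unfolding defect_eq_def
    by (intro conjI allI tp tR tfun_const) (simp_all add: L pTd pR pD_time)
qed

text \<open>The variation of \<open>b\<close> over a period is at least its increase over the first
  quarter; T^2 / 2 is the integral of t over [0,T].\<close>

lemma initial_size:
  fixes k0 :: "'d::finite"
  assumes T: "0 < T" and b: "smooth1 b" "per1 b"
  shows "T\<^sup>2 / 2 * (b (1/4) - b 0) \<le> n1 T (\<lambda>t (x :: real ^ 'd). t * deriv b (x $ k0))"
proof -
  let ?I = "integral {0..1} (\<lambda>y. \<bar>deriv b y\<bar>)"
  have c: "continuous_on A (deriv b)" for A by (intro smooth1_continuous smooth1_deriv b)
  have "b (1/4) - b 0 = integral {0..1/4} (deriv b)"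
    by (rule integral_unique[symmetric, OF fundamental_theorem_of_calculus])
       (auto intro!: has_field_derivative_at_within smooth1_has_deriv[OF b(1)] simp flip: has_real_derivative_iff_has_vector_derivative)
  also have "\<dots> \<le> integral {0..1/4} (\<lambda>y. \<bar>deriv b y\<bar>)"
    by (intro integral_le integrable_continuous_real continuous_intros c) auto
  also have "\<dots> \<le> ?I"
    by (intro integral_subset_le integrable_continuous_real continuous_intros c) auto
  finally have I: "b (1/4) - b 0 \<le> ?I" .
  have pd: "per1 (\<lambda>y. \<bar>deriv b y\<bar>)" using per1_deriv[OF b] by (simp add: per1_def)
  have "integral cell (\<lambda>x :: real ^ 'd. \<bar>t * deriv b (x $ k0)\<bar>) = t * ?I" if "t \<in> {0..T}" for t
    using that pd integral_cell_coord[of "\<lambda>y. \<bar>deriv b y\<bar>" k0] by (simp add: abs_mult c continuous_intros)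
  then have "n1 T (\<lambda>t (x :: real ^ 'd). t * deriv b (x $ k0)) = integral {0..T} (\<lambda>t. t * ?I)"
    unfolding n1_def by (intro integral_cong)
  also have "\<dots> = T\<^sup>2 / 2 * ?I"
    using integral_unique[OF ident_has_integral[of 0 T]] T by simp
  finally show ?thesis using I by (simp add: mult_left_mono)
qed

lemma zero_weak_solution: "weak_solution T m c u (\<lambda>x. 0) (\<lambda>t x. 0)"
  by (simp add: weak_solution_def L1_spacetime_def periodic_def case_prod_unfold set_lebesgue_integral_def)

theorem theorem6p1:
  fixes T :: real and m :: nat and c :: "('d::finite \<Rightarrow> nat) \<Rightarrow> real"
  assumes "CARD('d) \<ge> 2" and "T > 0" and "m \<ge> 1" and "exact_order m c"
  shows "\<exists>u :: real \<Rightarrow> real ^ 'd \<Rightarrow> real ^ 'd.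
    div_free T u \<and>
    (\<forall>p\<ge>1. u \<in> Bochner_Lp 1 T (W1p p) (W1p_norm p)) \<and>
    (\<exists>(\<rho>0 :: real ^ 'd \<Rightarrow> real) \<rho>1 \<rho>2.
       \<rho>0 \<in> Lp_torus 1 \<and>
       weak_solution T m c u \<rho>0 \<rho>1 \<and> weak_solution T m c u \<rho>0 \<rho>2 \<and>
       (\<forall>p\<ge>1. \<forall>k. \<rho>1 \<in> Bochner_Lp p T (Ck_torus k) (Ck_norm k)) \<and>
       (\<forall>p\<ge>1. \<forall>k. \<rho>2 \<in> Bochner_Lp p T (Ck_torus k) (Ck_norm k)) \<and>
       \<not> (AE (t, x) in lebesgue_on ({0..T} \<times> cell). \<rho>1 t x = \<rho>2 t x))"
proof -
  obtain k0 :: 'd where True by simp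
  \<comment> \<open>With this amplitude T^2/2 (b(1/4) - b(0)) equals 2 (T + 2), just above the
    threshold 2 (T + 1) of \<open>rho_nonzero\<close>.\<close>
  define b where "b y = 4 * (T + 2) / T\<^sup>2 * sin (2 * pi * y)" for y
  have b: "smooth1 b" "per1 b"
    unfolding b_def[abs_def] by (intro smooth1_mult smooth1_const smooth1_sin) (simp add: per1_def distrib_left)
  note init = initial_defect[OF b, of m c k0]
  obtain C \<rho> U R a \<gamma> \<Psi> s and i j :: "nat \<Rightarrow> 'd" where it:
    "0 < C" "\<rho> 0 = (\<lambda>t x. t * deriv b (x $ k0))" "U 0 = (\<lambda>k t x. 0)" "\<And>n. defect_eq m c (\<rho> n) (U n) (R n)" "\<And>n. i n \<noteq> j n"
    "\<And>n. ci_step T n ((1/4) ^ n) C (i n) (j n) (\<rho> n) (U n) (R n) (\<rho> (Suc n)) (U (Suc n)) (R (Suc n)) (a n) (\<gamma> n) (\<Psi> n) (s n)"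
    "\<And>n k. CARD('d) \<le> n \<Longrightarrow> n1 T (R n k) \<le> 2 * 4 ^ CARD('d) * (1/4) ^ n"
    by (rule iteration[OF assms(2,1) init]) (rule that)
  interpret ci_limit T C m c \<rho> U R a \<gamma> \<Psi> s i j
    by (unfold_locales; (fact it | fact assms))
  have "2 * (T + 1) < T\<^sup>2 / 2 * (b (1/4) - b 0)" using assms(2) by (simp add: b_def)
  also have "\<dots> \<le> n1 T (\<rho> 0)" unfolding it(2) by (rule initial_size[OF assms(2) b])
  finally have nz: "\<not> (AE (t, x) in lebesgue_on ({0..T} \<times> cell). rho t x = (0 :: real))" by (rule rho_nonzero)
  have z: "(\<lambda>x :: real ^ 'd. 0 :: real) \<in> Lp_torus 1" by (simp add: Lp_torus_def periodic_def set_integrable_def)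
  show ?thesis
    by (intro exI[of _ u] exI[of _ "\<lambda>x. 0"] exI[of _ rho] exI[of _ "\<lambda>t x. 0"] conjI allI impI div_u u_Bochner z
        weak_rho zero_weak_solution rho_Bochner zero_Bochner assms(2) nz)
qed

end
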